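(* Let $(\mathcal{X},f,\mu)$ be a measure preserving dynamical system with observable $\phi$, and let $X_i=\phi\circ f^{i-1}$ $(i\ge 1)$ and $M_n=\max(X_1,\dots,X_n)$ (standing assumptions as in the context). Suppose there exist sequences $a_n>0$, $b_n\in\mathbb{R}$ and a non-degenerate distribution function $G$ such that $n\mu\{X_1>u/a_n+b_n\}\to-\log G(u)$ as $n\to\infty$ for every $u\in\mathbb{R}$ (with $-\log 0=+\infty$). Suppose that for every $r\ge 1$, every $0<x_1\le x_2\le\cdots\le x_r$, and all real sequences $u_n^{(1)}\ge u_n^{(2)}\ge\cdots\ge u_n^{(r)}$ with $n\mu\{X_1>u_n^{(k)}\}\to x_k$ for all $k\le r$, both conditions $\mathcal{D}_r(u_n^{(k)})$ and $\mathcal{D}_r'(u_n^{(k)})$ hold. Let $$Y_n(t)=\begin{cases}a_n(M_{[nt]}-b_n), & t\ge 1/n,\\ a_n(X_1-b_n), & 0<t<1/n.\end{cases}$$ Then $Y_n$ converges weakly, as $n\to\infty$, to an extremal-$G$ process $Y_G$ in $\mathbb{D}(0,\infty)$ endowed with the Skorokhod $J_1$ topology.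
   Context: Standing assumptions: $\mathcal{X}\subset\mathbb{R}^d$, $f:\mathcal{X}\to\mathcal{X}$ is measurable, $\mu$ is an $f$-invariant probability measure on $\mathcal{X}$, absolutely continuous with respect to Lebesgue measure with density $\rho$. The observable is $\phi(x)=\psi(\mathrm{dist}(x,\tilde x))$, where $\mathrm{dist}$ is the Euclidean distance, $\tilde x\in\mathcal{X}$ is a fixed point of the space, and $\psi:[0,\infty)\to\mathbb{R}\cup\{+\infty\}$ is measurable, finite on $(0,\infty)$, with $\sup_{v\ge0}\psi(v)=\psi(0)$. The integer part of $s$ is $[s]$. Maxima over sets: $\mathfrak{R}$ is the ring of subsets of $[0,\infty)$ generated by the intervals $[a,b)$, so each element is a finite union of such intervals. For $A\in\mathfrak{R}$ let $M(A)=\max\{X_{i+1}: i\in A\cap\mathbb{Z}\}$ (with $\max\emptyset=-\infty$), so that $M([0,n))=M_n$; and $A+t=\{a+t:a\in A\}$. Condition $\mathcal{D}_r(u_n^{(k)})$, for real sequences $(u_n^{(k)})_n$, $1\le k\le r$: there is a function $\gamma(n,t)$ such that for all $n,t\in\mathbb{N}$, all pairwise disjoint $\mathcal{A}_1,\dots,\mathcal{A}_r\in\mathfrak{R}$, and all choices of $u_{n,0},u_{n,1},\dots,u_{n,r}$ each from $\{u_n^{(1)},\dots,u_n^{(r)}\}$, $$\Big|\mu\big(\{X_1>u_{n,0}\}\cap\{M(\mathcal{A}_1+t)\le u_{n,1},\dots,M(\mathcal{A}_r+t)\le u_{n,r}\}\big)-\mu\{X_1>u_{n,0}\}\,\mu\{M(\mathcal{A}_1)\le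 u_{n,1},\dots,M(\mathcal{A}_r)\le u_{n,r}\}\Big|\le\gamma(n,t),$$ and $n\gamma(n,t_n)\to0$ for some integer sequence $t_n=o(n)$. Condition $\mathcal{D}_r'(u_n^{(k)})$: for each $i\in\{1,\dots,r\}$, $$\lim_{q\to\infty}\limsup_{n\to\infty}\, n\sum_{j=2}^{[n/q]}\mu\big(\{X_1>u_n^{(i)}\}\cap\{X_j>u_n^{(i)}\}\big)=0.$$ Extremal-$F$ process: for a distribution function $F$, a process $Y_F(t)$, $t>0$, with càdlàg paths whose finite dimensional distributions are, for $0<t_1<\cdots<t_k$, $$P\{Y_F(t_1)\le u_1,\dots,Y_F(t_k)\le u_k\}=F^{t_1}\Big(\bigwedge_{i=1}^k u_i\Big)F^{t_2-t_1}\Big(\bigwedge_{i=2}^k u_i\Big)\cdots F^{t_k-t_{k-1}}(u_k),$$ where $\wedge$ denotes minimum. $\mathbb{D}(0,\infty)$ is the space of càdlàg functions $(0,\infty)\to\mathbb{R}$. The $J_1$ topology is given by the metric $d_{0,\infty}(\varphi_1,\varphi_2)=\int_0^1\int_1^\infty e^{-t}\big(1\wedge d_{s,t}(\varphi_1|_{[s,t]},\varphi_2|_{[s,t]})\big)\,dt\,ds$, where $d_{a,b}(\varphi_1,\varphi_2)=\inf_h\{\|\varphi_1\circ h-\varphi_2\|_\infty\vee\|h-\mathrm{id}\|_\infty\}$ over strictly increasing continuous $h:[a,b]\to[a,b]$ with $h(a)=a$, $h(b)=b$. Weak convergence means convergence of expectations of all bounded continuous functions on $\mathbb{D}(0,\infty)$.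 *)

theory Defs
  imports "HOL-Probability.Probability" "HOL-Library.Landau_Symbols"
begin

text \<open>Observables may take the value \<open>\<infinity>\<close>, so the time series and its maxima live in \<^typ>\<open>ereal\<close>.\<close>

definition observable :: "(real \<Rightarrow> ereal) \<Rightarrow> 'a::metric_space \<Rightarrow> 'a \<Rightarrow> ereal" where
  "observable \<psi> p x = \<psi> (dist x p)"

definition time_series :: "('a \<Rightarrow> ereal) \<Rightarrow> ('a \<Rightarrow> 'a) \<Rightarrow> nat \<Rightarrow> 'a \<Rightarrow> ereal" where
  "time_series \<phi> f i x = \<phi> ((f ^^ (i - 1)) x)"

text \<open>
  The suprema in the next two definitions range over finite index sets in all uses, so they are
  maxima; using the supremum gives the value \<open>-\<infinity>\<close> for an empty index set.
\<close>

definition partial_max :: "(nat \<Rightarrow> 'a \<Rightarrow> ereal) \<Rightarrow> nat \<Rightarrow> 'a \<Rightarrow> ereal" where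
  "partial_max X n x = (SUP i\<in>{1..n}. X i x)"

definition max_over :: "(nat \<Rightarrow> 'a \<Rightarrow> ereal) \<Rightarrow> real set \<Rightarrow> 'a \<Rightarrow> ereal" where
  "max_over X A x = (SUP i\<in>{i. real i \<in> A}. X (i + 1) x)"

definition interval_ring :: "real set set" where
  "interval_ring =
     \<Inter> {R. ring_of_sets {0..} R \<and> {{a..<b} | a b. 0 \<le> a \<and> a \<le> b} \<subseteq> R}"

text \<open>
  In the two mixing conditions, \<open>u k n\<close> is the \<open>k\<close>-th level (for \<open>1 \<le> k \<le> r\<close>) at time \<open>n\<close>.
\<close>

definition cond_D :: "'a measure \<Rightarrow> (nat \<Rightarrow> 'a \<Rightarrow> ereal) \<Rightarrow> nat \<Rightarrow> (nat \<Rightarrow> nat \<Rightarrow> real) \<Rightarrow> bool" where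
  "cond_D M X r u \<longleftrightarrow>
    (\<exists>\<gamma> :: nat \<Rightarrow> nat \<Rightarrow> real.
      (\<forall>n t A v.
         (\<forall>j\<in>{1..r}. A j \<in> interval_ring) \<and> disjoint_family_on A {1..r} \<and>
         (\<forall>j\<in>{0..r}. v j \<in> (\<lambda>k. u k n) ` {1..r}) \<longrightarrow>
         \<bar>measure M {x \<in> space M. X 1 x > ereal (v 0) \<and>
              (\<forall>j\<in>{1..r}. max_over X ((\<lambda>a. a + real t) ` A j) x \<le> ereal (v j))}
          - measure M {x \<in> space M. X 1 x > ereal (v 0)}
            * measure M {x \<in> space M. \<forall>j\<in>{1..r}. max_over X (A j) x \<le> ereal (v j)}\<bar>
         \<le> \<gamma> n t) \<and>
      (\<exists>s :: nat \<Rightarrow> nat.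
         (\<lambda>n. real (s n)) \<in> o(\<lambda>n. real n) \<and> (\<lambda>n. real n * \<gamma> n (s n)) \<longlonglongrightarrow> 0))"

definition cond_D' :: "'a measure \<Rightarrow> (nat \<Rightarrow> 'a \<Rightarrow> ereal) \<Rightarrow> nat \<Rightarrow> (nat \<Rightarrow> nat \<Rightarrow> real) \<Rightarrow> bool" where
  "cond_D' M X r u \<longleftrightarrow>
    (\<forall>i\<in>{1..r}.
      (\<lambda>q. limsup (\<lambda>n. ereal (real n *
         (\<Sum>j = 2..n div q. measure M {x \<in> space M. X 1 x > ereal (u i n) \<and> X j x > ereal (u i n)}))))
      \<longlonglongrightarrow> 0)"

definition distribution_function :: "(real \<Rightarrow> real) \<Rightarrow> bool" where
  "distribution_function F \<longleftrightarrow> (\<exists>\<nu>. real_distribution \<nu> \<and> F = cdf \<nu>)"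

definition nondegenerate :: "(real \<Rightarrow> real) \<Rightarrow> bool" where
  "nondegenerate F \<longleftrightarrow> \<not> (\<exists>c. F = indicator {c..})"

definition neg_log :: "real \<Rightarrow> ereal" where
  "neg_log p = (if p = 0 then \<infinity> else ereal (- ln p))"

text \<open>
  Functions on \<open>(0,\<infinity>)\<close> are represented by their \<^const>\<open>extensional\<close> extensions to all reals.
\<close>

definition skorokhod_space :: "(real \<Rightarrow> real) set" where
  "skorokhod_space = {\<phi> \<in> extensional {0<..}.
     \<forall>t>0. continuous (at_right t) \<phi> \<and> (\<exists>l. (\<phi> \<longlongrightarrow> l) (at_left t))}"

definition time_changes :: "real \<Rightarrow> real \<Rightarrow> (real \<Rightarrow> real) set" where
  "time_changes a b = {h. h \<in> {a..b} \<rightarrow> {a..b} \<and> strict_mono_on {a..b} h \<and> continuous_on {a..b} h \<and>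
     h a = a \<and> h b = b}"

definition J1_dist_on :: "real \<Rightarrow> real \<Rightarrow> (real \<Rightarrow> real) \<Rightarrow> (real \<Rightarrow> real) \<Rightarrow> real" where
  "J1_dist_on a b \<phi>\<^sub>1 \<phi>\<^sub>2 =
     (INF h\<in>time_changes a b.
        max (SUP x\<in>{a..b}. \<bar>\<phi>\<^sub>1 (h x) - \<phi>\<^sub>2 x\<bar>) (SUP x\<in>{a..b}. \<bar>h x - x\<bar>))"

definition J1_dist :: "(real \<Rightarrow> real) \<Rightarrow> (real \<Rightarrow> real) \<Rightarrow> real" where
  "J1_dist \<phi>\<^sub>1 \<phi>\<^sub>2 = (LBINT s=0..1. (LBINT t=1..\<infinity>. exp (- t) * min 1 (J1_dist_on s t \<phi>\<^sub>1 \<phi>\<^sub>2)))"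

definition J1_topology :: "(real \<Rightarrow> real) topology" where
  "J1_topology = Metric_space.mtopology skorokhod_space J1_dist"

definition J1_borel :: "(real \<Rightarrow> real) measure" where
  "J1_borel = sigma skorokhod_space {U. openin J1_topology U}"

definition sample_path :: "(real \<Rightarrow> 'a \<Rightarrow> real) \<Rightarrow> 'a \<Rightarrow> (real \<Rightarrow> real)" where
  "sample_path Y \<omega> = restrict (\<lambda>t. Y t \<omega>) {0<..}"

text \<open>
  Processes are written \<open>Y t \<omega>\<close> with \<open>t > 0\<close>. The measurability clauses say that the processes are
  random elements of the Skorokhod space, so that all the expectations are meaningful.
\<close>

definition converges_weakly_J1 ::
  "'a measure \<Rightarrow> (nat \<Rightarrow> real \<Rightarrow> 'a \<Rightarrow> real) \<Rightarrow> 'b measure \<Rightarrow> (real \<Rightarrow> 'b \<Rightarrow> real) \<Rightarrow> bool" where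
  "converges_weakly_J1 M Y N Z \<longleftrightarrow>
    (\<forall>n. sample_path (Y n) \<in> measurable M J1_borel) \<and>
    sample_path Z \<in> measurable N J1_borel \<and>
    (\<forall>H. continuous_map J1_topology euclideanreal H \<and> bounded (H ` skorokhod_space) \<longrightarrow>
       (\<lambda>n. \<integral>\<omega>. H (sample_path (Y n) \<omega>) \<partial>M) \<longlonglongrightarrow> (\<integral>\<omega>. H (sample_path Z \<omega>) \<partial>N))"

definition extremal_process :: "(real \<Rightarrow> real) \<Rightarrow> 'b measure \<Rightarrow> (real \<Rightarrow> 'b \<Rightarrow> real) \<Rightarrow> bool" where
  "extremal_process F N Y \<longleftrightarrow>
    prob_space N \<and>
    (\<forall>t>0. Y t \<in> borel_measurable N) \<and>
    (\<forall>\<omega>\<in>space N. sample_path Y \<omega> \<in> skorokhod_space) \<and>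
    (\<forall>k\<ge>1. \<forall>t u :: nat \<Rightarrow> real. 0 < t 1 \<and> strict_mono_on {1..k} t \<longrightarrow>
       measure N {\<omega> \<in> space N. \<forall>i\<in>{1..k}. Y (t i) \<omega> \<le> u i} =
       (\<Prod>i = 1..k. F (MIN j\<in>{i..k}. u j) powr (t i - (if i = 1 then 0 else t (i - 1)))))"

text \<open>
  The value \<open>\<infinity>\<close> of the rescaled maximum is replaced by \<open>0\<close>, so that all paths are real valued.
  This affects only a null set when the observable is infinite only on a null set and the
  measure is invariant.
\<close>

definition rescaled_max ::
  "(nat \<Rightarrow> 'a \<Rightarrow> ereal) \<Rightarrow> (nat \<Rightarrow> real) \<Rightarrow> (nat \<Rightarrow> real) \<Rightarrow> nat \<Rightarrow> real \<Rightarrow> 'a \<Rightarrow> real" where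
  "rescaled_max X a b n t x = real_of_ereal
     (if t \<ge> 1 / real n then ereal (a n) * (partial_max X (nat \<lfloor>real n * t\<rfloor>) x - ereal (b n))
      else ereal (a n) * (X 1 x - ereal (b n)))"

end

theory Submission
  imports Defs
begin

text \<open>
  The paths of \<open>Y\<^sub>n\<close> and of the limit are nondecreasing. Round such a path to levels
  of width \<open>\<eta>\<close> and sample it at the points \<open>i/q\<close>. If in each cell the rounded path
  takes only its two end values, then it jumps at most once there, and a piecewise linear time change
  carries the path to within \<open>2\<eta>\<close> of the sampled one; since few cells contain a jump, the
  \<open>J\<^sub>1\<close> distance is small. An intermediate value in a cell requires two exceedances of a
  level within one block, which \<open>\<D>'\<close> excludes in the limit. What remains is the law of
  finitely many discrete values, that is, the finite dimensional distributions: by stationarity,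
  Bonferroni's inequality and \<open>\<D>\<close>, prepending a block of length \<open>m\<close> with
  level \<open>u\<close> multiplies \<open>\<mu>{M \<le> u, \<dots>}\<close> by
  \<open>1 - m \<mu>{X\<^sub>1 > u}\<close> up to a small error, and many such factors give powers of \<open>G\<close>.

  Weak convergence is tested on Lipschitz functions, bounded continuous functions being monotone
  limits of these. The extremal process is obtained from Kolmogorov's extension theorem, with its paths
  regularised along the rationals. The smallness of its bad event is inherited from \<open>Y\<^sub>n\<close> through
  finite grids.
\<close>

section \<open>Right-continuous paths and time changes\<close>

text \<open>The mixing hypothesis speaks only of levels whose tail limits lie in
  \<open>(0, \<infinity>)\<close>, while \<open>G\<close> may take the values 0 and 1. A level with
  \<open>G u = 0\<close> is compared with higher ones of large finite limit, obtained from the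
  normalising constants of index \<open>n div c\<close>; nondegeneracy of \<open>G\<close> supplies
  the level to start from. Where \<open>G u = 1\<close>, exceedances disappear in the limit by a
  union bound. The metric averages over the end points \<open>s\<close> and \<open>t\<close>, so a
  time change has to fix only most of them: those in or next to a cell with a jump form a set of
  small measure. Random elements must be measurable for the Borel sets of the J1 topology, which
  measurability of the coordinates does not give at once. For \<open>Y\<^sub>n\<close> and for the
  limit it is derived by exhibiting the paths as pointwise limits of countably valued maps. For the
  limit this works off a null set, by Borel-Cantelli applied to the same approximation that yields
  the convergence.\<close>

lemma skorokhod_right:
  assumes "\<phi> \<in> skorokhod_space" "t > 0"
  shows "(\<phi> \<longlongrightarrow> \<phi> t) (at_right t)"
  using assms by (auto simp: skorokhod_space_def continuous_within)

lemma skorokhod_left: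
  assumes "\<phi> \<in> skorokhod_space" "t > 0"
  obtains l where "(\<phi> \<longlongrightarrow> l) (at_left t)"
  using assms by (auto simp: skorokhod_space_def)

text \<open>One-sided limits bound the path near each point, and compactness leaves finitely many
  neighbourhoods. The condition \<open>0 < a\<close> places all points of the interval where these
  limits exist.\<close>

lemma skorokhod_bounded:
  assumes \<phi>: "\<phi> \<in> skorokhod_space" and "0 < a"
  shows "bounded (\<phi> ` {a..b})"
proof -
  have loc: "\<exists>U B. open U \<and> x \<in> U \<and> (\<forall>y\<in>U. \<bar>\<phi> y\<bar> \<le> B)" if "x \<in> {a..b}" for x
  proof -
    have x: "x > 0" using that \<open>0 < a\<close> by auto
    obtain l where l: "(\<phi> \<longlongrightarrow> l) (at_left x)" using skorokhod_left[OF \<phi> x] .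
    have 1: "eventually (\<lambda>y. \<bar>\<phi> y\<bar> < \<bar>l\<bar> + \<bar>\<phi> x\<bar> + 1) (at_left x)"
      by (rule order_tendstoD(2)[OF tendsto_rabs[OF l]]) simp
    have 2: "eventually (\<lambda>y. \<bar>\<phi> y\<bar> < \<bar>l\<bar> + \<bar>\<phi> x\<bar> + 1) (at_right x)"
      by (rule order_tendstoD(2)[OF tendsto_rabs[OF skorokhod_right[OF \<phi> x]]]) simp
    have "eventually (\<lambda>y. \<bar>\<phi> y\<bar> < \<bar>l\<bar> + \<bar>\<phi> x\<bar> + 1) (nhds x)"
      using 1 2 by (simp add: eventually_nhds_conv_at eventually_at_split)
    then show ?thesis unfolding eventually_nhds by (meson less_imp_le)
  qed
  define W where "W = {U. open U \<and> (\<exists>B. \<forall>y\<in>U. \<bar>\<phi> y\<bar> \<le> B)}"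
  have "\<exists>\<D>\<subseteq>W. finite \<D> \<and> {a..b} \<subseteq> \<Union>\<D>"
    by (rule compactE[of "{a..b}" W]) (auto simp: W_def dest!: loc)
  then obtain \<D> where D: "\<D> \<subseteq> W" "finite \<D>" "{a..b} \<subseteq> \<Union>\<D>" by blast
  have "bounded (\<Union>U\<in>\<D>. \<phi> ` U)"
  proof (rule bounded_UN[OF D(2)], rule)
    fix U assume "U \<in> \<D>"
    then obtain B where "\<forall>y\<in>U. \<bar>\<phi> y\<bar> \<le> B" using D(1) by (auto simp: W_def)
    then show "bounded (\<phi> ` U)" by (auto simp: bounded_iff intro!: exI[of _ B])
  qed
  then show ?thesis by (rule bounded_subset) (use D(3) in blast)
qed

text \<open>A discontinuity \<open>t\<close> is tagged by a rational \<open>p < t\<close> and an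
  \<open>n\<close> such that on \<open>(p, t)\<close> the path stays within \<open>1 / Suc n\<close>
  of a value from which \<open>\<phi> t\<close> is more than three times as far. A tag determines
  its point: for two points with one tag, the window of the larger contains the smaller, and three
  small distances would add up to a large one.\<close>

lemma skorokhod_countable_discont:
  assumes \<phi>: "\<phi> \<in> skorokhod_space"
  shows "countable {t. t > 0 \<and> \<not> isCont \<phi> t}"
proof -
  let ?D = "{t. t > 0 \<and> \<not> isCont \<phi> t}"
  define R where "R t p n \<longleftrightarrow> real_of_rat p < t \<and> (\<exists>l. \<bar>\<phi> t - l\<bar> > 3 / real (Suc n) \<and>
      (\<forall>s. real_of_rat p < s \<and> s < t \<longrightarrow> \<bar>\<phi> s - l\<bar> < 1 / real (Suc n)))" for t p n
  have "\<exists>pn. R t (fst pn) (snd pn)" if "t \<in> ?D" for t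
  proof -
    have t: "t > 0" using that by auto
    obtain l where l: "(\<phi> \<longlongrightarrow> l) (at_left t)" using skorokhod_left[OF \<phi> t] .
    have "l \<noteq> \<phi> t"
      using that l skorokhod_right[OF \<phi> t] by (auto simp: isCont_def filterlim_split_at)
    then have "\<bar>\<phi> t - l\<bar> / 3 > 0" by simp
    then obtain n where n: "1 / real (Suc n) < \<bar>\<phi> t - l\<bar> / 3"
      using nat_approx_posE by metis
    have "eventually (\<lambda>s. dist (\<phi> s) l < 1 / real (Suc n)) (at_left t)"
      by (rule tendstoD[OF l]) simp
    then obtain b where b: "b < t" "\<And>s. b < s \<Longrightarrow> s < t \<Longrightarrow> \<bar>\<phi> s - l\<bar> < 1 / real (Suc n)"
      by (auto simp: eventually_at_left_field dist_real_def)
    obtain p where p: "b < real_of_rat p" "real_of_rat p < t" using of_rat_dense[OF b(1)] by blast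
    have "R t p n" unfolding R_def using p b n by (auto intro!: exI[of _ l] simp: field_simps)
    then show ?thesis by (intro exI[of _ "(p, n)"]) simp
  qed
  then obtain g where g: "\<And>t. t \<in> ?D \<Longrightarrow> R t (fst (g t)) (snd (g t))" by metis
  have lt: False if "R t p n" "R t' p n" "t < t'" for t t' p n
  proof -
    from that(1) obtain l where l: "real_of_rat p < t" "\<bar>\<phi> t - l\<bar> > 3 / real (Suc n)"
      "\<And>s. real_of_rat p < s \<Longrightarrow> s < t \<Longrightarrow> \<bar>\<phi> s - l\<bar> < 1 / real (Suc n)" unfolding R_def by blast
    from that(2) obtain l' where l': "\<And>s. real_of_rat p < s \<Longrightarrow> s < t' \<Longrightarrow> \<bar>\<phi> s - l'\<bar> < 1 / real (Suc n)"
      unfolding R_def by blast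
    obtain s where s: "real_of_rat p < s" "s < t" using dense[OF l(1)] by blast
    have "\<bar>\<phi> s - l\<bar> < 1 / real (Suc n)" "\<bar>\<phi> s - l'\<bar> < 1 / real (Suc n)" "\<bar>\<phi> t - l'\<bar> < 1 / real (Suc n)"
      using l(3)[of s] l'[of s] l'[of t] s l(1) that(3) by auto
    moreover have "3 / real (Suc n) = 1 / real (Suc n) + 1 / real (Suc n) + 1 / real (Suc n)" by simp
    ultimately show False using l(2) by linarith
  qed
  have "inj_on g ?D"
    by (rule inj_onI) (metis g lt linorder_neqE_linordered_idom)
  then show ?thesis by (rule countableI') 
qed

text \<open>The rate \<open>q = 0\<close> is allowed and gives the constant path \<open>c 0\<close>.
  It serves as default path and covers the index \<open>n = 0\<close> of the rescaled
  maxima.\<close>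

definition step_path :: "real \<Rightarrow> (nat \<Rightarrow> real) \<Rightarrow> real \<Rightarrow> real" where
  "step_path q c = restrict (\<lambda>t. c (nat \<lfloor>q * t\<rfloor>)) {0<..}"

lemma step_path_apply [simp]: "t > 0 \<Longrightarrow> step_path q c t = c (nat \<lfloor>q * t\<rfloor>)"
  by (simp add: step_path_def)

lemma step_path_in_skorokhod:
  assumes "q \<ge> 0"
  shows "step_path q c \<in> skorokhod_space"
proof (cases "q = 0")
  case True
  have *: "eventually (\<lambda>x. step_path q c x = c 0) (at_right t)" "eventually (\<lambda>x. step_path q c x = c 0) (at_left t)" if "t > 0" for t
    using that True by (auto simp: eventually_at_right_field eventually_at_left_field intro: exI[of _ "t+1"] exI[of _ "0::real"])
  show ?thesis unfolding skorokhod_space_def continuous_within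
  proof (intro CollectI conjI allI impI)
    fix t :: real assume t: "t > 0"
    show "(step_path q c \<longlongrightarrow> step_path q c t) (at_right t)"
      by (rule tendsto_eventually) (use *[OF t] t True in auto)
    show "\<exists>l. (step_path q c \<longlongrightarrow> l) (at_left t)"
      by (rule exI, rule tendsto_eventually) (use *[OF t] t True in auto)
  qed (auto simp: step_path_def)
next
  case False
  then have q: "q > 0" using assms by simp
  show ?thesis unfolding skorokhod_space_def continuous_within
  proof (intro CollectI conjI allI impI)
    fix t :: real assume t: "t > 0"
    define k where "k = \<lfloor>q * t\<rfloor>"
    have k: "of_int k \<le> q * t" "q * t < of_int k + 1" by (auto simp: k_def)
    have "step_path q c x = step_path q c t" if "t < x" "x < (of_int k + 1) / q" for x
    proof -
      have "\<lfloor>q * x\<rfloor> = k"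
        using that q k by (intro floor_unique) (auto simp: field_simps intro: order.trans[OF k(1)])
      then show ?thesis using that t by (simp add: k_def)
    qed
    then have "eventually (\<lambda>x. step_path q c x = step_path q c t) (at_right t)"
      unfolding eventually_at_right_field using k q
      by (intro exI[of _ "(of_int k + 1) / q"]) (auto simp: field_simps)
    then show "(step_path q c \<longlongrightarrow> step_path q c t) (at_right t)" by (rule tendsto_eventually)
    \<comment> \<open>\<open>m\<close> is the index of the cell just left of \<open>t\<close>, the
      preceding one when \<open>q * t\<close> is an integer.\<close>
    define m where "m = \<lceil>q * t\<rceil> - 1"
    have m: "of_int m < q * t" "q * t \<le> of_int m + 1" unfolding m_def by linarith+
    have "step_path q c x = c (nat m)" if "max 0 (of_int m / q) < x" "x < t" for x
    proof -
      have "q * x < q * t" using that q by simp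
      then have "\<lfloor>q * x\<rfloor> = m"
        using that q m less_le_trans[of "q * x" "q * t" "of_int m + 1"] by (intro floor_unique) (auto simp: field_simps)
      then show ?thesis using that t by (simp)
    qed
    then have "eventually (\<lambda>x. step_path q c x = c (nat m)) (at_left t)"
      unfolding eventually_at_left_field using m q t
      by (intro exI[of _ "max 0 (of_int m / q)"]) (auto simp: field_simps)
    then show "\<exists>l. (step_path q c \<longlongrightarrow> l) (at_left t)" by (intro exI tendsto_eventually)
  qed (auto simp: step_path_def)
qed

section \<open>Time changes of an interval and the distance on it\<close>

lemma time_changesD:
  assumes "h \<in> time_changes a b"
  shows "h a = a" "h b = b" "strict_mono_on {a..b} h" "continuous_on {a..b} h"
    "\<And>x. x \<in> {a..b} \<Longrightarrow> h x \<in> {a..b}"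
  using assms by (auto simp: time_changes_def)

lemma time_changesI:
  assumes "h a = a" "h b = b" "strict_mono_on {a..b} h" "continuous_on {a..b} h"
  shows "h \<in> time_changes a b"
proof -
  have "h x \<in> {a..b}" if x: "x \<in> {a..b}" for x
  proof -
    have "h a \<le> h x" "h x \<le> h b"
      using x by (auto intro!: monotone_onD[OF strict_mono_on_imp_mono_on[OF assms(3)]])
    then show ?thesis using assms by simp
  qed
  then show ?thesis using assms by (auto simp: time_changes_def)
qed

lemma id_time_change: "(\<lambda>x. x) \<in> time_changes a b"
  by (rule time_changesI) (auto simp: strict_mono_on_def)

lemma time_changes_comp:
  assumes h: "h \<in> time_changes a b" and g: "g \<in> time_changes a b"
  shows "(\<lambda>x. h (g x)) \<in> time_changes a b"
proof (rule time_changesI)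
  show "strict_mono_on {a..b} (\<lambda>x. h (g x))"
    using time_changesD(3,5)[OF h] time_changesD(3,5)[OF g] by (simp add: strict_mono_on_def)
  show "continuous_on {a..b} (\<lambda>x. h (g x))"
    by (rule continuous_on_compose2[OF time_changesD(4)[OF h] time_changesD(4)[OF g]])
       (use time_changesD(5)[OF g] in auto)
qed (use time_changesD[OF h] time_changesD[OF g] in auto)

lemma time_changes_inverse:
  assumes h: "h \<in> time_changes a b" and ab: "a \<le> b"
  obtains g where "g \<in> time_changes a b" "\<And>x. x \<in> {a..b} \<Longrightarrow> h (g x) = x" "\<And>x. x \<in> {a..b} \<Longrightarrow> g (h x) = x"
proof -
  note D = time_changesD[OF h]
  have inj: "inj_on h {a..b}" using D(3) by (rule strict_mono_on_imp_inj_on)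
  have im: "h ` {a..b} = {a..b}"
  proof
    show "h ` {a..b} \<subseteq> {a..b}" using D(5) by auto
    show "{a..b} \<subseteq> h ` {a..b}"
    proof
      fix y assume "y \<in> {a..b}"
      then have "\<exists>x\<ge>a. x \<le> b \<and> h x = y" using D ab by (intro IVT') auto
      then show "y \<in> h ` {a..b}" by auto
    qed
  qed
  define g where "g = inv_into {a..b} h"
  have hg: "h (g x) = x" "g x \<in> {a..b}" if "x \<in> {a..b}" for x
    using that im f_inv_into_f[of x h "{a..b}"] inv_into_into[of x h "{a..b}"] by (simp_all add: g_def)
  have gh: "g (h x) = x" if "x \<in> {a..b}" for x
    using that inj by (simp add: g_def)
  have "continuous_on (h ` {a..b}) g"
    by (rule continuous_on_inv) (use D gh in auto)
  then have "continuous_on {a..b} g" by (simp add: im)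
  moreover have "strict_mono_on {a..b} g"
  proof (rule strict_mono_onI)
    fix r s assume rs: "r \<in> {a..b}" "s \<in> {a..b}" "r < s"
    show "g r < g s"
    proof (rule ccontr)
      assume "\<not> g r < g s"
      then have "h (g s) \<le> h (g r)" using hg(2) rs
        by (intro monotone_onD[OF strict_mono_on_imp_mono_on[OF D(3)]]) auto
      then show False using hg rs by simp
    qed
  qed
  moreover have "g a = a" "g b = b" using gh[of a] gh[of b] D ab by auto
  ultimately have "g \<in> time_changes a b" by (intro time_changesI)
  then show thesis using hg gh that by blast
qed

lemma J1_dist_on_le:
  assumes h: "h \<in> time_changes a b" and ab: "a \<le> b"
    and 1: "\<And>x. x \<in> {a..b} \<Longrightarrow> \<bar>\<phi>\<^sub>1 (h x) - \<phi>\<^sub>2 x\<bar> \<le> c" and 2: "\<And>x. x \<in> {a..b} \<Longrightarrow> \<bar>h x - x\<bar> \<le> c"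
  shows "J1_dist_on a b \<phi>\<^sub>1 \<phi>\<^sub>2 \<le> c"
  unfolding J1_dist_on_def
proof (rule cINF_lower2[OF _ h])
  show "max (SUP x\<in>{a..b}. \<bar>\<phi>\<^sub>1 (h x) - \<phi>\<^sub>2 x\<bar>) (SUP x\<in>{a..b}. \<bar>h x - x\<bar>) \<le> c"
    using ab 1 2 by (auto intro!: cSUP_least)
  show "bdd_below ((\<lambda>h. max (SUP x\<in>{a..b}. \<bar>\<phi>\<^sub>1 (h x) - \<phi>\<^sub>2 x\<bar>) (SUP x\<in>{a..b}. \<bar>h x - x\<bar>)) ` time_changes a b)"
  proof (rule bdd_belowI2)
    fix g assume g: "g \<in> time_changes a b"
    have "\<bar>g a - a\<bar> \<le> (SUP x\<in>{a..b}. \<bar>g x - x\<bar>)"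
    proof (rule cSUP_upper)
      show "bdd_above ((\<lambda>x. \<bar>g x - x\<bar>) ` {a..b})"
        by (rule bdd_aboveI2[of _ _ "b - a"]) (use time_changesD(5)[OF g] in fastforce)
    qed (use ab in auto)
    then show "0 \<le> max (SUP x\<in>{a..b}. \<bar>\<phi>\<^sub>1 (g x) - \<phi>\<^sub>2 x\<bar>) (SUP x\<in>{a..b}. \<bar>g x - x\<bar>)" by linarith
  qed
qed

lemma J1_dist_on_nonneg: assumes ab: "a \<le> b" shows "J1_dist_on a b \<phi>\<^sub>1 \<phi>\<^sub>2 \<ge> 0"
  unfolding J1_dist_on_def
proof (rule cINF_greatest)
  show "time_changes a b \<noteq> {}" using id_time_change by blast
  fix g assume g: "g \<in> time_changes a b"
  have "\<bar>g a - a\<bar> \<le> (SUP x\<in>{a..b}. \<bar>g x - x\<bar>)"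
  proof (rule cSUP_upper)
    show "bdd_above ((\<lambda>x. \<bar>g x - x\<bar>) ` {a..b})"
      by (rule bdd_aboveI2[of _ _ "b - a"]) (use time_changesD(5)[OF g] in fastforce)
  qed (use ab in auto)
  then show "0 \<le> max (SUP x\<in>{a..b}. \<bar>\<phi>\<^sub>1 (g x) - \<phi>\<^sub>2 x\<bar>) (SUP x\<in>{a..b}. \<bar>g x - x\<bar>)" by linarith
qed

text \<open>Boundedness of the paths makes the two suprema genuine upper bounds, so that a
  near-optimal time change yields pointwise estimates.\<close>

lemma J1_dist_on_lessE:
  assumes less: "J1_dist_on a b \<phi>\<^sub>1 \<phi>\<^sub>2 < c" and bd: "bounded (\<phi>\<^sub>1 ` {a..b})" "bounded (\<phi>\<^sub>2 ` {a..b})"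
  obtains h where "h \<in> time_changes a b" "\<And>x. x \<in> {a..b} \<Longrightarrow> \<bar>\<phi>\<^sub>1 (h x) - \<phi>\<^sub>2 x\<bar> < c"
    "\<And>x. x \<in> {a..b} \<Longrightarrow> \<bar>h x - x\<bar> < c"
proof -
  have "time_changes a b \<noteq> {}" using id_time_change by blast
  from cInf_lessD[OF _ less[unfolded J1_dist_on_def]] this
  obtain h where h: "h \<in> time_changes a b"
    and less': "max (SUP x\<in>{a..b}. \<bar>\<phi>\<^sub>1 (h x) - \<phi>\<^sub>2 x\<bar>) (SUP x\<in>{a..b}. \<bar>h x - x\<bar>) < c" by auto
  obtain B1 B2 where B: "\<And>x. x \<in> {a..b} \<Longrightarrow> \<bar>\<phi>\<^sub>1 x\<bar> \<le> B1" "\<And>x. x \<in> {a..b} \<Longrightarrow> \<bar>\<phi>\<^sub>2 x\<bar> \<le> B2"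
    using bd unfolding bounded_iff by (metis imageI real_norm_def)
  note D = time_changesD[OF h]
  have "\<bar>\<phi>\<^sub>1 (h x) - \<phi>\<^sub>2 x\<bar> \<le> (SUP x\<in>{a..b}. \<bar>\<phi>\<^sub>1 (h x) - \<phi>\<^sub>2 x\<bar>)" if "x \<in> {a..b}" for x
  proof (rule cSUP_upper[OF that])
    show "bdd_above ((\<lambda>x. \<bar>\<phi>\<^sub>1 (h x) - \<phi>\<^sub>2 x\<bar>) ` {a..b})"
    proof (rule bdd_aboveI2)
      fix x assume "x \<in> {a..b}"
      then show "\<bar>\<phi>\<^sub>1 (h x) - \<phi>\<^sub>2 x\<bar> \<le> B1 + B2" using B(1)[OF D(5)[of x]] B(2)[of x] by linarith
    qed
  qed
  moreover have "\<bar>h x - x\<bar> \<le> (SUP x\<in>{a..b}. \<bar>h x - x\<bar>)" if "x \<in> {a..b}" for x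
  proof (rule cSUP_upper[OF that])
    show "bdd_above ((\<lambda>x. \<bar>h x - x\<bar>) ` {a..b})"
      by (rule bdd_aboveI2[of _ _ "b - a"]) (use D(5) in fastforce)
  qed
  ultimately show thesis using less' h by (intro that[of h]) (auto intro: le_less_trans)
qed

lemma J1_dist_on_refl: "a \<le> b \<Longrightarrow> J1_dist_on a b \<phi> \<phi> = 0"
  using J1_dist_on_le[OF id_time_change, of a b \<phi> \<phi> 0] J1_dist_on_nonneg[of a b \<phi> \<phi>] by simp

text \<open>Both sides are infima of the same set, so no boundedness is needed.\<close>

lemma J1_dist_on_sym:
  assumes ab: "a \<le> b"
  shows "J1_dist_on a b \<phi>\<^sub>1 \<phi>\<^sub>2 = J1_dist_on a b \<phi>\<^sub>2 \<phi>\<^sub>1"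
proof -
  define D where "D \<phi>\<^sub>1 \<phi>\<^sub>2 h =
    max (SUP x\<in>{a..b}. \<bar>\<phi>\<^sub>1 (h x) - \<phi>\<^sub>2 x\<bar>) (SUP x\<in>{a..b}. \<bar>h x - x\<bar>)" for \<phi>\<^sub>1 \<phi>\<^sub>2 h
  have sub: "D \<phi>\<^sub>1 \<phi>\<^sub>2 ` time_changes a b \<subseteq> D \<phi>\<^sub>2 \<phi>\<^sub>1 ` time_changes a b" for \<phi>\<^sub>1 \<phi>\<^sub>2
  proof
    fix y assume "y \<in> D \<phi>\<^sub>1 \<phi>\<^sub>2 ` time_changes a b"
    then obtain h where h: "h \<in> time_changes a b" "y = D \<phi>\<^sub>1 \<phi>\<^sub>2 h" by auto
    obtain g where g: "g \<in> time_changes a b" "\<And>x. x \<in> {a..b} \<Longrightarrow> h (g x) = x" "\<And>x. x \<in> {a..b} \<Longrightarrow> g (h x) = x"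
      using time_changes_inverse[OF h(1) ab] by metis
    have "h ` {a..b} = {a..b}"
    proof
      show "{a..b} \<subseteq> h ` {a..b}"
        using g(2) time_changesD(5)[OF g(1)] by (metis image_eqI subsetI)
    qed (use time_changesD(5)[OF h(1)] in auto)
    then have eq: "F ` {a..b} = (\<lambda>x. F (h x)) ` {a..b}" for F :: "real \<Rightarrow> real"
      by (metis image_image)
    have "(\<lambda>x. \<bar>\<phi>\<^sub>2 (g x) - \<phi>\<^sub>1 x\<bar>) ` {a..b} = (\<lambda>x. \<bar>\<phi>\<^sub>1 (h x) - \<phi>\<^sub>2 x\<bar>) ` {a..b}"
      by (subst eq) (auto simp: g(3) abs_minus_commute intro!: image_cong)
    moreover have "(\<lambda>x. \<bar>g x - x\<bar>) ` {a..b} = (\<lambda>x. \<bar>h x - x\<bar>) ` {a..b}"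
      by (subst eq) (auto simp: g(3) abs_minus_commute intro!: image_cong)
    ultimately have "D \<phi>\<^sub>2 \<phi>\<^sub>1 g = y" by (simp add: D_def h(2))
    then show "y \<in> D \<phi>\<^sub>2 \<phi>\<^sub>1 ` time_changes a b" using g(1) by blast
  qed
  have "D \<phi>\<^sub>1 \<phi>\<^sub>2 ` time_changes a b = D \<phi>\<^sub>2 \<phi>\<^sub>1 ` time_changes a b" using sub by blast
  then show ?thesis unfolding J1_dist_on_def D_def by simp
qed

text \<open>Near-optimal time changes are composed, and each of the two errors enters once.\<close>

lemma J1_dist_on_triangle:
  assumes ab: "a \<le> b" and bd: "bounded (\<phi>\<^sub>1 ` {a..b})" "bounded (\<phi>\<^sub>2 ` {a..b})" "bounded (\<phi>\<^sub>3 ` {a..b})"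
  shows "J1_dist_on a b \<phi>\<^sub>1 \<phi>\<^sub>3 \<le> J1_dist_on a b \<phi>\<^sub>1 \<phi>\<^sub>2 + J1_dist_on a b \<phi>\<^sub>2 \<phi>\<^sub>3"
proof (rule field_le_epsilon)
  fix e :: real assume "e > 0"
  then have 1: "J1_dist_on a b \<phi>\<^sub>1 \<phi>\<^sub>2 < J1_dist_on a b \<phi>\<^sub>1 \<phi>\<^sub>2 + e/2" (is "_ < ?c")
    and 2: "J1_dist_on a b \<phi>\<^sub>2 \<phi>\<^sub>3 < J1_dist_on a b \<phi>\<^sub>2 \<phi>\<^sub>3 + e/2" (is "_ < ?d") by simp_all
  from J1_dist_on_lessE[OF 1 bd(1,2)] obtain h where h: "h \<in> time_changes a b"
    "\<And>x. x \<in> {a..b} \<Longrightarrow> \<bar>\<phi>\<^sub>1 (h x) - \<phi>\<^sub>2 x\<bar> < ?c" "\<And>x. x \<in> {a..b} \<Longrightarrow> \<bar>h x - x\<bar> < ?c" by metis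
  from J1_dist_on_lessE[OF 2 bd(2,3)] obtain g where g: "g \<in> time_changes a b"
    "\<And>x. x \<in> {a..b} \<Longrightarrow> \<bar>\<phi>\<^sub>2 (g x) - \<phi>\<^sub>3 x\<bar> < ?d" "\<And>x. x \<in> {a..b} \<Longrightarrow> \<bar>g x - x\<bar> < ?d" by metis
  have "J1_dist_on a b \<phi>\<^sub>1 \<phi>\<^sub>3 \<le> ?c + ?d"
  proof (rule J1_dist_on_le[OF time_changes_comp[OF h(1) g(1)] ab])
    fix x assume x: "x \<in> {a..b}"
    show "\<bar>\<phi>\<^sub>1 (h (g x)) - \<phi>\<^sub>3 x\<bar> \<le> ?c + ?d" "\<bar>h (g x) - x\<bar> \<le> ?c + ?d"
      using h(2,3)[OF time_changesD(5)[OF g(1) x]] g(2,3)[OF x] by linarith+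
  qed
  then show "J1_dist_on a b \<phi>\<^sub>1 \<phi>\<^sub>3 \<le> J1_dist_on a b \<phi>\<^sub>1 \<phi>\<^sub>2 + J1_dist_on a b \<phi>\<^sub>2 \<phi>\<^sub>3 + e" by simp
qed

text \<open>The map of \<open>[a,b]\<close> onto \<open>[a',b']\<close> that fixes the middle part \<open>[l,r]\<close>.\<close>

definition end_stretch :: "real \<Rightarrow> real \<Rightarrow> real \<Rightarrow> real \<Rightarrow> real \<Rightarrow> real \<Rightarrow> real \<Rightarrow> real" where
  "end_stretch l r a b a' b' x =
     (if x \<le> l then l - (l - x) * ((l - a') / (l - a))
      else if x \<le> r then x else r + (x - r) * ((b' - r) / (b - r)))"

text \<open>Three affine pieces of positive slope are glued at \<open>l\<close> and
  \<open>r\<close>. Exchanging the two intervals inverts the outer slopes, which gives the inverse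
  map.\<close>

lemma end_stretch:
  assumes "a < l" "a' < l" "l < r" "r < b" "r < b'"
  shows "strict_mono (end_stretch l r a b a' b')" "continuous_on UNIV (end_stretch l r a b a' b')"
    "end_stretch l r a b a' b' a = a'" "end_stretch l r a b a' b' b = b'"
    "end_stretch l r a' b' a b (end_stretch l r a b a' b' x) = x"
proof -
  let ?E = "end_stretch l r a b a' b'"
  define \<alpha> \<beta> where "\<alpha> = (l - a') / (l - a)" and "\<beta> = (b' - r) / (b - r)"
  have ab: "\<alpha> > 0" "\<beta> > 0" using assms by (auto simp: \<alpha>_def \<beta>_def)
  have E: "?E x = (if x \<le> l then l - (l - x) * \<alpha> else if x \<le> r then x else r + (x - r) * \<beta>)" for x
    by (simp add: end_stretch_def \<alpha>_def \<beta>_def)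
  show "strict_mono ?E"
  proof (rule strict_monoI)
    fix x y :: real assume xy: "x < y"
    have p: "0 \<le> (l - x) * \<alpha>" if "x \<le> l" for x using ab that by simp
    have q: "0 < (x - r) * \<beta>" if "r < x" for x using ab that by simp
    have "(l - y) * \<alpha> < (l - x) * \<alpha>" "(x - r) * \<beta> < (y - r) * \<beta>" using ab xy by simp_all
    then show "?E x < ?E y" using p[of x] q[of y] xy assms by (auto simp: E)
  qed
  have "continuous_on ({..l} \<union> {l..}) ?E"
  proof (rule continuous_on_closed_Un)
    show "continuous_on {..l} ?E"
      by (rule continuous_on_eq[of _ "\<lambda>x. l - (l - x) * \<alpha>"]) (auto intro!: continuous_intros simp: E)
    have "continuous_on ({l..r} \<union> {r..}) ?E"
    proof (rule continuous_on_closed_Un)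
      show "continuous_on {l..r} ?E"
        by (rule continuous_on_eq[of _ "\<lambda>x. x"]) (auto intro!: continuous_intros simp: E)
      show "continuous_on {r..} ?E"
        by (rule continuous_on_eq[of _ "\<lambda>x. r + (x - r) * \<beta>"]) (use assms in \<open>auto intro!: continuous_intros simp: E\<close>)
    qed auto
    moreover have "{l..r} \<union> {r..} = {l..}" using assms by auto
    ultimately show "continuous_on {l..} ?E" by simp
  qed auto
  moreover have "{..l} \<union> {l..} = UNIV" by auto
  ultimately show "continuous_on UNIV ?E" by simp
  show "?E a = a'" "?E b = b'" using assms by (auto simp: end_stretch_def)
  have p: "0 \<le> (l - x) * \<alpha>" if "x \<le> l" for x using ab that by simp
  have q: "0 < (x - r) * \<beta>" if "r < x" for x using ab that by simp
  have "(l - a) / (l - a') = 1 / \<alpha>" "(b - r) / (b' - r) = 1 / \<beta>" by (auto simp: \<alpha>_def \<beta>_def)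
  then have F: "end_stretch l r a' b' a b y = (if y \<le> l then l - (l - y) / \<alpha> else if y \<le> r then y else r + (y - r) / \<beta>)" for y
    by (simp add: end_stretch_def)
  then show "end_stretch l r a' b' a b (?E x) = x"
  proof (cases "x \<le> r")
    case True
    then show ?thesis using F p[of x] ab assms unfolding E by (cases "x \<le> l") auto
  next
    case False
    then have "\<not> r + (x - r) * \<beta> \<le> l" "\<not> r + (x - r) * \<beta> \<le> r" using q[of x] assms by linarith+
    then show ?thesis using F False ab assms unfolding E by simp
  qed
qed

text \<open>A time change of \<open>[a,b]\<close> is conjugated by the stretch \<open>A\<close> onto
  \<open>[a',b']\<close>. As \<open>A\<close> moves points only inside the end zones
  \<open>[l',l]\<close> and \<open>[r,r']\<close>, which are narrow and where both paths hardly
  oscillate, it costs \<open>e\<close> at each of the two points to which it is applied. The lemma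
  gives continuity of the distance in its end points, from which the double integral gets its
  measurability.\<close>

lemma J1_dist_on_perturb:
  assumes ord: "a < l" "a' < l" "l < r" "r < b" "r < b'" "l' \<le> a" "l' \<le> a'" "b \<le> r'" "b' \<le> r'"
    and small: "l - l' \<le> e" "r' - r \<le> e"
    and bd: "bounded (\<phi>\<^sub>1 ` {a..b})" "bounded (\<phi>\<^sub>2 ` {a..b})"
    and osc: "\<And>x y. {x, y} \<subseteq> {l'..l} \<Longrightarrow> \<bar>\<phi>\<^sub>1 x - \<phi>\<^sub>1 y\<bar> \<le> e \<and> \<bar>\<phi>\<^sub>2 x - \<phi>\<^sub>2 y\<bar> \<le> e"
      "\<And>x y. {x, y} \<subseteq> {r..r'} \<Longrightarrow> \<bar>\<phi>\<^sub>1 x - \<phi>\<^sub>1 y\<bar> \<le> e \<and> \<bar>\<phi>\<^sub>2 x - \<phi>\<^sub>2 y\<bar> \<le> e"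
  shows "J1_dist_on a' b' \<phi>\<^sub>1 \<phi>\<^sub>2 \<le> J1_dist_on a b \<phi>\<^sub>1 \<phi>\<^sub>2 + 2 * e"
proof (rule field_le_epsilon)
  fix \<delta> :: real assume "\<delta> > 0"
  then have 1: "J1_dist_on a b \<phi>\<^sub>1 \<phi>\<^sub>2 < J1_dist_on a b \<phi>\<^sub>1 \<phi>\<^sub>2 + \<delta>" (is "_ < ?c") by simp
  from J1_dist_on_lessE[OF 1 bd] obtain h where h: "h \<in> time_changes a b"
    "\<And>x. x \<in> {a..b} \<Longrightarrow> \<bar>\<phi>\<^sub>1 (h x) - \<phi>\<^sub>2 x\<bar> < ?c" "\<And>x. x \<in> {a..b} \<Longrightarrow> \<bar>h x - x\<bar> < ?c" by metis
  define A B where "A = end_stretch l r a b a' b'" and "B = end_stretch l r a' b' a b"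
  have A: "strict_mono A" "continuous_on UNIV A" "A a = a'" "A b = b'" "\<And>x. B (A x) = x"
    using end_stretch[of a l a' r b b'] ord by (auto simp: A_def B_def)
  have B: "strict_mono B" "continuous_on UNIV B" "B a' = a" "B b' = b" "\<And>x. A (B x) = x"
    using end_stretch[of a' l a r b' b] ord by (auto simp: A_def B_def)
  have Bin: "B x \<in> {a..b}" if "x \<in> {a'..b'}" for x
    using that strict_mono_less_eq[OF B(1), of a' x] strict_mono_less_eq[OF B(1), of x b'] B by auto
  have near: "A x = x \<or> {A x, x} \<subseteq> {l'..l} \<or> {A x, x} \<subseteq> {r..r'}" if "x \<in> {a..b}" for x
  proof -
    have m: "A a \<le> A x" "A x \<le> A b" "x \<le> l \<Longrightarrow> A x \<le> A l" "r \<le> x \<Longrightarrow> A r \<le> A x"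
      using that strict_mono_less_eq[OF A(1)] by auto
    have "A l = l" "A r = r" using ord by (auto simp: A_def end_stretch_def)
    moreover have "A x = x" if "l \<le> x" "x \<le> r" using that ord by (auto simp: A_def end_stretch_def)
    ultimately show ?thesis using m A that ord by fastforce
  qed
  have n1: "\<bar>A x - x\<bar> \<le> e" "\<bar>\<phi>\<^sub>1 (A x) - \<phi>\<^sub>1 x\<bar> \<le> e" "\<bar>\<phi>\<^sub>2 (A x) - \<phi>\<^sub>2 x\<bar> \<le> e" if x: "x \<in> {a..b}" for x
    using near[OF x] osc(1)[of "A x" x] osc(2)[of "A x" x] small ord by auto
  have "(\<lambda>x. A (h (B x))) \<in> time_changes a' b'"
  proof (rule time_changesI)
    show "strict_mono_on {a'..b'} (\<lambda>x. A (h (B x)))"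
      by (intro strict_mono_onI strict_monoD[OF A(1)] strict_mono_onD[OF time_changesD(3)[OF h(1)]] Bin strict_monoD[OF B(1)])
    show "continuous_on {a'..b'} (\<lambda>x. A (h (B x)))"
      by (rule continuous_on_compose2[OF A(2)], rule continuous_on_compose2[OF time_changesD(4)[OF h(1)]],
          rule continuous_on_subset[OF B(2)]) (use Bin in auto)
  qed (use A B time_changesD[OF h(1)] in auto)
  then have "J1_dist_on a' b' \<phi>\<^sub>1 \<phi>\<^sub>2 \<le> ?c + 2 * e"
  proof (rule J1_dist_on_le)
    fix x assume x: "x \<in> {a'..b'}"
    define z where "z = B x"
    have z: "z \<in> {a..b}" "h z \<in> {a..b}" "x = A z"
      using Bin[OF x] time_changesD(5)[OF h(1)] B by (auto simp: z_def)
    have "\<bar>\<phi>\<^sub>1 (A (h z)) - \<phi>\<^sub>2 (A z)\<bar> \<le> ?c + 2 * e" "\<bar>A (h z) - A z\<bar> \<le> ?c + 2 * e"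
      using n1[OF z(1)] n1[OF z(2)] h(2,3)[OF z(1)] by linarith+
    then show "\<bar>\<phi>\<^sub>1 (A (h (B x))) - \<phi>\<^sub>2 x\<bar> \<le> ?c + 2 * e" "\<bar>A (h (B x)) - x\<bar> \<le> ?c + 2 * e"
      by (simp_all only: z(3)[symmetric] z_def[symmetric])
  qed (use ord in auto)
  then show "J1_dist_on a' b' \<phi>\<^sub>1 \<phi>\<^sub>2 \<le> J1_dist_on a b \<phi>\<^sub>1 \<phi>\<^sub>2 + 2 * e + \<delta>" by simp
qed

section \<open>The Skorokhod metric\<close>

lemma has_bochner_integral_exp_tail:
  fixes a :: real
  shows "has_bochner_integral lborel (\<lambda>t. indicator {a..} t * exp (- t)) (exp (- a))"
proof -
  have "(\<integral>\<^sup>+ t. ennreal (exp (- t)) * indicator {a..} t \<partial>lborel) = ennreal (0 - (- exp (- a)))"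
  proof (rule nn_integral_FTC_atLeast)
    show "((\<lambda>t::real. - exp (- t)) \<longlongrightarrow> 0) at_top"
      using tendsto_minus[OF filterlim_compose[OF exp_at_bot filterlim_uminus_at_bot_at_top]] by simp
  qed (auto intro!: derivative_eq_intros)
  also have "(\<integral>\<^sup>+ t. ennreal (exp (- t)) * indicator {a..} t \<partial>lborel)
      = (\<integral>\<^sup>+ t. ennreal (indicator {a..} t * exp (- t)) \<partial>lborel)"
    by (intro nn_integral_cong) (auto split: split_indicator)
  finally show ?thesis by (intro has_bochner_integral_nn_integral) auto
qed

definition J1_inner :: "(real \<Rightarrow> real) \<Rightarrow> (real \<Rightarrow> real) \<Rightarrow> real \<Rightarrow> real" where
  "J1_inner \<phi>\<^sub>1 \<phi>\<^sub>2 s = (\<integral>t. indicator {1<..} t * (exp (- t) * min 1 (J1_dist_on s t \<phi>\<^sub>1 \<phi>\<^sub>2)) \<partial>lborel)"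

lemma J1_dist_eq:
  "J1_dist \<phi>\<^sub>1 \<phi>\<^sub>2 = (\<integral>s. indicator {0<..<1} s * J1_inner \<phi>\<^sub>1 \<phi>\<^sub>2 s \<partial>lborel)"
proof -
  have 1: "einterval 1 \<infinity> = {1<..}" "einterval 0 1 = {0<..<1}"
    by (auto simp: einterval_def one_ereal_def zero_ereal_def)
  have "(LBINT t=1..\<infinity>. exp (- t) * min 1 (J1_dist_on s t \<phi>\<^sub>1 \<phi>\<^sub>2)) = J1_inner \<phi>\<^sub>1 \<phi>\<^sub>2 s" for s
    by (simp add: interval_lebesgue_integral_def set_lebesgue_integral_def J1_inner_def 1)
  then show ?thesis
    by (simp add: J1_dist_def interval_lebesgue_integral_def set_lebesgue_integral_def 1)
qed

text \<open>Around common continuity points of both paths the end zones of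
  \<open>J1_dist_on_perturb\<close> have small oscillation. The estimate is used in both directions,
  since old and new end points enter it symmetrically.\<close>

lemma J1_dist_on_continuous:
  assumes \<phi>: "\<phi>\<^sub>1 \<in> skorokhod_space" "\<phi>\<^sub>2 \<in> skorokhod_space"
    and C: "C = {t. t > 0 \<and> isCont \<phi>\<^sub>1 t \<and> isCont \<phi>\<^sub>2 t}"
  shows "continuous_on ((C \<inter> {0<..<1}) \<times> (C \<inter> {1<..})) (\<lambda>(s, t). J1_dist_on s t \<phi>\<^sub>1 \<phi>\<^sub>2)"
proof (rule continuous_onI)
  fix x and \<epsilon> :: real
  assume "x \<in> (C \<inter> {0<..<1}) \<times> (C \<inter> {1<..})" and "\<epsilon> > 0"
  then obtain s t where st: "x = (s, t)" "s \<in> C" "t \<in> C" "0 < s" "s < 1" "1 < t" by auto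
  define e where "e = \<epsilon> / 4"
  have e: "e > 0" "2 * e \<le> \<epsilon>" using \<open>\<epsilon> > 0\<close> by (auto simp: e_def)
  have "\<exists>d>0. \<forall>x y. \<bar>x - c\<bar> < d \<and> \<bar>y - c\<bar> < d \<longrightarrow> \<bar>\<phi>\<^sub>1 x - \<phi>\<^sub>1 y\<bar> \<le> e \<and> \<bar>\<phi>\<^sub>2 x - \<phi>\<^sub>2 y\<bar> \<le> e" if "c \<in> C" for c
  proof -
    have "isCont \<phi>\<^sub>1 c" "isCont \<phi>\<^sub>2 c" using that C by auto
    moreover have "e / 2 > 0" using e by simp
    ultimately obtain d1 d2 where d: "d1 > 0" "d2 > 0" "\<And>x. \<bar>x - c\<bar> < d1 \<Longrightarrow> \<bar>\<phi>\<^sub>1 x - \<phi>\<^sub>1 c\<bar> < e/2"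
        "\<And>x. \<bar>x - c\<bar> < d2 \<Longrightarrow> \<bar>\<phi>\<^sub>2 x - \<phi>\<^sub>2 c\<bar> < e/2"
      unfolding continuous_at_eps_delta dist_real_def by metis
    show ?thesis
    proof (intro exI[of _ "min d1 d2"] conjI allI impI)
      fix x y assume a: "\<bar>x - c\<bar> < min d1 d2 \<and> \<bar>y - c\<bar> < min d1 d2"
      then have "\<bar>\<phi>\<^sub>1 x - \<phi>\<^sub>1 c\<bar> < e/2" "\<bar>\<phi>\<^sub>1 y - \<phi>\<^sub>1 c\<bar> < e/2" using d(3) by auto
      then show "\<bar>\<phi>\<^sub>1 x - \<phi>\<^sub>1 y\<bar> \<le> e" by linarith
      have "\<bar>\<phi>\<^sub>2 x - \<phi>\<^sub>2 c\<bar> < e/2" "\<bar>\<phi>\<^sub>2 y - \<phi>\<^sub>2 c\<bar> < e/2" using d(4) a by auto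
      then show "\<bar>\<phi>\<^sub>2 x - \<phi>\<^sub>2 y\<bar> \<le> e" by linarith
    qed (use d in auto)
  qed
  then obtain d1 d2 where d: "d1 > 0" "d2 > 0"
    "\<And>x y. \<bar>x - s\<bar> < d1 \<Longrightarrow> \<bar>y - s\<bar> < d1 \<Longrightarrow> \<bar>\<phi>\<^sub>1 x - \<phi>\<^sub>1 y\<bar> \<le> e \<and> \<bar>\<phi>\<^sub>2 x - \<phi>\<^sub>2 y\<bar> \<le> e"
    "\<And>x y. \<bar>x - t\<bar> < d2 \<Longrightarrow> \<bar>y - t\<bar> < d2 \<Longrightarrow> \<bar>\<phi>\<^sub>1 x - \<phi>\<^sub>1 y\<bar> \<le> e \<and> \<bar>\<phi>\<^sub>2 x - \<phi>\<^sub>2 y\<bar> \<le> e"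
    using st(2,3) by metis
  \<comment> \<open>The zones of half width \<open>m\<close> about \<open>s\<close> and
    \<open>t\<close> lie within the continuity radii, stay positive and disjoint, and have width at
    most \<open>e\<close>.\<close>
  define m where "m = min (min (d1/2) (d2/2)) (min (s/2) (min ((t - s) / 3) (e/2)))"
  have m: "m > 0" "m < d1" "m < d2" "m < s" "s + m < t - m" "2 * m \<le> e"
    using d st e by (auto simp: m_def min_def field_simps)
  show "\<exists>\<delta>>0. \<forall>x'\<in>(C \<inter> {0<..<1}) \<times> (C \<inter> {1<..}). dist x' x < \<delta> \<longrightarrow>
       dist ((\<lambda>(s, t). J1_dist_on s t \<phi>\<^sub>1 \<phi>\<^sub>2) x') ((\<lambda>(s, t). J1_dist_on s t \<phi>\<^sub>1 \<phi>\<^sub>2) x) \<le> \<epsilon>"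
  proof (intro exI[of _ m] conjI ballI impI)
    fix x' assume x': "x' \<in> (C \<inter> {0<..<1}) \<times> (C \<inter> {1<..})" "dist x' x < m"
    obtain s' t' where st': "x' = (s', t')" by force
    have "\<bar>s' - s\<bar> < m" "\<bar>t' - t\<bar> < m"
      using x'(2) dist_fst_le[of x' x] dist_snd_le[of x' x] by (auto simp: st st' dist_real_def)
    then have *: "J1_dist_on a' b' \<phi>\<^sub>1 \<phi>\<^sub>2 \<le> J1_dist_on a b \<phi>\<^sub>1 \<phi>\<^sub>2 + 2 * e"
      if "(a, b, a', b') \<in> {(s, t, s', t'), (s', t', s, t)}" for a b a' b'
      using that m d
      by (intro J1_dist_on_perturb[of a "s + m" a' "t - m" b b' "s - m" "t + m" e] skorokhod_bounded \<phi>) auto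
    have "J1_dist_on s' t' \<phi>\<^sub>1 \<phi>\<^sub>2 \<le> J1_dist_on s t \<phi>\<^sub>1 \<phi>\<^sub>2 + 2 * e"
      "J1_dist_on s t \<phi>\<^sub>1 \<phi>\<^sub>2 \<le> J1_dist_on s' t' \<phi>\<^sub>1 \<phi>\<^sub>2 + 2 * e" by (auto intro!: *)
    then show "dist ((\<lambda>(s, t). J1_dist_on s t \<phi>\<^sub>1 \<phi>\<^sub>2) x') ((\<lambda>(s, t). J1_dist_on s t \<phi>\<^sub>1 \<phi>\<^sub>2) x) \<le> \<epsilon>"
      using e by (auto simp: st st' dist_real_def)
  qed (rule m)
qed

text \<open>Joint continuity is known only at pairs of common continuity points. Set to 0 elsewhere,
  the distance becomes the jointly Borel function \<open>g\<close>; the true integrands differ from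
  those of \<open>g\<close> on a countable set, which affects neither measurability nor the inner
  integral.\<close>

lemma J1_integrands_measurable:
  assumes \<phi>: "\<phi>\<^sub>1 \<in> skorokhod_space" "\<phi>\<^sub>2 \<in> skorokhod_space"
    and C: "C = {t. t > 0 \<and> isCont \<phi>\<^sub>1 t \<and> isCont \<phi>\<^sub>2 t}"
  shows "countable ({0<..} - C)"
    and "s \<in> C \<Longrightarrow> s < 1 \<Longrightarrow> 
      (\<lambda>t. indicator {1<..} t * (exp (- t) * min 1 (J1_dist_on s t \<phi>\<^sub>1 \<phi>\<^sub>2))) \<in> borel_measurable lborel"
    and "(\<lambda>s. indicator {0<..<1} s * J1_inner \<phi>\<^sub>1 \<phi>\<^sub>2 s) \<in> borel_measurable lborel"
proof -
  have "{0<..} - C \<subseteq> {t. t > 0 \<and> \<not> isCont \<phi>\<^sub>1 t} \<union> {t. t > 0 \<and> \<not> isCont \<phi>\<^sub>2 t}" by (auto simp: C)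
  then show cnt: "countable ({0<..} - C)"
    using skorokhod_countable_discont[OF \<phi>(1)] skorokhod_countable_discont[OF \<phi>(2)]
    by (meson countable_Un countable_subset)
  have Cb: "C \<in> sets borel"
  proof -
    have "({0<..} - C) \<in> sets borel" by (rule sets.countable[OF _ cnt]) simp
    then have "{0<..} - ({0<..} - C) \<in> sets borel" by (rule sets.Diff[rotated]) simp
    moreover have "{0<..} - ({0<..} - C) = C" by (auto simp: C)
    ultimately show ?thesis by simp
  qed
  define R where "R = (C \<inter> {0<..<1}) \<times> (C \<inter> {1<..})"
  define g where "g x = (if x \<in> R then (\<lambda>(s, t). J1_dist_on s t \<phi>\<^sub>1 \<phi>\<^sub>2) x else 0)" for x
  have R: "R \<in> sets borel"
    unfolding R_def borel_prod[symmetric] by (intro pair_measureI sets.Int Cb) auto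
  have "g \<in> borel_measurable borel"
    unfolding g_def by (intro borel_measurable_continuous_on_if[OF R]) 
      (auto simp: R_def intro!: J1_dist_on_continuous[OF \<phi> C])
  then have g: "g \<in> borel_measurable (lborel \<Otimes>\<^sub>M lborel)" by (simp add: lborel_prod)
  show inner: "(\<lambda>t. indicator {1<..} t * (exp (- t) * min 1 (J1_dist_on s t \<phi>\<^sub>1 \<phi>\<^sub>2))) \<in> borel_measurable lborel"
    if s: "s \<in> C" "s < 1" for s
  proof (rule measurable_discrete_difference[of "\<lambda>t. indicator {1<..} t * (exp (- t) * min 1 (g (s, t)))" _ _ "{0<..} - C"])
    show "(\<lambda>t. indicator {1<..} t * (exp (- t) * min 1 (g (s, t)))) \<in> borel_measurable lborel"
      using g by measurable
  qed (use cnt s C in \<open>auto simp: g_def R_def split: split_indicator\<close>)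
  show "(\<lambda>s. indicator {0<..<1} s * J1_inner \<phi>\<^sub>1 \<phi>\<^sub>2 s) \<in> borel_measurable lborel"
  proof (rule measurable_discrete_difference[of "\<lambda>s. indicator {0<..<1} s * (\<integral>t. indicator {1<..} t * (exp (- t) * min 1 (g (s, t))) \<partial>lborel)" _ _ "{0<..} - C"])
    show "(\<lambda>s. indicator {0<..<1} s * (\<integral>t. indicator {1<..} t * (exp (- t) * min 1 (g (s, t))) \<partial>lborel)) \<in> borel_measurable lborel"
      using g by measurable
    fix s :: real assume s: "s \<notin> {0<..} - C" "s \<in> space lborel"
    show "indicator {0<..<1} s * (\<integral>t. indicator {1<..} t * (exp (- t) * min 1 (g (s, t))) \<partial>lborel) =
         indicator {0<..<1} s * J1_inner \<phi>\<^sub>1 \<phi>\<^sub>2 s"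
    proof (cases "s \<in> {0<..<1}")
      case True
      then have sC: "s \<in> C" "s < 1" "s > 0" using s by auto
      have "(\<integral>t. indicator {1<..} t * (exp (- t) * min 1 (g (s, t))) \<partial>lborel) = J1_inner \<phi>\<^sub>1 \<phi>\<^sub>2 s"
        unfolding J1_inner_def
      proof (rule integral_cong_AE)
        show "(\<lambda>t. indicator {1<..} t * (exp (- t) * min 1 (g (s, t)))) \<in> borel_measurable lborel"
          using g by measurable
        have "AE t in lborel. t \<notin> {0<..} - C"
          by (rule AE_I'[OF countable_imp_null_set_lborel[OF cnt]]) auto
        then show "AE t in lborel. indicator {1<..} t * (exp (- t) * min 1 (g (s, t))) =
           indicator {1<..} t * (exp (- t) * min 1 (J1_dist_on s t \<phi>\<^sub>1 \<phi>\<^sub>2))"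
          by eventually_elim (use sC in \<open>auto simp: g_def R_def split: split_indicator\<close>)
      qed (rule inner[OF sC(1,2)])
      then show ?thesis by simp
    qed simp
  qed (use cnt in auto)
qed

lemma J1_inner_integrable:
  assumes \<phi>: "\<phi>\<^sub>1 \<in> skorokhod_space" "\<phi>\<^sub>2 \<in> skorokhod_space"
    and s: "0 < s" "s < 1" "isCont \<phi>\<^sub>1 s" "isCont \<phi>\<^sub>2 s"
  shows "integrable lborel (\<lambda>t. indicator {1<..} t * (exp (- t) * min 1 (J1_dist_on s t \<phi>\<^sub>1 \<phi>\<^sub>2)))"
proof (rule Bochner_Integration.integrable_bound)
  show "integrable lborel (\<lambda>t. indicator {1..} t * exp (- t) :: real)"
    using has_bochner_integral_exp_tail[of 1] by (auto simp: has_bochner_integral_iff)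
  show "(\<lambda>t. indicator {1<..} t * (exp (- t) * min 1 (J1_dist_on s t \<phi>\<^sub>1 \<phi>\<^sub>2))) \<in> borel_measurable lborel"
    by (rule J1_integrands_measurable(2)[OF \<phi> refl]) (use s in auto)
  show "AE t in lborel. norm (indicator {1<..} t * (exp (- t) * min 1 (J1_dist_on s t \<phi>\<^sub>1 \<phi>\<^sub>2))) \<le> norm (indicator {1..} t * exp (- t) :: real)"
  proof (rule AE_I2)
    fix t :: real
    have "t > 1 \<Longrightarrow> \<bar>min 1 (J1_dist_on s t \<phi>\<^sub>1 \<phi>\<^sub>2)\<bar> \<le> 1"
      using s J1_dist_on_nonneg[of s t \<phi>\<^sub>1 \<phi>\<^sub>2] by simp
    then show "norm (indicator {1<..} t * (exp (- t) * min 1 (J1_dist_on s t \<phi>\<^sub>1 \<phi>\<^sub>2))) \<le> norm (indicator {1..} t * exp (- t) :: real)"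
      by (cases "t > 1") (simp_all add: abs_mult)
  qed
qed

lemma J1_integrand_nonneg:
  assumes "s < 1"
  shows "0 \<le> indicator {1<..} t * (exp (- t) * min 1 (J1_dist_on s t \<phi>\<^sub>1 \<phi>\<^sub>2))"
proof (cases "1 < t")
  case True
  then have "0 \<le> J1_dist_on s t \<phi>\<^sub>1 \<phi>\<^sub>2" using assms by (intro J1_dist_on_nonneg) simp
  then show ?thesis by (intro mult_nonneg_nonneg) simp_all
qed simp

lemma J1_inner_nonneg: "s < 1 \<Longrightarrow> J1_inner \<phi>\<^sub>1 \<phi>\<^sub>2 s \<ge> 0"
  unfolding J1_inner_def
  by (intro Bochner_Integration.integral_nonneg J1_integrand_nonneg)

lemma J1_inner_le_1: assumes "s < 1" shows "J1_inner \<phi>\<^sub>1 \<phi>\<^sub>2 s \<le> 1"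
proof -
  have "J1_inner \<phi>\<^sub>1 \<phi>\<^sub>2 s \<le> (\<integral>t. indicator {1..} t * exp (- t) \<partial>lborel)"
    unfolding J1_inner_def using has_bochner_integral_exp_tail[of 1]
    by (intro integral_mono') (auto simp: has_bochner_integral_iff split: split_indicator)
  also have "\<dots> = exp (- 1)" using has_bochner_integral_exp_tail[of 1] by (simp add: has_bochner_integral_iff)
  finally show ?thesis by (simp add: order.trans[of _ "exp (-1)"])
qed

lemma J1_outer_integrable:
  assumes \<phi>: "\<phi>\<^sub>1 \<in> skorokhod_space" "\<phi>\<^sub>2 \<in> skorokhod_space"
  shows "integrable lborel (\<lambda>s. indicator {0<..<1} s * J1_inner \<phi>\<^sub>1 \<phi>\<^sub>2 s)"
proof (rule Bochner_Integration.integrable_bound)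
  have "emeasure lborel {0<..<1::real} < \<infinity>" by (subst emeasure_lborel_Ioo) simp_all
  then show "integrable lborel (\<lambda>s::real. indicator {0<..<1} s :: real)"
    by (intro integrable_real_indicator) simp_all
  show "AE s in lborel. norm (indicator {0<..<1} s * J1_inner \<phi>\<^sub>1 \<phi>\<^sub>2 s) \<le> norm (indicator {0<..<1} s :: real)"
    using J1_inner_nonneg[of _ \<phi>\<^sub>1 \<phi>\<^sub>2] J1_inner_le_1[of _ \<phi>\<^sub>1 \<phi>\<^sub>2] by (intro AE_I2) (auto split: split_indicator)
qed (rule J1_integrands_measurable(3)[OF \<phi> refl])

section \<open>The metric axioms\<close>

lemma AE_continuity_points:
  assumes "\<phi> \<in> skorokhod_space"
  shows "AE s in lborel. s > 0 \<longrightarrow> isCont \<phi> s"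
  by (rule AE_I'[OF countable_imp_null_set_lborel[OF skorokhod_countable_discont[OF assms]]]) auto

lemma AE_lborel_interval_ex:
  fixes a b :: real
  assumes P: "AE x in lborel. P x" and "a < b"
  obtains x where "a < x" "x < b" "P x"
proof (rule ccontr)
  assume "\<not> thesis"
  then have "\<And>x. a < x \<Longrightarrow> x < b \<Longrightarrow> \<not> P x" using that by blast
  with P have "AE x in lborel. x \<notin> {a<..<b}" by (auto elim: eventually_mono)
  then have "emeasure lborel {a<..<b} = 0"
    by (subst (asm) AE_iff_measurable[of "{a<..<b}"]) auto
  then show False using \<open>a < b\<close> by simp
qed

lemma J1_dist_nonneg: "J1_dist \<phi>\<^sub>1 \<phi>\<^sub>2 \<ge> 0"
  unfolding J1_dist_eq
  by (intro Bochner_Integration.integral_nonneg) (auto split: split_indicator intro!: J1_inner_nonneg)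

lemma J1_dist_refl: "J1_dist \<phi> \<phi> = 0"
proof -
  have "(\<lambda>t. indicator {1<..} t * (exp (- t) * min 1 (J1_dist_on s t \<phi> \<phi>))) = (\<lambda>t. 0)" if "s < 1" for s
    using that by (auto split: split_indicator simp: J1_dist_on_refl)
  then have "(\<lambda>s. indicator {0<..<1} s * J1_inner \<phi> \<phi> s) = (\<lambda>s. 0)"
    by (auto split: split_indicator simp: J1_inner_def)
  then show ?thesis by (simp add: J1_dist_eq)
qed

lemma J1_dist_sym: "J1_dist \<phi>\<^sub>1 \<phi>\<^sub>2 = J1_dist \<phi>\<^sub>2 \<phi>\<^sub>1"
proof -
  have "J1_inner \<phi>\<^sub>1 \<phi>\<^sub>2 s = J1_inner \<phi>\<^sub>2 \<phi>\<^sub>1 s" if "s < 1" for s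
    using that J1_dist_on_sym[of s _ \<phi>\<^sub>1 \<phi>\<^sub>2] unfolding J1_inner_def
    by (intro Bochner_Integration.integral_cong) (auto split: split_indicator)
  then show ?thesis unfolding J1_dist_eq
    by (intro Bochner_Integration.integral_cong) (auto split: split_indicator)
qed

text \<open>Truncation at 1 preserves the triangle inequality for fixed end points. It is integrated
  for those \<open>s\<close> at which all three paths are continuous, hence for almost every
  \<open>s\<close>, where the inner integrals are known to exist.\<close>

lemma J1_dist_triangle:
  assumes \<phi>: "\<phi>\<^sub>1 \<in> skorokhod_space" "\<phi>\<^sub>2 \<in> skorokhod_space" "\<phi>\<^sub>3 \<in> skorokhod_space"
  shows "J1_dist \<phi>\<^sub>1 \<phi>\<^sub>3 \<le> J1_dist \<phi>\<^sub>1 \<phi>\<^sub>2 + J1_dist \<phi>\<^sub>2 \<phi>\<^sub>3"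
proof -
  have tri: "min 1 (J1_dist_on s t \<phi>\<^sub>1 \<phi>\<^sub>3) \<le> min 1 (J1_dist_on s t \<phi>\<^sub>1 \<phi>\<^sub>2) + min 1 (J1_dist_on s t \<phi>\<^sub>2 \<phi>\<^sub>3)"
    if "0 < s" "s < 1" "1 < t" for s t
    using that J1_dist_on_triangle[of s t \<phi>\<^sub>1 \<phi>\<^sub>2 \<phi>\<^sub>3] J1_dist_on_nonneg[of s t \<phi>\<^sub>1 \<phi>\<^sub>2]
      J1_dist_on_nonneg[of s t \<phi>\<^sub>2 \<phi>\<^sub>3] by (auto simp: skorokhod_bounded \<phi>)
  have inner: "J1_inner \<phi>\<^sub>1 \<phi>\<^sub>3 s \<le> J1_inner \<phi>\<^sub>1 \<phi>\<^sub>2 s + J1_inner \<phi>\<^sub>2 \<phi>\<^sub>3 s"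
    if s: "0 < s" "s < 1" "isCont \<phi>\<^sub>1 s" "isCont \<phi>\<^sub>2 s" "isCont \<phi>\<^sub>3 s" for s
  proof -
    have "J1_inner \<phi>\<^sub>1 \<phi>\<^sub>3 s \<le> (\<integral>t. indicator {1<..} t * (exp (- t) * min 1 (J1_dist_on s t \<phi>\<^sub>1 \<phi>\<^sub>2))
        + indicator {1<..} t * (exp (- t) * min 1 (J1_dist_on s t \<phi>\<^sub>2 \<phi>\<^sub>3)) \<partial>lborel)"
      unfolding J1_inner_def
    proof (rule integral_mono)
      fix t :: real
      show "indicator {1<..} t * (exp (- t) * min 1 (J1_dist_on s t \<phi>\<^sub>1 \<phi>\<^sub>3)) \<le>
         indicator {1<..} t * (exp (- t) * min 1 (J1_dist_on s t \<phi>\<^sub>1 \<phi>\<^sub>2))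
        + indicator {1<..} t * (exp (- t) * min 1 (J1_dist_on s t \<phi>\<^sub>2 \<phi>\<^sub>3))"
        using mult_left_mono[OF tri[of s t], of "exp (-t)"] s by (auto split: split_indicator simp: distrib_left)
    qed (intro Bochner_Integration.integrable_add J1_inner_integrable \<phi> s)+
    also have "\<dots> = J1_inner \<phi>\<^sub>1 \<phi>\<^sub>2 s + J1_inner \<phi>\<^sub>2 \<phi>\<^sub>3 s"
      unfolding J1_inner_def by (intro Bochner_Integration.integral_add J1_inner_integrable \<phi> s)
    finally show ?thesis .
  qed
  have "J1_dist \<phi>\<^sub>1 \<phi>\<^sub>3 \<le> (\<integral>s. indicator {0<..<1} s * J1_inner \<phi>\<^sub>1 \<phi>\<^sub>2 s + indicator {0<..<1} s * J1_inner \<phi>\<^sub>2 \<phi>\<^sub>3 s \<partial>lborel)"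
    unfolding J1_dist_eq
  proof (rule integral_mono_AE)
    show "AE s in lborel. indicator {0<..<1} s * J1_inner \<phi>\<^sub>1 \<phi>\<^sub>3 s
        \<le> indicator {0<..<1} s * J1_inner \<phi>\<^sub>1 \<phi>\<^sub>2 s + indicator {0<..<1} s * J1_inner \<phi>\<^sub>2 \<phi>\<^sub>3 s"
      using AE_continuity_points[OF \<phi>(1)] AE_continuity_points[OF \<phi>(2)] AE_continuity_points[OF \<phi>(3)]
      by eventually_elim (use inner in \<open>auto split: split_indicator\<close>)
  qed (intro Bochner_Integration.integrable_add J1_outer_integrable \<phi>)+
  also have "\<dots> = J1_dist \<phi>\<^sub>1 \<phi>\<^sub>2 + J1_dist \<phi>\<^sub>2 \<phi>\<^sub>3"
    unfolding J1_dist_eq by (intro Bochner_Integration.integral_add J1_outer_integrable \<phi>)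
  finally show ?thesis .
qed

text \<open>A near-optimal time change moves \<open>x\<close> so little that, by continuity at
  \<open>x\<close>, the value \<open>\<phi>\<^sub>1 (h x)\<close> is near both
  \<open>\<phi>\<^sub>1 x\<close> and \<open>\<phi>\<^sub>2 x\<close>.\<close>

lemma J1_dist_on_zeroD:
  assumes z: "J1_dist_on a b \<phi>\<^sub>1 \<phi>\<^sub>2 = 0" and bd: "bounded (\<phi>\<^sub>1 ` {a..b})" "bounded (\<phi>\<^sub>2 ` {a..b})"
    and x: "x \<in> {a..b}" "isCont \<phi>\<^sub>1 x"
  shows "\<phi>\<^sub>1 x = \<phi>\<^sub>2 x"
proof (rule ccontr)
  assume ne: "\<phi>\<^sub>1 x \<noteq> \<phi>\<^sub>2 x"
  define e where "e = \<bar>\<phi>\<^sub>1 x - \<phi>\<^sub>2 x\<bar> / 2"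
  have e: "e > 0" using ne by (simp add: e_def)
  obtain d where d: "d > 0" "\<And>y. \<bar>y - x\<bar> < d \<Longrightarrow> \<bar>\<phi>\<^sub>1 y - \<phi>\<^sub>1 x\<bar> < e"
    using x(2) e unfolding continuous_at_eps_delta dist_real_def by metis
  have "J1_dist_on a b \<phi>\<^sub>1 \<phi>\<^sub>2 < min d e" using z d e by simp
  from J1_dist_on_lessE[OF this bd] obtain h where
    "\<bar>\<phi>\<^sub>1 (h x) - \<phi>\<^sub>2 x\<bar> < min d e" "\<bar>h x - x\<bar> < min d e" using x(1) by metis
  then have "\<bar>\<phi>\<^sub>1 (h x) - \<phi>\<^sub>2 x\<bar> < e" "\<bar>\<phi>\<^sub>1 (h x) - \<phi>\<^sub>1 x\<bar> < e" using d(2)[of "h x"] by auto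
  moreover have "\<bar>\<phi>\<^sub>1 x - \<phi>\<^sub>2 x\<bar> \<le> \<bar>\<phi>\<^sub>1 (h x) - \<phi>\<^sub>2 x\<bar> + \<bar>\<phi>\<^sub>1 (h x) - \<phi>\<^sub>1 x\<bar>" by linarith
  ultimately show False unfolding e_def by simp
qed

text \<open>A vanishing integral forces distance 0 on some interval \<open>[s,t]\<close> around any
  given point, which identifies the paths at the continuity points of the first. These are dense,
  and right continuity does the rest.\<close>

lemma J1_dist_zeroD:
  assumes \<phi>: "\<phi>\<^sub>1 \<in> skorokhod_space" "\<phi>\<^sub>2 \<in> skorokhod_space" and z: "J1_dist \<phi>\<^sub>1 \<phi>\<^sub>2 = 0"
  shows "\<phi>\<^sub>1 = \<phi>\<^sub>2"
proof -
  have nn: "0 \<le> indicator {0<..<1} s * J1_inner \<phi>\<^sub>1 \<phi>\<^sub>2 s" for s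
    by (auto split: split_indicator intro!: J1_inner_nonneg)
  have "AE s in lborel. indicator {0<..<1} s * J1_inner \<phi>\<^sub>1 \<phi>\<^sub>2 s = 0"
    using z unfolding J1_dist_eq
    by (subst (asm) integral_nonneg_eq_0_iff_AE[OF J1_outer_integrable[OF \<phi>]]) (use nn in auto)
  then have AE0: "AE s in lborel. (s > 0 \<longrightarrow> isCont \<phi>\<^sub>1 s) \<and> (s > 0 \<longrightarrow> isCont \<phi>\<^sub>2 s) \<and>
      indicator {0<..<1} s * J1_inner \<phi>\<^sub>1 \<phi>\<^sub>2 s = 0"
    using AE_continuity_points[OF \<phi>(1)] AE_continuity_points[OF \<phi>(2)] by eventually_elim auto
  have cont_eq: "\<phi>\<^sub>1 x = \<phi>\<^sub>2 x" if x: "x > 0" "isCont \<phi>\<^sub>1 x" for x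
  proof -
    obtain s where s: "0 < s" "s < min 1 x" "isCont \<phi>\<^sub>1 s" "isCont \<phi>\<^sub>2 s" "J1_inner \<phi>\<^sub>1 \<phi>\<^sub>2 s = 0"
      using AE_lborel_interval_ex[OF AE0, of 0 "min 1 x"] x by (auto simp: less_le_trans)
    have AE1: "AE t in lborel. indicator {1<..} t * (exp (- t) * min 1 (J1_dist_on s t \<phi>\<^sub>1 \<phi>\<^sub>2)) = 0"
      using s(5) unfolding J1_inner_def
      by (subst (asm) integral_nonneg_eq_0_iff_AE[OF J1_inner_integrable[OF \<phi>]])
         (use s in \<open>auto intro!: J1_integrand_nonneg\<close>)
    obtain t where t: "max 1 x < t" "indicator {1<..} t * (exp (- t) * min 1 (J1_dist_on s t \<phi>\<^sub>1 \<phi>\<^sub>2)) = 0"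
      by (rule AE_lborel_interval_ex[OF AE1, of "max 1 x" "max 1 x + 1"]) simp_all
    then have "min 1 (J1_dist_on s t \<phi>\<^sub>1 \<phi>\<^sub>2) = 0" by (simp split: split_indicator_asm)
    then have "J1_dist_on s t \<phi>\<^sub>1 \<phi>\<^sub>2 = 0" by (simp add: min_def split: if_splits)
    then show ?thesis
      by (rule J1_dist_on_zeroD) (use x s t in \<open>auto intro!: skorokhod_bounded \<phi>\<close>)
  qed
  have "\<phi>\<^sub>1 x = \<phi>\<^sub>2 x" if x: "x > 0" for x
  proof (rule ccontr)
    assume ne: "\<phi>\<^sub>1 x \<noteq> \<phi>\<^sub>2 x"
    have "((\<lambda>y. \<phi>\<^sub>1 y - \<phi>\<^sub>2 y) \<longlongrightarrow> \<phi>\<^sub>1 x - \<phi>\<^sub>2 x) (at_right x)"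
      by (intro tendsto_diff skorokhod_right \<phi> x)
    then have "eventually (\<lambda>y. \<phi>\<^sub>1 y - \<phi>\<^sub>2 y \<noteq> 0) (at_right x)"
      using ne by (intro tendsto_imp_eventually_ne) auto
    then obtain b where b: "b > x" "\<And>y. x < y \<Longrightarrow> y < b \<Longrightarrow> \<phi>\<^sub>1 y \<noteq> \<phi>\<^sub>2 y"
      by (auto simp: eventually_at_right_field)
    obtain y where "x < y" "y < b" "y > 0 \<longrightarrow> isCont \<phi>\<^sub>1 y"
      using AE_lborel_interval_ex[OF AE_continuity_points[OF \<phi>(1)] b(1)] by metis
    then show False using cont_eq[of y] b(2)[of y] x by auto
  qed
  moreover have "\<phi>\<^sub>1 \<in> extensional {0<..}" "\<phi>\<^sub>2 \<in> extensional {0<..}" using \<phi> by (auto simp: skorokhod_space_def)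
  ultimately show ?thesis by (intro extensionalityI) auto
qed

interpretation J1: Metric_space skorokhod_space J1_dist
  by unfold_locales
    (auto simp: J1_dist_nonneg J1_dist_refl intro: J1_dist_sym J1_dist_zeroD J1_dist_triangle)

text \<open>The set \<open>B\<close> collects the end points at which the two paths cannot be matched.\<close>

lemma J1_dist_le:
  assumes c: "0 \<le> c" and e: "0 \<le> e"
    and B: "B \<in> sets lborel" "emeasure lborel B \<le> ennreal \<beta>" "0 \<le> \<beta>"
    and le: "\<And>s t. e < s \<Longrightarrow> s < 1 \<Longrightarrow> 1 < t \<Longrightarrow> t < T \<Longrightarrow> s \<notin> B \<Longrightarrow> t \<notin> B \<Longrightarrow> J1_dist_on s t \<phi>\<^sub>1 \<phi>\<^sub>2 \<le> c"
  shows "J1_dist \<phi>\<^sub>1 \<phi>\<^sub>2 \<le> c + e + 2 * \<beta> + exp (- T)"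
proof -
  have Bf: "emeasure lborel B < \<infinity>" using B(2) by (rule le_less_trans) simp
  have Bm: "measure lborel B \<le> \<beta>" using B by (simp add: measure_def enn2real_leI)
  have iB: "has_bochner_integral lborel (indicator B) (measure lborel B)"
    using has_bochner_integral_real_indicator[OF B(1)] Bf by auto
  have inner: "J1_inner \<phi>\<^sub>1 \<phi>\<^sub>2 s \<le> c + \<beta> + exp (- T)" if s: "e < s" "s < 1" "s \<notin> B" for s
  proof -
    \<comment> \<open>The majorant splits the range of \<open>t\<close>: matched end points weigh at
      most \<open>c\<close>, while \<open>B\<close> and the tail beyond \<open>T\<close> are charged
      in full.\<close>
    let ?u = "\<lambda>t. c * (indicator {1..} t * exp (- t)) + (indicator B t + indicator {T..} t * exp (- t)) :: real"
    have hb: "has_bochner_integral lborel ?u (c * exp (- 1) + (measure lborel B + exp (- T)))"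
      by (intro has_bochner_integral_add has_bochner_integral_mult_right has_bochner_integral_exp_tail iB)
    have "J1_inner \<phi>\<^sub>1 \<phi>\<^sub>2 s \<le> integral\<^sup>L lborel ?u"
      unfolding J1_inner_def
    proof (rule integral_mono')
      show "integrable lborel ?u" using hb by (simp add: has_bochner_integral_iff)
      fix t :: real
      have n: "0 \<le> c * (indicator {1..} t * exp (- t))" "0 \<le> (indicator B t :: real)"
        "0 \<le> indicator {T..} t * exp (- t)" using c by auto
      then show "0 \<le> ?u t" by linarith
      show "indicator {1<..} t * (exp (- t) * min 1 (J1_dist_on s t \<phi>\<^sub>1 \<phi>\<^sub>2)) \<le> ?u t"
      proof (cases "1 < t")
        case t: True
        have t1: "exp (- t) * min 1 (J1_dist_on s t \<phi>\<^sub>1 \<phi>\<^sub>2) \<le> exp (- t) * 1"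
          by (intro mult_left_mono) auto
        have t2: "exp (- t) \<le> 1" using t by simp
        consider "t \<in> B" | "t \<ge> T" | "t \<notin> B" "t < T" by linarith
        then have "exp (- t) * min 1 (J1_dist_on s t \<phi>\<^sub>1 \<phi>\<^sub>2) \<le> ?u t"
        proof cases
          case 1
          then have "(indicator B t :: real) = 1" by simp
          then show ?thesis using n t1 t2 by linarith
        next
          case 2
          then have "indicator {T..} t * exp (- t) = exp (- t)" by simp
          then show ?thesis using n t1 by linarith
        next
          case 3
          have "exp (- t) * min 1 (J1_dist_on s t \<phi>\<^sub>1 \<phi>\<^sub>2) \<le> exp (- t) * c"
            using le[of s t] s t 3 by (intro mult_left_mono) auto
          also have "\<dots> = c * (indicator {1..} t * exp (- t))" using t by simp
          finally show ?thesis using n by linarith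
        qed
        then show ?thesis using t by simp
      qed (use \<open>0 \<le> ?u t\<close> in simp)
    qed
    also have "\<dots> = c * exp (- 1) + (measure lborel B + exp (- T))"
      using hb by (simp add: has_bochner_integral_iff)
    also have "\<dots> \<le> c * 1 + (\<beta> + exp (- T))"
      using Bm c by (intro add_mono mult_left_mono) auto
    finally show ?thesis by simp
  qed
  let ?d = "c + \<beta> + exp (- T)"
  \<comment> \<open>Now \<open>B\<close> is charged again, as a set of left end points; hence
    \<open>2 * \<beta>\<close> in the bound.\<close>
  let ?v = "\<lambda>s. ?d * indicator {0<..<1} s + (indicator {0..e} s + indicator B s) :: real"
  have d: "0 \<le> ?d" using c B by auto
  have hb: "has_bochner_integral lborel ?v (?d * 1 + (e + measure lborel B))"
    using has_bochner_integral_real_indicator[of "{0<..<1::real}" lborel] has_bochner_integral_real_indicator[of "{0..e}" lborel] e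
    by (intro has_bochner_integral_add has_bochner_integral_mult_right iB) auto
  have "J1_dist \<phi>\<^sub>1 \<phi>\<^sub>2 \<le> integral\<^sup>L lborel ?v"
    unfolding J1_dist_eq
  proof (rule integral_mono')
    show "integrable lborel ?v" using hb by (simp add: has_bochner_integral_iff)
    fix s :: real
    have n: "0 \<le> ?d * indicator {0<..<1} s" "0 \<le> (indicator B s :: real)" "0 \<le> (indicator {0..e} s :: real)"
      using d by auto
    then show "0 \<le> ?v s" by linarith
    show "indicator {0<..<1} s * J1_inner \<phi>\<^sub>1 \<phi>\<^sub>2 s \<le> ?v s"
    proof (cases "0 < s \<and> s < 1")
      case s: True
      show ?thesis
      proof (cases "e < s \<and> s \<notin> B")
        case True
        then have "J1_inner \<phi>\<^sub>1 \<phi>\<^sub>2 s \<le> ?d" using inner[of s] s by auto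
        moreover have "?d * indicator {0<..<1} s = ?d" "indicator {0<..<1} s * J1_inner \<phi>\<^sub>1 \<phi>\<^sub>2 s = J1_inner \<phi>\<^sub>1 \<phi>\<^sub>2 s"
          using s by simp_all
        ultimately show ?thesis using n by linarith
      next
        case False
        then have "1 \<le> indicator {0..e} s + (indicator B s :: real)" using s by (auto split: split_indicator)
        then have "J1_inner \<phi>\<^sub>1 \<phi>\<^sub>2 s \<le> indicator {0..e} s + (indicator B s :: real)"
          using J1_inner_le_1[of s \<phi>\<^sub>1 \<phi>\<^sub>2] s by linarith
        then show ?thesis using n s by simp
      qed
    qed (use \<open>0 \<le> ?v s\<close> in simp)
  qed
  also have "\<dots> = ?d + (e + measure lborel B)"
    using hb by (simp add: has_bochner_integral_iff)
  finally show ?thesis using Bm by simp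
qed

section \<open>Weak convergence in the Skorokhod space\<close>

lemma topspace_J1 [simp]: "topspace J1_topology = skorokhod_space"
  by (simp add: J1_topology_def)

lemma space_J1_borel [simp]: "space J1_borel = skorokhod_space"
  by (simp add: J1_borel_def space_measure_of_conv)

lemma openin_J1_sets: "openin J1_topology U \<Longrightarrow> U \<in> sets J1_borel"
  using openin_subset[of J1_topology]
  by (auto simp: J1_borel_def sets_measure_of_conv intro: sigma_sets.Basic)

lemma measurable_J1I:
  assumes "\<And>\<omega>. \<omega> \<in> space M \<Longrightarrow> Z \<omega> \<in> skorokhod_space"
    and "\<And>U. openin J1_topology U \<Longrightarrow> Z -` U \<inter> space M \<in> sets M"
  shows "Z \<in> measurable M J1_borel"
  unfolding J1_borel_def
  by (rule measurable_measure_of) (use assms openin_subset[of J1_topology] in auto)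

lemma continuous_map_J1_measurable:
  assumes "continuous_map J1_topology euclideanreal H"
  shows "H \<in> borel_measurable J1_borel"
proof (rule borel_measurableI)
  fix S :: "real set" assume "open S"
  then have "openin J1_topology {x \<in> topspace J1_topology. H x \<in> S}"
    using assms by (auto simp: continuous_map)
  moreover have "{x \<in> topspace J1_topology. H x \<in> S} = H -` S \<inter> space J1_borel" by auto
  ultimately show "H -` S \<inter> space J1_borel \<in> sets J1_borel" by (metis openin_J1_sets)
qed

lemma J1_mball_shrink:
  assumes "openin J1_topology U" "x \<in> U"
  obtains j where "J1.mball x (1 / real (Suc j)) \<subseteq> U"
proof -
  obtain r where r: "r > 0" "J1.mball x r \<subseteq> U"
    using assms unfolding J1_topology_def J1.openin_mtopology by blast
  obtain j where "1 / real (Suc j) < r" using nat_approx_posE[OF r(1)] by blast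
  then have "J1.mball x (1 / real (Suc j)) \<subseteq> J1.mball x r" by (intro J1.mball_subset_concentric) simp
  then show thesis using r that by blast
qed

text \<open>A limit lies in an open \<open>U\<close> exactly when, for some \<open>j\<close>, the
  approximants eventually lie in the set \<open>V j\<close> of points whose ball of radius
  \<open>1 / Suc j\<close> is inside \<open>U\<close>. Since the approximants have countable range,
  the preimage of any set, in particular of \<open>V j\<close>, is measurable.\<close>

lemma measurable_J1_limit:
  assumes sk: "\<And>k \<omega>. \<omega> \<in> space M \<Longrightarrow> Zs k \<omega> \<in> skorokhod_space" "\<And>\<omega>. \<omega> \<in> space M \<Longrightarrow> Z \<omega> \<in> skorokhod_space"
    and cnt: "\<And>k. countable (Zs k ` space M)"
    and ms: "\<And>k c. {\<omega> \<in> space M. Zs k \<omega> = c} \<in> sets M"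
    and lim: "\<And>\<omega>. \<omega> \<in> space M \<Longrightarrow> (\<lambda>k. J1_dist (Zs k \<omega>) (Z \<omega>)) \<longlonglongrightarrow> 0"
  shows "Z \<in> measurable M J1_borel"
proof (rule measurable_J1I)
  fix U assume U: "openin J1_topology U"
  have pre: "{\<omega> \<in> space M. Zs k \<omega> \<in> V} \<in> sets M" for k V
  proof -
    have "{\<omega> \<in> space M. Zs k \<omega> \<in> V} = (\<Union>c\<in>Zs k ` space M \<inter> V. {\<omega> \<in> space M. Zs k \<omega> = c})" by auto
    also have "\<dots> \<in> sets M" using cnt[of k] ms by (intro sets.countable_UN'') (auto intro: countable_subset)
    finally show ?thesis .
  qed
  define V where "V j = {x \<in> skorokhod_space. J1.mball x (1 / real (Suc j)) \<subseteq> U}" for j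
  have "Z -` U \<inter> space M = (\<Union>j. \<Union>m. \<Inter>k. {\<omega> \<in> space M. Zs (m + k) \<omega> \<in> V j})"
  proof (intro equalityI subsetI)
    fix \<omega> assume "\<omega> \<in> Z -` U \<inter> space M"
    then have \<omega>: "\<omega> \<in> space M" "Z \<omega> \<in> U" by auto
    from U this(2) obtain i where i: "J1.mball (Z \<omega>) (1 / real (Suc i)) \<subseteq> U" by (rule J1_mball_shrink)
    \<comment> \<open>The radius is halved: one half for the distance of the approximant to the
      limit, one half for its own ball.\<close>
    define j where "j = 2 * i + 1"
    have j: "2 / real (Suc j) = 1 / real (Suc i)" by (simp add: j_def field_simps)
    have "\<forall>\<^sub>F k in sequentially. J1_dist (Zs k \<omega>) (Z \<omega>) < 1 / real (Suc j)"
      using lim[OF \<omega>(1)] by (rule order_tendstoD(2)) simp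
    then obtain m where "\<forall>k\<ge>m. J1_dist (Zs k \<omega>) (Z \<omega>) < 1 / real (Suc j)"
      unfolding eventually_sequentially by blast
    then have m: "J1_dist (Zs (m + k) \<omega>) (Z \<omega>) < 1 / real (Suc j)" for k by simp
    have "Zs (m + k) \<omega> \<in> V j" for k
    proof -
      have "J1.mball (Zs (m + k) \<omega>) (1 / real (Suc j)) \<subseteq> J1.mball (Z \<omega>) (1 / real (Suc i))"
        using m[of k] j sk[OF \<omega>(1)] J1.commute J1.triangle
        by (intro J1.mball_subset) auto
      then show ?thesis using i sk[OF \<omega>(1)] by (auto simp: V_def)
    qed
    then show "\<omega> \<in> (\<Union>j. \<Union>m. \<Inter>k. {\<omega> \<in> space M. Zs (m + k) \<omega> \<in> V j})" using \<omega> by blast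
  next
    fix \<omega> assume "\<omega> \<in> (\<Union>j. \<Union>m. \<Inter>k. {\<omega> \<in> space M. Zs (m + k) \<omega> \<in> V j})"
    then obtain j m where jm: "\<And>k. \<omega> \<in> space M \<and> Zs (m + k) \<omega> \<in> V j" by blast
    then have \<omega>: "\<omega> \<in> space M" by blast
    have "\<forall>\<^sub>F k in sequentially. J1_dist (Zs k \<omega>) (Z \<omega>) < 1 / real (Suc j)"
      using lim[OF \<omega>(1)] by (rule order_tendstoD(2)) simp
    then obtain k' where "\<forall>k\<ge>k'. J1_dist (Zs k \<omega>) (Z \<omega>) < 1 / real (Suc j)"
      unfolding eventually_sequentially by blast
    then obtain k where "J1_dist (Zs (m + k) \<omega>) (Z \<omega>) < 1 / real (Suc j)" using le_add2 by blast
    moreover have "J1.mball (Zs (m + k) \<omega>) (1 / real (Suc j)) \<subseteq> U" using jm[of k] by (auto simp: V_def)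
    ultimately have "Z \<omega> \<in> U" using sk[OF \<omega>] by auto
    then show "\<omega> \<in> Z -` U \<inter> space M" using \<omega> by auto
  qed
  also have "\<dots> \<in> sets M" using pre by (intro sets.countable_UN sets.countable_INT) auto
  finally show "Z -` U \<inter> space M \<in> sets M" .
qed (use sk in auto)

section \<open>Reduction of weak convergence to Lipschitz functions\<close>

definition J1_lipschitz :: "((real \<Rightarrow> real) \<Rightarrow> real) \<Rightarrow> real \<Rightarrow> bool" where
  "J1_lipschitz F L \<longleftrightarrow> L > 0 \<and> (\<forall>x\<in>skorokhod_space. \<bar>F x\<bar> \<le> L) \<and>
     (\<forall>x\<in>skorokhod_space. \<forall>y\<in>skorokhod_space. \<bar>F x - F y\<bar> \<le> L * J1_dist x y)"

lemma J1_lipschitz_continuous: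
  assumes "J1_lipschitz F L"
  shows "continuous_map J1_topology euclideanreal F"
proof -
  have L: "L > 0" "\<And>x y. x \<in> skorokhod_space \<Longrightarrow> y \<in> skorokhod_space \<Longrightarrow> \<bar>F x - F y\<bar> \<le> L * J1_dist x y"
    using assms by (auto simp: J1_lipschitz_def)
  have "openin J1_topology {x \<in> skorokhod_space. F x \<in> U}" if U: "open U" for U
    unfolding J1_topology_def J1.openin_mtopology
  proof (intro conjI allI impI)
    fix x assume x: "x \<in> {x \<in> skorokhod_space. F x \<in> U}"
    then obtain e where e: "e > 0" "\<And>y. \<bar>y - F x\<bar> < e \<Longrightarrow> y \<in> U"
      using U unfolding open_dist dist_real_def by blast
    have "J1.mball x (e / L) \<subseteq> {x \<in> skorokhod_space. F x \<in> U}"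
    proof
      fix y assume y: "y \<in> J1.mball x (e / L)"
      then have "J1_dist y x < e / L" by (auto simp: J1.commute)
      then have "L * J1_dist y x < e" using L(1) by (simp add: field_simps)
      then show "y \<in> {x \<in> skorokhod_space. F x \<in> U}" using L(2)[of y x] x y e(2)[of "F y"] by auto
    qed
    then show "\<exists>r>0. J1.mball x r \<subseteq> {x \<in> skorokhod_space. F x \<in> U}" using e(1) L(1) by (intro exI[of _ "e / L"]) auto
  qed auto
  then show ?thesis by (auto simp: continuous_map)
qed

text \<open>The infimal convolution of \<open>H\<close> with \<open>k\<close> times the metric, also
  called the Pasch-Hausdorff envelope: a Lipschitz function below \<open>H\<close> that approaches
  \<open>H\<close> as \<open>k\<close> grows.\<close>

definition J1_inf_conv :: "((real \<Rightarrow> real) \<Rightarrow> real) \<Rightarrow> real \<Rightarrow> (real \<Rightarrow> real) \<Rightarrow> real" where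
  "J1_inf_conv H k x = (INF y\<in>skorokhod_space. H y + k * J1_dist x y)"

lemma J1_inf_conv:
  assumes B: "\<And>x. x \<in> skorokhod_space \<Longrightarrow> \<bar>H x\<bar> \<le> B" and k: "k \<ge> 0"
  shows "\<And>x y. x \<in> skorokhod_space \<Longrightarrow> y \<in> skorokhod_space \<Longrightarrow> J1_inf_conv H k x \<le> H y + k * J1_dist x y"
    and "\<And>x. x \<in> skorokhod_space \<Longrightarrow> J1_inf_conv H k x \<le> H x"
    and "\<And>x c. x \<in> skorokhod_space \<Longrightarrow> (\<And>y. y \<in> skorokhod_space \<Longrightarrow> c \<le> H y + k * J1_dist x y) \<Longrightarrow> c \<le> J1_inf_conv H k x"
    and "\<And>x. x \<in> skorokhod_space \<Longrightarrow> \<bar>J1_inf_conv H k x\<bar> \<le> B"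
    and "J1_lipschitz (J1_inf_conv H k) (B + k + 1)"
proof -
  show 1: "J1_inf_conv H k x \<le> H y + k * J1_dist x y" if "x \<in> skorokhod_space" "y \<in> skorokhod_space" for x y
    unfolding J1_inf_conv_def
  proof (rule cINF_lower[OF _ that(2)])
    show "bdd_below ((\<lambda>y. H y + k * J1_dist x y) ` skorokhod_space)"
    proof (rule bdd_belowI2)
      fix y assume "y \<in> skorokhod_space"
      then have "- B \<le> H y" "0 \<le> k * J1_dist x y" using B[of y] k by auto
      then show "- B \<le> H y + k * J1_dist x y" by linarith
    qed
  qed
  show 2: "J1_inf_conv H k x \<le> H x" if "x \<in> skorokhod_space" for x
    using 1[OF that that] J1_dist_refl[of x] by simp
  show 3: "c \<le> J1_inf_conv H k x" if "x \<in> skorokhod_space" "\<And>y. y \<in> skorokhod_space \<Longrightarrow> c \<le> H y + k * J1_dist x y" for x c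
    unfolding J1_inf_conv_def using that by (intro cINF_greatest) auto
  show 4: "\<bar>J1_inf_conv H k x\<bar> \<le> B" if x: "x \<in> skorokhod_space" for x
  proof -
    have "- B \<le> J1_inf_conv H k x"
    proof (rule 3[OF x])
      fix y assume "y \<in> skorokhod_space"
      then have "- B \<le> H y" "0 \<le> k * J1_dist x y" using B[of y] k by auto
      then show "- B \<le> H y + k * J1_dist x y" by linarith
    qed
    then show ?thesis using 2[OF x] B[OF x] by linarith
  qed
  have 5: "J1_inf_conv H k x \<le> J1_inf_conv H k y + k * J1_dist x y" if x: "x \<in> skorokhod_space" and y: "y \<in> skorokhod_space" for x y
  proof -
    have "J1_inf_conv H k x - k * J1_dist x y \<le> J1_inf_conv H k y"
    proof (rule 3[OF y])
      fix z assume z: "z \<in> skorokhod_space"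
      have "k * J1_dist x z \<le> k * (J1_dist x y + J1_dist y z)"
        using k by (intro mult_left_mono J1.triangle x y z)
      then show "J1_inf_conv H k x - k * J1_dist x y \<le> H z + k * J1_dist y z"
        using 1[OF x z] by (simp add: distrib_left)
    qed
    then show ?thesis by simp
  qed
  \<comment> \<open>The space is nonempty, as a constant path shows, so the bound \<open>B\<close>
    of an absolute value is nonnegative.\<close>
  have "B \<ge> 0" using B[of "step_path 0 (\<lambda>_. 0)"] step_path_in_skorokhod[of 0 "\<lambda>_. 0"] by force
  show "J1_lipschitz (J1_inf_conv H k) (B + k + 1)"
    unfolding J1_lipschitz_def
  proof (intro conjI ballI)
    show "0 < B + k + 1" using \<open>B \<ge> 0\<close> k by simp
    fix x assume x: "x \<in> skorokhod_space"
    show "\<bar>J1_inf_conv H k x\<bar> \<le> B + k + 1" using 4[OF x] k by simp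
    fix y assume y: "y \<in> skorokhod_space"
    have "k * J1_dist x y \<le> (B + k + 1) * J1_dist x y"
      using \<open>B \<ge> 0\<close> by (intro mult_right_mono) auto
    then show "\<bar>J1_inf_conv H k x - J1_inf_conv H k y\<bar> \<le> (B + k + 1) * J1_dist x y"
      using 5[OF x y] 5[OF y x] J1.commute[of x y] by (simp add: abs_le_iff)
  qed
qed

text \<open>In a small ball around \<open>x\<close> continuity keeps \<open>H\<close> above
  \<open>H x - e/2\<close>; outside the ball the penalty \<open>k * J1_dist x y\<close> outweighs
  any drop of a function bounded by \<open>B\<close>.\<close>

lemma J1_inf_conv_tendsto:
  assumes H: "continuous_map J1_topology euclideanreal H"
    and B: "\<And>x. x \<in> skorokhod_space \<Longrightarrow> \<bar>H x\<bar> \<le> B" and x: "x \<in> skorokhod_space"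
  shows "(\<lambda>k. J1_inf_conv H (real k) x) \<longlonglongrightarrow> H x"
proof (rule LIMSEQ_I)
  fix e :: real assume e: "e > 0"
  have "openin J1_topology {y \<in> topspace J1_topology. H y \<in> {H x - e/2 <..}}"
    by (rule openin_continuous_map_preimage[OF H]) (simp flip: open_openin)
  moreover have "x \<in> {y \<in> topspace J1_topology. H y \<in> {H x - e/2 <..}}" using x e by simp
  ultimately obtain j where j: "J1.mball x (1 / real (Suc j)) \<subseteq> {y \<in> topspace J1_topology. H y \<in> {H x - e/2 <..}}"
    by (rule J1_mball_shrink)
  \<comment> \<open>From \<open>K\<close> on the penalty outside the ball is at least
    \<open>2 * B\<close>, the largest possible variation of \<open>H\<close>.\<close>
  obtain K :: nat where K: "2 * B * real (Suc j) \<le> real K" using real_arch_simple by blast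
  show "\<exists>no. \<forall>k\<ge>no. norm (J1_inf_conv H (real k) x - H x) < e"
  proof (intro exI allI impI)
    fix k assume k: "K \<le> k"
    have "H x - e/2 \<le> J1_inf_conv H (real k) x"
    proof (rule J1_inf_conv(3)[OF B _ x])
      fix y assume y: "y \<in> skorokhod_space"
      show "H x - e/2 \<le> H y + real k * J1_dist x y"
      proof (cases "J1_dist x y < 1 / real (Suc j)")
        case True
        then have "y \<in> J1.mball x (1 / real (Suc j))" using x y by simp
        then have "H x - e/2 < H y" using j by auto
        moreover have "0 \<le> real k * J1_dist x y" by simp
        ultimately show ?thesis by linarith
      next
        case False
        have "2 * B \<le> real K * (1 / real (Suc j))" using K by (simp add: field_simps)
        also have "\<dots> \<le> real k * J1_dist x y" using False k by (intro mult_mono) auto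
        finally show ?thesis using B[OF x] B[OF y] e by linarith
      qed
    qed auto
    moreover have "J1_inf_conv H (real k) x \<le> H x" by (rule J1_inf_conv(2)[OF B _ x]) auto
    ultimately show "norm (J1_inf_conv H (real k) x - H x) < e" using e by simp
  qed
qed

text \<open>Lipschitz functions below \<open>H\<close> whose integrals approach that of
  \<open>H\<close> give the bound from below for the limit inferior. Applied to \<open>- H\<close>,
  the same bound controls the limit superior.\<close>

lemma J1_weak_convergence_lipschitz:
  assumes M: "prob_space M" and N: "prob_space N"
    and Y: "\<And>n. Y n \<in> measurable M J1_borel" and Z: "Z \<in> measurable N J1_borel"
    and lip: "\<And>F L. J1_lipschitz F L \<Longrightarrow> (\<lambda>n. \<integral>\<omega>. F (Y n \<omega>) \<partial>M) \<longlonglongrightarrow> (\<integral>\<omega>. F (Z \<omega>) \<partial>N)"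
    and H: "continuous_map J1_topology euclideanreal H" "bounded (H ` skorokhod_space)"
  shows "(\<lambda>n. \<integral>\<omega>. H (Y n \<omega>) \<partial>M) \<longlonglongrightarrow> (\<integral>\<omega>. H (Z \<omega>) \<partial>N)"
proof -
  interpret M: prob_space M by fact
  interpret N: prob_space N by fact
  have Ysk: "Y n \<omega> \<in> skorokhod_space" if "\<omega> \<in> space M" for n \<omega>
    using measurable_space[OF Y that] by simp
  have Zsk: "Z \<omega> \<in> skorokhod_space" if "\<omega> \<in> space N" for \<omega>
    using measurable_space[OF Z that] by simp
  have lower: "\<forall>\<^sub>F n in sequentially. (\<integral>\<omega>. H (Y n \<omega>) \<partial>M) > (\<integral>\<omega>. H (Z \<omega>) \<partial>N) - e"
    if e: "e > 0" and H: "continuous_map J1_topology euclideanreal H" and "bounded (H ` skorokhod_space)" for H e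
  proof -
    obtain B where B: "\<And>x. x \<in> skorokhod_space \<Longrightarrow> \<bar>H x\<bar> \<le> B"
      using \<open>bounded (H ` skorokhod_space)\<close> unfolding bounded_iff by auto
    have meas: "J1_inf_conv H (real k) \<in> borel_measurable J1_borel" for k
      by (intro continuous_map_J1_measurable J1_lipschitz_continuous[OF J1_inf_conv(5)[OF B]]) auto
    note Hm = continuous_map_J1_measurable[OF H]
    have "(\<lambda>k. \<integral>\<omega>. J1_inf_conv H (real k) (Z \<omega>) \<partial>N) \<longlonglongrightarrow> (\<integral>\<omega>. H (Z \<omega>) \<partial>N)"
    proof (rule integral_dominated_convergence[where w = "\<lambda>_. B"])
      show "(\<lambda>\<omega>. H (Z \<omega>)) \<in> borel_measurable N" using measurable_compose[OF Z Hm] .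
      show "(\<lambda>\<omega>. J1_inf_conv H (real k) (Z \<omega>)) \<in> borel_measurable N" for k
        using measurable_compose[OF Z meas] .
      show "AE \<omega> in N. (\<lambda>k. J1_inf_conv H (real k) (Z \<omega>)) \<longlonglongrightarrow> H (Z \<omega>)"
        by (intro AE_I2 J1_inf_conv_tendsto[OF H B] Zsk)
      show "AE \<omega> in N. norm (J1_inf_conv H (real k) (Z \<omega>)) \<le> B" for k
        unfolding real_norm_def by (intro AE_I2 J1_inf_conv(4)[OF B] Zsk) auto
    qed simp
    then have "\<forall>\<^sub>F k in sequentially. (\<integral>\<omega>. J1_inf_conv H (real k) (Z \<omega>) \<partial>N) > (\<integral>\<omega>. H (Z \<omega>) \<partial>N) - e/2"
      by (rule order_tendstoD) (use e in simp)
    then obtain k where k: "(\<integral>\<omega>. J1_inf_conv H (real k) (Z \<omega>) \<partial>N) > (\<integral>\<omega>. H (Z \<omega>) \<partial>N) - e/2"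
      by (auto simp: eventually_sequentially)
    have "\<forall>\<^sub>F n in sequentially. (\<integral>\<omega>. J1_inf_conv H (real k) (Y n \<omega>) \<partial>M) > (\<integral>\<omega>. J1_inf_conv H (real k) (Z \<omega>) \<partial>N) - e/2"
      by (rule order_tendstoD[OF lip[OF J1_inf_conv(5)[OF B]]]) (use e in auto)
    then show ?thesis
    proof eventually_elim
      case (elim n)
      have "(\<integral>\<omega>. J1_inf_conv H (real k) (Y n \<omega>) \<partial>M) \<le> (\<integral>\<omega>. H (Y n \<omega>) \<partial>M)"
      proof (rule integral_mono)
        show "integrable M (\<lambda>\<omega>. J1_inf_conv H (real k) (Y n \<omega>))"
          by (rule M.integrable_const_bound[of _ B]) 
             (use measurable_compose[OF Y meas] J1_inf_conv(4)[OF B] Ysk in auto)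
        show "integrable M (\<lambda>\<omega>. H (Y n \<omega>))"
          by (rule M.integrable_const_bound[of _ B]) 
             (use measurable_compose[OF Y Hm] B Ysk in auto)
      qed (intro J1_inf_conv(2)[OF B] Ysk, auto)
      then show ?case using elim k by linarith
    qed
  qed
  show ?thesis
  proof (rule LIMSEQ_I)
    fix e :: real assume e: "e > 0"
    have H': "continuous_map J1_topology euclideanreal (\<lambda>x. - H x)" "bounded ((\<lambda>x. - H x) ` skorokhod_space)"
      using H by (auto intro: continuous_map_minus simp: bounded_iff)
    have "\<forall>\<^sub>F n in sequentially. norm ((\<integral>\<omega>. H (Y n \<omega>) \<partial>M) - (\<integral>\<omega>. H (Z \<omega>) \<partial>N)) < e"
      using lower[OF e H] lower[OF e H'] by eventually_elim auto
    then show "\<exists>no. \<forall>n\<ge>no. norm ((\<integral>\<omega>. H (Y n \<omega>) \<partial>M) - (\<integral>\<omega>. H (Z \<omega>) \<partial>N)) < e"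
      by (simp add: eventually_sequentially)
  qed
qed

section \<open>Discretisation of monotone paths\<close>

text \<open>Level \<open>j\<close> stands for the interval from \<open>u + j * \<eta>\<close> to
  \<open>u + (j + 1) * \<eta>\<close>, open on the left and closed on the right, except that level 0
  extends down and level \<open>m\<close> up without bound. Being closed on the right makes
  \<open>level \<le> j\<close> a condition of the form \<open>v \<le> threshold\<close>, which
  distribution functions can evaluate.\<close>

definition level :: "real \<Rightarrow> real \<Rightarrow> nat \<Rightarrow> real \<Rightarrow> nat" where
  "level u \<eta> m v = min m (nat (\<lceil>(v - u) / \<eta>\<rceil> - 1))"

lemma level_le_iff:
  assumes "\<eta> > 0"
  shows "level u \<eta> m v \<le> j \<longleftrightarrow> m \<le> j \<or> v \<le> u + (real j + 1) * \<eta>"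
proof -
  have "nat (\<lceil>(v - u) / \<eta>\<rceil> - 1) \<le> j \<longleftrightarrow> \<lceil>(v - u) / \<eta>\<rceil> \<le> int j + 1" by linarith
  also have "\<dots> \<longleftrightarrow> (v - u) / \<eta> \<le> real j + 1" by (simp add: ceiling_le_iff)
  also have "\<dots> \<longleftrightarrow> v \<le> u + (real j + 1) * \<eta>" using assms by (simp add: field_simps)
  finally show ?thesis by (auto simp: level_def min_le_iff_disj)
qed

lemma level_le_max: "level u \<eta> m v \<le> m"
  by (simp add: level_def)

lemma level_mono: "\<eta> > 0 \<Longrightarrow> v \<le> w \<Longrightarrow> level u \<eta> m v \<le> level u \<eta> m w"
  using level_le_iff[of \<eta> u m v "level u \<eta> m w"] level_le_iff[of \<eta> u m w "level u \<eta> m w"] by auto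

lemma level_close:
  assumes \<eta>: "\<eta> > 0" and v: "u < v" "v \<le> u + (real m + 1) * \<eta>"
  shows "\<bar>v - (u + \<eta> * real (level u \<eta> m v))\<bar> \<le> \<eta>"
proof -
  define j where "j = level u \<eta> m v"
  have "v \<le> u + (real j + 1) * \<eta>"
    using level_le_iff[OF \<eta>, of u m v j] level_le_max[of u \<eta> m v] v by (auto simp: j_def)
  moreover have "u + real j * \<eta> \<le> v"
  proof (cases j)
    case (Suc k)
    then have "\<not> v \<le> u + (real k + 1) * \<eta>" using level_le_iff[OF \<eta>, of u m v k] by (auto simp: j_def)
    then show ?thesis by (simp add: Suc add.commute)
  qed (use v in simp)
  ultimately show ?thesis unfolding j_def[symmetric] by (simp add: algebra_simps abs_le_iff)
qed

text \<open>If the level takes only its two end values on \<open>[a,b]\<close>, it changes at a single point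
  \<open>\<sigma>\<close>. The point is moved off \<open>a\<close> by right continuity, whence \<open>2 \<eta>\<close> instead of \<open>\<eta>\<close>.\<close>

lemma crossing_point:
  fixes y :: "real \<Rightarrow> real"
  assumes \<eta>: "\<eta> > 0" and ab: "a < b" and y: "mono_on {a..b} y"
    and rc: "\<And>r. a \<le> r \<Longrightarrow> r < b \<Longrightarrow> (y \<longlongrightarrow> y r) (at_right r)"
    and range: "u < y a" "y b \<le> u + (real m + 1) * \<eta>"
    and rat: "\<And>r. r \<in> \<rat> \<Longrightarrow> a \<le> r \<Longrightarrow> r \<le> b \<Longrightarrow>
      level u \<eta> m (y r) \<in> {level u \<eta> m (y a), level u \<eta> m (y b)}"
  obtains \<sigma> where "a < \<sigma>" "\<sigma> \<le> b"
    "\<And>r. a \<le> r \<Longrightarrow> r < \<sigma> \<Longrightarrow> \<bar>y r - (u + \<eta> * real (level u \<eta> m (y a)))\<bar> \<le> 2 * \<eta>"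
    "\<And>r. \<sigma> \<le> r \<Longrightarrow> r \<le> b \<Longrightarrow> \<bar>y r - (u + \<eta> * real (level u \<eta> m (y b)))\<bar> \<le> 2 * \<eta>"
    "level u \<eta> m (y a) = level u \<eta> m (y b) \<Longrightarrow> \<sigma> = b"
proof -
  let ?L = "\<lambda>r. level u \<eta> m (y r)" and ?h = "\<lambda>l. u + \<eta> * real l"
  have ymono: "y r \<le> y s" if "a \<le> r" "r \<le> s" "s \<le> b" for r s
    using that by (intro monotone_onD[OF y]) auto
  have Lmono: "?L r \<le> ?L s" if "a \<le> r" "r \<le> s" "s \<le> b" for r s
    by (rule level_mono[OF \<eta> ymono[OF that]])
  have close: "\<bar>y r - ?h (?L r)\<bar> \<le> \<eta>" if "a \<le> r" "r \<le> b" for r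
    using that range ymono[of a r] ymono[of r b] by (intro level_close \<eta>) auto
  show thesis
  proof (cases "?L a = ?L b")
    case True
    have *: "\<bar>y r - ?h (?L a)\<bar> \<le> 2 * \<eta>" if "a \<le> r" "r \<le> b" for r
    proof -
      have "?L r = ?L a" using that Lmono[of a r] Lmono[of r b] True by simp
      then show ?thesis using close[OF that] \<eta> by simp
    qed
    show thesis
    proof (rule that[of b])
      show "\<bar>y r - ?h (?L a)\<bar> \<le> 2 * \<eta>" if "a \<le> r" "r < b" for r using *[of r] that by simp
      show "\<bar>y r - ?h (?L b)\<bar> \<le> 2 * \<eta>" if "b \<le> r" "r \<le> b" for r
        unfolding True[symmetric] using *[of r] that ab by simp
    qed (use ab in simp_all)
  next
    case ne: False
    define S where "S = {r \<in> {a..b}. ?L r = ?L b}"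
    define \<sigma> where "\<sigma> = Inf S"
    have bS: "b \<in> S" using ab by (simp add: S_def)
    have bdd: "bdd_below S" by (rule bdd_belowI[of _ a]) (auto simp: S_def)
    have \<sigma>: "a \<le> \<sigma>" "\<sigma> \<le> b"
      using bS bdd unfolding \<sigma>_def by (auto intro!: cInf_greatest cInf_lower simp: S_def)
    have below: "?L r = ?L a" if r: "a \<le> r" "r < \<sigma>" for r
    proof -
      \<comment> \<open>Only rational times are controlled by hypothesis. A rational between
        \<open>r\<close> and \<open>\<sigma>\<close> together with monotonicity of the level settles
        the real ones.\<close>
      obtain p where p: "p \<in> \<rat>" "r < p" "p < \<sigma>" using Rats_dense_in_real[OF r(2)] by blast
      have "p \<notin> S" using p(3) bdd unfolding \<sigma>_def by (meson cInf_lower not_le)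
      then have "?L p = ?L a" using rat[of p] p r \<sigma> by (auto simp: S_def)
      then show ?thesis using Lmono[of a r] Lmono[of r p] p r \<sigma> by simp
    qed
    have above: "?L r = ?L b" if r: "\<sigma> < r" "r \<le> b" for r
    proof -
      obtain p where p: "p \<in> S" "p < r" using cInf_lessD[of S r] r(1) bS unfolding \<sigma>_def by blast
      then show ?thesis using Lmono[of p r] Lmono[of r b] r by (auto simp: S_def)
    qed
    have cb: "\<bar>y r - ?h (?L b)\<bar> \<le> 2 * \<eta>" if "\<sigma> < r" "r \<le> b" for r
      using close[of r] above[OF that] that \<sigma> \<eta> by simp
    have ca: "\<bar>y r - ?h (?L a)\<bar> \<le> 2 * \<eta>" if "a \<le> r" "r < \<sigma>" for r
      using close[of r] below[OF that] that \<sigma> \<eta> by simp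
    have near: "\<exists>c>\<sigma>. c \<le> b \<and> (\<forall>r. \<sigma> \<le> r \<and> r < c \<longrightarrow> \<bar>y r - y \<sigma>\<bar> \<le> \<eta>)" if "\<sigma> < b"
    proof -
      have "eventually (\<lambda>r. dist (y r) (y \<sigma>) < \<eta>) (at_right \<sigma>)"
        by (rule tendstoD[OF rc[OF \<sigma>(1) that] \<eta>])
      then obtain c where c: "c > \<sigma>" "\<And>r. \<sigma> < r \<Longrightarrow> r < c \<Longrightarrow> \<bar>y r - y \<sigma>\<bar> < \<eta>"
        by (auto simp: eventually_at_right_field dist_real_def)
      show ?thesis
      proof (intro exI[of _ "min c b"] conjI allI impI)
        fix r assume "\<sigma> \<le> r \<and> r < min c b"
        then show "\<bar>y r - y \<sigma>\<bar> \<le> \<eta>" using c(2)[of r] \<eta> by (cases "r = \<sigma>") auto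
      qed (use c that in auto)
    qed
    show thesis
    \<comment> \<open>If \<open>\<sigma>\<close> itself still has the low level, the switch is
      postponed to a point \<open>c\<close> up to which the path stays within \<open>\<eta>\<close>
      of \<open>y \<sigma>\<close>. Otherwise \<open>\<sigma>\<close> exceeds \<open>a\<close> and
      serves itself. In that case \<open>\<sigma>\<close> may be irrational and its level need not
      be the final one, but right continuity keeps \<open>y \<sigma>\<close> within
      \<open>\<eta>\<close> of values that have it.\<close>
    proof (cases "?L \<sigma> = ?L a")
      case True
      then have "\<sigma> < b" using ne \<sigma> by (cases "\<sigma> = b") auto
      then obtain c where c: "c > \<sigma>" "c \<le> b" "\<And>r. \<sigma> \<le> r \<Longrightarrow> r < c \<Longrightarrow> \<bar>y r - y \<sigma>\<bar> \<le> \<eta>"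
        using near by blast
      show thesis
      proof (rule that[of c])
        fix r assume r: "a \<le> r" "r < c"
        show "\<bar>y r - ?h (?L a)\<bar> \<le> 2 * \<eta>"
        proof (cases "r < \<sigma>")
          case False
          then show ?thesis using c(3)[of r] r close[of \<sigma>] \<sigma> True by simp
        qed (use ca r in auto)
      qed (use c \<sigma> cb ne in auto)
    next
      case False
      then have "a < \<sigma>" using \<sigma> by (cases "\<sigma> = a") auto
      moreover have "\<bar>y \<sigma> - ?h (?L b)\<bar> \<le> 2 * \<eta>"
      proof (cases "\<sigma> < b")
        case True
        then obtain c where c: "c > \<sigma>" "c \<le> b" "\<And>r. \<sigma> \<le> r \<Longrightarrow> r < c \<Longrightarrow> \<bar>y r - y \<sigma>\<bar> \<le> \<eta>"
          using near by blast
        define r where "r = (\<sigma> + c) / 2"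
        have r: "\<sigma> < r" "r < c" using c by (auto simp: r_def)
        then have "\<bar>y r - y \<sigma>\<bar> \<le> \<eta>" "\<bar>y r - ?h (?L b)\<bar> \<le> \<eta>"
          using c(2) c(3)[of r] close[of r] above[of r] \<sigma> by auto
        then show ?thesis by linarith
      next
        case False
        then have "\<sigma> = b" using \<sigma> by simp
        then show ?thesis using close[of b] ab \<eta> by simp
      qed
      ultimately show thesis
        using ca cb \<sigma> ne by (intro that[of \<sigma>]) (auto simp: le_less)
    qed
  qed
qed

section \<open>Sampled paths and the time change that carries a path to its sample\<close>

text \<open>On \<open>x \<ge> 0\<close> this is the linear interpolation through the points
  \<open>(i / q, \<nu> i)\<close>.\<close>

definition pw_linear :: "real \<Rightarrow> (nat \<Rightarrow> real) \<Rightarrow> real \<Rightarrow> real" where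
  "pw_linear q \<nu> x = \<nu> (nat \<lfloor>q * x\<rfloor>) + (\<nu> (Suc (nat \<lfloor>q * x\<rfloor>)) - \<nu> (nat \<lfloor>q * x\<rfloor>)) * (q * x - real (nat \<lfloor>q * x\<rfloor>))"

lemma pw_linear_cell:
  assumes q: "q > 0" and x: "real i / q \<le> x" "x \<le> (real i + 1) / q"
  shows "pw_linear q \<nu> x = \<nu> i + (\<nu> (Suc i) - \<nu> i) * (q * x - real i)"
\<comment> \<open>At its right end point the floor already selects the next cell, where the formula
  gives the same value.\<close>
proof (cases "x = (real i + 1) / q")
  case True
  then have qx: "q * x = real (Suc i)" using q by simp
  then have "nat \<lfloor>q * x\<rfloor> = Suc i" by (simp only: floor_of_nat nat_int)
  then show ?thesis unfolding pw_linear_def qx by simp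
next
  case False
  then have "q * x < real i + 1" "real i \<le> q * x" using x q by (auto simp: field_simps less_le)
  then have "\<lfloor>q * x\<rfloor> = int i" by (intro floor_unique) auto
  then show ?thesis by (simp add: pw_linear_def)
qed

lemma pw_linear_homeo:
  assumes q: "q > 0" and \<nu>: "strict_mono \<nu>"
  shows "strict_mono_on {0..real k / q} (pw_linear q \<nu>) \<and> continuous_on {0..real k / q} (pw_linear q \<nu>)"
proof (induction k)
  case 0
  then show ?case by (auto simp: strict_mono_on_def)
next
  case (Suc k)
  let ?f = "pw_linear q \<nu>"
  let ?a = "real k / q" and ?b = "real (Suc k) / q"
  have ab: "0 \<le> ?a" "?a \<le> ?b" using q by (auto simp: divide_right_mono)
  have f: "?f x = \<nu> k + (\<nu> (Suc k) - \<nu> k) * (q * x - real k)" if "x \<in> {?a..?b}" for x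
    using that by (intro pw_linear_cell q) (auto simp: add.commute)
  have slope: "\<nu> (Suc k) - \<nu> k > 0" using \<nu> by (simp add: strict_mono_Suc_iff)
  have mono2: "?f x < ?f y" if "x \<in> {?a..?b}" "y \<in> {?a..?b}" "x < y" for x y
    using that slope q by (simp add: f)
  have U: "{0..?b} = {0..?a} \<union> {?a..?b}" using ab by auto
  have "continuous_on {?a..?b} ?f"
    by (rule continuous_on_eq[of _ "\<lambda>x. \<nu> k + (\<nu> (Suc k) - \<nu> k) * (q * x - real k)"])
       (auto intro!: continuous_intros simp: f)
  then have "continuous_on {0..?b} ?f" unfolding U using Suc by (intro continuous_on_closed_Un) auto
  moreover have "strict_mono_on {0..?b} ?f"
  proof (rule strict_mono_onI)
    fix x y assume xy: "x \<in> {0..?b}" "y \<in> {0..?b}" "x < y"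
    have m1: "?f x < ?f y" if "x \<in> {0..?a}" "y \<in> {0..?a}" "x < y" for x y
      using strict_mono_onD[OF conjunct1[OF Suc] that] .
    consider "y \<le> ?a" | "x \<ge> ?a" | "x < ?a" "?a < y" by linarith
    then show "?f x < ?f y"
    proof cases
      case 3
      then have "?f x < ?f ?a" "?f ?a < ?f y" using m1[of x ?a] mono2[of ?a y] xy ab by auto
      then show ?thesis by simp
    qed (use m1[of x y] mono2[of x y] xy in auto)
  qed
  ultimately show ?case by simp
qed

text \<open>Clamping the index between \<open>k\<close> and \<open>K\<close> makes the path a
  function of finitely many samples, the first of them at time \<open>k / q\<close>.\<close>

definition grid_path :: "real \<Rightarrow> real \<Rightarrow> nat \<Rightarrow> nat \<Rightarrow> nat \<Rightarrow> nat \<Rightarrow> (real \<Rightarrow> real) \<Rightarrow> real \<Rightarrow> real" where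
  "grid_path u \<eta> m q k K y =
     step_path (real q) (\<lambda>i. u + \<eta> * real (level u \<eta> m (y (real (max k (min K i)) / real q))))"

text \<open>Only rational times are inspected, so that the event involves countably many coordinates
  of a process and is exhausted by finite grids; \<open>crossing_point\<close> recovers the real
  times.\<close>

definition intermediate_level :: "real \<Rightarrow> real \<Rightarrow> nat \<Rightarrow> nat \<Rightarrow> nat \<Rightarrow> nat \<Rightarrow> (real \<Rightarrow> real) \<Rightarrow> bool" where
  "intermediate_level u \<eta> m q k K y \<longleftrightarrow>
     (\<exists>i\<in>{k..<K}. \<exists>r\<in>\<rat>. real i / real q \<le> r \<and> r \<le> real (Suc i) / real q \<and>
        level u \<eta> m (y r) \<notin> {level u \<eta> m (y (real i / real q)), level u \<eta> m (y (real (Suc i) / real q))})"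

text \<open>For a monotone path the two outer inequalities hold at all times in between, so that
  there the rounding error of \<open>level\<close> is at most one step.\<close>

definition good_path :: "real \<Rightarrow> real \<Rightarrow> nat \<Rightarrow> nat \<Rightarrow> nat \<Rightarrow> nat \<Rightarrow> (real \<Rightarrow> real) \<Rightarrow> bool" where
  "good_path u \<eta> m q k K y \<longleftrightarrow>
     u < y (real k / real q) \<and> y (real K / real q) \<le> u + (real m + 1) * \<eta> \<and>
     \<not> intermediate_level u \<eta> m q k K y"

text \<open>Each change in a nondecreasing integer sequence is a rise by at least 1. For levels
  between 0 and \<open>m\<close> at most \<open>m\<close> cells contain a change.\<close>

lemma card_increases_le:
  fixes l :: "nat \<Rightarrow> nat"
  assumes "\<And>i. i \<in> {k..<K} \<Longrightarrow> l i \<le> l (Suc i)" "k \<le> K"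
  shows "card {i \<in> {k..<K}. l i \<noteq> l (Suc i)} + l k \<le> l K"
  using assms(2,1)
proof (induction K rule: dec_induct)
  case (step n)
  have "{i \<in> {k..<Suc n}. l i \<noteq> l (Suc i)} = {i \<in> {k..<n}. l i \<noteq> l (Suc i)} \<union> (if l n \<noteq> l (Suc n) then {n} else {})"
    using step.hyps by (auto simp: less_Suc_eq)
  then have "card {i \<in> {k..<Suc n}. l i \<noteq> l (Suc i)} \<le> card {i \<in> {k..<n}. l i \<noteq> l (Suc i)} + (if l n \<noteq> l (Suc n) then 1 else 0)"
    by (auto intro: order.trans[OF card_Un_le])
  moreover have "l n \<le> l (Suc n)" using step by simp
  moreover have "card {i \<in> {k..<n}. l i \<noteq> l (Suc i)} + l k \<le> l n" using step by simp
  ultimately show ?case by (simp split: if_splits)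
qed simp

text \<open>The time change sends each grid point to the crossing point in the cell before it, so
  the image of cell \<open>i\<close> lies between two consecutive crossings, where the path is near
  its rounded value at \<open>i / q\<close>. The bound collects \<open>2 * \<eta>\<close> for values
  and \<open>2 / q\<close> for displaced times, \<open>k / q\<close> for left end points before the
  first sample, \<open>4 * m / q\<close> for the end points near the at most \<open>m\<close> jump
  cells (an exceptional set of measure \<open>2 * m / q\<close>, charged twice), and the exponential
  tail beyond \<open>K / q\<close>.\<close>

lemma J1_dist_grid_path:
  assumes \<eta>: "\<eta> > 0" and q: "q > 0" and k: "0 < k" "k \<le> K"
    and y: "y \<in> skorokhod_space" "mono_on {0<..} y" and good: "good_path u \<eta> m q k K y"
  shows "J1_dist y (grid_path u \<eta> m q k K y) \<le>
    2 * \<eta> + (2 + real k + 4 * real m) / real q + exp (- (real K / real q))"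
proof -
  define g where "g i = real i / real q" for i
  let ?L = "\<lambda>i. level u \<eta> m (y (g i))"
  let ?h = "\<lambda>i. u + \<eta> * real (?L i)"
  have g_less: "g i < g j \<longleftrightarrow> i < j" "g i \<le> g j \<longleftrightarrow> i \<le> j" for i j
    using q by (auto simp: g_def divide_less_cancel divide_le_cancel)
  have g_pos: "0 < g i" if "0 < i" for i using that q by (simp add: g_def)
  have ymono: "y r \<le> y s" if "0 < r" "r \<le> s" for r s
    using that by (intro monotone_onD[OF y(2)]) auto
  define Q where "Q i \<sigma> \<longleftrightarrow> g i < \<sigma> \<and> \<sigma> \<le> g (Suc i) \<and>
      (\<forall>r. g i \<le> r \<and> r < \<sigma> \<longrightarrow> \<bar>y r - ?h i\<bar> \<le> 2 * \<eta>) \<and>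
      (\<forall>r. \<sigma> \<le> r \<and> r \<le> g (Suc i) \<longrightarrow> \<bar>y r - ?h (Suc i)\<bar> \<le> 2 * \<eta>) \<and>
      (?L i = ?L (Suc i) \<longrightarrow> \<sigma> = g (Suc i))" for i \<sigma>
  have "\<exists>\<sigma>. Q i \<sigma>" if i: "i \<in> {k..<K}" for i
  proof (rule crossing_point[of \<eta> "g i" "g (Suc i)" y u m])
    show "g i < g (Suc i)" by (simp add: g_less)
    have gi: "0 < g i" "g k \<le> g i" "g (Suc i) \<le> g K" using i k by (auto simp: g_less intro: g_pos)
    show "mono_on {g i..g (Suc i)} y" by (rule mono_on_subset[OF y(2)]) (use gi in auto)
    show "(y \<longlongrightarrow> y r) (at_right r)" if "g i \<le> r" for r
      using gi that by (intro skorokhod_right y) auto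
    have "u < y (g k)" "y (g K) \<le> u + (real m + 1) * \<eta>" using good by (auto simp: good_path_def g_def)
    then show "u < y (g i)" "y (g (Suc i)) \<le> u + (real m + 1) * \<eta>"
      using gi ymono[of "g k" "g i"] ymono[of "g (Suc i)" "g K"] g_pos[OF k(1)] g_pos[of "Suc i"] by auto
    show "level u \<eta> m (y r) \<in> {?L i, ?L (Suc i)}" if "r \<in> \<rat>" "g i \<le> r" "r \<le> g (Suc i)" for r
      using good i that unfolding good_path_def intermediate_level_def g_def by blast
  qed (use \<eta> in \<open>auto simp: Q_def\<close>)
  then obtain \<sigma> where \<sigma>Q: "\<And>i. i \<in> {k..<K} \<Longrightarrow> Q i (\<sigma> i)" by metis
  have \<sigma>: "\<And>i. i \<in> {k..<K} \<Longrightarrow> g i < \<sigma> i \<and> \<sigma> i \<le> g (Suc i)"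
    "\<And>i r. i \<in> {k..<K} \<Longrightarrow> g i \<le> r \<Longrightarrow> r < \<sigma> i \<Longrightarrow> \<bar>y r - ?h i\<bar> \<le> 2 * \<eta>"
    "\<And>i r. i \<in> {k..<K} \<Longrightarrow> \<sigma> i \<le> r \<Longrightarrow> r \<le> g (Suc i) \<Longrightarrow> \<bar>y r - ?h (Suc i)\<bar> \<le> 2 * \<eta>"
    "\<And>i. i \<in> {k..<K} \<Longrightarrow> ?L i = ?L (Suc i) \<Longrightarrow> \<sigma> i = g (Suc i)"
    using \<sigma>Q unfolding Q_def by blast+
  \<comment> \<open>The right end of cell \<open>j\<close> goes to the crossing point of that cell;
    nodes up to \<open>k\<close> and beyond \<open>K\<close> stay fixed. Since a crossing lies
    strictly to the right of the left end of its cell, the nodes remain strictly ordered.\<close>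
  define \<nu> where "\<nu> i = (case i of 0 \<Rightarrow> 0 | Suc j \<Rightarrow> if j \<in> {k..<K} then \<sigma> j else g (Suc j))" for i
  have \<nu>0: "\<nu> 0 = 0" and \<nu>S: "\<nu> (Suc j) = (if j \<in> {k..<K} then \<sigma> j else g (Suc j))" for j
    by (simp_all add: \<nu>_def)
  have \<nu>_le: "\<nu> i \<le> g i" for i
    using \<sigma>(1) by (cases i) (auto simp: \<nu>0 \<nu>S g_def)
  have \<nu>_gr: "g i < \<nu> (Suc i)" for i
    using \<sigma>(1)[of i] by (auto simp: \<nu>S g_less)
  have \<nu>: "strict_mono \<nu>"
    unfolding strict_mono_Suc_iff using \<nu>_le \<nu>_gr le_less_trans by blast
  let ?f = "pw_linear (real q) \<nu>"
  have f_cell: "\<nu> i \<le> ?f x" "?f x < \<nu> (Suc i)" if "g i \<le> x" "x < g (Suc i)" for i x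
  proof -
    have z: "0 \<le> real q * x - real i" "real q * x - real i < 1" using that q by (auto simp: g_def field_simps)
    have s: "\<nu> (Suc i) - \<nu> i > 0" using \<nu> by (simp add: strict_mono_Suc_iff)
    have f: "?f x = \<nu> i + (\<nu> (Suc i) - \<nu> i) * (real q * x - real i)"
      using that q by (intro pw_linear_cell) (auto simp: g_def add.commute)
    show "\<nu> i \<le> ?f x" using f z s by simp
    have "(\<nu> (Suc i) - \<nu> i) * (real q * x - real i) < (\<nu> (Suc i) - \<nu> i) * 1"
      using s z by (intro mult_strict_left_mono) auto
    then show "?f x < \<nu> (Suc i)" using f by simp
  qed
  have cell: "\<exists>i. g i \<le> x \<and> x < g (Suc i)" if "0 \<le> x" for x
  proof (intro exI conjI)
    have *: "0 \<le> real q * x" using that by simp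
    show "g (nat \<lfloor>real q * x\<rfloor>) \<le> x" using q * by (simp add: g_def field_simps)
    show "x < g (Suc (nat \<lfloor>real q * x\<rfloor>))" using q * by (simp add: g_def field_simps) linarith
  qed
  define J where "J = {i \<in> {k..<K}. ?L i \<noteq> ?L (Suc i)}"
  have "card J + ?L k \<le> ?L K"
    unfolding J_def using k by (intro card_increases_le level_mono \<eta> ymono) (auto simp: g_less intro: g_pos)
  then have cJ: "card J \<le> m" using level_le_max[of u \<eta> m "y (g K)"] by simp
  \<comment> \<open>Moving the node \<open>Suc i\<close> bends the map on the two cells that share
    it. Elsewhere between the outer samples it is the identity, so end points outside
    \<open>B\<close> are fixed.\<close>
  define B where "B = (\<Union>i\<in>J. {g i..g (i + 2)})"
  have fix_pt: "?f x = x" if x: "g k \<le> x" "x < g K" "x \<notin> B" for x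
  proof -
    obtain i where i: "g i \<le> x" "x < g (Suc i)" using cell[of x] x g_pos[OF k(1)] by auto
    have "g k < g (Suc i)" "g i < g K" using i x by linarith+
    then have iK: "k \<le> i" "i < K" by (auto simp: g_less)
    have "i \<notin> J"
    proof
      assume "i \<in> J"
      moreover have "x \<le> g (i + 2)" using i g_less(2)[of "Suc i" "i+2"] by auto
      ultimately show False using x i by (auto simp: B_def)
    qed
    then have 1: "\<nu> (Suc i) = g (Suc i)" using iK \<sigma>(4) by (auto simp: J_def \<nu>S)
    have 2: "\<nu> i = g i"
    proof (cases "i = k")
      case True
      then show ?thesis using k by (cases i) (auto simp: \<nu>S)
    next
      case False
      then obtain j where j: "i = Suc j" "j \<in> {k..<K}" using iK by (cases i) auto
      have "j \<notin> J"
      proof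
        assume "j \<in> J"
        moreover have "x \<le> g (j + 2)" "g j \<le> x" using i j g_less(2)[of j i] by auto
        ultimately show False using x by (auto simp: B_def)
      qed
      then show ?thesis using j \<sigma>(4) by (auto simp: J_def \<nu>S)
    qed
    have "?f x = g i + (g (Suc i) - g i) * (real q * x - real i)"
      using i q pw_linear_cell[of "real q" i x \<nu>] unfolding 1 2 by (simp add: g_def add.commute)
    also have "\<dots> = x" using q by (simp add: g_def field_simps)
    finally show ?thesis .
  qed
  have "J1_dist y (grid_path u \<eta> m q k K y) \<le>
    (2 * \<eta> + 2 / real q) + g k + 2 * (real m * (2 / real q)) + exp (- g K)"
  proof (rule J1_dist_le[where B = B])
    show "B \<in> sets lborel" unfolding B_def J_def by (intro sets.finite_UN) auto
    have "emeasure lborel B \<le> (\<Sum>i\<in>J. emeasure lborel {g i..g (i + 2)})"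
      unfolding B_def by (intro emeasure_subadditive_finite) (auto simp: J_def)
    also have "\<dots> = (\<Sum>i\<in>J. ennreal (2 / real q))"
    proof (intro sum.cong refl)
      fix i
      have "g (i + 2) - g i = 2 / real q" by (simp add: g_def diff_divide_distrib[symmetric])
      then show "emeasure lborel {g i..g (i + 2)} = ennreal (2 / real q)" using g_less(2)[of i "i+2"] by simp
    qed
    also have "\<dots> = of_nat (card J) * ennreal (2 / real q)" by simp
    also have "\<dots> \<le> of_nat m * ennreal (2 / real q)" using cJ by (intro mult_right_mono) auto
    also have "\<dots> = ennreal (real m * (2 / real q))" by (simp add: ennreal_mult ennreal_of_nat_eq_real_of_nat del: times_divide_eq_right)
    finally show "emeasure lborel B \<le> ennreal (real m * (2 / real q))" .
    fix s t assume st: "g k < s" "s < 1" "1 < t" "t < g K" "s \<notin> B" "t \<notin> B"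
    have s0: "0 < s" using st g_pos[OF k(1)] by simp
    have homeo: "strict_mono_on {0..g K} ?f" "continuous_on {0..g K} ?f"
      using pw_linear_homeo[of "real q" \<nu> K] q \<nu> by (auto simp: g_def)
    show "J1_dist_on s t y (grid_path u \<eta> m q k K y) \<le> 2 * \<eta> + 2 / real q"
    proof (rule J1_dist_on_le)
      show "?f \<in> time_changes s t"
      proof (rule time_changesI)
        show "?f s = s" "?f t = t" using st by (auto intro!: fix_pt)
        show "strict_mono_on {s..t} ?f"
          by (rule monotone_on_subset[OF homeo(1)]) (use s0 st in auto)
        show "continuous_on {s..t} ?f"
          by (rule continuous_on_subset[OF homeo(2)]) (use s0 st in auto)
      qed
      show "s \<le> t" using st by simp
      fix x assume x: "x \<in> {s..t}"
      obtain i where i: "g i \<le> x" "x < g (Suc i)" using cell[of x] x s0 by auto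
      have "g k < g (Suc i)" "g i < g K" using i x st by auto
      then have iK: "k \<le> i" "i < K" by (auto simp: g_less)
      have fl: "\<lfloor>real q * x\<rfloor> = int i" using i q by (intro floor_unique) (auto simp: g_def field_simps)
      have gp: "grid_path u \<eta> m q k K y x = ?h i"
        using x s0 iK by (simp add: grid_path_def fl g_def max_def min_def)
      have "\<bar>y (?f x) - ?h i\<bar> \<le> 2 * \<eta>"
      proof (cases "g i \<le> ?f x")
        case True
        then show ?thesis using f_cell(2)[OF i] \<sigma>(2)[of i "?f x"] iK by (auto simp: \<nu>S)
      next
        case False
        \<comment> \<open>A time mapped before \<open>g i\<close> lies in cell \<open>i - 1\<close>
          after its crossing, where the path already has the level of grid point \<open>i\<close>.
          For \<open>i = k\<close> this cannot happen, the node \<open>k\<close> being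
          fixed.\<close>
        then have "i \<noteq> k" using f_cell(1)[OF i] k by (cases i) (auto simp: \<nu>S)
        then obtain j where j: "i = Suc j" "j \<in> {k..<K}" using iK by (cases i) auto
        then show ?thesis using f_cell(1)[OF i] \<sigma>(3)[of j "?f x"] False by (auto simp: \<nu>S)
      qed
      moreover have "0 \<le> 2 / real q" by simp
      ultimately show "\<bar>y (?f x) - grid_path u \<eta> m q k K y x\<bar> \<le> 2 * \<eta> + 2 / real q"
        unfolding gp by linarith
      have "g (Suc i) = g i + 1 / real q" by (simp add: g_def add_divide_distrib)
      moreover have "g i - 1 / real q \<le> \<nu> i"
        using \<nu>_gr[of "i - 1"] iK k by (cases i) (auto simp: g_def add_divide_distrib)
      moreover have "\<nu> (Suc i) \<le> g (Suc i)" by (rule \<nu>_le)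
      moreover have "2 / real q = 1 / real q + 1 / real q" by simp
      ultimately have "\<bar>?f x - x\<bar> \<le> 2 / real q"
        using f_cell[OF i] i by (simp only: abs_le_iff) linarith
      then show "\<bar>?f x - x\<bar> \<le> 2 * \<eta> + 2 / real q" using \<eta> by simp
    qed
  qed (use \<eta> g_pos[OF k(1)] in auto)
  also have "\<dots> = 2 * \<eta> + (2 + real k + 4 * real m) / real q + exp (- (real K / real q))"
    by (simp add: g_def add_divide_distrib)
  finally show ?thesis .
qed

section \<open>Exceedances of a stationary process under mixing\<close>

locale stationary_process = prob_space M for M :: "'a measure" +
  fixes T :: "'a \<Rightarrow> 'a" and \<phi> :: "'a \<Rightarrow> ereal" and X :: "nat \<Rightarrow> 'a \<Rightarrow> ereal"
  assumes T [measurable]: "T \<in> measurable M M" and T_inv: "distr M M T = M"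
    and \<phi> [measurable]: "\<phi> \<in> borel_measurable M" and X_eq: "X = time_series \<phi> T"
begin

lemma T_pow [measurable]: "(T ^^ k) \<in> measurable M M"
  by (induction k) (auto intro: measurable_comp[OF _ T])

lemma T_pow_inv: "distr M M (T ^^ k) = M"
proof (induction k)
  case 0
  then show ?case by (simp add: distr_id id_def)
next
  case (Suc k)
  have "distr M M (T ^^ Suc k) = distr (distr M M (T ^^ k)) M T"
    by (subst distr_distr) (auto intro: T)
  then show ?case by (simp only: Suc T_inv)
qed

lemma X_meas [measurable]: "X i \<in> borel_measurable M"
  unfolding X_eq time_series_def by measurable

lemma X_shift: "X (Suc (k + i)) x = X (Suc i) ((T ^^ k) x)"
  by (simp add: X_eq time_series_def funpow_add add.commute)

text \<open>The predicate takes the whole sequence as its argument, so that one statement of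
  stationarity covers single exceedances, pairs and events about several windows.\<close>

lemma prob_shift:
  assumes "{x \<in> space M. P (\<lambda>i. X (Suc i) x)} \<in> events"
  shows "prob {x \<in> space M. P (\<lambda>i. X (Suc (k + i)) x)} = prob {x \<in> space M. P (\<lambda>i. X (Suc i) x)}"
proof -
  have "prob {x \<in> space M. P (\<lambda>i. X (Suc i) x)} = measure (distr M M (T ^^ k)) {x \<in> space M. P (\<lambda>i. X (Suc i) x)}"
    by (simp add: T_pow_inv)
  also have "\<dots> = prob ((T ^^ k) -` {x \<in> space M. P (\<lambda>i. X (Suc i) x)} \<inter> space M)"
    by (rule measure_distr) (use assms in auto)
  also have "(T ^^ k) -` {x \<in> space M. P (\<lambda>i. X (Suc i) x)} \<inter> space M = {x \<in> space M. P (\<lambda>i. X (Suc (k + i)) x)}"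
    using measurable_space[OF T_pow[of k]] by (auto simp: X_shift)
  finally show ?thesis by simp
qed

definition exc :: "real \<Rightarrow> real" where
  "exc w = prob {x \<in> space M. X 1 x > ereal w}"

definition exc2 :: "real \<Rightarrow> nat \<Rightarrow> real" where
  "exc2 w j = prob {x \<in> space M. X 1 x > ereal w \<and> X j x > ereal w}"

lemma exc_nonneg [simp]: "exc w \<ge> 0" and exc2_nonneg [simp]: "exc2 w j \<ge> 0"
  by (simp_all add: exc_def exc2_def)

lemma exc_antimono: "v \<le> w \<Longrightarrow> exc w \<le> exc v"
  unfolding exc_def by (intro finite_measure_mono) (auto intro: order.strict_trans1[of _ "ereal w"])

lemma exc2_antimono: "v \<le> w \<Longrightarrow> exc2 w j \<le> exc2 v j"
  unfolding exc2_def by (intro finite_measure_mono) (auto intro: order.strict_trans1[of _ "ereal w"])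

lemma prob_exceed: "prob {x \<in> space M. X (Suc k) x > ereal w} = exc w"
  using prob_shift[of "\<lambda>f. f 0 > ereal w" k] by (simp add: exc_def)

lemma prob_exceed2:
  assumes "i < j"
  shows "prob {x \<in> space M. X (Suc i) x > ereal w \<and> X (Suc j) x > ereal w} = exc2 w (Suc (j - i))"
  using prob_shift[of "\<lambda>f. f 0 > ereal w \<and> f (j - i) > ereal w" i] assms by (simp add: exc2_def)

section \<open>One block of observations\<close>

text \<open>Each new event loses at most its overlap with the earlier ones. The pair terms are
  enlarged by dropping \<open>R\<close>, because \<open>\<D>'\<close> controls pairs of exceedances
  alone.\<close>

lemma bonferroni_lower:
  fixes E :: "nat \<Rightarrow> 'a set"
  assumes [measurable]: "\<And>i. E i \<in> events" "R \<in> events"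
  shows "(\<Sum>i<k. prob (E i \<inter> R)) - (\<Sum>j<k. \<Sum>i<j. prob (E i \<inter> E j)) \<le> prob ((\<Union>i<k. E i) \<inter> R)"
proof (induction k)
  case (Suc k)
  have [measurable]: "(\<Union>i<k. E i) \<in> events" by (intro sets.finite_UN) auto
  let ?U = "(\<Union>i<k. E i) \<inter> R"
  have U [measurable]: "?U \<in> events" by measurable
  have "prob ((\<Union>i<Suc k. E i) \<inter> R) = prob (?U \<union> (E k \<inter> R))"
    by (rule arg_cong[where f = prob]) (auto simp: less_Suc_eq)
  also have "\<dots> = prob ?U + prob ((E k \<inter> R) - ?U)"
    by (intro finite_measure_Union') auto
  finally have 1: "prob ((\<Union>i<Suc k. E i) \<inter> R) = prob ?U + prob ((E k \<inter> R) - ?U)" .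
  have 2: "prob ((E k \<inter> R) - ?U) = prob (E k \<inter> R) - prob ((E k \<inter> R) \<inter> ?U)"
    by (rule finite_measure_Diff') auto
  have "prob ((E k \<inter> R) \<inter> ?U) \<le> prob (\<Union>i<k. E i \<inter> E k)"
    by (intro finite_measure_mono sets.finite_UN) auto
  also have "\<dots> \<le> (\<Sum>i<k. prob (E i \<inter> E k))"
    by (intro finite_measure_subadditive_finite) auto
  finally have 3: "prob ((E k \<inter> R) \<inter> ?U) \<le> (\<Sum>i<k. prob (E i \<inter> E k))" .
  show ?case unfolding sum.lessThan_Suc using Suc 1 2 3 by linarith
qed simp

lemma sum_exc2_le:
  assumes "j < p"
  shows "(\<Sum>i<j. exc2 w (Suc (j - i))) \<le> (\<Sum>d = 2..p. exc2 w d)"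
proof -
  have "(\<Sum>i<j. exc2 w (Suc (j - i))) = (\<Sum>d \<in> (\<lambda>i. Suc (j - i)) ` {..<j}. exc2 w d)"
    by (subst sum.reindex) (auto simp: inj_on_def)
  also have "\<dots> \<le> (\<Sum>d = 2..p. exc2 w d)"
    by (rule sum_mono2) (use assms in auto)
  finally show ?thesis .
qed

text \<open>Exceedances in the last \<open>g\<close> positions are left aside, so that each
  remaining one is far enough from \<open>R\<close>, in the applications an event about times from
  \<open>e\<close> on, to factorise up to \<open>\<gamma>\<close>. Subadditivity bounds the
  probability of an exceedance from above, Bonferroni from below at the cost of \<open>S\<close>.
  The gap costs at most \<open>g * exc w\<close> on either side: its own exceedances in the lower
  bound, the missing part of the factor in the upper one.\<close>

lemma exceed_block:
  assumes sg: "s + g \<le> e" and \<gamma>0: "0 \<le> \<gamma>" and R [measurable]: "Measurable.pred M R"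
    and \<gamma>: "\<And>l. s \<le> l \<Longrightarrow> l + g < e \<Longrightarrow>
      \<bar>prob {x \<in> space M. X (Suc l) x > ereal w \<and> R x} - exc w * prob {x \<in> space M. R x}\<bar> \<le> \<gamma>"
    and S: "(\<Sum>j = 2..e - s - g. exc2 w j) \<le> S"
  shows "\<bar>prob {x \<in> space M. (\<forall>l\<in>{s..<e}. X (Suc l) x \<le> ereal w) \<and> R x}
      - (1 - real (e - s) * exc w) * prob {x \<in> space M. R x}\<bar> \<le> real (e - s) * (\<gamma> + S) + 2 * real g * exc w"
proof -
  define p where "p = e - s - g"
  have e: "e = s + p + g" using sg by (simp add: p_def)
  have S0: "0 \<le> S" using S by (rule order.trans[rotated]) (simp add: sum_nonneg)
  define E where "E i = {x \<in> space M. X (Suc (s + i)) x > ereal w}" for i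
  have E [measurable]: "E i \<in> events" for i unfolding E_def by measurable
  define R' where "R' = {x \<in> space M. R x}"
  have R' [measurable]: "R' \<in> events" unfolding R'_def by measurable
  define A where "A = (\<Union>i<p. E i) \<inter> R'"
  have [measurable]: "A \<in> events" unfolding A_def by (intro sets.Int sets.finite_UN) auto
  define r \<mu> where "r = prob R'" and "\<mu> = exc w"
  have r: "0 \<le> r" "r \<le> 1" by (simp_all add: r_def)
  have \<mu>: "0 \<le> \<mu>" by (simp add: \<mu>_def)
  have ER: "\<bar>prob (E i \<inter> R') - \<mu> * r\<bar> \<le> \<gamma>" if "i < p" for i
  proof -
    have "E i \<inter> R' = {x \<in> space M. X (Suc (s + i)) x > ereal w \<and> R x}" by (auto simp: E_def R'_def)
    then show ?thesis using \<gamma>[of "s + i"] that by (simp add: e r_def \<mu>_def R'_def)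
  qed
  have ER': "prob (E i \<inter> R') \<le> \<mu> * r + \<gamma>" "\<mu> * r - \<gamma> \<le> prob (E i \<inter> R')" if "i < p" for i
    using ER[OF that] by linarith+
  have "(\<Sum>i<p. prob (E i \<inter> R')) \<le> (\<Sum>i<p. \<mu> * r + \<gamma>)"
    using ER' by (intro sum_mono) auto
  moreover have "prob A \<le> (\<Sum>i<p. prob (E i \<inter> R'))"
  proof -
    have "A = (\<Union>i<p. E i \<inter> R')" by (auto simp: A_def)
    then show ?thesis by (simp only:) (intro finite_measure_subadditive_finite, auto)
  qed
  ultimately have up: "prob A \<le> p * (\<mu> * r + \<gamma>)" by simp
  have "(\<Sum>i<p. \<mu> * r - \<gamma>) \<le> (\<Sum>i<p. prob (E i \<inter> R'))"
    using ER' by (intro sum_mono) auto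
  moreover have "(\<Sum>j<p. \<Sum>i<j. prob (E i \<inter> E j)) \<le> (\<Sum>j<p. S)"
  proof (rule sum_mono)
    fix j assume j: "j \<in> {..<p}"
    have "prob (E i \<inter> E j) = exc2 w (Suc (j - i))" if "i < j" for i
    proof -
      have "E i \<inter> E j = {x \<in> space M. X (Suc (s + i)) x > ereal w \<and> X (Suc (s + j)) x > ereal w}"
        by (auto simp: E_def)
      then show ?thesis using prob_exceed2[of "s + i" "s + j" w] that by simp
    qed
    then have "(\<Sum>i<j. prob (E i \<inter> E j)) = (\<Sum>i<j. exc2 w (Suc (j - i)))" by (intro sum.cong) auto
    also have "\<dots> \<le> S" using sum_exc2_le[of j p w] j S by (simp add: p_def)
    finally show "(\<Sum>i<j. prob (E i \<inter> E j)) \<le> S" .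
  qed
  ultimately have lo: "p * (\<mu> * r - \<gamma>) - p * S \<le> prob A"
    using bonferroni_lower[of E R' p] by (simp add: A_def)
  define Q where "Q = {x \<in> space M. (\<forall>l\<in>{s..<e}. X (Suc l) x \<le> ereal w) \<and> R x}"
  have [measurable]: "Q \<in> events" unfolding Q_def by measurable
  have RA: "prob (R' - A) = r - prob A"
    unfolding r_def by (rule finite_measure_Diff) (auto simp: A_def)
  have "prob Q \<le> prob (R' - A)"
  proof (intro finite_measure_mono)
    show "Q \<subseteq> R' - A"
    proof
      fix x assume x: "x \<in> Q"
      then have "x \<in> R'" by (simp add: Q_def R'_def)
      moreover have "x \<notin> E i" if "i < p" for i
      proof -
        have "X (Suc (s + i)) x \<le> ereal w" using x that unfolding Q_def e by auto
        then show ?thesis unfolding E_def by (simp add: not_less)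
      qed
      ultimately show "x \<in> R' - A" by (auto simp: A_def)
    qed
  qed auto
  then have Q1: "prob Q \<le> r - prob A" by (simp add: RA)
  have "prob (R' - A) \<le> prob (Q \<union> (\<Union>i<g. E (p + i)))"
  proof (intro finite_measure_mono)
    show "R' - A \<subseteq> Q \<union> (\<Union>i<g. E (p + i))"
    proof
      fix x assume x: "x \<in> R' - A"
      then have xs: "x \<in> space M" "R x" by (auto simp: R'_def)
      have nE: "x \<notin> E i" if "i < p" for i using x that by (auto simp: A_def)
      show "x \<in> Q \<union> (\<Union>i<g. E (p + i))"
      proof (cases "\<exists>i<g. x \<in> E (p + i)")
        case False
        have "X (Suc l) x \<le> ereal w" if l: "l \<in> {s..<e}" for l
        proof -
          define i where "i = l - s"
          have i: "l = s + i" "i < p + g" using l by (auto simp: i_def e)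
          have "x \<notin> E i"
          proof (cases "i < p")
            case False
            then have "i = p + (i - p)" "i - p < g" using i by auto
            then show ?thesis using \<open>\<not> (\<exists>i<g. x \<in> E (p + i))\<close> by metis
          qed (use nE in auto)
          then show ?thesis using xs by (simp add: E_def i)
        qed
        then show ?thesis using xs by (simp add: Q_def)
      qed auto
    qed
  qed (auto intro!: sets.Un sets.finite_UN)
  also have "\<dots> \<le> prob Q + prob (\<Union>i<g. E (p + i))"
    by (intro measure_Un_le) (auto intro!: sets.finite_UN)
  also have "prob (\<Union>i<g. E (p + i)) \<le> (\<Sum>i<g. prob (E (p + i)))"
    by (intro finite_measure_subadditive_finite) auto
  also have "\<dots> = g * \<mu>" by (simp add: E_def prob_exceed \<mu>_def)
  finally have Q2: "r - prob A - g * \<mu> \<le> prob Q" by (simp add: RA)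
  have es: "real (e - s) = real p + real g" by (simp add: e)
  have gr: "0 \<le> g * \<mu> * r" "g * \<mu> * r \<le> g * \<mu>" using r \<mu> by (auto intro: mult_left_le)
  have main: "\<bar>prob Q - (1 - (real p + real g) * \<mu>) * r\<bar> \<le> p * \<gamma> + p * S + 2 * g * \<mu>"
  proof (rule abs_leI)
    have eq: "prob Q - (1 - (real p + real g) * \<mu>) * r = prob Q - r + p * (\<mu> * r) + g * \<mu> * r"
      by (simp add: algebra_simps)
    show "prob Q - (1 - (real p + real g) * \<mu>) * r \<le> p * \<gamma> + p * S + 2 * g * \<mu>"
      unfolding eq using Q1 lo gr \<mu> by (simp add: algebra_simps)
    have "0 \<le> p * S" "0 \<le> g * \<mu>" using S0 \<mu> by auto
    then show "- (prob Q - (1 - (real p + real g) * \<mu>) * r) \<le> p * \<gamma> + p * S + 2 * g * \<mu>"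
      unfolding eq using Q2 up gr by (simp add: algebra_simps)
  qed
  have "p * \<gamma> + p * S \<le> real (e - s) * (\<gamma> + S)"
    unfolding es using S0 \<gamma>0 by (simp add: algebra_simps)
  then show ?thesis using main unfolding Q_def[symmetric] R'_def[symmetric] r_def[symmetric] \<mu>_def[symmetric] es
    by linarith
qed

lemma max_over_le_iff:
  "max_over X A x \<le> ereal v \<longleftrightarrow> (\<forall>i. real i \<in> A \<longrightarrow> X (Suc i) x \<le> ereal v)"
  by (auto simp: max_over_def SUP_le_iff)

lemma interval_in_ring: "0 \<le> a \<Longrightarrow> {a..<b} \<in> interval_ring"
proof -
  assume a: "0 \<le> a"
  have eq: "{a..<b} = {a..<max a b}" by auto
  have "{a..<b} \<in> {{a..<b} | a b. 0 \<le> a \<and> a \<le> b}"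
    by (rule CollectI, intro exI[of _ a] exI[of _ "max a b"] conjI eq a) simp
  then show ?thesis unfolding interval_ring_def by blast
qed

text \<open>Window \<open>i\<close> is \<open>{c i..<c (Suc i)}\<close>, the offset \<open>l\<close>
  belonging to \<open>X (Suc l)\<close>. Times before \<open>e\<close> are ignored, so that raising
  \<open>e\<close> peels off blocks from the front.\<close>

definition below :: "nat \<Rightarrow> (nat \<Rightarrow> nat) \<Rightarrow> (nat \<Rightarrow> real) \<Rightarrow> nat \<Rightarrow> 'a \<Rightarrow> bool" where
  "below K c w e x \<longleftrightarrow> (\<forall>i<K. \<forall>l\<in>{max e (c i)..<c (Suc i)}. X (Suc l) x \<le> ereal (w i))"

lemma below_meas [measurable]: "Measurable.pred M (below K c w e)"
  unfolding below_def by measurable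

lemma below_split:
  assumes c: "mono c" and i: "i < K" and se: "c i \<le> s" "s \<le> e" "e \<le> c (Suc i)"
  shows "below K c w s x \<longleftrightarrow> (\<forall>l\<in>{s..<e}. X (Suc l) x \<le> ereal (w i)) \<and> below K c w e x"
proof
  assume b: "below K c w s x"
  show "(\<forall>l\<in>{s..<e}. X (Suc l) x \<le> ereal (w i)) \<and> below K c w e x"
  proof
    show "\<forall>l\<in>{s..<e}. X (Suc l) x \<le> ereal (w i)" using b i se by (auto simp: below_def)
    show "below K c w e x" using b se by (auto simp: below_def)
  qed
next
  assume b: "(\<forall>l\<in>{s..<e}. X (Suc l) x \<le> ereal (w i)) \<and> below K c w e x"
  show "below K c w s x"
    unfolding below_def
  proof (intro allI impI ballI)
    fix j l assume j: "j < K" and l: "l \<in> {max s (c j)..<c (Suc j)}"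
    show "X (Suc l) x \<le> ereal (w j)"
    proof (cases "l < e")
      case True
      have "j = i"
      proof (rule ccontr)
        assume "j \<noteq> i"
        then consider "Suc j \<le> i" | "Suc i \<le> j" by linarith
        then show False
        proof cases
          case 1
          then have "c (Suc j) \<le> c i" by (rule monoD[OF c])
          then show False using l se by auto
        next
          case 2
          then have "c (Suc i) \<le> c j" by (rule monoD[OF c])
          then show False using l se True by auto
        qed
      qed
      then show ?thesis using b l True by auto
    next
      case False
      then show ?thesis using b l j by (auto simp: below_def)
    qed
  qed
qed

text \<open>Stationarity moves the exceedance from offset \<open>l\<close> to the first observation
  and the windows back by \<open>l + t\<close>, which is the form of \<open>cond_D\<close>. The
  reversal \<open>K - k\<close> turns levels that increase along the windows into the decreasing
  order of the mixing hypothesis.\<close>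

lemma cond_D_below:
  assumes D: "\<And>A v. (\<forall>j\<in>{1..K}. A j \<in> interval_ring) \<and> disjoint_family_on A {1..K} \<and>
         (\<forall>j\<in>{0..K}. v j \<in> (\<lambda>k. w (K - k)) ` {1..K}) \<longrightarrow>
         \<bar>measure M {x \<in> space M. X 1 x > ereal (v 0) \<and>
              (\<forall>j\<in>{1..K}. max_over X ((\<lambda>a. a + real t) ` A j) x \<le> ereal (v j))}
          - measure M {x \<in> space M. X 1 x > ereal (v 0)}
            * measure M {x \<in> space M. \<forall>j\<in>{1..K}. max_over X (A j) x \<le> ereal (v j)}\<bar> \<le> \<gamma>"
    and c: "mono c" and i: "i < K" and lt: "l + t \<le> e"
  shows "\<bar>prob {x \<in> space M. X (Suc l) x > ereal (w i) \<and> below K c w e x}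
      - exc (w i) * prob {x \<in> space M. below K c w e x}\<bar> \<le> \<gamma>"
proof -
  \<comment> \<open>A window ending before \<open>e\<close> becomes empty with both ends equal to
    \<open>e\<close>. All ends are now at least \<open>l + t\<close>, so the natural number
    subtractions below are exact.\<close>
  define lo where "lo j = max e (c j)" for j
  have lo: "lo j \<le> lo (Suc j)" "l + t \<le> lo j" for j
    using monoD[OF c, of j "Suc j"] lt by (auto simp: lo_def)
  define A where "A k = {real (lo (K - k) - l - t)..<real (lo (Suc (K - k)) - l - t)}" for k
  define v where "v k = (if k = 0 then w i else w (K - k))" for k
  have below_lo: "below K c w e x \<longleftrightarrow> (\<forall>j<K. \<forall>l\<in>{lo j..<lo (Suc j)}. X (Suc l) x \<le> ereal (w j))" for x
  proof -
    have "{max e (c j)..<c (Suc j)} = {lo j..<lo (Suc j)}" for j by (auto simp: lo_def)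
    then show ?thesis by (simp add: below_def)
  qed
  have disj: "disjoint_family_on A {1..K}"
    unfolding disjoint_family_on_def
  proof (intro ballI impI)
    fix k k' assume k: "k \<in> {1..K}" "k' \<in> {1..K}" "k \<noteq> k'"
    have *: "A k \<inter> A k' = {}" if "k < k'" "k' \<le> K" for k k'
    proof -
      have "lo (Suc (K - k')) \<le> lo (K - k)" by (rule lift_Suc_mono_le[of lo, OF lo(1)]) (use that in linarith)
      then have "lo (Suc (K - k')) - l - t \<le> lo (K - k) - l - t" by simp
      then show ?thesis by (auto simp: A_def simp del: of_nat_diff)
    qed
    show "A k \<inter> A k' = {}" using *[of k k'] *[of k' k] k by (cases "k < k'") auto
  qed
  have vin: "\<forall>j\<in>{0..K}. v j \<in> (\<lambda>k. w (K - k)) ` {1..K}"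
  proof
    fix j assume j: "j \<in> {0..K}"
    show "v j \<in> (\<lambda>k. w (K - k)) ` {1..K}"
    proof (cases "j = 0")
      case True
      then show ?thesis using i by (intro image_eqI[of _ _ "K - i"]) (auto simp: v_def)
    qed (use j in \<open>auto simp: v_def\<close>)
  qed
  have ring: "\<forall>j\<in>{1..K}. A j \<in> interval_ring" by (auto simp: A_def intro!: interval_in_ring)
  have idx: "(\<forall>k\<in>{1..K}. P (K - k)) \<longleftrightarrow> (\<forall>j<K. P j)" for P
  proof safe
    fix j assume "\<forall>k\<in>{1..K}. P (K - k)" "j < K"
    then show "P j" by (auto dest: bspec[of _ _ "K - j"])
  qed auto
  have ma: "(\<forall>k\<in>{1..K}. max_over X (A k) x \<le> ereal (v k)) \<longleftrightarrow>
      (\<forall>j<K. \<forall>l'\<in>{lo j - l - t..<lo (Suc j) - l - t}. X (Suc l') x \<le> ereal (w j))" for x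
    unfolding idx[symmetric] by (auto simp: max_over_le_iff A_def v_def simp del: of_nat_diff)
  have mb: "(\<forall>k\<in>{1..K}. max_over X ((\<lambda>a. a + real t) ` A k) x \<le> ereal (v k)) \<longleftrightarrow>
      (\<forall>j<K. \<forall>l'\<in>{lo j - l..<lo (Suc j) - l}. X (Suc l') x \<le> ereal (w j))" for x
  proof -
    have "real l' \<in> (\<lambda>a. a + real t) ` A k \<longleftrightarrow> l' \<in> {lo (K - k) - l..<lo (Suc (K - k)) - l}" for l' k
    proof -
      have "real l' \<in> (\<lambda>a. a + real t) ` A k \<longleftrightarrow> real l' - real t \<in> A k" 
        by (auto simp: image_iff intro: bexI[of _ "real l' - real t"])
      also have "\<dots> \<longleftrightarrow> l' \<in> {lo (K - k) - l..<lo (Suc (K - k)) - l}"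
        using lo(2)[of "K - k"] lo(2)[of "Suc (K - k)"] by (auto simp: A_def of_nat_diff)
      finally show ?thesis .
    qed
    then show ?thesis unfolding idx[symmetric] by (auto simp: max_over_le_iff v_def)
  qed
  have sh: "prob {x \<in> space M. below K c w e x} = prob {x \<in> space M. \<forall>k\<in>{1..K}. max_over X (A k) x \<le> ereal (v k)}"
  proof -
    have "below K c w e x \<longleftrightarrow> (\<forall>j<K. \<forall>l'\<in>{lo j - l - t..<lo (Suc j) - l - t}. X (Suc (l + t + l')) x \<le> ereal (w j))" for x
    proof -
      have "(\<forall>l\<in>{lo j..<lo (Suc j)}. X (Suc l) x \<le> ereal (w j)) \<longleftrightarrow>
        (\<forall>l'\<in>{lo j - l - t..<lo (Suc j) - l - t}. X (Suc (l + t + l')) x \<le> ereal (w j))" (is "?A \<longleftrightarrow> ?B") for j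
      proof
        assume A: ?A
        show ?B
        proof
          fix l' assume "l' \<in> {lo j - l - t..<lo (Suc j) - l - t}"
          then have "l + t + l' \<in> {lo j..<lo (Suc j)}" using lo(2)[of j] by simp linarith
          then show "X (Suc (l + t + l')) x \<le> ereal (w j)" using A by blast
        qed
      next
        assume B: ?B
        show ?A
        proof
          fix n assume n: "n \<in> {lo j..<lo (Suc j)}"
          then have "n - l - t \<in> {lo j - l - t..<lo (Suc j) - l - t}" "l + t + (n - l - t) = n"
            using lo(2)[of j] by simp_all linarith
          then show "X (Suc n) x \<le> ereal (w j)" using bspec[OF B, of "n - l - t"] by metis
        qed
      qed
      then show ?thesis unfolding below_lo by blast
    qed
    then show ?thesis unfolding ma
      by (simp only:) (rule prob_shift[of "\<lambda>f. \<forall>j<K. \<forall>l'\<in>{lo j - l - t..<lo (Suc j) - l - t}. f l' \<le> ereal (w j)" "l + t"], measurable)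
  qed
  have sh2: "prob {x \<in> space M. X (Suc l) x > ereal (w i) \<and> below K c w e x} =
      prob {x \<in> space M. X 1 x > ereal (v 0) \<and> (\<forall>k\<in>{1..K}. max_over X ((\<lambda>a. a + real t) ` A k) x \<le> ereal (v k))}"
  proof -
    have "below K c w e x \<longleftrightarrow> (\<forall>j<K. \<forall>l'\<in>{lo j - l..<lo (Suc j) - l}. X (Suc (l + l')) x \<le> ereal (w j))" for x
    proof -
      have "(\<forall>l\<in>{lo j..<lo (Suc j)}. X (Suc l) x \<le> ereal (w j)) \<longleftrightarrow>
        (\<forall>l'\<in>{lo j - l..<lo (Suc j) - l}. X (Suc (l + l')) x \<le> ereal (w j))" (is "?A \<longleftrightarrow> ?B") for j
      proof
        assume A: ?A
        show ?B
        proof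
          fix l' assume "l' \<in> {lo j - l..<lo (Suc j) - l}"
          then have "l + l' \<in> {lo j..<lo (Suc j)}" using lo(2)[of j] by simp linarith
          then show "X (Suc (l + l')) x \<le> ereal (w j)" using A by blast
        qed
      next
        assume B: ?B
        show ?A
        proof
          fix n assume n: "n \<in> {lo j..<lo (Suc j)}"
          then have "n - l \<in> {lo j - l..<lo (Suc j) - l}" "l + (n - l) = n"
            using lo(2)[of j] by simp_all linarith
          then show "X (Suc n) x \<le> ereal (w j)" using bspec[OF B, of "n - l"] by metis
        qed
      qed
      then show ?thesis unfolding below_lo by blast
    qed
    then show ?thesis unfolding mb
      using prob_shift[of "\<lambda>f. f 0 > ereal (w i) \<and> (\<forall>j<K. \<forall>l'\<in>{lo j - l..<lo (Suc j) - l}. f l' \<le> ereal (w j))" l]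
      by (simp add: v_def)
  qed
  show ?thesis
    using D[of A v] ring disj vin unfolding sh sh2 exc_def by (simp add: v_def)
qed

end

section \<open>Limits of window probabilities under mixing\<close>

text \<open>The errors of the single steps telescope, and factors of modulus at most 1 do not
  amplify them.\<close>

lemma prod_step_error:
  fixes Q y :: "nat \<Rightarrow> real"
  assumes "\<And>j. j < L \<Longrightarrow> \<bar>Q j - y j * Q (Suc j)\<bar> \<le> e" "\<And>j. j < L \<Longrightarrow> \<bar>y j\<bar> \<le> 1"
  shows "\<bar>Q 0 - (\<Prod>j<L. y j) * Q L\<bar> \<le> real L * e"
  using assms
proof (induction L)
  case (Suc L)
  have P: "\<bar>\<Prod>j<L. y j\<bar> \<le> 1" unfolding abs_prod by (rule prod_le_1) (use Suc.prems(2) in auto)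
  have "\<bar>(\<Prod>j<L. y j) * (Q L - y L * Q (Suc L))\<bar> \<le> 1 * e"
    unfolding abs_mult using P Suc.prems(1)[of L] by (intro mult_mono) auto
  moreover have "\<bar>Q 0 - (\<Prod>j<L. y j) * Q L\<bar> \<le> real L * e" using Suc by auto
  moreover have "Q 0 - (\<Prod>j<Suc L. y j) * Q (Suc L) =
      (Q 0 - (\<Prod>j<L. y j) * Q L) + (\<Prod>j<L. y j) * (Q L - y L * Q (Suc L))"
    by (simp add: algebra_simps)
  moreover have "real (Suc L) * e = real L * e + 1 * e" by (simp add: algebra_simps)
  ultimately show ?case by linarith
qed simp

lemma grid_length:
  fixes n j q :: nat
  assumes "q > 0"
  shows "n * j div q + n div q \<le> n * Suc j div q" "n * Suc j div q \<le> n * j div q + n div q + 1"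
proof -
  have "n * Suc j = n * j + n" by simp
  then have "n * Suc j div q = n * j div q + n div q + (n * j mod q + n mod q) div q"
    by (simp only: div_add1_eq[of "n * j" n q])
  moreover have "(n * j mod q + n mod q) div q \<le> 1"
  proof -
    have "n * j mod q + n mod q < 2 * q"
      using mod_less_divisor[OF assms, of "n * j"] mod_less_divisor[OF assms, of n] by linarith
    then have "(n * j mod q + n mod q) div q < 2" by (simp add: less_mult_imp_div_less)
    then show ?thesis by simp
  qed
  ultimately show "n * j div q + n div q \<le> n * Suc j div q" "n * Suc j div q \<le> n * j div q + n div q + 1"
    by simp_all
qed

lemma nat_div_bounds: "real a / real q - 1 \<le> real (a div q)" "real (a div q) \<le> real a / real q"
proof -
  have "real (a div q) = real_of_int \<lfloor>real a / real q\<rfloor>" by (simp add: floor_divide_of_nat_eq)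
  then show "real a / real q - 1 \<le> real (a div q)" "real (a div q) \<le> real a / real q" by linarith+
qed

lemma grid_tendsto:
  assumes "q > 0"
  shows "(\<lambda>n. real (n * j div q) / real n) \<longlonglongrightarrow> real j / real q"
proof (rule real_tendsto_sandwich)
  have *: "eventually (\<lambda>n. real n > 0) sequentially"
    by (rule eventually_mono[OF eventually_gt_at_top[of 0]]) simp
  show "\<forall>\<^sub>F n in sequentially. real j / real q - 1 / real n \<le> real (n * j div q) / real n"
    using *
  proof eventually_elim
    case (elim n)
    have "real (n * j) / real q - 1 \<le> real (n * j div q)" by (rule nat_div_bounds)
    then have "(real (n * j) / real q - 1) / real n \<le> real (n * j div q) / real n"
      using elim by (intro divide_right_mono) auto
    moreover have "(real (n * j) / real q - 1) / real n = real j / real q - 1 / real n"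
      using elim by (simp add: diff_divide_distrib)
    ultimately show ?case by simp
  qed
  show "\<forall>\<^sub>F n in sequentially. real (n * j div q) / real n \<le> real j / real q"
    using *
  proof eventually_elim
    case (elim n)
    have "real (n * j div q) \<le> real (n * j) / real q" by (rule nat_div_bounds)
    then show ?case using elim assms by (simp add: field_simps)
  qed
  show "(\<lambda>n. real j / real q - 1 / real n) \<longlonglongrightarrow> real j / real q"
    using tendsto_diff[OF tendsto_const lim_1_over_n] by simp
qed simp

text \<open>The factors are constant on groups of \<open>m\<close> consecutive indices, and each
  group is a power that tends to an exponential.\<close>

lemma prod_blocks_tendsto:
  fixes x :: "nat \<Rightarrow> real"
  assumes "q > 0"
  shows "(\<lambda>m. \<Prod>j<K * m. 1 - x (j div m) / real (q * m)) \<longlonglongrightarrow> (\<Prod>i<K. exp (- (x i / real q)))"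
proof -
  have eq: "(\<Prod>j<K * m. 1 - x (j div m) / real (q * m)) = (\<Prod>i<K. (1 + (- (x i / real q)) / real m) ^ m)" if "m > 0" for m
  proof -
    have "(\<Prod>j<K * m. 1 - x (j div m) / real (q * m)) =
        (\<Prod>i<K. \<Prod>j\<in>{i * m..<i * m + m}. 1 - x (j div m) / real (q * m))"
      by (rule prod.nat_group[symmetric])
    also have "\<dots> = (\<Prod>i<K. (1 + (- (x i / real q)) / real m) ^ m)"
    proof (rule prod.cong[OF refl])
      fix i
      have "(\<Prod>j\<in>{i * m..<i * m + m}. 1 - x (j div m) / real (q * m)) = (\<Prod>j\<in>{i * m..<i * m + m}. 1 + (- (x i / real q)) / real m)"
      proof (rule prod.cong[OF refl])
        fix j assume j: "j \<in> {i * m..<i * m + m}"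
        then have "j div m = i" by (intro div_nat_eqI) (auto simp: mult.commute)
        then show "1 - x (j div m) / real (q * m) = 1 + (- (x i / real q)) / real m" by simp
      qed
      then show "(\<Prod>j\<in>{i * m..<i * m + m}. 1 - x (j div m) / real (q * m)) = (1 + (- (x i / real q)) / real m) ^ m" by simp
    qed
    finally show ?thesis .
  qed
  have "(\<lambda>m. \<Prod>i<K. (1 + (- (x i / real q)) / real m) ^ m) \<longlonglongrightarrow> (\<Prod>i<K. exp (- (x i / real q)))"
    by (intro tendsto_prod tendsto_exp_limit_sequentially)
  then show ?thesis
    by (rule Lim_transform_eventually) (use eq in \<open>auto intro: eventually_mono[OF eventually_gt_at_top[of 0]]\<close>)
qed

context stationary_process
begin

lemma cond_D'E:
  assumes D': "cond_D' M X r u" and i: "i \<in> {1..r}" and \<delta>: "\<delta> > 0"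
  obtains Q where "\<And>q. q \<ge> Q \<Longrightarrow> \<forall>\<^sub>F n in sequentially. real n * (\<Sum>j = 2..n div q. exc2 (u i n) j) < \<delta>"
proof -
  have "(\<lambda>q. limsup (\<lambda>n. ereal (real n * (\<Sum>j = 2..n div q. exc2 (u i n) j)))) \<longlonglongrightarrow> 0"
    using D' i unfolding cond_D'_def exc2_def by blast
  then have "\<forall>\<^sub>F q in sequentially. limsup (\<lambda>n. ereal (real n * (\<Sum>j = 2..n div q. exc2 (u i n) j))) < ereal \<delta>"
    by (rule order_tendstoD) (use \<delta> in simp)
  then obtain Q where Q: "\<And>q. q \<ge> Q \<Longrightarrow> limsup (\<lambda>n. ereal (real n * (\<Sum>j = 2..n div q. exc2 (u i n) j))) < ereal \<delta>"
    by (auto simp: eventually_sequentially)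
  show thesis
  proof (rule that[of Q])
    fix q assume "q \<ge> Q"
    from Limsup_lessD[OF Q[OF this]]
    show "\<forall>\<^sub>F n in sequentially. real n * (\<Sum>j = 2..n div q. exc2 (u i n) j) < \<delta>" by simp
  qed
qed

text \<open>Each window is cut into \<open>m\<close> blocks, to which \<open>exceed_block\<close> is
  applied one after the other from the front. The order of limits matters: \<open>m\<close> is fixed
  first, large enough for \<open>\<D>'\<close> and for the product to be near its exponential limit;
  then \<open>n\<close> tends to infinity. The tolerance is split into two quarters for the product
  and one half for the accumulated error.\<close>

lemma block_limit:
  fixes w :: "nat \<Rightarrow> nat \<Rightarrow> real"
  assumes K: "0 < K" and q0: "0 < q0"
    and wm: "\<And>n i j. i \<le> j \<Longrightarrow> j < K \<Longrightarrow> w i n \<le> w j n"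
    and lim: "\<And>i. i < K \<Longrightarrow> (\<lambda>n. real n * exc (w i n)) \<longlonglongrightarrow> x i"
    and D: "cond_D M X K (\<lambda>k n. w (K - k) n)" and D': "cond_D' M X K (\<lambda>k n. w (K - k) n)"
  shows "(\<lambda>n. prob {y \<in> space M. below K (\<lambda>i. n * i div q0) (\<lambda>i. w i n) 0 y}) \<longlonglongrightarrow> (\<Prod>i<K. exp (- (x i / real q0)))"
    (is "?P \<longlonglongrightarrow> ?L")
proof (rule tendstoI)
  fix \<epsilon> :: real assume \<epsilon>: "\<epsilon> > 0"
  obtain \<gamma> s where D\<gamma>: "\<And>n t A v. (\<forall>j\<in>{1..K}. A j \<in> interval_ring) \<and> disjoint_family_on A {1..K} \<and>
         (\<forall>j\<in>{0..K}. v j \<in> (\<lambda>k. w (K - k) n) ` {1..K}) \<longrightarrow>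
         \<bar>measure M {x \<in> space M. X 1 x > ereal (v 0) \<and>
              (\<forall>j\<in>{1..K}. max_over X ((\<lambda>a. a + real t) ` A j) x \<le> ereal (v j))}
          - measure M {x \<in> space M. X 1 x > ereal (v 0)}
            * measure M {x \<in> space M. \<forall>j\<in>{1..K}. max_over X (A j) x \<le> ereal (v j)}\<bar> \<le> \<gamma> n t"
    and s: "(\<lambda>n. real (s n)) \<in> o(\<lambda>n. real n)" "(\<lambda>n. real n * \<gamma> n (s n)) \<longlonglongrightarrow> 0"
    using D unfolding cond_D_def by blast
  \<comment> \<open>\<open>\<gamma>\<close> bounds absolute values; any admissible instance, here
    with empty sets, shows its sign.\<close>
  have \<gamma>0: "0 \<le> \<gamma> n t" for n t
  proof -
    have "(\<forall>j\<in>{1..K}. {0..<0::real} \<in> interval_ring) \<and> disjoint_family_on (\<lambda>_. {0..<0::real}) {1..K} \<and>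
         (\<forall>j\<in>{0..K}. w 0 n \<in> (\<lambda>k. w (K - k) n) ` {1..K})"
      using K interval_in_ring[of 0 0] by (auto simp: disjoint_family_on_def intro!: image_eqI[of _ _ K])
    from D\<gamma>[rule_format, OF this] show ?thesis by (rule order.trans[OF abs_ge_zero])
  qed
  \<comment> \<open>The gap is at least \<open>s n\<close>, as \<open>\<D>\<close> demands, and at
    least 1 to absorb the rounding of block lengths: a block without its gap has at most
    \<open>n div q\<close> observations.\<close>
  define g where "g n = max 1 (s n)" for n
  have glim: "(\<lambda>n. real (g n) / real n) \<longlonglongrightarrow> 0"
  proof (rule real_tendsto_sandwich[where f = "\<lambda>_. 0" and h = "\<lambda>n. 1 / real n + real (s n) / real n"])
    show "\<forall>\<^sub>F n in sequentially. real (g n) / real n \<le> 1 / real n + real (s n) / real n"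
      by (auto simp: g_def add_divide_distrib[symmetric] intro!: divide_right_mono always_eventually)
    show "(\<lambda>n. 1 / real n + real (s n) / real n) \<longlonglongrightarrow> 0"
      using tendsto_add[OF lim_1_over_n smalloD_tendsto[OF s(1)]] by simp
  qed auto
  \<comment> \<open>\<open>w 0\<close> is the lowest level, so its joint exceedances dominate those
    of all windows. It is the level with index \<open>K\<close> in the reversed order.\<close>
  define S where "S q n = real n * (\<Sum>j = 2..n div q. exc2 (w 0 n) j)" for q n
  \<comment> \<open>\<open>K * m\<close> blocks of length at most \<open>2 * n / q\<close>
    contribute \<open>C * S q n\<close> with \<open>C = 2 * K / q0\<close>; this choice makes
    \<open>C * \<delta>\<close> equal to \<open>\<epsilon> / 4\<close>.\<close>
  define \<delta> where "\<delta> = \<epsilon> * real q0 / (8 * real K)"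
  have \<delta>: "\<delta> > 0" using \<epsilon> K q0 by (simp add: \<delta>_def)
  obtain Q where Q: "\<And>q. q \<ge> Q \<Longrightarrow> \<forall>\<^sub>F n in sequentially. S q n < \<delta>"
    using cond_D'E[OF D' _ \<delta>, of K] K unfolding S_def by auto
  define \<pi> where "\<pi> m = (\<Prod>j<K * m. 1 - x (j div m) / real (q0 * m))" for m
  have x0: "0 \<le> x i" if "i < K" for i
    by (rule LIMSEQ_le_const[OF lim[OF that]]) auto
  have "\<forall>\<^sub>F m in sequentially. dist (\<pi> m) ?L < \<epsilon> / 4"
    using tendstoD[OF prod_blocks_tendsto[OF q0, where x = x and K = K], of "\<epsilon>/4"] \<epsilon> by (simp add: \<pi>_def)
  moreover have "\<forall>\<^sub>F m in sequentially. \<forall>i\<in>{..<K}. x i / real (q0 * m) < 1"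
  proof (rule eventually_ball_finite)
    show "\<forall>i\<in>{..<K}. \<forall>\<^sub>F m in sequentially. x i / real (q0 * m) < 1"
    proof
      fix i
      have "(\<lambda>m. (x i / real q0) * (1 / real m)) \<longlonglongrightarrow> (x i / real q0) * 0"
        by (intro tendsto_mult tendsto_const lim_1_over_n)
      then have "(\<lambda>m. x i / real (q0 * m)) \<longlonglongrightarrow> 0" by simp
      then show "\<forall>\<^sub>F m in sequentially. x i / real (q0 * m) < 1" by (rule order_tendstoD) simp
    qed
  qed simp
  ultimately have "\<forall>\<^sub>F m in sequentially. dist (\<pi> m) ?L < \<epsilon> / 4 \<and> (\<forall>i\<in>{..<K}. x i / real (q0 * m) < 1) \<and> m > 0 \<and> m \<ge> Q"
    using eventually_gt_at_top[of "0::nat"] eventually_ge_at_top[of Q] by eventually_elim auto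
  then obtain m where m: "dist (\<pi> m) ?L < \<epsilon> / 4" "\<And>i. i < K \<Longrightarrow> x i / real (q0 * m) < 1" "m > 0" "m \<ge> Q"
    by (auto simp: eventually_sequentially)
  define q where "q = q0 * m"
  have q: "q > 0" "q \<ge> Q" using q0 m by (auto simp: q_def intro: order.trans)
  define b where "b n j = n * j div q" for n j
  define len where "len n j = b n (Suc j) - b n j" for n j
  have len: "n div q \<le> len n j" "len n j \<le> n div q + 1" "b n j + len n j = b n (Suc j)" for n j
    using grid_length[OF q(1), of n j] by (auto simp: len_def b_def)
  have lenlim: "(\<lambda>n. real (len n j) / real n) \<longlonglongrightarrow> 1 / real q" for j
  proof -
    have "(\<lambda>n. real (b n (Suc j)) / real n - real (b n j) / real n) \<longlonglongrightarrow> real (Suc j) / real q - real j / real q"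
      unfolding b_def by (intro tendsto_diff grid_tendsto q)
    moreover have "real (len n j) = real (b n (Suc j)) - real (b n j)" for n
      using len(3)[of n j] by linarith
    ultimately show ?thesis by (simp add: diff_divide_distrib[symmetric])
  qed
  define y where "y n j = 1 - real (len n j) * exc (w (j div m) n)" for n j
  have jK: "j div m < K" if "j < K * m" for j using that by (simp add: less_mult_imp_div_less)
  have ylim: "(\<lambda>n. y n j) \<longlonglongrightarrow> 1 - x (j div m) / real q" if "j < K * m" for j
  proof -
    have "(\<lambda>n. 1 - (real (len n j) / real n) * (real n * exc (w (j div m) n))) \<longlonglongrightarrow> 1 - (1 / real q) * x (j div m)"
      by (intro tendsto_intros lenlim lim jK that)
    moreover have "\<forall>\<^sub>F n in sequentially. 1 - (real (len n j) / real n) * (real n * exc (w (j div m) n)) = y n j"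
      using eventually_gt_at_top[of 0] by eventually_elim (simp add: y_def)
    ultimately have "(\<lambda>n. y n j) \<longlonglongrightarrow> 1 - (1 / real q) * x (j div m)"
      by (rule Lim_transform_eventually)
    then show ?thesis by simp
  qed
  have ev1: "\<forall>\<^sub>F n in sequentially. dist (\<Prod>j<K * m. y n j) (\<pi> m) < \<epsilon> / 4"
    unfolding \<pi>_def q_def[symmetric] by (rule tendstoD[OF tendsto_prod]) (use ylim \<epsilon> in auto)
  have ev2: "\<forall>\<^sub>F n in sequentially. \<forall>j\<in>{..<K * m}. \<bar>y n j\<bar> \<le> 1"
  proof (rule eventually_ball_finite)
    show "\<forall>j\<in>{..<K * m}. \<forall>\<^sub>F n in sequentially. \<bar>y n j\<bar> \<le> 1"
    proof
      fix j assume j: "j \<in> {..<K * m}"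
      have "\<forall>\<^sub>F n in sequentially. y n j > 0"
        by (rule order_tendstoD(1)[OF ylim]) (use j m(2)[OF jK] in \<open>auto simp: q_def\<close>)
      then show "\<forall>\<^sub>F n in sequentially. \<bar>y n j\<bar> \<le> 1"
        by eventually_elim (auto simp: y_def abs_le_iff intro: order.trans[OF _ mult_nonneg_nonneg])
    qed
  qed simp
  have ev3: "\<forall>\<^sub>F n in sequentially. g n \<le> n div q"
  proof -
    have "\<forall>\<^sub>F n in sequentially. real (g n) / real n < 1 / (2 * real q)"
      by (rule order_tendstoD(2)[OF glim]) (use q in simp)
    then show ?thesis using eventually_ge_at_top[of "2 * q"]
    proof eventually_elim
      case (elim n)
      have n: "real n > 0" "real n \<ge> 2 * real q" using elim q by linarith+
      have "real (g n) < real n / (2 * real q)" using elim(1) n q by (simp add: field_simps)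
      also have "\<dots> \<le> real n / real q - 1" using n q by (simp add: field_simps)
      also have "\<dots> \<le> real (n div q)" using nat_div_bounds(1)[of n q] by simp
      finally show ?case by simp
    qed
  qed
  define err where "err n = real (n div q + 1) * (\<gamma> n (s n) + S q n / real n) + 2 * real (g n) * exc (w 0 n)" for n
  have ev4: "\<forall>\<^sub>F n in sequentially. real (K * m) * err n < \<epsilon> / 2"
  proof -
    define C where "C = 2 * real K / real q0"
    have "(\<lambda>n. C * (real n * \<gamma> n (s n)) + real (K * m) * (2 * (real (g n) / real n) * (real n * exc (w 0 n)))) \<longlonglongrightarrow>
        C * 0 + real (K * m) * (2 * 0 * x 0)"
      by (intro tendsto_intros s glim lim K)
    then have "\<forall>\<^sub>F n in sequentially. C * (real n * \<gamma> n (s n)) + real (K * m) * (2 * (real (g n) / real n) * (real n * exc (w 0 n))) < \<epsilon> / 4"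
      by (rule order_tendstoD) (use \<epsilon> in simp)
    then show ?thesis using Q[OF q(2)] eventually_ge_at_top[of q]
    proof eventually_elim
      case (elim n)
      have n: "real n > 0" using elim(3) q by simp
      have "real (n div q + 1) \<le> real n / real q + 1" using nat_div_bounds(2)[of n q] by simp
      also have "\<dots> \<le> 2 * real n / real q" using elim(3) q by (simp add: field_simps)
      finally have l: "real (n div q + 1) \<le> 2 * real n / real q" .
      have S0: "0 \<le> S q n" by (simp add: S_def sum_nonneg)
      have "real (n div q + 1) * (\<gamma> n (s n) + S q n / real n) \<le> 2 * real n / real q * (\<gamma> n (s n) + S q n / real n)"
        using l \<gamma>0[of n "s n"] S0 by (intro mult_right_mono) auto
      then have "real (K * m) * (real (n div q + 1) * (\<gamma> n (s n) + S q n / real n)) \<le>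
          real (K * m) * (2 * real n / real q * (\<gamma> n (s n) + S q n / real n))" by (rule mult_left_mono) simp
      also have "\<dots> = C * (real n * \<gamma> n (s n)) + C * S q n"
        using n m(3) q0 by (simp add: C_def q_def field_simps)
      finally have 1: "real (K * m) * (real (n div q + 1) * (\<gamma> n (s n) + S q n / real n)) \<le> C * (real n * \<gamma> n (s n)) + C * S q n" .
      have "C * S q n \<le> C * \<delta>" using elim(2) by (intro mult_left_mono) (auto simp: C_def)
      also have "\<dots> = \<epsilon> / 4" using K q0 by (simp add: C_def \<delta>_def)
      finally have 2: "C * S q n \<le> \<epsilon> / 4" .
      have "real (K * m) * err n = real (K * m) * (real (n div q + 1) * (\<gamma> n (s n) + S q n / real n))
          + real (K * m) * (2 * (real (g n) / real n) * (real n * exc (w 0 n)))"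
        using n by (simp add: err_def algebra_simps)
      then show ?case using 1 2 elim(1) by linarith
    qed
  qed
  show "\<forall>\<^sub>F n in sequentially. dist (?P n) ?L < \<epsilon>"
    using ev1 ev2 ev3 ev4 eventually_gt_at_top[of 0]
  proof eventually_elim
    case (elim n)
    define c where "c i = n * i div q0" for i
    define v where "v i = w i n" for i
    have veq: "v = (\<lambda>i. w i n)" by (simp add: v_def fun_eq_iff)
    define Qn where "Qn j = prob {y \<in> space M. below K c v (b n j) y}" for j
    have cmono: "mono c" unfolding c_def by (intro monoI div_le_mono mult_le_mono2)
    \<comment> \<open>Since \<open>q\<close> is a multiple of \<open>q0\<close>, every window
      boundary is a block boundary, and no block meets two levels.\<close>
    have cb: "c i = b n (i * m)" for i
    proof -
      have "b n (i * m) = (n * i) * m div (q0 * m)" by (simp add: b_def q_def mult.assoc)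
      then show ?thesis using m(3) by (simp add: c_def)
    qed
    have bm: "b n i \<le> b n j" if "i \<le> j" for i j
      unfolding b_def using that by (intro div_le_mono mult_le_mono2)
    have "\<bar>Qn j - y n j * Qn (Suc j)\<bar> \<le> err n" if j: "j < K * m" for j
    proof -
      define i where "i = j div m"
      have i: "i < K" unfolding i_def by (rule jK[OF j])
      have ij: "i * m \<le> j" "Suc j \<le> Suc i * m"
        using m(3) dividend_less_div_times[of m j] by (auto simp: i_def)
      have cs: "c i \<le> b n j" "b n j \<le> b n (Suc j)" "b n (Suc j) \<le> c (Suc i)"
        unfolding cb using ij by (auto intro!: bm simp del: mult_Suc)
      have gl: "g n \<le> len n j" using elim(3) len(1)[of n j] by simp
      have v0: "v 0 \<le> v i" unfolding v_def by (rule wm) (use i in auto)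
      have "\<bar>prob {y \<in> space M. (\<forall>l\<in>{b n j..<b n (Suc j)}. X (Suc l) y \<le> ereal (v i)) \<and> below K c v (b n (Suc j)) y}
        - (1 - real (b n (Suc j) - b n j) * exc (v i)) * prob {y \<in> space M. below K c v (b n (Suc j)) y}\<bar>
        \<le> real (b n (Suc j) - b n j) * (\<gamma> n (s n) + S q n / real n) + 2 * real (g n) * exc (v i)"
      proof (rule exceed_block)
        show "b n j + g n \<le> b n (Suc j)" using gl len(3)[of n j] by simp
        show "0 \<le> \<gamma> n (s n)" by (rule \<gamma>0)
        show "Measurable.pred M (below K c v (b n (Suc j)))" by measurable
        fix l assume l: "b n j \<le> l" "l + g n < b n (Suc j)"
        show "\<bar>prob {x \<in> space M. ereal (v i) < X (Suc l) x \<and> below K c v (b n (Suc j)) x} -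
          exc (v i) * prob {x \<in> space M. below K c v (b n (Suc j)) x}\<bar> \<le> \<gamma> n (s n)"
          unfolding veq by (rule cond_D_below[OF D\<gamma> cmono i]) (use l in \<open>auto simp: g_def\<close>)
      next
        have "b n (Suc j) - b n j - g n \<le> n div q"
          using len(2)[of n j] by (auto simp: g_def len_def)
        then have "(\<Sum>j = 2..b n (Suc j) - b n j - g n. exc2 (v i) j) \<le> (\<Sum>j = 2..n div q. exc2 (v i) j)"
          by (intro sum_mono2) auto
        also have "\<dots> \<le> (\<Sum>j = 2..n div q. exc2 (v 0) j)"
          by (intro sum_mono exc2_antimono v0)
        also have "\<dots> = S q n / real n" using elim(5) by (simp add: S_def v_def)
        finally show "(\<Sum>j = 2..b n (Suc j) - b n j - g n. exc2 (v i) j) \<le> S q n / real n" .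
      qed
      also have "\<dots> \<le> err n"
        unfolding err_def
      proof (intro add_mono mult_mono)
        show "real (b n (Suc j) - b n j) \<le> real (n div q + 1)" using len(2)[of n j] unfolding len_def by linarith
        show "exc (v i) \<le> exc (w 0 n)" using exc_antimono[OF v0] by (simp add: v_def)
        have "0 \<le> S q n" by (simp add: S_def sum_nonneg)
        then show "0 \<le> \<gamma> n (s n) + S q n / real n" using \<gamma>0[of n "s n"] by auto
      qed auto
      finally show ?thesis
        unfolding Qn_def y_def below_split[OF cmono i cs] len_def v_def i_def .
    qed
    then have "\<bar>Qn 0 - (\<Prod>j<K * m. y n j) * Qn (K * m)\<bar> \<le> real (K * m) * err n"
      by (rule prod_step_error) (use elim(2) in auto)
    \<comment> \<open>After the last boundary no constraint is left.\<close>
    moreover have "Qn (K * m) = 1"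
    proof -
      have "below K c v (b n (K * m)) y" for y
        unfolding below_def cb[symmetric]
      proof (intro allI impI ballI)
        fix i l assume "i < K" "l \<in> {max (c K) (c i)..<c (Suc i)}"
        moreover from this have "c (Suc i) \<le> c K" by (intro monoD[OF cmono]) simp
        ultimately show "X (Suc l) y \<le> ereal (v i)" by simp
      qed
      then show ?thesis by (simp add: Qn_def prob_space)
    qed
    moreover have "Qn 0 = ?P n"
    proof -
      have "b n 0 = 0" "c = (\<lambda>i. n * i div q0)" by (simp_all add: b_def c_def fun_eq_iff)
      then show ?thesis unfolding Qn_def veq by (simp only:)
    qed
    ultimately have "\<bar>?P n - (\<Prod>j<K * m. y n j)\<bar> < \<epsilon> / 2" using elim(4) by simp
    then show ?case using elim(1) m(1) unfolding dist_real_def by linarith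
  qed
qed

end

section \<open>Finite-dimensional limits of rescaled maxima\<close>

lemma distribution_functionD:
  assumes "distribution_function F"
  shows "mono F" "0 \<le> F x" "F x \<le> 1" "(F \<longlongrightarrow> F x) (at_right x)" "(F \<longlongrightarrow> 0) at_bot" "(F \<longlongrightarrow> 1) at_top"
proof -
  obtain \<nu> where "real_distribution \<nu>" and F: "F = cdf \<nu>" using assms by (auto simp: distribution_function_def)
  then interpret real_distribution \<nu> by simp
  show "mono F" unfolding F by (intro monoI cdf_nondecreasing)
  show "0 \<le> F x" "F x \<le> 1" unfolding F by (rule cdf_nonneg, rule cdf_bounded_prob)
  show "(F \<longlongrightarrow> F x) (at_right x)" using cdf_is_right_cont[of x] unfolding F by (simp add: continuous_within)
  show "(F \<longlongrightarrow> 0) at_bot" "(F \<longlongrightarrow> 1) at_top" unfolding F by (rule cdf_lim_at_bot, rule cdf_lim_at_top_prob)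
qed

text \<open>With values 0 and 1 only, \<open>F\<close> would be the indicator of a half-line
  starting at the infimum of \<open>{u. F u = 1}\<close>, closed by right continuity. The lemma
  provides a level whose tail limit is positive and finite.\<close>

lemma nondegenerateE:
  assumes F: "distribution_function F" and nd: "nondegenerate F"
  obtains u where "0 < F u" "F u < 1"
proof (rule ccontr)
  assume "\<not> thesis"
  then have 01: "F u = 0 \<or> F u = 1" for u
    using that[of u] distribution_functionD(2,3)[OF F, of u] by force
  note D = distribution_functionD[OF F]
  define A where "A = {u. F u = 1}"
  have "eventually (\<lambda>u. F u > 0) at_top" by (rule order_tendstoD(1)[OF D(6)]) simp
  then obtain u1 where "F u1 > 0" by (auto simp: eventually_at_top_linorder)
  then have u1: "u1 \<in> A" using 01[of u1] by (auto simp: A_def)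
  have "eventually (\<lambda>u. F u < 1) at_bot" by (rule order_tendstoD(2)[OF D(5)]) simp
  then obtain u0 where u0: "\<And>u. u \<le> u0 \<Longrightarrow> F u < 1" by (auto simp: eventually_at_bot_linorder)
  have bdd: "bdd_below A" 
  proof (rule bdd_belowI[of _ u0])
    fix x assume "x \<in> A"
    then show "u0 \<le> x" using u0[of x] by (cases "x \<le> u0") (auto simp: A_def)
  qed
  define c where "c = Inf A"
  have lt: "F x = 0" if "x < c" for x
    using 01[of x] that cInf_lower[OF _ bdd, of x] by (auto simp: A_def c_def)
  have gt: "F x = 1" if x: "c < x" for x
  proof -
    obtain z where "z \<in> A" "z < x" using cInf_lessD[of A x] u1 x unfolding c_def by blast
    then have "1 \<le> F x" using monoD[OF D(1), of z x] by (auto simp: A_def)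
    then show ?thesis using D(3)[of x] by simp
  qed
  have "F c = 1"
  proof -
    have "eventually (\<lambda>x. F x = 1) (at_right c)"
      unfolding eventually_at_right_field using gt by (intro exI[of _ "c + 1"]) auto
    then have "(F \<longlongrightarrow> 1) (at_right c)" by (rule tendsto_eventually)
    then show ?thesis using tendsto_unique[OF _ D(4)[of c]] by (metis trivial_limit_at_right_real)
  qed
  then have "F = indicator {c..}"
    using lt gt by (intro ext) (auto simp: indicator_def le_less not_less)
  then show False using nd by (auto simp: nondegenerate_def)
qed

text \<open>If \<open>F\<close> is positive arbitrarily far left, any such point with small value
  will do; otherwise \<open>u\<close> is half a step below the left end of the support. The path is
  to exceed \<open>u\<close> with high probability, while \<open>u + \<eta>\<close>, above which
  intermediate levels lie, must have a finite tail limit.\<close>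

lemma distribution_function_left_end:
  assumes F: "distribution_function F" and "\<theta> > 0" "\<eta> > 0"
  obtains u where "F u \<le> \<theta>" "F (u + \<eta>) > 0"
proof -
  note D = distribution_functionD[OF F]
  have "eventually (\<lambda>u. F u < \<theta>) at_bot" by (rule order_tendstoD(2)[OF D(5)]) fact
  then obtain u0 where u0: "\<And>u. u \<le> u0 \<Longrightarrow> F u < \<theta>" by (auto simp: eventually_at_bot_linorder)
  define A where "A = {u. F u > 0}"
  have "eventually (\<lambda>u. F u > 0) at_top" by (rule order_tendstoD(1)[OF D(6)]) simp
  then obtain u1 where u1: "u1 \<in> A" by (auto simp: eventually_at_top_linorder A_def)
  show thesis
  proof (cases "\<exists>a\<in>A. a \<le> u0")
    case True
    then obtain a where a: "F a > 0" "a \<le> u0" by (auto simp: A_def)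
    then show thesis using u0[of a] monoD[OF D(1), of a "a + \<eta>"] \<open>\<eta> > 0\<close> by (intro that[of a]) auto
  next
    case False
    then have bdd: "bdd_below A" by (intro bdd_belowI[of _ u0]) auto
    define u where "u = Inf A - \<eta> / 2"
    have "u \<notin> A" using cInf_lower[OF _ bdd, of u] \<open>\<eta> > 0\<close> by (auto simp: u_def)
    then have "F u = 0" using D(2)[of u] by (simp add: A_def)
    obtain z where "z \<in> A" "z < u + \<eta>"
      using cInf_lessD[of A "u + \<eta>"] u1 \<open>\<eta> > 0\<close> by (auto simp: u_def)
    then have "F (u + \<eta>) > 0" using monoD[OF D(1), of z "u + \<eta>"] by (auto simp: A_def)
    then show thesis using that[of u] \<open>F u = 0\<close> \<open>\<theta> > 0\<close> by simp
  qed
qed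

context stationary_process
begin

section \<open>Two exceedances within one block\<close>

lemma double_exceed_block:
  "prob {x \<in> space M. \<exists>l l'. s \<le> l \<and> l < l' \<and> l' < e \<and> X (Suc l) x > ereal w \<and> X (Suc l') x > ereal w}
    \<le> real (e - s) * (\<Sum>j = 2..e - s. exc2 w j)" (is "prob ?A \<le> _")
proof -
  define p where "p = e - s"
  define E where "E i j = {x \<in> space M. X (Suc (s + i)) x > ereal w \<and> X (Suc (s + j)) x > ereal w}" for i j
  have E [measurable]: "E i j \<in> events" for i j unfolding E_def by measurable
  have "?A \<subseteq> (\<Union>j<p. \<Union>i<j. E i j)"
  proof
    fix x assume "x \<in> ?A"
    then obtain l l' where l: "x \<in> space M" "s \<le> l" "l < l'" "l' < e" "X (Suc l) x > ereal w" "X (Suc l') x > ereal w" by auto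
    then have "x \<in> E (l - s) (l' - s)" "l - s < l' - s" "l' - s < p" by (auto simp: E_def p_def)
    then show "x \<in> (\<Union>j<p. \<Union>i<j. E i j)" by blast
  qed
  then have "prob ?A \<le> prob (\<Union>j<p. \<Union>i<j. E i j)" by (intro finite_measure_mono) auto
  also have "\<dots> \<le> (\<Sum>j<p. prob (\<Union>i<j. E i j))" by (intro finite_measure_subadditive_finite) auto
  also have "\<dots> \<le> (\<Sum>j<p. \<Sum>j = 2..p. exc2 w j)"
  proof (rule sum_mono)
    fix j assume j: "j \<in> {..<p}"
    have "prob (\<Union>i<j. E i j) \<le> (\<Sum>i<j. prob (E i j))" by (intro finite_measure_subadditive_finite) auto
    also have "\<dots> = (\<Sum>i<j. exc2 w (Suc (j - i)))"
    proof (rule sum.cong[OF refl])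
      fix i assume "i \<in> {..<j}"
      then show "prob (E i j) = exc2 w (Suc (j - i))" using prob_exceed2[of "s + i" "s + j" w] by (simp add: E_def)
    qed
    also have "\<dots> \<le> (\<Sum>j = 2..p. exc2 w j)" using j by (intro sum_exc2_le) auto
    finally show "prob (\<Union>i<j. E i j) \<le> (\<Sum>j = 2..p. exc2 w j)" .
  qed
  finally show ?thesis by (simp add: p_def)
qed

definition double_exceed :: "nat \<Rightarrow> nat \<Rightarrow> nat \<Rightarrow> real \<Rightarrow> 'a set" where
  "double_exceed n q L w = {x \<in> space M. \<exists>j<L. \<exists>l l'. n * j div q \<le> l \<and> l < l' \<and> l' < n * Suc j div q \<and>
      X (Suc l) x > ereal w \<and> X (Suc l') x > ereal w}"

lemma double_exceed_events [measurable]: "double_exceed n q L w \<in> events"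
  unfolding double_exceed_def by measurable

lemma double_exceed_antimono: "v \<le> w \<Longrightarrow> double_exceed n q L w \<subseteq> double_exceed n q L v"
  unfolding double_exceed_def using order.strict_trans1[of "ereal v" "ereal w"] by fastforce

text \<open>The \<open>H * q\<close> blocks have about \<open>H * n\<close> observations in all, so
  the union bound is of order \<open>H * n * S\<close> whatever \<open>q\<close> is, where
  \<open>S\<close> is the sum in \<open>\<D>'\<close> for a fixed coarser block length. The horizon
  \<open>H\<close> thus does not depend on how fine the grid becomes.\<close>

lemma double_exceed_small:
  assumes D': "cond_D' M X 1 (\<lambda>k. w)" and \<epsilon>: "\<epsilon> > 0"
  obtains Q where "Q > 0" "\<And>q. q \<ge> Q \<Longrightarrow> \<forall>\<^sub>F n in sequentially. prob (double_exceed n q (H * q) (w n)) \<le> \<epsilon>"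
proof -
  define \<delta> where "\<delta> = \<epsilon> / (2 * real H + 1)"
  have \<delta>: "\<delta> > 0" "2 * real H * \<delta> \<le> \<epsilon>" using \<epsilon> by (auto simp: \<delta>_def field_simps)
  obtain Q0 where Q0: "\<And>q. q \<ge> Q0 \<Longrightarrow> \<forall>\<^sub>F n in sequentially. real n * (\<Sum>j = 2..n div q. exc2 (w n) j) < \<delta>"
    using cond_D'E[OF D' _ \<delta>(1), of 1] by auto
  define Q where "Q = Suc Q0"
  have Q: "\<forall>\<^sub>F n in sequentially. real n * (\<Sum>j = 2..n div Q. exc2 (w n) j) < \<delta>"
    by (rule Q0) (simp add: Q_def)
  show thesis
  \<comment> \<open>For \<open>q \<ge> 2 * Q\<close> and \<open>n \<ge> q\<close> even a block of
    \<open>n div q + 1\<close> observations is no longer than \<open>n div Q\<close>, so the sum for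
    \<open>Q\<close> covers every finer grid.\<close>
  proof (rule that[of "2 * Q"])
    fix q assume q: "q \<ge> 2 * Q"
    have q0: "q > 0" "Q > 0" using q by (auto simp: Q_def)
    show "\<forall>\<^sub>F n in sequentially. prob (double_exceed n q (H * q) (w n)) \<le> \<epsilon>"
      using Q eventually_ge_at_top[of q]
    proof eventually_elim
      case (elim n)
      define S where "S = (\<Sum>j = 2..n div Q. exc2 (w n) j)"
      have S0: "0 \<le> S" by (simp add: S_def sum_nonneg)
      have "n div q + 1 \<le> n div Q"
      proof -
        have "n div q \<le> n div (2 * Q)" using q q0 by (intro div_le_mono2) auto
        also have "\<dots> = (n div Q) div 2" by (simp add: div_mult2_eq mult.commute)
        finally have "n div q \<le> (n div Q) div 2" .
        moreover have "2 \<le> n div Q" using elim(2) q q0 by (simp add: less_eq_div_iff_mult_less_eq)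
        ultimately show ?thesis by linarith
      qed
      define D where "D j = {x \<in> space M. \<exists>l l'. n * j div q \<le> l \<and> l < l' \<and> l' < n * Suc j div q \<and>
          X (Suc l) x > ereal (w n) \<and> X (Suc l') x > ereal (w n)}" for j
      have [measurable]: "D j \<in> events" for j unfolding D_def by measurable
      have "double_exceed n q (H * q) (w n) = (\<Union>j<H * q. D j)" by (auto simp: double_exceed_def D_def)
      then have "prob (double_exceed n q (H * q) (w n)) \<le> (\<Sum>j<H * q. prob (D j))"
        by (simp only:) (intro finite_measure_subadditive_finite, auto)
      also have "\<dots> \<le> (\<Sum>j<H * q. (real n / real q + 1) * S)"
      proof (rule sum_mono)
        fix j
        define p where "p = n * Suc j div q - n * j div q"
        have p: "p \<le> n div q + 1" using grid_length(2)[OF q0(1), of n j] by (simp add: p_def)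
        have "prob (D j) \<le> real p * (\<Sum>j = 2..p. exc2 (w n) j)" unfolding D_def p_def by (rule double_exceed_block)
        also have "\<dots> \<le> (real n / real q + 1) * S"
        proof (rule mult_mono)
          show "real p \<le> real n / real q + 1" using p nat_div_bounds(2)[of n q] by linarith
          show "(\<Sum>j = 2..p. exc2 (w n) j) \<le> S" unfolding S_def
            using p \<open>n div q + 1 \<le> n div Q\<close> by (intro sum_mono2) auto
        qed (auto simp: sum_nonneg)
        finally show "prob (D j) \<le> (real n / real q + 1) * S" .
      qed
      also have "\<dots> = real H * ((real n + real q) * S)" using q0 by (simp add: field_simps)
      also have "\<dots> \<le> real H * ((2 * real n) * S)"
        using elim(2) S0 by (intro mult_left_mono mult_right_mono) auto
      also have "\<dots> = 2 * real H * (real n * S)" by simp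
      also have "\<dots> \<le> 2 * real H * \<delta>" using elim(1) by (intro mult_left_mono) (auto simp: S_def)
      also have "\<dots> \<le> \<epsilon>" by (rule \<delta>)
      finally show ?case .
    qed
  qed (simp add: Q_def)
qed

end

section \<open>Levels attached to the limit distribution\<close>

locale extremal_domain = stationary_process +
  fixes a b :: "nat \<Rightarrow> real" and G :: "real \<Rightarrow> real"
  assumes a: "\<And>n. a n > 0" and G: "distribution_function G" and nondeg: "nondegenerate G"
    and tail: "\<And>u. (\<lambda>n. ereal (real n * exc (u / a n + b n))) \<longlonglongrightarrow> neg_log (G u)"
    and mixing: "\<And>(r::nat) (x :: nat \<Rightarrow> real) (u :: nat \<Rightarrow> nat \<Rightarrow> real).
           r \<ge> 1 \<Longrightarrow> 0 < x 1 \<Longrightarrow> mono_on {1..r} x \<Longrightarrow> (\<And>n. antimono_on {1..r} (\<lambda>k. u k n)) \<Longrightarrow>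
           (\<And>k. k \<in> {1..r} \<Longrightarrow> (\<lambda>n. real n * exc (u k n)) \<longlonglongrightarrow> x k) \<Longrightarrow>
           cond_D M X r u \<and> cond_D' M X r u"
    and X_finite: "AE x in M. \<forall>i. \<bar>X i x\<bar> \<noteq> \<infinity>"
begin

lemmas GD = distribution_functionD[OF G]

definition lev :: "real \<Rightarrow> nat \<Rightarrow> real" where
  "lev u n = u / a n + b n"

lemma lev_mono: "u \<le> v \<Longrightarrow> lev u n \<le> lev v n"
  using a[of n] by (simp add: lev_def divide_right_mono)

lemma exc_lev_tendsto:
  assumes "G u > 0"
  shows "(\<lambda>n. real n * exc (lev u n)) \<longlonglongrightarrow> - ln (G u)"
  using tail[of u] assms by (simp add: neg_log_def lev_def)

lemma neg_ln_G: "G u > 0 \<Longrightarrow> 0 \<le> - ln (G u)"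
  using GD(3)[of u] by simp

text \<open>Levels with arbitrarily large limits come from the normalising constants of a smaller index.\<close>

lemma scaled_levels:
  assumes "C \<ge> 0"
  obtains w x where "x > C" "(\<lambda>n. real n * exc (w n)) \<longlonglongrightarrow> x"
    "cond_D M X 1 (\<lambda>k. w)" "cond_D' M X 1 (\<lambda>k. w)"
proof -
  obtain u1 where u1: "0 < G u1" "G u1 < 1" using nondegenerateE[OF G nondeg] .
  define \<tau> where "\<tau> = - ln (G u1)"
  have \<tau>: "\<tau> > 0" using u1 by (simp add: \<tau>_def)
  obtain c :: nat where "C / \<tau> < real c" using reals_Archimedean2 by blast
  then have c: "C < real c * \<tau>" using \<tau> by (simp add: field_simps)
  then have c0: "c > 0" using \<open>C \<ge> 0\<close> by (cases c) auto
  \<comment> \<open>Along \<open>n div c\<close> the level has tail limit \<open>\<tau>\<close>;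
    relative to \<open>n\<close> this is multiplied by \<open>c\<close>, which was chosen with
    \<open>c * \<tau> > C\<close>.\<close>
  define w where "w n = lev u1 (n div c)" for n
  have dv: "filterlim (\<lambda>n. n div c) sequentially sequentially"
    unfolding filterlim_at_top
  proof
    fix Z
    show "\<forall>\<^sub>F n in sequentially. Z \<le> n div c"
      using eventually_ge_at_top[of "Z * c"] by eventually_elim (use c0 in \<open>simp add: less_eq_div_iff_mult_less_eq\<close>)
  qed
  have 1: "(\<lambda>n. real (n div c) * exc (w n)) \<longlonglongrightarrow> \<tau>"
    unfolding w_def \<tau>_def by (rule filterlim_compose[OF exc_lev_tendsto[OF u1(1)] dv])
  have "(\<lambda>n. real (n * 1 div c) / real n) \<longlonglongrightarrow> real 1 / real c" by (rule grid_tendsto[OF c0])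
  then have 2: "(\<lambda>n. real (n div c) / real n) \<longlonglongrightarrow> 1 / real c" by simp
  have "(\<lambda>n. (real (n div c) * exc (w n)) / (real (n div c) / real n)) \<longlonglongrightarrow> \<tau> / (1 / real c)"
    by (rule tendsto_divide[OF 1 2]) (use c0 in simp)
  moreover have "\<forall>\<^sub>F n in sequentially. (real (n div c) * exc (w n)) / (real (n div c) / real n) = real n * exc (w n)"
    using eventually_ge_at_top[of c]
  proof eventually_elim
    case (elim n)
    then have "n div c > 0" using c0 by (simp add: div_greater_zero_iff)
    then have "real (n div c) \<noteq> 0" by simp
    then show ?case by (simp add: divide_simps)
  qed
  ultimately have "(\<lambda>n. real n * exc (w n)) \<longlonglongrightarrow> \<tau> / (1 / real c)" by (rule Lim_transform_eventually)
  then have lim: "(\<lambda>n. real n * exc (w n)) \<longlonglongrightarrow> real c * \<tau>" by (simp add: mult.commute)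
  have "cond_D M X 1 (\<lambda>k. w) \<and> cond_D' M X 1 (\<lambda>k. w)"
    by (rule mixing[of 1 "\<lambda>_. real c * \<tau>"]) (use c0 \<tau> lim in \<open>auto simp: monotone_on_def\<close>)
  then show thesis using that[of "real c * \<tau>" w] c lim by blast
qed

text \<open>Exceedance probabilities decrease in the level, so strictly ordered tail limits force
  the opposite order of the levels.\<close>

lemma eventually_level_less:
  assumes w: "(\<lambda>n. real n * exc (w n)) \<longlonglongrightarrow> x" and v: "(\<lambda>n. ereal (real n * exc (v n))) \<longlonglongrightarrow> z" and "ereal x < z"
  shows "\<forall>\<^sub>F n in sequentially. v n \<le> w n"
proof -
  obtain y where y: "ereal x < y" "y < z" using dense[OF assms(3)] by blast
  have "\<forall>\<^sub>F n in sequentially. ereal (real n * exc (w n)) < y"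
    by (rule order_tendstoD(2)[OF _ y(1)]) (use w in simp)
  moreover have "\<forall>\<^sub>F n in sequentially. y < ereal (real n * exc (v n))"
    by (rule order_tendstoD(1)[OF v y(2)])
  ultimately show ?thesis
  proof eventually_elim
    case (elim n)
    then have "ereal (real n * exc (w n)) < ereal (real n * exc (v n))" by (rule less_trans)
    then have "real n * exc (w n) < real n * exc (v n)" by simp
    then have "exc (w n) < exc (v n)" by (rule mult_left_less_imp_less) simp
    then show ?case using exc_antimono[of "w n" "v n"] by linarith
  qed
qed

text \<open>For \<open>G u = 1\<close> the tail limit of \<open>lev u\<close> is 0, outside the
  scope of \<open>mixing\<close>. A lower level with larger, positive limit is used instead; its
  double exceedances contain those of \<open>lev u\<close>.\<close>

lemma double_exceed_lev_small:
  assumes "G u > 0" and \<epsilon>: "\<epsilon> > 0"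
  obtains Q where "Q > 0" "\<And>q. q \<ge> Q \<Longrightarrow> \<forall>\<^sub>F n in sequentially. prob (double_exceed n q (H * q) (lev u n)) \<le> \<epsilon>"
proof -
  obtain w x where w: "x > - ln (G u)" "(\<lambda>n. real n * exc (w n)) \<longlonglongrightarrow> x" "cond_D' M X 1 (\<lambda>k. w)"
    using scaled_levels[OF neg_ln_G[OF assms(1)]] by metis
  have ev: "\<forall>\<^sub>F n in sequentially. w n \<le> lev u n"
    by (rule eventually_level_less[OF exc_lev_tendsto[OF assms(1)], of _ "ereal x"]) (use w in auto)
  obtain Q where Q: "Q > 0" "\<And>q. q \<ge> Q \<Longrightarrow> \<forall>\<^sub>F n in sequentially. prob (double_exceed n q (H * q) (w n)) \<le> \<epsilon>"
    using double_exceed_small[OF w(3) \<epsilon>, where H = H] by blast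
  show thesis
  proof (rule that[OF Q(1)])
    fix q assume "q \<ge> Q"
    from ev Q(2)[OF this] show "\<forall>\<^sub>F n in sequentially. prob (double_exceed n q (H * q) (lev u n)) \<le> \<epsilon>"
    proof eventually_elim
      case (elim n)
      have "prob (double_exceed n q (H * q) (lev u n)) \<le> prob (double_exceed n q (H * q) (w n))"
        by (intro finite_measure_mono double_exceed_antimono elim double_exceed_events)
      then show ?case using elim(2) by simp
    qed
  qed
qed

text \<open>The tail limit is infinite, so \<open>mixing\<close> does not apply to
  \<open>lev v\<close>. Levels of finite limit \<open>x\<close> are eventually higher, which bounds
  the probability by one that tends to \<open>exp (- x / q)\<close>, with \<open>x\<close> as large
  as desired.\<close>

lemma max_tendsto_zero:
  assumes Gv: "G v = 0" and q: "q > 0"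
  shows "(\<lambda>n. prob {x \<in> space M. below 1 (\<lambda>i. n * i div q) (\<lambda>i. lev v n) 0 x}) \<longlonglongrightarrow> 0" (is "?P \<longlonglongrightarrow> 0")
proof (rule tendstoI)
  fix \<epsilon> :: real assume \<epsilon>: "\<epsilon> > 0"
  \<comment> \<open>Chosen so that \<open>x > C\<close> gives
    \<open>exp (- x / q) < \<epsilon>\<close>.\<close>
  define C where "C = max 0 (- real q * ln \<epsilon>)"
  obtain w x where w: "x > C" "(\<lambda>n. real n * exc (w n)) \<longlonglongrightarrow> x" "cond_D M X 1 (\<lambda>k. w)" "cond_D' M X 1 (\<lambda>k. w)"
    using scaled_levels[of C] unfolding C_def by (metis max.cobounded1)
  have "exp (- (x / real q)) < \<epsilon>"
  proof -
    have "- real q * ln \<epsilon> < x" using w(1) by (simp add: C_def)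
    then have "- (x / real q) < ln \<epsilon>" using q by (simp add: field_simps)
    then show ?thesis using \<epsilon> exp_less_mono[of "- (x / real q)" "ln \<epsilon>"] by simp
  qed
  moreover have "(\<lambda>n. prob {y \<in> space M. below 1 (\<lambda>i. n * i div q) (\<lambda>i. w n) 0 y}) \<longlonglongrightarrow> (\<Prod>i<1::nat. exp (- (x / real q)))"
    by (rule block_limit[of 1 q "\<lambda>_. w" "\<lambda>_. x"]) (use q w in auto)
  ultimately have "\<forall>\<^sub>F n in sequentially. prob {y \<in> space M. below 1 (\<lambda>i. n * i div q) (\<lambda>i. w n) 0 y} < \<epsilon>"
    by (intro order_tendstoD(2)) auto
  moreover have "\<forall>\<^sub>F n in sequentially. lev v n \<le> w n"
    by (rule eventually_level_less[OF w(2), of _ \<infinity>]) (use tail[of v] Gv in \<open>auto simp: neg_log_def lev_def\<close>)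
  ultimately show "\<forall>\<^sub>F n in sequentially. dist (?P n) 0 < \<epsilon>"
  proof eventually_elim
    case (elim n)
    have "?P n \<le> prob {y \<in> space M. below 1 (\<lambda>i. n * i div q) (\<lambda>i. w n) 0 y}"
    proof (intro finite_measure_mono)
      have "ereal (lev v n) \<le> ereal (w n)" using elim(2) by simp
      then show "{x \<in> space M. below 1 (\<lambda>i. n * i div q) (\<lambda>i. lev v n) 0 x} \<subseteq> {y \<in> space M. below 1 (\<lambda>i. n * i div q) (\<lambda>i. w n) 0 y}"
        unfolding below_def by (auto intro: order.trans)
    qed measurable
    then show ?case using elim(1) by simp
  qed
qed

text \<open>If \<open>G (w 0) = 0\<close>, the first window alone forces the limit 0. Otherwise the
  windows from \<open>K'\<close> on, where \<open>G\<close> is 1, are dropped, and the remaining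
  levels have tail limits in \<open>(0, \<infinity>)\<close>, so that \<open>block_limit\<close>
  applies.\<close>

lemma below_tendsto:
  assumes q: "q > 0" and w: "\<And>i j. i \<le> j \<Longrightarrow> j < K \<Longrightarrow> w i \<le> w j"
  shows "(\<lambda>n. prob {x \<in> space M. below K (\<lambda>i. n * i div q) (\<lambda>i. lev (w i) n) 0 x})
    \<longlonglongrightarrow> (\<Prod>i<K. G (w i) powr (1 / real q))" (is "?P K \<longlonglongrightarrow> ?L")
proof (cases "K > 0 \<and> G (w 0) = 0")
  case True
  then have "?L = 0" by (intro prod_zero) (auto intro!: bexI[of _ 0])
  moreover have "?P K \<longlonglongrightarrow> 0"
  proof (rule real_tendsto_sandwich[where f = "\<lambda>_. 0"])
    show "\<forall>\<^sub>F n in sequentially. ?P K n \<le> prob {x \<in> space M. below 1 (\<lambda>i. n * i div q) (\<lambda>i. lev (w 0) n) 0 x}"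
    proof (intro always_eventually allI finite_measure_mono)
      fix n
      show "{x \<in> space M. below K (\<lambda>i. n * i div q) (\<lambda>i. lev (w i) n) 0 x} \<subseteq> {x \<in> space M. below 1 (\<lambda>i. n * i div q) (\<lambda>i. lev (w 0) n) 0 x}"
        using True unfolding below_def by auto
    qed measurable
    show "(\<lambda>n. prob {x \<in> space M. below 1 (\<lambda>i. n * i div q) (\<lambda>i. lev (w 0) n) 0 x}) \<longlonglongrightarrow> 0"
      by (rule max_tendsto_zero) (use True q in auto)
  qed auto
  ultimately show ?thesis by (simp only:)
next
  case False
  have Gpos: "G (w i) > 0" if "i < K" for i
    using False that monoD[OF GD(1) w[of 0 i]] GD(2)[of "w 0"] by (force simp: le_less)
  define K' where "K' = (LEAST k. k = K \<or> G (w k) = 1)"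
  have K': "K' = K \<or> G (w K') = 1" unfolding K'_def by (rule LeastI[of _ K]) simp
  have K'K: "K' \<le> K" unfolding K'_def by (rule Least_le) simp
  have lt: "G (w i) < 1" if "i < K'" for i
    using not_less_Least[of i "\<lambda>k. k = K \<or> G (w k) = 1"] that GD(3)[of "w i"] unfolding K'_def by force
  have ge: "G (w i) = 1" if "K' \<le> i" "i < K" for i
    using K' that monoD[OF GD(1) w[of K' i]] GD(3)[of "w i"] by auto
  have "?L = (\<Prod>i<K'. G (w i) powr (1 / real q))"
    by (rule prod.mono_neutral_right) (use K'K ge in auto)
  also have "\<dots> = (\<Prod>i<K'. exp (- (- ln (G (w i)) / real q)))"
  proof (rule prod.cong[OF refl])
    fix i assume "i \<in> {..<K'}"
    then have "G (w i) > 0" using Gpos K'K by simp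
    then show "G (w i) powr (1 / real q) = exp (- (- ln (G (w i)) / real q))" by (simp add: powr_def)
  qed
  finally have L: "?L = (\<Prod>i<K'. exp (- (- ln (G (w i)) / real q)))" .
  have lim': "?P K' \<longlonglongrightarrow> (\<Prod>i<K'. exp (- (- ln (G (w i)) / real q)))"
  proof (cases "K' = 0")
    case True
    then show ?thesis by (simp add: below_def prob_space)
  next
    case False
    have lm: "(\<lambda>n. real n * exc (lev (w i) n)) \<longlonglongrightarrow> - ln (G (w i))" if "i < K'" for i
      by (rule exc_lev_tendsto[OF Gpos]) (use that K'K in simp)
    have "cond_D M X K' (\<lambda>k n. lev (w (K' - k)) n) \<and> cond_D' M X K' (\<lambda>k n. lev (w (K' - k)) n)"
    \<comment> \<open>After the reversal the levels decrease and the limits increase; the first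
      limit is positive because \<open>G (w (K' - 1)) < 1\<close>.\<close>
    proof (rule mixing[of K' "\<lambda>k. - ln (G (w (K' - k)))"])
      show "1 \<le> K'" using False by simp
      show "0 < - ln (G (w (K' - 1)))"
        using Gpos[of "K' - 1"] lt[of "K' - 1"] False K'K by simp
      show "mono_on {1..K'} (\<lambda>k. - ln (G (w (K' - k))))"
      proof (rule mono_onI)
        fix r s assume rs: "r \<in> {1..K'}" "s \<in> {1..K'}" "r \<le> s"
        then have "G (w (K' - s)) \<le> G (w (K' - r))"
          using False K'K by (intro monoD[OF GD(1)] w) auto
        moreover have "G (w (K' - s)) > 0" using rs False K'K by (intro Gpos) auto
        ultimately show "- ln (G (w (K' - r))) \<le> - ln (G (w (K' - s)))" by simp
      qed
      show "antimono_on {1..K'} (\<lambda>k. lev (w (K' - k)) n)" for n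
        using K'K by (intro monotone_onI lev_mono w) auto
      show "(\<lambda>n. real n * exc (lev (w (K' - k)) n)) \<longlonglongrightarrow> - ln (G (w (K' - k)))" if "k \<in> {1..K'}" for k
        by (rule lm) (use that in auto)
    qed
    then show ?thesis
      using False q K'K lm by (intro block_limit[where w = "\<lambda>i n. lev (w i) n"] lev_mono w) auto
  qed
  define c where "c n i = n * i div q" for n i :: nat
  \<comment> \<open>Dropping windows costs at most the probability of an exceedance of
    \<open>lev (w K') n\<close> among the first \<open>n * K\<close> observations, and this tends to
    0 as \<open>G (w K') = 1\<close>.\<close>
  have "(\<lambda>n. ?P K' n - ?P K n) \<longlonglongrightarrow> 0"
  proof (cases "K' = K")
    case True
    then show ?thesis by simp
  next
    case False
    then have K'l: "K' < K" "G (w K') = 1" using K' K'K by auto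
    show ?thesis
    proof (rule real_tendsto_sandwich[where f = "\<lambda>_. 0" and h = "\<lambda>n. real K * (real n * exc (lev (w K') n))"])
      have bn: "below K' (c n) v 0 x" if "below K (c n) v 0 x" for n v x
        using that K'K by (auto simp: below_def)
      show "\<forall>\<^sub>F n in sequentially. 0 \<le> ?P K' n - ?P K n"
        unfolding diff_ge_0_iff_ge
        by (intro always_eventually allI finite_measure_mono) (use bn[unfolded c_def] in auto)
      show "\<forall>\<^sub>F n in sequentially. ?P K' n - ?P K n \<le> real K * (real n * exc (lev (w K') n))"
      proof (intro always_eventually allI)
        fix n
        let ?E = "\<lambda>l. {x \<in> space M. X (Suc l) x > ereal (lev (w K') n)}"
        have cn: "c n i \<le> n * K" if "i \<le> K" for i
          unfolding c_def using that div_le_dividend[of "n * i" q] mult_le_mono2[of i K n] by linarith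
        have "?P K' n \<le> prob ({x \<in> space M. below K (\<lambda>i. n * i div q) (\<lambda>i. lev (w i) n) 0 x} \<union> (\<Union>l<n * K. ?E l))"
        proof (intro finite_measure_mono)
          show "{x \<in> space M. below K' (\<lambda>i. n * i div q) (\<lambda>i. lev (w i) n) 0 x} \<subseteq>
             {x \<in> space M. below K (\<lambda>i. n * i div q) (\<lambda>i. lev (w i) n) 0 x} \<union> (\<Union>l<n * K. ?E l)"
          proof
            fix x assume x: "x \<in> {x \<in> space M. below K' (\<lambda>i. n * i div q) (\<lambda>i. lev (w i) n) 0 x}"
            show "x \<in> {x \<in> space M. below K (\<lambda>i. n * i div q) (\<lambda>i. lev (w i) n) 0 x} \<union> (\<Union>l<n * K. ?E l)"
            proof (cases "x \<in> (\<Union>l<n * K. ?E l)")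
              case nx: False
              have "X (Suc l) x \<le> ereal (lev (w i) n)" if i: "i < K" and l: "l \<in> {max 0 (c n i)..<c n (Suc i)}" for i l
              proof (cases "i < K'")
                case True
                then show ?thesis using x l by (auto simp: below_def c_def)
              next
                case False
                have "l < n * K" using l cn[of "Suc i"] i by auto
                then have "X (Suc l) x \<le> ereal (lev (w K') n)" using nx x by (auto simp: not_less)
                also have "\<dots> \<le> ereal (lev (w i) n)" using lev_mono[OF w[of K' i]] False i by simp
                finally show ?thesis .
              qed
              then show ?thesis using x by (auto simp: below_def c_def)
            qed simp
          qed
        qed measurable
        also have "\<dots> \<le> ?P K n + prob (\<Union>l<n * K. ?E l)"
          by (intro measure_Un_le) measurable
        also have "prob (\<Union>l<n * K. ?E l) \<le> (\<Sum>l<n * K. prob (?E l))"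
          by (intro finite_measure_subadditive_finite) auto
        also have "\<dots> = real K * (real n * exc (lev (w K') n))" by (simp add: prob_exceed)
        finally show "?P K' n - ?P K n \<le> real K * (real n * exc (lev (w K') n))" by simp
      qed
      have "(\<lambda>n. real K * (real n * exc (lev (w K') n))) \<longlonglongrightarrow> real K * (- ln (G (w K')))"
        by (intro tendsto_intros exc_lev_tendsto) (simp add: K'l)
      then show "(\<lambda>n. real K * (real n * exc (lev (w K') n))) \<longlonglongrightarrow> 0" by (simp add: K'l)
    qed simp
  qed
  from tendsto_diff[OF lim' this] show ?thesis unfolding L by simp
qed

end

section \<open>From joint distribution functions to expectations\<close>

text \<open>Interpolates, one coordinate at a time, between joint distribution functions at
  \<open>k = 0\<close> and point probabilities at \<open>k = K\<close>.\<close>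

definition eq_le_event :: "nat \<Rightarrow> 'c measure \<Rightarrow> (nat \<Rightarrow> 'c \<Rightarrow> nat) \<Rightarrow> nat \<Rightarrow> (nat \<Rightarrow> nat) \<Rightarrow> 'c set" where
  "eq_le_event K P J k v = {x \<in> space P. (\<forall>i<k. J i x = v i) \<and> (\<forall>i\<in>{k..<K}. J i x \<le> v i)}"

lemma eq_le_event_sets:
  assumes [measurable]: "\<And>i. J i \<in> measurable P (count_space UNIV)"
  shows "eq_le_event K P J k v \<in> sets P"
  unfolding eq_le_event_def by measurable

text \<open>Equality in a coordinate is the difference of two inequalities. For
  \<open>v k = 0\<close> the second event is empty, but truncated subtraction would turn it into the
  first; hence the case distinction.\<close>

lemma measure_eq_le_event_Suc:
  assumes k: "k < K" and P: "prob_space P" and J: "\<And>i. J i \<in> measurable P (count_space UNIV)"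
  shows "measure P (eq_le_event K P J (Suc k) v) = measure P (eq_le_event K P J k v)
    - (if v k = 0 then 0 else measure P (eq_le_event K P J k (v(k := v k - 1))))"
proof -
  interpret P: prob_space P by fact
  have split: "{k..<K} = insert k {Suc k..<K}" using k by auto
  show ?thesis
  proof (cases "v k = 0")
    case True
    then have "eq_le_event K P J (Suc k) v = eq_le_event K P J k v" by (auto simp: eq_le_event_def split less_Suc_eq)
    then show ?thesis using True by simp
  next
    case False
    have "eq_le_event K P J (Suc k) v = eq_le_event K P J k v - eq_le_event K P J k (v(k := v k - 1))"
    proof -
      have "(J k x = v k) \<longleftrightarrow> J k x \<le> v k \<and> \<not> J k x \<le> v k - 1" for x using False by auto
      moreover have "(\<forall>i\<in>{Suc k..<K}. J i x \<le> (v(k := v k - 1)) i) \<longleftrightarrow> (\<forall>i\<in>{Suc k..<K}. J i x \<le> v i)" for x by auto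
      moreover have "(\<forall>i<k. J i x = (v(k := v k - 1)) i) \<longleftrightarrow> (\<forall>i<k. J i x = v i)" for x by auto
      ultimately show ?thesis by (auto simp: eq_le_event_def split less_Suc_eq)
    qed
    moreover have "eq_le_event K P J k (v(k := v k - 1)) \<subseteq> eq_le_event K P J k v" by (auto simp: eq_le_event_def split)
    ultimately show ?thesis using False by (simp add: P.finite_measure_Diff eq_le_event_sets J)
  qed
qed

text \<open>Setting the coordinates from \<open>K\<close> on to 0 leaves finitely many possible
  vectors, so the integral is a finite sum over them.\<close>

lemma integral_finite_levels:
  fixes F :: "(nat \<Rightarrow> nat) \<Rightarrow> real"
  assumes P: "prob_space P" and J: "\<And>i. J i \<in> measurable P (count_space UNIV)" and bd: "\<And>i x. J i x \<le> m"
  shows "(\<integral>x. F (\<lambda>i. if i < K then J i x else 0) \<partial>P) =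
    (\<Sum>v \<in> {v. \<forall>i. (i \<in> {..<K} \<longrightarrow> v i \<in> {..m}) \<and> (i \<notin> {..<K} \<longrightarrow> v i = 0)}. F v * measure P (eq_le_event K P J K v))"
    (is "_ = (\<Sum>v\<in>?V. _ v)")
proof -
  interpret P: prob_space P by fact
  have fV: "finite ?V" by (rule finite_set_of_finite_funs) auto
  have "F (\<lambda>i. if i < K then J i x else 0) = (\<Sum>v\<in>?V. F v * indicator (eq_le_event K P J K v) x)" if "x \<in> space P" for x
  proof -
    let ?v = "\<lambda>i. if i < K then J i x else 0"
    have v: "?v \<in> ?V" using bd by auto
    have "indicator (eq_le_event K P J K v) x = (if v = ?v then 1 else 0 :: real)" if "v \<in> ?V" for v
      using that \<open>x \<in> space P\<close> by (auto simp: eq_le_event_def indicator_def fun_eq_iff)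
    then have "(\<Sum>v\<in>?V. F v * indicator (eq_le_event K P J K v) x) = (\<Sum>v\<in>?V. if v = ?v then F v else 0)"
      by (intro sum.cong) auto
    also have "\<dots> = F ?v" using fV v by (subst sum.delta) auto
    finally show ?thesis by simp
  qed
  then have "(\<integral>x. F (\<lambda>i. if i < K then J i x else 0) \<partial>P) = (\<integral>x. (\<Sum>v\<in>?V. F v * indicator (eq_le_event K P J K v) x) \<partial>P)"
    by (intro Bochner_Integration.integral_cong) auto
  also have "\<dots> = (\<Sum>v\<in>?V. F v * measure P (eq_le_event K P J K v))"
    by (subst Bochner_Integration.integral_sum) (auto simp: P.emeasure_eq_measure eq_le_event_sets J)
  finally show ?thesis .
qed

lemma finite_levels_expectation:
  fixes Jn :: "nat \<Rightarrow> nat \<Rightarrow> 'a \<Rightarrow> nat" and J :: "nat \<Rightarrow> 'b \<Rightarrow> nat" and F :: "(nat \<Rightarrow> nat) \<Rightarrow> real"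
  assumes M: "prob_space M" and N: "prob_space N"
    and Jn: "\<And>n i. Jn n i \<in> measurable M (count_space UNIV)"
    and J: "\<And>i. J i \<in> measurable N (count_space UNIV)"
    and bd: "\<And>n i x. Jn n i x \<le> m" "\<And>i x. J i x \<le> m"
    and conv: "\<And>v. (\<lambda>n. measure M {x \<in> space M. \<forall>i<K. Jn n i x \<le> v i}) \<longlonglongrightarrow> measure N {x \<in> space N. \<forall>i<K. J i x \<le> v i}"
  shows "(\<lambda>n. \<integral>x. F (\<lambda>i. if i < K then Jn n i x else 0) \<partial>M) \<longlonglongrightarrow> (\<integral>x. F (\<lambda>i. if i < K then J i x else 0) \<partial>N)"
proof -
  have conv': "(\<lambda>n. measure M (eq_le_event K M (Jn n) k v)) \<longlonglongrightarrow> measure N (eq_le_event K N J k v)" if "k \<le> K" for k v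
    using that
  proof (induction k arbitrary: v)
    case 0
    have iv: "(\<forall>i\<in>{0..<K}. Q i) \<longleftrightarrow> (\<forall>i<K. Q i)" for Q by auto
    show ?case using conv[of v] by (simp add: eq_le_event_def iv)
  next
    case (Suc k)
    then have k: "k < K" "k \<le> K" by auto
    note * = measure_eq_le_event_Suc[OF k(1) M Jn] measure_eq_le_event_Suc[OF k(1) N J]
    show ?case unfolding * by (cases "v k = 0") (auto intro!: tendsto_intros Suc.IH k)
  qed
  let ?V = "{v. \<forall>i. (i \<in> {..<K} \<longrightarrow> v i \<in> {..m}) \<and> (i \<notin> {..<K} \<longrightarrow> v i = 0)}"
  have "(\<integral>x. F (\<lambda>i. if i < K then Jn n i x else 0) \<partial>M) = (\<Sum>v\<in>?V. F v * measure M (eq_le_event K M (Jn n) K v))" for n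
    by (rule integral_finite_levels) (rule M Jn bd(1))+
  moreover have "(\<integral>x. F (\<lambda>i. if i < K then J i x else 0) \<partial>N) = (\<Sum>v\<in>?V. F v * measure N (eq_le_event K N J K v))"
    by (rule integral_finite_levels) (rule N J bd(2))+
  moreover have "(\<lambda>n. \<Sum>v\<in>?V. F v * measure M (eq_le_event K M (Jn n) K v)) \<longlonglongrightarrow> (\<Sum>v\<in>?V. F v * measure N (eq_le_event K N J K v))"
    by (intro tendsto_intros conv') simp
  ultimately show ?thesis by simp
qed

text \<open>Lists over a countable type form a countable type, so a finite tuple of discrete
  variables is again a single discrete variable.\<close>

lemma measurable_list_count_space:
  fixes f :: "nat \<Rightarrow> 'a \<Rightarrow> 'c::countable"
  assumes [measurable]: "\<And>j. f j \<in> measurable M (count_space UNIV)"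
  shows "(\<lambda>x. map (\<lambda>j. f j x) [0..<N]) \<in> measurable M (count_space UNIV)"
  by (induction N) (simp_all, measurable)

text \<open>The codes \<open>g k \<omega>\<close> live in a discrete space, on which every map
  \<open>F k\<close> into the Skorokhod space is measurable and has countable range.\<close>

lemma measurable_J1_limit_countable:
  fixes g :: "nat \<Rightarrow> 'a \<Rightarrow> 'c::countable"
  assumes sk: "\<And>k c. F k c \<in> skorokhod_space" "\<And>\<omega>. \<omega> \<in> space M \<Longrightarrow> Z \<omega> \<in> skorokhod_space"
    and g [measurable]: "\<And>k. g k \<in> measurable M (count_space UNIV)"
    and lim: "\<And>\<omega>. \<omega> \<in> space M \<Longrightarrow> (\<lambda>k. J1_dist (F k (g k \<omega>)) (Z \<omega>)) \<longlonglongrightarrow> 0"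
  shows "Z \<in> measurable M J1_borel"
proof (rule measurable_J1_limit[where Zs = "\<lambda>k \<omega>. F k (g k \<omega>)"])
  show "countable ((\<lambda>\<omega>. F k (g k \<omega>)) ` space M)" for k
    by (rule countable_subset[of _ "range (F k)"]) auto
  show "{\<omega> \<in> space M. F k (g k \<omega>) = c} \<in> sets M" for k c by measurable
qed (use sk lim in auto)

lemma J1_dist_uniform_le:
  assumes "c \<ge> 0" and "\<And>t. 0 < t \<Longrightarrow> t \<le> T \<Longrightarrow> \<bar>\<phi>\<^sub>1 t - \<phi>\<^sub>2 t\<bar> \<le> c"
  shows "J1_dist \<phi>\<^sub>1 \<phi>\<^sub>2 \<le> c + exp (- T)"
proof -
  have "J1_dist \<phi>\<^sub>1 \<phi>\<^sub>2 \<le> c + 0 + 2 * 0 + exp (- T)"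
  proof (rule J1_dist_le[where B = "{}"])
    fix s t :: real assume "0 < s" "s < 1" "1 < t" "t < T"
    then show "J1_dist_on s t \<phi>\<^sub>1 \<phi>\<^sub>2 \<le> c"
      by (intro J1_dist_on_le[OF id_time_change]) (use assms in auto)
  qed (use assms in auto)
  then show ?thesis by simp
qed

context extremal_domain
begin

section \<open>The rescaled maxima and their paths\<close>

definition scaled_max :: "nat \<Rightarrow> nat \<Rightarrow> 'a \<Rightarrow> real" where
  "scaled_max n k x = real_of_ereal (ereal (a n) * (partial_max X k x - ereal (b n)))"

abbreviation Y :: "nat \<Rightarrow> real \<Rightarrow> 'a \<Rightarrow> real" where
  "Y \<equiv> rescaled_max X a b"

text \<open>Elsewhere the value 0 put in place of infinite maxima may destroy monotonicity and the
  description by exceedances.\<close>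

definition fin :: "'a set" where
  "fin = {x \<in> space M. \<forall>i. \<bar>X i x\<bar> \<noteq> \<infinity>}"

lemma AE_fin: "AE x in M. x \<in> fin"
  using X_finite by (auto simp: fin_def)

lemma partial_max_meas [measurable]: "partial_max X k \<in> borel_measurable M"
  unfolding partial_max_def[abs_def] by measurable

lemma scaled_max_meas [measurable]: "scaled_max n k \<in> borel_measurable M"
  unfolding scaled_max_def[abs_def] by measurable

lemma Y_meas [measurable]: "Y n t \<in> borel_measurable M"
  unfolding rescaled_max_def[abs_def] by measurable

lemma partial_max_le_iff: "partial_max X k x \<le> v \<longleftrightarrow> (\<forall>l<k. X (Suc l) x \<le> v)"
proof
  assume "partial_max X k x \<le> v"
  then have "\<forall>i\<in>{1..k}. X i x \<le> v" by (simp add: partial_max_def SUP_le_iff)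
  then show "\<forall>l<k. X (Suc l) x \<le> v" by auto
next
  assume r: "\<forall>l<k. X (Suc l) x \<le> v"
  have "X i x \<le> v" if "i \<in> {1..k}" for i using r[rule_format, of "i - 1"] that by auto
  then show "partial_max X k x \<le> v" by (simp add: partial_max_def SUP_le_iff)
qed

lemma partial_max_finite:
  assumes "x \<in> fin" "k \<ge> 1"
  obtains r where "partial_max X k x = ereal r"
proof -
  have "partial_max X k x = Max ((\<lambda>i. X i x) ` {1..k})"
    unfolding partial_max_def using assms(2) by (intro cSup_eq_Max) auto
  also have "\<dots> \<in> (\<lambda>i. X i x) ` {1..k}" using assms(2) by (intro Max_in) auto
  finally obtain i where "partial_max X k x = X i x" by auto
  then have "\<bar>partial_max X k x\<bar> \<noteq> \<infinity>" using assms(1) by (simp add: fin_def)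
  then show thesis using that by (cases "partial_max X k x") auto
qed

lemma scaled_max_le_iff:
  assumes "x \<in> fin" "k \<ge> 1"
  shows "scaled_max n k x \<le> u \<longleftrightarrow> (\<forall>l<k. X (Suc l) x \<le> ereal (lev u n))"
proof -
  obtain r where r: "partial_max X k x = ereal r" using partial_max_finite[OF assms] .
  have "scaled_max n k x \<le> u \<longleftrightarrow> a n * (r - b n) \<le> u" by (simp add: scaled_max_def r)
  also have "\<dots> \<longleftrightarrow> r \<le> lev u n" using a[of n] by (simp add: lev_def field_simps)
  also have "\<dots> \<longleftrightarrow> partial_max X k x \<le> ereal (lev u n)" by (simp add: r)
  finally show ?thesis by (simp add: partial_max_le_iff)
qed

lemma scaled_max_mono:
  assumes "x \<in> fin" "1 \<le> k" "k \<le> k'"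
  shows "scaled_max n k x \<le> scaled_max n k' x"
  using scaled_max_le_iff[of x k' n "scaled_max n k' x"] assms by (auto simp: scaled_max_le_iff)

lemma Y_eq:
  assumes "n > 0" "t > 0"
  shows "Y n t x = scaled_max n (max 1 (nat \<lfloor>real n * t\<rfloor>)) x"
proof (cases "t \<ge> 1 / real n")
  case True
  then have "1 \<le> real n * t" using assms by (simp add: field_simps)
  then have "1 \<le> nat \<lfloor>real n * t\<rfloor>" by (simp add: le_nat_iff le_floor_iff)
  then show ?thesis using True by (simp add: rescaled_max_def scaled_max_def max_absorb2)
next
  case False
  then have "real n * t < 1" using assms by (simp add: field_simps)
  then have "nat \<lfloor>real n * t\<rfloor> = 0" using assms by (simp add: floor_less_iff)
  moreover have "partial_max X 1 x = X 1 x" by (simp add: partial_max_def)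
  ultimately show ?thesis using False by (simp add: rescaled_max_def scaled_max_def)
qed

lemma sample_path_Y:
  "sample_path (Y n) x = step_path (real n) (\<lambda>j. scaled_max n (if n = 0 then j else max 1 j) x)"
\<comment> \<open>For \<open>n = 0\<close> the quotient \<open>1 / real n\<close> is 0, so the first
  branch of \<open>rescaled_max\<close> applies at all times, with an empty maximum.\<close>
proof (cases "n = 0")
  case True
  then show ?thesis
    by (auto simp: sample_path_def step_path_def rescaled_max_def scaled_max_def fun_eq_iff restrict_def)
next
  case False
  then show ?thesis
    by (auto simp: sample_path_def step_path_def fun_eq_iff restrict_def Y_eq)
qed

lemma sample_path_Y_in_skorokhod: "sample_path (Y n) x \<in> skorokhod_space"
  unfolding sample_path_Y by (intro step_path_in_skorokhod) simp

lemma Y_mono: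
  assumes "x \<in> fin" "n > 0" "0 < s" "s \<le> t"
  shows "Y n s x \<le> Y n t x"
proof -
  have "nat \<lfloor>real n * s\<rfloor> \<le> nat \<lfloor>real n * t\<rfloor>" using assms by (intro nat_mono floor_mono mult_left_mono) auto
  then show ?thesis using assms by (simp add: Y_eq) (intro scaled_max_mono, auto)
qed

lemma Y_grid:
  assumes "q > 0" "n \<ge> q" "i \<ge> 1"
  shows "Y n (real i / real q) x = scaled_max n (n * i div q) x" and "n * i div q \<ge> 1"
proof -
  have "q \<le> n * i" using assms by (metis le_trans mult_le_mono nat_mult_1_right)
  then show *: "n * i div q \<ge> 1" using assms by (simp add: less_eq_div_iff_mult_less_eq)
  have "real n * (real i / real q) = real (n * i) / real q" by simp
  then have "nat \<lfloor>real n * (real i / real q)\<rfloor> = n * i div q"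
    using floor_divide_of_nat_eq[of "n * i" q, where 'a = real] by simp
  then show "Y n (real i / real q) x = scaled_max n (n * i div q) x"
    using Y_eq[of n "real i / real q" x] assms * by (simp add: max_absorb2)
qed

text \<open>Up to time \<open>k\<close> a path has finitely many values. Rounded to multiples of
  \<open>1 / Suc k\<close> they are coded by a list of integers, and the coded paths converge
  uniformly on bounded time intervals.\<close>

lemma Y_measurable_J1: "sample_path (Y n) \<in> measurable M J1_borel"
proof (rule measurable_J1_limit_countable)
  define c where "c j x = scaled_max n (if n = 0 then j else max 1 j) x" for j x
  have [measurable]: "c j \<in> borel_measurable M" for j unfolding c_def[abs_def] by (cases "n = 0") simp_all
  define g where "g k x = map (\<lambda>j. \<lfloor>real (Suc k) * c j x\<rfloor>) [0..<Suc (k * n)]" for k x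
  define F where "F k zs = step_path (real n) (\<lambda>j. real_of_int (zs ! min j (k * n)) / real (Suc k))" for k zs
  show "F k zs \<in> skorokhod_space" for k zs unfolding F_def by (intro step_path_in_skorokhod) simp
  show "sample_path (Y n) \<omega> \<in> skorokhod_space" for \<omega> by (rule sample_path_Y_in_skorokhod)
  show "g k \<in> measurable M (count_space UNIV)" for k
    unfolding g_def[abs_def] by (intro measurable_list_count_space) measurable
  fix \<omega> assume "\<omega> \<in> space M"
  have le: "J1_dist (F k (g k \<omega>)) (sample_path (Y n) \<omega>) \<le> 1 / real (Suc k) + exp (- real k)" for k
  proof (rule J1_dist_uniform_le)
    fix t :: real assume t: "0 < t" "t \<le> real k"
    have "real n * t \<le> real (k * n)" using t by (simp add: mult.commute mult_right_mono)
    then have j: "nat \<lfloor>real n * t\<rfloor> \<le> k * n" by (simp add: floor_le_iff nat_le_iff)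
    define j where "j = nat \<lfloor>real n * t\<rfloor>"
    have "F k (g k \<omega>) t = real_of_int \<lfloor>real (Suc k) * c j \<omega>\<rfloor> / real (Suc k)"
      using t j by (simp add: F_def g_def j_def[symmetric] min_absorb1 del: upt_Suc)
    moreover have "sample_path (Y n) \<omega> t = c j \<omega>" using t by (simp add: sample_path_Y c_def j_def)
    moreover have "\<bar>real_of_int \<lfloor>real (Suc k) * c j \<omega>\<rfloor> / real (Suc k) - c j \<omega>\<bar> \<le> 1 / real (Suc k)"
    proof -
      have "\<bar>real_of_int \<lfloor>real (Suc k) * c j \<omega>\<rfloor> - real (Suc k) * c j \<omega>\<bar> \<le> 1" by linarith
      then have "\<bar>real_of_int \<lfloor>real (Suc k) * c j \<omega>\<rfloor> - real (Suc k) * c j \<omega>\<bar> / real (Suc k) \<le> 1 / real (Suc k)"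
        by (intro divide_right_mono) auto
      moreover have "real_of_int \<lfloor>real (Suc k) * c j \<omega>\<rfloor> / real (Suc k) - c j \<omega> =
          (real_of_int \<lfloor>real (Suc k) * c j \<omega>\<rfloor> - real (Suc k) * c j \<omega>) / real (Suc k)"
        by (simp add: diff_divide_distrib del: of_nat_Suc)
      ultimately show ?thesis by (simp add: abs_divide del: of_nat_Suc)
    qed
    ultimately show "\<bar>F k (g k \<omega>) t - sample_path (Y n) \<omega> t\<bar> \<le> 1 / real (Suc k)" by simp
  qed simp
  show "(\<lambda>k. J1_dist (F k (g k \<omega>)) (sample_path (Y n) \<omega>)) \<longlonglongrightarrow> 0"
  proof (rule real_tendsto_sandwich[where f = "\<lambda>_. 0" and h = "\<lambda>k. 1 / real (Suc k) + exp (- real k)"])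
    have "(\<lambda>k. exp (- real k)) \<longlonglongrightarrow> 0"
      by (rule filterlim_compose[OF exp_at_bot]) (simp add: filterlim_uminus_at_bot filterlim_real_sequentially)
    then show "(\<lambda>k. 1 / real (Suc k) + exp (- real k)) \<longlonglongrightarrow> 0"
      using tendsto_add[OF LIMSEQ_Suc[OF lim_1_over_n]] by fastforce
  qed (use le J1_dist_nonneg in auto)
qed

end

section \<open>Convergence on finite grids\<close>

text \<open>\<open>extremal_process\<close> prescribes the law and cadlag paths; monotonicity of
  every single path is an additional property of the version constructed later.\<close>

locale extremal_limit = extremal_domain +
  fixes N :: "'b measure" and Z :: "real \<Rightarrow> 'b \<Rightarrow> real"
  assumes ext: "extremal_process G N Z"
    and Z_mono: "\<And>\<omega> s t. \<omega> \<in> space N \<Longrightarrow> 0 < s \<Longrightarrow> s \<le> t \<Longrightarrow> Z s \<omega> \<le> Z t \<omega>"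
begin

sublocale N: prob_space N
  using ext by (simp add: extremal_process_def)

lemma Z_meas: "t > 0 \<Longrightarrow> Z t \<in> borel_measurable N"
  using ext by (simp add: extremal_process_def)

lemma grid_meas [measurable]: "q > 0 \<Longrightarrow> Z (real (Suc i) / real q) \<in> borel_measurable N"
  by (rule Z_meas) simp

lemma Z_grid_prob:
  assumes q: "q > 0" and w: "\<And>i j. i \<le> j \<Longrightarrow> j < K \<Longrightarrow> w i \<le> w j"
  shows "N.prob {\<omega> \<in> space N. \<forall>i<K. Z (real (Suc i) / real q) \<omega> \<le> w i} = (\<Prod>i<K. G (w i) powr (1 / real q))"
proof (cases "K = 0")
  case False
  define t where "t i = real i / real q" for i :: nat
  define u where "u i = w (i - 1)" for i
  have sm: "strict_mono_on {1..K} t" using q by (auto simp: strict_mono_on_def t_def divide_strict_right_mono)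
  have "(\<forall>i<K. Z (real (Suc i) / real q) \<omega> \<le> w i) \<longleftrightarrow> (\<forall>i\<in>{1..K}. Z (t i) \<omega> \<le> u i)" for \<omega>
  proof
    assume l: "\<forall>i<K. Z (real (Suc i) / real q) \<omega> \<le> w i"
    show "\<forall>i\<in>{1..K}. Z (t i) \<omega> \<le> u i"
    proof
      fix i assume "i \<in> {1..K}"
      then show "Z (t i) \<omega> \<le> u i" using l[rule_format, of "i - 1"] by (cases i) (auto simp: t_def u_def)
    qed
  next
    assume r: "\<forall>i\<in>{1..K}. Z (t i) \<omega> \<le> u i"
    show "\<forall>i<K. Z (real (Suc i) / real q) \<omega> \<le> w i"
    proof (intro allI impI)
      fix i assume "i < K"
      then show "Z (real (Suc i) / real q) \<omega> \<le> w i" using r[rule_format, of "Suc i"] by (auto simp: t_def u_def)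
    qed
  qed
  then have "N.prob {\<omega> \<in> space N. \<forall>i<K. Z (real (Suc i) / real q) \<omega> \<le> w i} = N.prob {\<omega> \<in> space N. \<forall>i\<in>{1..K}. Z (t i) \<omega> \<le> u i}"
    by simp
  also have "\<dots> = (\<Prod>i = 1..K. G (MIN j\<in>{i..K}. u j) powr (t i - (if i = 1 then 0 else t (i - 1))))"
  proof -
    have "0 < t 1" "1 \<le> K" using q False by (auto simp: t_def)
    then show ?thesis using ext sm unfolding extremal_process_def by blast
  qed
  also have "\<dots> = (\<Prod>i = 1..K. G (w (i - 1)) powr (1 / real q))"
  proof (rule prod.cong[OF refl])
    fix i assume i: "i \<in> {1..K}"
    have "(MIN j\<in>{i..K}. u j) = u i" using i by (intro Min_eqI) (auto simp: u_def intro!: w)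
    moreover have "t i - (if i = 1 then 0 else t (i - 1)) = 1 / real q"
      using i by (cases i) (auto simp: t_def diff_divide_distrib[symmetric])
    ultimately show "G (MIN j\<in>{i..K}. u j) powr (t i - (if i = 1 then 0 else t (i - 1))) = G (w (i - 1)) powr (1 / real q)"
      by (simp add: u_def)
  qed
  also have "\<dots> = (\<Prod>i<K. G (w i) powr (1 / real q))"
    by (rule prod.reindex_bij_witness[of _ Suc "\<lambda>i. i - 1"]) auto
  finally show ?thesis .
qed (simp add: N.prob_space)

text \<open>A bound on the maximum up to the end of window \<open>i\<close> also constrains the
  earlier windows, but there the levels are at least as strict already.\<close>

lemma Y_below_iff:
  assumes x: "x \<in> fin" and n: "q > 0" "n \<ge> q" and w: "\<And>i j. i \<le> j \<Longrightarrow> j < K \<Longrightarrow> w i \<le> w j"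
  shows "(\<forall>i<K. Y n (real (Suc i) / real q) x \<le> w i) \<longleftrightarrow> below K (\<lambda>i. n * i div q) (\<lambda>i. lev (w i) n) 0 x"
proof -
  have Yi: "Y n (real (Suc i) / real q) x \<le> v \<longleftrightarrow> (\<forall>l<n * Suc i div q. X (Suc l) x \<le> ereal (lev v n))" for i v
    using Y_grid(1)[OF n, of "Suc i" x] Y_grid(2)[OF n, of "Suc i"] scaled_max_le_iff[OF x, of "n * Suc i div q" n v] by simp
  show ?thesis
    unfolding Yi below_def
  proof safe
    fix i l assume b: "\<forall>i<K. \<forall>l\<in>{max 0 (n * i div q)..<n * Suc i div q}. X (Suc l) x \<le> ereal (lev (w i) n)"
      and i: "i < K" and l: "l < n * Suc i div q"
    \<comment> \<open>\<open>j\<close> is the window that contains the offset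
      \<open>l\<close>.\<close>
    define j where "j = (LEAST j. l < n * Suc j div q)"
    have j: "l < n * Suc j div q" unfolding j_def by (rule LeastI[of _ i]) fact
    have ji: "j \<le> i" unfolding j_def by (rule Least_le) fact
    have "n * j div q \<le> l"
    proof (cases j)
      case (Suc j')
      then have "j' < (LEAST j. l < n * Suc j div q)" by (simp add: j_def)
      then have "\<not> l < n * Suc j' div q" by (rule not_less_Least)
      then show ?thesis using Suc by simp
    qed simp
    then have "X (Suc l) x \<le> ereal (lev (w j) n)" using b[rule_format, of j l] j ji i by auto
    also have "\<dots> \<le> ereal (lev (w i) n)" using lev_mono[OF w[OF ji i]] by simp
    finally show "X (Suc l) x \<le> ereal (lev (w i) n)" .
  qed auto
qed

lemma grid_prob_tendsto:
  assumes q: "q > 0" and w: "\<And>i j. i \<le> j \<Longrightarrow> j < K \<Longrightarrow> w i \<le> w j"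
  shows "(\<lambda>n. prob {x \<in> space M. \<forall>i<K. Y n (real (Suc i) / real q) x \<le> w i}) \<longlonglongrightarrow>
    N.prob {\<omega> \<in> space N. \<forall>i<K. Z (real (Suc i) / real q) \<omega> \<le> w i}"
proof -
  have Zp: "N.prob {\<omega> \<in> space N. \<forall>i<K. Z (real (Suc i) / real q) \<omega> \<le> w i} = (\<Prod>i<K. G (w i) powr (1 / real q))"
    by (rule Z_grid_prob[OF q]) (rule w)
  have lim: "(\<lambda>n. prob {x \<in> space M. below K (\<lambda>i. n * i div q) (\<lambda>i. lev (w i) n) 0 x})
    \<longlonglongrightarrow> (\<Prod>i<K. G (w i) powr (1 / real q))"
    by (rule below_tendsto[OF q]) (rule w)
  show ?thesis
    unfolding Zp
proof (rule Lim_transform_eventually[OF lim])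
  show "\<forall>\<^sub>F n in sequentially. prob {x \<in> space M. below K (\<lambda>i. n * i div q) (\<lambda>i. lev (w i) n) 0 x} =
      prob {x \<in> space M. \<forall>i<K. Y n (real (Suc i) / real q) x \<le> w i}"
    using eventually_ge_at_top[of q]
  proof eventually_elim
    case (elim n)
    show ?case
    proof (rule measure_eq_AE)
      show "AE x in M. (x \<in> {x \<in> space M. below K (\<lambda>i. n * i div q) (\<lambda>i. lev (w i) n) 0 x}) =
          (x \<in> {x \<in> space M. \<forall>i<K. Y n (real (Suc i) / real q) x \<le> w i})"
        using AE_fin
      proof eventually_elim
        case (elim x)
        have "(\<forall>i<K. Y n (real (Suc i) / real q) x \<le> w i) \<longleftrightarrow> below K (\<lambda>i. n * i div q) (\<lambda>i. lev (w i) n) 0 x"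
          by (rule Y_below_iff[OF elim q \<open>q \<le> n\<close>]) (rule w)
        then show ?case by simp
      qed
    qed measurable
  qed
qed
qed

text \<open>For a nondecreasing sequence a threshold at \<open>j\<close> binds at all earlier
  indices. Taking the minimum over later thresholds reduces arbitrary thresholds on \<open>I\<close>
  to nondecreasing ones on an initial segment, the case treated by the windows.\<close>

lemma running_min_iff:
  fixes y U :: "nat \<Rightarrow> real"
  assumes y: "\<And>i j. i \<le> j \<Longrightarrow> y i \<le> y j" and I: "finite I" "I \<noteq> {}"
  shows "(\<forall>i\<in>I. y i \<le> U i) \<longleftrightarrow> (\<forall>i<Suc (Max I). y i \<le> Min (U ` {j \<in> I. i \<le> j}))"
proof -
  have ne: "{j \<in> I. i \<le> j} \<noteq> {}" if "i < Suc (Max I)" for i using Max_in[OF I] that by force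
  have "(\<forall>i<Suc (Max I). y i \<le> Min (U ` {j \<in> I. i \<le> j})) \<longleftrightarrow> (\<forall>i<Suc (Max I). \<forall>j\<in>I. i \<le> j \<longrightarrow> y i \<le> U j)"
    using I ne by (auto simp: Min_ge_iff)
  also have "\<dots> \<longleftrightarrow> (\<forall>i\<in>I. y i \<le> U i)"
  proof safe
    fix i assume r: "\<forall>i<Suc (Max I). \<forall>j\<in>I. i \<le> j \<longrightarrow> y i \<le> U j" and i: "i \<in> I"
    have "i \<le> Max I" using I i by simp
    then show "y i \<le> U i" using r[rule_format, of i i] i by simp
  next
    fix i j assume "\<forall>i\<in>I. y i \<le> U i" "j \<in> I" "i \<le> j"
    then show "y i \<le> U j" using y[of i j] by (meson order.trans)
  qed
  finally show ?thesis by blast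
qed

text \<open>A subset of the grid is allowed because a condition \<open>level \<le> j\<close> with
  \<open>j \<ge> m\<close> is void by the cap, and its grid point has to be left out.\<close>

lemma grid_prob_subset_tendsto:
  assumes q: "q > 0" and I: "finite I"
  shows "(\<lambda>n. prob {x \<in> space M. \<forall>i\<in>I. Y n (real (Suc i) / real q) x \<le> U i}) \<longlonglongrightarrow>
    N.prob {\<omega> \<in> space N. \<forall>i\<in>I. Z (real (Suc i) / real q) \<omega> \<le> U i}"
proof (cases "I = {}")
  case True
  then show ?thesis by (simp add: prob_space N.prob_space)
next
  case ne: False
  define w where "w i = Min (U ` {j \<in> I. i \<le> j})" for i
  have w: "w i \<le> w j" if "i \<le> j" "j < Suc (Max I)" for i j
    unfolding w_def using that I Max_in[OF I ne] by (intro Min_antimono) auto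
  have grid_le: "real (Suc i) / real q \<le> real (Suc j) / real q" if "i \<le> j" for i j
    using that q by (intro divide_right_mono) auto
  have lim: "(\<lambda>n. prob {x \<in> space M. \<forall>i<Suc (Max I). Y n (real (Suc i) / real q) x \<le> w i}) \<longlonglongrightarrow>
    N.prob {\<omega> \<in> space N. \<forall>i<Suc (Max I). Z (real (Suc i) / real q) \<omega> \<le> w i}"
    by (rule grid_prob_tendsto[OF q w])
  have "{\<omega> \<in> space N. \<forall>i\<in>I. Z (real (Suc i) / real q) \<omega> \<le> U i} = {\<omega> \<in> space N. \<forall>i<Suc (Max I). Z (real (Suc i) / real q) \<omega> \<le> w i}"
  proof (rule Collect_cong, rule conj_cong[OF refl])
    fix \<omega> assume "\<omega> \<in> space N"
    then show "(\<forall>i\<in>I. Z (real (Suc i) / real q) \<omega> \<le> U i) \<longleftrightarrow> (\<forall>i<Suc (Max I). Z (real (Suc i) / real q) \<omega> \<le> w i)"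
      unfolding w_def using q by (intro running_min_iff Z_mono grid_le I ne) auto
  qed
  moreover have "\<forall>\<^sub>F n in sequentially. prob {x \<in> space M. \<forall>i<Suc (Max I). Y n (real (Suc i) / real q) x \<le> w i} =
      prob {x \<in> space M. \<forall>i\<in>I. Y n (real (Suc i) / real q) x \<le> U i}"
    using eventually_gt_at_top[of 0]
  proof eventually_elim
    case (elim n)
    show ?case
    proof (rule measure_eq_AE)
      show "AE x in M. (x \<in> {x \<in> space M. \<forall>i<Suc (Max I). Y n (real (Suc i) / real q) x \<le> w i}) =
          (x \<in> {x \<in> space M. \<forall>i\<in>I. Y n (real (Suc i) / real q) x \<le> U i})"
        using AE_fin
      proof eventually_elim
        case (elim x)
        have "(\<forall>i\<in>I. Y n (real (Suc i) / real q) x \<le> U i) \<longleftrightarrow> (\<forall>i<Suc (Max I). Y n (real (Suc i) / real q) x \<le> w i)"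
          unfolding w_def using q \<open>0 < n\<close> elim by (intro running_min_iff Y_mono grid_le I ne) auto
        then show ?case by simp
      qed
      show "{x \<in> space M. \<forall>i\<in>I. Y n (real (Suc i) / real q) x \<le> U i} \<in> events"
        by (rule sets.sets_Collect_finite_All) (use I in measurable)
    qed measurable
  qed
  ultimately show ?thesis using Lim_transform_eventually[OF lim] by simp
qed

lemma level_measurable [measurable]: "level u \<eta> m \<in> measurable borel (count_space UNIV)"
  unfolding level_def[abs_def] by measurable

lemma level_expectation_tendsto:
  fixes F :: "(nat \<Rightarrow> nat) \<Rightarrow> real"
  assumes q: "q > 0" and \<eta>: "\<eta> > 0"
  shows "(\<lambda>n. \<integral>x. F (\<lambda>i. if i < K then level u \<eta> m (Y n (real (Suc i) / real q) x) else 0) \<partial>M) \<longlonglongrightarrow>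
    (\<integral>\<omega>. F (\<lambda>i. if i < K then level u \<eta> m (Z (real (Suc i) / real q) \<omega>) else 0) \<partial>N)"
proof (rule finite_levels_expectation[where F = F and Jn = "\<lambda>n i x. level u \<eta> m (Y n (real (Suc i) / real q) x)"
      and J = "\<lambda>i \<omega>. level u \<eta> m (Z (real (Suc i) / real q) \<omega>)"])
  show "prob_space M" "prob_space N" by unfold_locales
  show "(\<lambda>x. level u \<eta> m (Y n (real (Suc i) / real q) x)) \<in> measurable M (count_space UNIV)" for n i by measurable
  show "(\<lambda>x. level u \<eta> m (Z (real (Suc i) / real q) x)) \<in> measurable N (count_space UNIV)" for i
    using q by measurable
  fix v :: "nat \<Rightarrow> nat"
  define I where "I = {i. i < K \<and> v i < m}"
  have "(\<forall>i<K. level u \<eta> m (y i) \<le> v i) \<longleftrightarrow> (\<forall>i\<in>I. y i \<le> u + (real (v i) + 1) * \<eta>)" for y :: "nat \<Rightarrow> real"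
    by (auto simp: level_le_iff[OF \<eta>] I_def)
  then show "(\<lambda>n. prob {x \<in> space M. \<forall>i<K. level u \<eta> m (Y n (real (Suc i) / real q) x) \<le> v i}) \<longlonglongrightarrow>
    N.prob {x \<in> space N. \<forall>i<K. level u \<eta> m (Z (real (Suc i) / real q) x) \<le> v i}"
    using grid_prob_subset_tendsto[OF q, of I "\<lambda>i. u + (real (v i) + 1) * \<eta>"] by (simp add: I_def)
qed (rule level_le_max)+

end

section \<open>Intermediate levels between grid points\<close>

lemma good_path_cong:
  assumes k: "0 < k" and q: "0 < q" and eq: "\<And>t. t > 0 \<Longrightarrow> y t = z t"
    and kK: "k \<le> K"
  shows "good_path u \<eta> m q k K y \<longleftrightarrow> good_path u \<eta> m q k K z"
proof -
  have 1: "y (real i / real q) = z (real i / real q)" if "k \<le> i" for i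
    using that k q by (intro eq) simp
  have 2: "y r = z r" if "k \<le> i" "real i / real q \<le> r" for i r
  proof (rule eq)
    have "0 < real i / real q" using that k q by simp
    then show "0 < r" using that(2) by linarith
  qed
  have 3: "y (real (Suc i) / real q) = z (real (Suc i) / real q)" if "k \<le> i" for i
    using 1[of "Suc i"] that by simp
  have 4: "(level u \<eta> m (y r) \<in> {level u \<eta> m (y (real i / real q)), level u \<eta> m (y (real (Suc i) / real q))}) =
     (level u \<eta> m (z r) \<in> {level u \<eta> m (z (real i / real q)), level u \<eta> m (z (real (Suc i) / real q))})"
    if "k \<le> i" "real i / real q \<le> r" for i r
    using 1[OF that(1)] 2[OF that] 3[OF that(1)] by (simp only:)
  have "intermediate_level u \<eta> m q k K y \<longleftrightarrow> intermediate_level u \<eta> m q k K z"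
    unfolding intermediate_level_def
    by (intro bex_cong refl conj_cong arg_cong[where f = Not] 4) simp_all
  then show ?thesis
    unfolding good_path_def using 1[of k] 1[of K] kK by simp
qed

text \<open>Entry \<open>j\<close> of the vector belongs to time \<open>(j + 1) / q\<close>, the
  indexing of the grid lemmas. For \<open>k > 0\<close> the subtraction is exact.\<close>

definition levels_path :: "real \<Rightarrow> real \<Rightarrow> nat \<Rightarrow> nat \<Rightarrow> nat \<Rightarrow> (nat \<Rightarrow> nat) \<Rightarrow> real \<Rightarrow> real" where
  "levels_path u \<eta> q k K v = step_path (real q) (\<lambda>i. u + \<eta> * real (v (max k (min K i) - 1)))"

lemma levels_path_in_skorokhod: "levels_path u \<eta> q k K v \<in> skorokhod_space"
  unfolding levels_path_def by (intro step_path_in_skorokhod) simp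

lemma levels_path_cong:
  assumes "0 < k" "k \<le> K" "\<And>j. j < K \<Longrightarrow> v j = v' j"
  shows "levels_path u \<eta> q k K v = levels_path u \<eta> q k K v'"
proof -
  have "max k (min K i) - 1 < K" for i using assms by auto
  then show ?thesis unfolding levels_path_def using assms(3) by simp
qed

lemma grid_path_eq_levels_path:
  assumes "0 < k" "k \<le> K"
  shows "grid_path u \<eta> m q k K y = levels_path u \<eta> q k K (\<lambda>j. level u \<eta> m (y (real (Suc j) / real q)))"
proof -
  have "Suc (max k (min K i) - 1) = max k (min K i)" for i using assms by auto
  then show ?thesis unfolding levels_path_def grid_path_def by (simp only:)
qed

context extremal_domain
begin

text \<open>The level rises strictly from \<open>i / q\<close> to \<open>r\<close> and again from
  \<open>r\<close> to the end of the cell. Each rise is caused by a new maximum above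
  \<open>u + \<eta>\<close>, the first observed before time \<open>r\<close> is passed and the
  second after it, both inside the block.\<close>

lemma intermediate_level_double_exceed:
  assumes x: "x \<in> fin" and q: "q > 0" "n \<ge> q" and i: "1 \<le> i" "i < K" and \<eta>: "\<eta> > 0"
    and r: "real i / real q \<le> r" "r \<le> real (Suc i) / real q"
    and lv: "level u \<eta> m (Y n r x) \<notin> {level u \<eta> m (Y n (real i / real q) x), level u \<eta> m (Y n (real (Suc i) / real q) x)}"
  shows "x \<in> double_exceed n q K (lev (u + \<eta>) n)"
proof -
  have n: "n > 0" using q by simp
  have "0 < real i / real q" using i q by simp
  with r(1) have pos: "0 < real i / real q" "0 < r" by linarith+
  let ?y0 = "Y n (real i / real q) x" and ?y1 = "Y n r x" and ?y2 = "Y n (real (Suc i) / real q) x"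
  have m: "?y0 \<le> ?y1" "?y1 \<le> ?y2" using x n pos r by (auto intro!: Y_mono)
  have l: "level u \<eta> m ?y0 < level u \<eta> m ?y1" "level u \<eta> m ?y1 < level u \<eta> m ?y2"
    using lv level_mono[OF \<eta> m(1), of u m] level_mono[OF \<eta> m(2), of u m] by auto
  have y1: "u + \<eta> < ?y1" using l(1) level_le_iff[OF \<eta>, of u m ?y1 0] by (auto simp: not_le)
  \<comment> \<open>Exceeding \<open>?y0\<close> rules out observations before the block, and
    exceeding \<open>u + \<eta>\<close> is what \<open>double_exceed\<close> records.\<close>
  define v0 where "v0 = max ?y0 (u + \<eta>)"
  have "?y0 < ?y1"
  proof (rule ccontr)
    assume "\<not> ?y0 < ?y1"
    then have "?y0 = ?y1" using m by simp
    then show False using l(1) by simp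
  qed
  then have v0: "v0 < ?y1" using y1 by (simp add: v0_def)
  have y12: "?y1 < ?y2"
  proof (rule ccontr)
    assume "\<not> ?y1 < ?y2"
    then have "?y1 = ?y2" using m by simp
    then show False using l(2) by simp
  qed
  \<comment> \<open>\<open>c\<close> observations determine the value at time \<open>r\<close>; this
    index separates the two exceedances.\<close>
  define c where "c = max 1 (nat \<lfloor>real n * r\<rfloor>)"
  have Yr: "?y1 = scaled_max n c x" using Y_eq[OF n pos(2)] by (simp add: c_def)
  note Y0 = Y_grid[OF q i(1)]
  have Y2: "?y2 = scaled_max n (n * Suc i div q) x" "n * Suc i div q \<ge> 1"
    using Y_grid[OF q, of "Suc i"] by auto
  have "\<not> scaled_max n c x \<le> v0" using v0 Yr by simp
  then obtain l where l: "l < c" "X (Suc l) x > ereal (lev v0 n)"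
    using scaled_max_le_iff[OF x, of c n v0] by (auto simp: c_def not_le)
  have "\<not> l < n * i div q"
  proof
    assume "l < n * i div q"
    moreover have "scaled_max n (n * i div q) x \<le> v0" using Y0(1)[of x] by (simp add: v0_def)
    ultimately have "X (Suc l) x \<le> ereal (lev v0 n)" using scaled_max_le_iff[OF x Y0(2)] by blast
    then show False using l by simp
  qed
  have "\<not> scaled_max n (n * Suc i div q) x \<le> ?y1" using y12 Y2 by simp
  then obtain l' where l': "l' < n * Suc i div q" "X (Suc l') x > ereal (lev ?y1 n)"
    unfolding scaled_max_le_iff[OF x Y2(2)] not_all not_imp not_le by blast
  have "\<not> l' < c"
  proof
    assume "l' < c"
    moreover have "scaled_max n c x \<le> ?y1" "1 \<le> c" by (simp_all add: Yr c_def)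
    ultimately have "X (Suc l') x \<le> ereal (lev ?y1 n)" using scaled_max_le_iff[OF x] by blast
    then show False using l' by simp
  qed
  have "ereal (lev (u + \<eta>) n) \<le> ereal (lev v0 n)" "ereal (lev (u + \<eta>) n) \<le> ereal (lev ?y1 n)"
    using lev_mono[of "u + \<eta>" v0 n] lev_mono[of "u + \<eta>" ?y1 n] y1 by (auto simp: v0_def)
  then have "X (Suc l) x > ereal (lev (u + \<eta>) n)" "X (Suc l') x > ereal (lev (u + \<eta>) n)"
    using l(2) l'(2) order.strict_trans1 by blast+
  moreover have "n * i div q \<le> l" "l < l'" using \<open>\<not> l < n * i div q\<close> \<open>\<not> l' < c\<close> l(1) by auto
  ultimately show ?thesis using x i(2) l'(1) unfolding double_exceed_def fin_def
    by (intro CollectI conjI exI[of _ i] exI[of _ l] exI[of _ l']) simp_all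
qed

end

context extremal_limit
begin

text \<open>The event involves infinitely many times, whereas convergence is known on finite grids.
  Grids with \<open>fact p\<close> points per cell are nested and exhaust the rationals; on each of
  them the probability is a limit of probabilities for \<open>Y n\<close>, all bounded by that of
  \<open>double_exceed\<close>, and the bound survives the increasing union.\<close>

lemma Z_intermediate_level_prob:
  assumes q: "q > 0" and k: "k > 0" and \<eta>: "\<eta> > 0"
    and dbl: "\<forall>\<^sub>F n in sequentially. prob (double_exceed n q K (lev (u + \<eta>) n)) \<le> \<epsilon>"
  shows "{\<omega> \<in> space N. intermediate_level u \<eta> m q k K (\<lambda>t. Z t \<omega>)} \<in> N.events"
    and "N.prob {\<omega> \<in> space N. intermediate_level u \<eta> m q k K (\<lambda>t. Z t \<omega>)} \<le> \<epsilon>"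
proof -
  define B where "B = {\<omega> \<in> space N. intermediate_level u \<eta> m q k K (\<lambda>t. Z t \<omega>)}"
  let ?L = "level u \<eta> m"
  define P where "P y p \<longleftrightarrow> (\<exists>i\<in>{k..<K}. \<exists>l\<le>fact p. ?L (y (real (i * fact p + l) / real (q * fact p))) \<notin>
      {?L (y (real i / real q)), ?L (y (real (Suc i) / real q))})" for y :: "real \<Rightarrow> real" and p :: nat
  define Bp where "Bp p = {\<omega> \<in> space N. P (\<lambda>t. Z t \<omega>) p}" for p
  have f0: "(fact p :: nat) > 0" for p by simp
  have frac: "real (i * fact p) / real (q * fact p) = real i / real q" for i p
    unfolding of_nat_mult using f0[of p] by simp
  \<comment> \<open>The event as a function of the vector whose entry \<open>j\<close> is the level
    at time \<open>(j + 1) / (q * fact p)\<close>; hence the subtractions of 1.\<close>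
  define F where "F p v = (if (\<exists>i\<in>{k..<K}. \<exists>l\<le>fact p. v (i * fact p + l - 1) \<notin> {v (i * fact p - 1), v (Suc i * fact p - 1)}) then 1 else 0 :: real)"
    for p :: nat and v :: "nat \<Rightarrow> nat"
  have FP: "F p (\<lambda>j. if j < K * fact p then ?L (y (real (Suc j) / real (q * fact p))) else 0) = (if P y p then 1 else 0)" for y p
  proof -
    let ?v = "\<lambda>j. if j < K * fact p then ?L (y (real (Suc j) / real (q * fact p))) else 0"
    have vi: "?v (i * fact p + l - 1) = ?L (y (real (i * fact p + l) / real (q * fact p)))"
      if "i \<in> {k..<K}" "l \<le> fact p" for i l
    proof -
      have "0 < i * fact p + l" using that k f0[of p] by simp
      then have S: "Suc (i * fact p + l - 1) = i * fact p + l" by simp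
      have "i * fact p + l \<le> Suc i * fact p" using that by simp
      also have "\<dots> \<le> K * fact p" using that by (intro mult_right_mono) auto
      finally have "i * fact p + l - 1 < K * fact p" using S by linarith
      then show ?thesis by (simp only: S if_True)
    qed
    note e = frac
    have v0: "?v (i * fact p - 1) = ?L (y (real i / real q))" if "i \<in> {k..<K}" for i
      using vi[OF that, of 0] e by (simp only: add_0_right le0)
    have v1: "?v (Suc i * fact p - 1) = ?L (y (real (Suc i) / real q))" if "i \<in> {k..<K}" for i
    proof -
      have "i * fact p + fact p = Suc i * fact p" by simp
      then show ?thesis using vi[OF that, of "fact p"] e[of "Suc i"] by (simp only: order_refl)
    qed
    have "(\<exists>i\<in>{k..<K}. \<exists>l\<le>fact p. ?v (i * fact p + l - 1) \<notin> {?v (i * fact p - 1), ?v (Suc i * fact p - 1)}) \<longleftrightarrow> P y p"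
      unfolding P_def using vi v0 v1 by (intro bex_cong refl ex_cong1 conj_cong) (simp only:)
    then show ?thesis unfolding F_def by (simp only:)
  qed
  have pos: "0 < real i / real q" if "k \<le> i" for i using that k q by simp
  have pos': "0 < real (i * fact p + l) / real (q * fact p)" if "i \<in> {k..<K}" for i l p
  proof -
    have "0 < i * fact p + l" "0 < q * fact p" using that k q f0[of p] by simp_all
    then show ?thesis by (intro divide_pos_pos) (simp_all only: of_nat_0_less_iff)
  qed
  have Zr: "(\<lambda>\<omega>. ?L (Z r \<omega>)) \<in> measurable N (count_space UNIV)" if "r > 0" for r
    by (rule measurable_compose[OF Z_meas[OF that] level_measurable])
  have ev: "{\<omega> \<in> space N. ?L (Z r \<omega>) \<notin> {?L (Z s \<omega>), ?L (Z t \<omega>)}} \<in> N.events" if "r > 0" "s > 0" "t > 0" for r s t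
    using Zr[OF that(1)] Zr[OF that(2)] Zr[OF that(3)] by measurable
  have Bp_meas: "Bp p \<in> N.events" for p
  proof -
    have "Bp p = (\<Union>i\<in>{k..<K}. \<Union>l\<in>{..fact p}. {\<omega> \<in> space N. ?L (Z (real (i * fact p + l) / real (q * fact p)) \<omega>) \<notin>
      {?L (Z (real i / real q) \<omega>), ?L (Z (real (Suc i) / real q) \<omega>)}})"
      by (auto simp: Bp_def P_def)
    also have "\<dots> \<in> N.events"
      by (intro sets.finite_UN ev pos' pos) auto
    finally show ?thesis .
  qed
  have Bp_le: "N.prob (Bp p) \<le> \<epsilon>" for p
  proof (rule tendsto_upperbound)
    have qp: "0 < q * fact p" using q f0[of p] by simp
    have "(\<lambda>n. \<integral>x. (if P (\<lambda>t. Y n t x) p then 1 else 0) \<partial>M) \<longlonglongrightarrow> (\<integral>\<omega>. (if P (\<lambda>t. Z t \<omega>) p then 1 else 0 :: real) \<partial>N)"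
      using level_expectation_tendsto[OF qp \<eta>, of "F p" "K * fact p" u m]
      unfolding FP[of p "\<lambda>t. Y _ t _"] FP[of p "\<lambda>t. Z t _"] .
    moreover have "(\<integral>\<omega>. (if P (\<lambda>t. Z t \<omega>) p then 1 else 0 :: real) \<partial>N) = N.prob (Bp p)"
    proof -
      have "(\<integral>\<omega>. (if P (\<lambda>t. Z t \<omega>) p then 1 else 0 :: real) \<partial>N) = (\<integral>\<omega>. indicator (Bp p) \<omega> \<partial>N)"
        by (intro Bochner_Integration.integral_cong) (auto simp: Bp_def)
      then show ?thesis using Bp_meas[of p] by simp
    qed
    ultimately show "(\<lambda>n. \<integral>x. (if P (\<lambda>t. Y n t x) p then 1 else 0) \<partial>M) \<longlonglongrightarrow> N.prob (Bp p)" by simp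
    show "\<forall>\<^sub>F n in sequentially. (\<integral>x. (if P (\<lambda>t. Y n t x) p then 1 else 0) \<partial>M) \<le> \<epsilon>"
      using dbl eventually_ge_at_top[of q]
    proof eventually_elim
      case (elim n)
      have "(\<integral>x. (if P (\<lambda>t. Y n t x) p then 1 else 0 :: real) \<partial>M) \<le> (\<integral>x. indicator (double_exceed n q K (lev (u + \<eta>) n)) x \<partial>M)"
      proof (rule integral_mono_AE')
        show "integrable M (\<lambda>x. indicator (double_exceed n q K (lev (u + \<eta>) n)) x :: real)"
          by (simp add: emeasure_eq_measure)
        show "AE x in M. (if P (\<lambda>t. Y n t x) p then 1 else 0 :: real) \<le> indicator (double_exceed n q K (lev (u + \<eta>) n)) x"
          using AE_fin
        proof eventually_elim
          case (elim x)
          have "x \<in> double_exceed n q K (lev (u + \<eta>) n)" if "P (\<lambda>t. Y n t x) p"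
          proof -
            from that obtain i l where il: "i \<in> {k..<K}" "l \<le> fact p"
              "?L (Y n (real (i * fact p + l) / real (q * fact p)) x) \<notin> {?L (Y n (real i / real q) x), ?L (Y n (real (Suc i) / real q) x)}"
              unfolding P_def by blast
            note e = frac[of i p] frac[of "Suc i" p]
            have "real (i * fact p) / real (q * fact p) \<le> real (i * fact p + l) / real (q * fact p)"
              by (intro divide_right_mono) auto
            moreover have "real (i * fact p + l) / real (q * fact p) \<le> real (Suc i * fact p) / real (q * fact p)"
              using il(2) by (intro divide_right_mono) (auto simp del: of_nat_mult of_nat_add)
            ultimately show ?thesis
              using il k unfolding e by (intro intermediate_level_double_exceed[OF elim q \<open>q \<le> n\<close> _ _ \<eta>]) auto
          qed
          then show ?case by (auto split: split_indicator)
        qed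
      qed auto
      also have "\<dots> = prob (double_exceed n q K (lev (u + \<eta>) n))" by simp
      finally show ?case using elim(1) by simp
    qed
  qed simp
  \<comment> \<open>A point of the grid belongs to the next one after expanding its fraction by
    \<open>Suc p\<close>.\<close>
  have "incseq Bp"
  proof (rule incseq_SucI, rule subsetI)
    fix p \<omega> assume "\<omega> \<in> Bp p"
    then obtain i l where il: "\<omega> \<in> space N" "i \<in> {k..<K}" "l \<le> fact p"
      "?L (Z (real (i * fact p + l) / real (q * fact p)) \<omega>) \<notin> {?L (Z (real i / real q) \<omega>), ?L (Z (real (Suc i) / real q) \<omega>)}"
      unfolding Bp_def P_def by blast
    have "real (i * fact (Suc p) + Suc p * l) / real (q * fact (Suc p)) = real (Suc p * (i * fact p + l)) / real (Suc p * (q * fact p))"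
      by (simp only: fact_Suc of_nat_id algebra_simps)
    also have "\<dots> = real (i * fact p + l) / real (q * fact p)" by (simp only: of_nat_mult) simp
    finally have eq: "real (i * fact (Suc p) + Suc p * l) / real (q * fact (Suc p)) = real (i * fact p + l) / real (q * fact p)" .
    have "?L (Z (real (i * fact (Suc p) + Suc p * l) / real (q * fact (Suc p))) \<omega>) \<notin> {?L (Z (real i / real q) \<omega>), ?L (Z (real (Suc i) / real q) \<omega>)}"
      unfolding eq by (rule il(4))
    moreover have "Suc p * l \<le> fact (Suc p)" unfolding fact_Suc of_nat_id by (rule mult_le_mono2[OF il(3)])
    ultimately show "\<omega> \<in> Bp (Suc p)" unfolding Bp_def P_def
      by (intro CollectI conjI bexI[of _ i] exI[of _ "Suc p * l"] il(1,2))
  qed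
  have UB: "(\<Union>p. Bp p) = B"
  proof
    show "(\<Union>p. Bp p) \<subseteq> B"
    proof
      fix \<omega> assume "\<omega> \<in> (\<Union>p. Bp p)"
      then obtain p i l where il: "\<omega> \<in> space N" "i \<in> {k..<K}" "l \<le> fact p"
        "?L (Z (real (i * fact p + l) / real (q * fact p)) \<omega>) \<notin> {?L (Z (real i / real q) \<omega>), ?L (Z (real (Suc i) / real q) \<omega>)}"
        unfolding Bp_def P_def by blast
      let ?r = "real (i * fact p + l) / real (q * fact p)"
      note e = frac[of i p] frac[of "Suc i" p]
      have "real i / real q \<le> ?r" unfolding e(1)[symmetric] by (intro divide_right_mono) auto
      moreover have "?r \<le> real (Suc i) / real q" unfolding e(2)[symmetric]
        using il(3) by (intro divide_right_mono) (auto simp del: of_nat_mult of_nat_add)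
      moreover have "?r \<in> \<rat>" by (intro Rats_divide Rats_of_nat)
      ultimately show "\<omega> \<in> B" unfolding B_def intermediate_level_def
        by (intro CollectI conjI bexI[of _ i] bexI[of _ ?r] il(1,2,4))
    qed
    show "B \<subseteq> (\<Union>p. Bp p)"
    proof
      fix \<omega> assume "\<omega> \<in> B"
      then obtain i r where ir: "\<omega> \<in> space N" "i \<in> {k..<K}" "r \<in> \<rat>" "real i / real q \<le> r" "r \<le> real (Suc i) / real q"
        "?L (Z r \<omega>) \<notin> {?L (Z (real i / real q) \<omega>), ?L (Z (real (Suc i) / real q) \<omega>)}"
        unfolding B_def intermediate_level_def by blast
      \<comment> \<open>\<open>z\<close> is the relative position of \<open>r\<close> in its cell.
        Its denominator \<open>n\<close> divides \<open>fact n\<close>, so \<open>r\<close> lies on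
        the \<open>n\<close>-th grid.\<close>
      define z where "z = real q * r - real i"
      have z: "0 \<le> z" "z \<le> 1" using ir(4,5) q by (auto simp: z_def field_simps)
      have "z \<in> \<rat>" using ir(3) by (simp add: z_def)
      then obtain d n where dn: "n \<noteq> 0" "\<bar>z\<bar> = real d / real n" by (rule Rats_abs_nat_div_natE) blast
      have "n dvd fact n" using dn(1) by (intro dvd_fact) auto
      then obtain h where h: "fact n = n * h" by (auto simp: dvd_def)
      have h0: "h > 0" using h f0[of n] by (cases h) auto
      define l where "l = d * h"
      have zl: "real l = z * real (fact n)" using dn z h by (simp add: l_def)
      have "real l \<le> real (fact n)" using zl z by (simp add: mult_left_le_one_le)
      then have "l \<le> fact n" by (simp only: of_nat_le_iff)
      moreover have "real (i * fact n + l) / real (q * fact n) = r"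
      proof -
        have "real (i * fact n + l) = real q * r * real (fact n)"
          using zl by (simp add: z_def algebra_simps)
        then show ?thesis using q f0[of n] by simp
      qed
      ultimately have "\<omega> \<in> Bp n" using ir(6) unfolding Bp_def P_def
        by (intro CollectI conjI bexI[of _ i] exI[of _ l] ir(1,2)) (simp_all only: not_False_eq_True)
      then show "\<omega> \<in> (\<Union>p. Bp p)" by blast
    qed
  qed
  have "B \<in> N.events" unfolding UB[symmetric] using Bp_meas by (intro sets.countable_UN) auto
  have "(\<lambda>p. N.prob (Bp p)) \<longlonglongrightarrow> N.prob (\<Union>p. Bp p)"
    using \<open>incseq Bp\<close> Bp_meas by (intro N.finite_Lim_measure_incseq) auto
  then have "N.prob B \<le> \<epsilon>" unfolding UB by (rule LIMSEQ_le_const2) (use Bp_le in auto)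
  with \<open>B \<in> N.events\<close> show "{\<omega> \<in> space N. intermediate_level u \<eta> m q k K (\<lambda>t. Z t \<omega>)} \<in> N.events"
    "N.prob {\<omega> \<in> space N. intermediate_level u \<eta> m q k K (\<lambda>t. Z t \<omega>)} \<le> \<epsilon>"
    unfolding B_def by simp_all
qed

end

section \<open>Weak convergence of rescaled maxima\<close>

lemma sample_path_apply [simp]: "t > 0 \<Longrightarrow> sample_path y \<omega> t = y t \<omega>"
  by (simp add: sample_path_def)

lemma grid_path_sample_path:
  assumes "0 < k" "k \<le> K" "0 < q"
  shows "grid_path u \<eta> m q k K (sample_path y \<omega>) =
    levels_path u \<eta> q k K (\<lambda>j. level u \<eta> m (y (real (Suc j) / real q) \<omega>))"
proof -
  have "sample_path y \<omega> (real (Suc j) / real q) = y (real (Suc j) / real q) \<omega>" for j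
    by (rule sample_path_apply) (use assms in simp)
  then show ?thesis unfolding grid_path_eq_levels_path[OF assms(1,2)] by (simp only:)
qed

lemma J1_dist_levels_path:
  assumes \<eta>: "\<eta> > 0" and q: "q > 0" and k: "0 < k" "k \<le> K"
    and y: "sample_path y \<omega> \<in> skorokhod_space" "\<And>s t. 0 < s \<Longrightarrow> s \<le> t \<Longrightarrow> y s \<omega> \<le> y t \<omega>"
    and good: "good_path u \<eta> m q k K (\<lambda>t. y t \<omega>)"
  shows "J1_dist (sample_path y \<omega>) (levels_path u \<eta> q k K (\<lambda>j. level u \<eta> m (y (real (Suc j) / real q) \<omega>))) \<le>
    2 * \<eta> + (2 + real k + 4 * real m) / real q + exp (- (real K / real q))"
  unfolding grid_path_sample_path[OF k q, symmetric]
proof (rule J1_dist_grid_path[OF \<eta> q k y(1)])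
  show "mono_on {0<..} (sample_path y \<omega>)" by (intro mono_onI) (simp add: y(2))
  show "good_path u \<eta> m q k K (sample_path y \<omega>)"
    using good good_path_cong[OF k(1) q _ k(2), of "sample_path y \<omega>" "\<lambda>t. y t \<omega>"] by simp
qed

text \<open>Off \<open>B\<close> the integrands differ by at most \<open>L * \<epsilon>\<close>, on
  \<open>B\<close> by at most \<open>2 * L\<close>, and \<open>B\<close> has measure at most
  \<open>\<epsilon>\<close>.\<close>

lemma lipschitz_integral_close:
  assumes P: "prob_space P" and F: "J1_lipschitz F L"
    and S: "S \<in> measurable P J1_borel" and g: "\<And>\<omega>. \<omega> \<in> space P \<Longrightarrow> g \<omega> \<in> skorokhod_space"
    and Fg: "(\<lambda>\<omega>. F (g \<omega>)) \<in> borel_measurable P"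
    and B: "B \<in> sets P" "measure P B \<le> \<epsilon>"
    and close: "AE \<omega> in P. \<omega> \<notin> B \<longrightarrow> J1_dist (S \<omega>) (g \<omega>) \<le> \<epsilon>"
  shows "\<bar>(\<integral>\<omega>. F (S \<omega>) \<partial>P) - (\<integral>\<omega>. F (g \<omega>) \<partial>P)\<bar> \<le> 3 * L * \<epsilon>"
proof -
  interpret P: prob_space P by fact
  have L: "L > 0" "\<And>x. x \<in> skorokhod_space \<Longrightarrow> \<bar>F x\<bar> \<le> L"
    "\<And>x y. x \<in> skorokhod_space \<Longrightarrow> y \<in> skorokhod_space \<Longrightarrow> \<bar>F x - F y\<bar> \<le> L * J1_dist x y"
    using F by (auto simp: J1_lipschitz_def)
  have e0: "0 \<le> \<epsilon>" using B(2) by (rule order.trans[rotated]) simp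
  have Ssk: "S \<omega> \<in> skorokhod_space" if "\<omega> \<in> space P" for \<omega> using measurable_space[OF S that] by simp
  have FS: "(\<lambda>\<omega>. F (S \<omega>)) \<in> borel_measurable P"
    by (rule measurable_compose[OF S continuous_map_J1_measurable[OF J1_lipschitz_continuous[OF F]]])
  have i1: "integrable P (\<lambda>\<omega>. F (S \<omega>))"
    by (rule P.integrable_const_bound[OF _ FS, of L]) (auto intro!: AE_I2 L(2) Ssk)
  have i2: "integrable P (\<lambda>\<omega>. F (g \<omega>))"
    by (rule P.integrable_const_bound[OF _ Fg, of L]) (auto intro!: AE_I2 L(2) g)
  have "\<bar>(\<integral>\<omega>. F (S \<omega>) \<partial>P) - (\<integral>\<omega>. F (g \<omega>) \<partial>P)\<bar> = \<bar>\<integral>\<omega>. F (S \<omega>) - F (g \<omega>) \<partial>P\<bar>"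
    using i1 i2 by simp
  also have "\<dots> \<le> (\<integral>\<omega>. \<bar>F (S \<omega>) - F (g \<omega>)\<bar> \<partial>P)" by (rule integral_abs_bound)
  also have "\<dots> \<le> (\<integral>\<omega>. L * \<epsilon> + 2 * L * indicator B \<omega> \<partial>P)"
  proof (rule integral_mono_AE)
    show "integrable P (\<lambda>\<omega>. \<bar>F (S \<omega>) - F (g \<omega>)\<bar>)" using i1 i2 by auto
    show "integrable P (\<lambda>\<omega>. L * \<epsilon> + 2 * L * indicator B \<omega>)"
      using B(1) by (auto simp: P.emeasure_eq_measure)
    show "AE \<omega> in P. \<bar>F (S \<omega>) - F (g \<omega>)\<bar> \<le> L * \<epsilon> + 2 * L * indicator B \<omega>"
      using close AE_space
    proof eventually_elim
      case (elim \<omega>)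
      have Le: "0 \<le> L * \<epsilon>" using L(1) e0 by simp
      show ?case
      proof (cases "\<omega> \<in> B")
        case True
        have "\<bar>F (S \<omega>)\<bar> \<le> L" "\<bar>F (g \<omega>)\<bar> \<le> L" using elim(2) by (auto intro: L(2) Ssk g)
        then show ?thesis using True Le by simp
      next
        case False
        then have "L * J1_dist (S \<omega>) (g \<omega>) \<le> L * \<epsilon>" using elim(1) L(1) by simp
        then show ?thesis using False L(3)[OF Ssk[OF elim(2)] g[OF elim(2)]] by simp
      qed
    qed
  qed
  also have "\<dots> = L * \<epsilon> + 2 * L * measure P B"
    using B(1) by (subst Bochner_Integration.integral_add) (auto simp: P.emeasure_eq_measure P.prob_space)
  also have "\<dots> \<le> L * \<epsilon> + 2 * L * \<epsilon>" using B(2) L(1) by simp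
  finally show ?thesis by simp
qed

context extremal_limit
begin

text \<open>One set of parameters must serve the limit and all large \<open>n\<close>. The distance
  bound is spent in quarters on \<open>2 * \<eta>\<close>, the starting time \<open>1 / q0\<close>,
  the term \<open>(2 + 4 * m) / q\<close>, and the tail \<open>exp (- H)\<close>. A path fails to be
  good by starting at or below \<open>u\<close>, by exceeding the top level by time
  \<open>H\<close>, or by an intermediate level. The first two are fixed by \<open>u\<close> and
  \<open>m\<close> before the grid is refined; the last is made small by choosing \<open>q\<close>
  afterwards.\<close>

lemma approximation_parameters:
  assumes \<epsilon>: "\<epsilon> > 0"
  obtains u \<eta> m q k K where "\<eta> > 0" "q > 0" "0 < k" "k \<le> K"
    "2 * \<eta> + (2 + real k + 4 * real m) / real q + exp (- (real K / real q)) \<le> \<epsilon>"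
    "{\<omega> \<in> space N. \<not> good_path u \<eta> m q k K (\<lambda>t. Z t \<omega>)} \<in> N.events"
    "N.prob {\<omega> \<in> space N. \<not> good_path u \<eta> m q k K (\<lambda>t. Z t \<omega>)} \<le> \<epsilon>"
    "\<forall>\<^sub>F n in sequentially. \<exists>B\<in>events. prob B \<le> \<epsilon> \<and> (\<forall>x\<in>fin - B. good_path u \<eta> m q k K (\<lambda>t. Y n t x))"
proof -
  define \<eta> where "\<eta> = \<epsilon> / 8"
  have \<eta>: "\<eta> > 0" using \<epsilon> by (simp add: \<eta>_def)
  obtain q0' where "1 / real (Suc q0') < \<epsilon> / 4" using nat_approx_posE[of "\<epsilon> / 4"] \<epsilon> by auto
  then obtain q0 :: nat where q0: "q0 > 0" "1 / real q0 < \<epsilon> / 4" by blast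
  obtain H' :: nat where H': "- ln (\<epsilon> / 4) \<le> real H'" using real_arch_simple by blast
  define H where "H = Suc H'"
  have H: "H > 0" "exp (- real H) \<le> \<epsilon> / 4"
  proof -
    have "- real H \<le> ln (\<epsilon> / 4)" using H' by (simp add: H_def)
    then have "exp (- real H) \<le> exp (ln (\<epsilon> / 4))" by simp
    then show "exp (- real H) \<le> \<epsilon> / 4" using \<epsilon> by simp
  qed (simp add: H_def)
  \<comment> \<open>Then \<open>\<theta> powr (1 / q0)\<close> is \<open>\<epsilon> / 4\<close>, so
    \<open>G u \<le> \<theta>\<close> bounds the probability that the limit is at most
    \<open>u\<close> at time \<open>1 / q0\<close>.\<close>
  define \<theta> where "\<theta> = (\<epsilon> / 4) powr real q0"
  have "\<theta> > 0" using \<epsilon> by (simp add: \<theta>_def)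
  then obtain u where u: "G u \<le> \<theta>" "G (u + \<eta>) > 0"
    using distribution_function_left_end[OF G _ \<eta>] by blast
  have u1: "G u powr (1 / real q0) \<le> \<epsilon> / 4"
  proof -
    have "G u powr (1 / real q0) \<le> \<theta> powr (1 / real q0)" using u(1) GD(2)[of u] by (intro powr_mono2) auto
    also have "\<dots> = \<epsilon> / 4" using \<epsilon> q0 by (simp add: \<theta>_def powr_powr)
    finally show ?thesis .
  qed
  \<comment> \<open>\<open>w m\<close> is the top of the level range. Time \<open>H\<close> is the
    last of \<open>H\<close> unit steps of a grid, whence the power \<open>H\<close> of
    \<open>G (w m)\<close>.\<close>
  define w where "w m = u + (real m + 1) * \<eta>" for m
  have "filterlim w at_top sequentially"
  proof -
    have "filterlim (\<lambda>m. (u + \<eta>) + real m * \<eta>) at_top sequentially"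
      by (rule filterlim_tendsto_add_at_top[OF tendsto_const
            filterlim_at_top_mult_tendsto_pos[OF tendsto_const \<eta> filterlim_real_sequentially]])
    moreover have "w = (\<lambda>m. (u + \<eta>) + real m * \<eta>)" by (simp add: w_def fun_eq_iff algebra_simps)
    ultimately show ?thesis by simp
  qed
  then have "(\<lambda>m. 1 - G (w m) ^ H) \<longlonglongrightarrow> 1 - 1 ^ H"
    by (intro tendsto_intros filterlim_compose[OF GD(6)])
  then have "\<forall>\<^sub>F m in sequentially. 1 - G (w m) ^ H < \<epsilon> / 4"
    by (rule order_tendstoD(2)) (use \<epsilon> in simp)
  then obtain m where m: "1 - G (w m) ^ H < \<epsilon> / 4" by (auto simp: eventually_sequentially)
  have "\<epsilon> / 3 > 0" using \<epsilon> by simp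
  then obtain Q where Q: "\<And>q. q \<ge> Q \<Longrightarrow> \<forall>\<^sub>F n in sequentially. prob (double_exceed n q (H * q) (lev (u + \<eta>) n)) \<le> \<epsilon> / 3"
    using double_exceed_lev_small[OF u(2), where H = H] by blast
  obtain p' :: nat where p': "4 * (2 + 4 * real m) / \<epsilon> \<le> real p'" using real_arch_simple by blast
  \<comment> \<open>\<open>p\<close> becomes the first grid index. With \<open>q = q0 * p\<close>
    the starting time \<open>p / q\<close> equals \<open>1 / q0\<close> however fine the grid
    is.\<close>
  define p where "p = Suc (p' + Q)"
  define q where "q = q0 * p"
  have p: "p > 0" "p \<ge> Q" "4 * (2 + 4 * real m) / \<epsilon> \<le> real p" using p' by (auto simp: p_def)
  have q: "q > 0" "q \<ge> Q" "q \<ge> p" using q0 p by (auto simp: q_def intro: order.trans)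
  have pq: "real p / real q = real (Suc 0) / real q0" using p q0 by (simp add: q_def)
  have Kq: "real (H * q) / real q = real (Suc (H - 1)) / real 1" using q H by simp
  have pK: "p \<le> H * q" using q(3) H(1) by (metis One_nat_def Suc_leI le_trans mult_le_mono nat_mult_1)
  have bound: "2 * \<eta> + (2 + real p + 4 * real m) / real q + exp (- (real (H * q) / real q)) \<le> \<epsilon>"
  proof -
    have "(2 + 4 * real m) / real q \<le> (2 + 4 * real m) / real p"
      using q p by (intro divide_left_mono) auto
    also have "\<dots> \<le> \<epsilon> / 4" using p \<epsilon> by (simp add: field_simps)
    finally have 1: "(2 + 4 * real m) / real q \<le> \<epsilon> / 4" .
    have "(2 + real p + 4 * real m) / real q = (2 + 4 * real m) / real q + real p / real q"
      by (simp add: add_divide_distrib)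
    also have "real p / real q = 1 / real q0" using pq by simp
    also have "(2 + 4 * real m) / real q + 1 / real q0 \<le> \<epsilon> / 4 + \<epsilon> / 4" using 1 q0(2) by linarith
    finally have "(2 + real p + 4 * real m) / real q \<le> \<epsilon> / 2" by simp
    moreover have "exp (- (real (H * q) / real q)) \<le> \<epsilon> / 4" using H Kq by simp
    moreover have "2 * \<eta> = \<epsilon> / 4" by (simp add: \<eta>_def)
    ultimately show ?thesis by linarith
  qed
  define U where "U = w m"
  have Z1: "N.prob {\<omega> \<in> space N. \<forall>i<1. Z (real (Suc i) / real q0) \<omega> \<le> u} = G u powr (1 / real q0)"
    using Z_grid_prob[OF q0(1), of 1 "\<lambda>_. u"] by simp
  have Z2: "N.prob {\<omega> \<in> space N. \<forall>i<H. Z (real (Suc i) / real 1) \<omega> \<le> U} = G U ^ H"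
    using Z_grid_prob[of 1 H "\<lambda>_. U"] GD(2)[of U] by simp
  show thesis
  proof (rule that[OF \<eta> q(1) p(1) pK bound])
    let ?E1 = "{\<omega> \<in> space N. \<forall>i<1. Z (real (Suc i) / real q0) \<omega> \<le> u}"
    let ?E2 = "{\<omega> \<in> space N. \<forall>i<H. Z (real (Suc i) / real 1) \<omega> \<le> U}"
    let ?D = "{\<omega> \<in> space N. intermediate_level u \<eta> m q p (H * q) (\<lambda>t. Z t \<omega>)}"
    note D = Z_intermediate_level_prob[OF q(1) p(1) \<eta> Q[OF q(2)], of m]
    have E1: "?E1 \<in> N.events" using q0(1) by measurable
    have E2: "?E2 \<in> N.events" using grid_meas[of 1] by measurable
    have Zp: "Z (real p / real q) \<in> borel_measurable N" "Z (real (H * q) / real q) \<in> borel_measurable N"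
      using p q H by (auto intro!: Z_meas)
    have eq: "{\<omega> \<in> space N. \<not> good_path u \<eta> m q p (H * q) (\<lambda>t. Z t \<omega>)} =
      {\<omega> \<in> space N. Z (real p / real q) \<omega> \<le> u} \<union> {\<omega> \<in> space N. \<not> Z (real (H * q) / real q) \<omega> \<le> U} \<union> ?D"
      by (auto simp: good_path_def U_def w_def)
    show "{\<omega> \<in> space N. \<not> good_path u \<eta> m q p (H * q) (\<lambda>t. Z t \<omega>)} \<in> N.events"
    proof -
      note [measurable] = Zp
      have "{\<omega> \<in> space N. Z (real p / real q) \<omega> \<le> u} \<in> N.events" by measurable
      moreover have "{\<omega> \<in> space N. \<not> Z (real (H * q) / real q) \<omega> \<le> U} \<in> N.events" by measurable
      ultimately show ?thesis unfolding eq by (intro sets.Un D(1))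
    qed
    have "N.prob {\<omega> \<in> space N. \<not> good_path u \<eta> m q p (H * q) (\<lambda>t. Z t \<omega>)} \<le> N.prob (?E1 \<union> (space N - ?E2) \<union> ?D)"
    proof (rule N.finite_measure_mono)
      show "?E1 \<union> (space N - ?E2) \<union> ?D \<in> N.events" by (intro sets.Un sets.Diff E1 E2 D(1) sets.top)
      have "\<omega> \<notin> ?E2" if "\<omega> \<in> space N" "\<not> Z (real (H * q) / real q) \<omega> \<le> U" for \<omega>
      proof
        assume "\<omega> \<in> ?E2"
        moreover have "H - 1 < H" using H(1) by simp
        ultimately show False using that(2) unfolding Kq by blast
      qed
      moreover have "\<omega> \<in> ?E1" if "\<omega> \<in> space N" "Z (real p / real q) \<omega> \<le> u" for \<omega>
        using that unfolding pq by simp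
      ultimately show "{\<omega> \<in> space N. \<not> good_path u \<eta> m q p (H * q) (\<lambda>t. Z t \<omega>)} \<subseteq> ?E1 \<union> (space N - ?E2) \<union> ?D"
        unfolding eq by blast
    qed
    also have "\<dots> \<le> N.prob (?E1 \<union> (space N - ?E2)) + N.prob ?D"
      by (intro measure_Un_le sets.Un sets.Diff E1 E2 D(1) sets.top)
    also have "\<dots> \<le> N.prob ?E1 + N.prob (space N - ?E2) + N.prob ?D"
      by (intro add_right_mono measure_Un_le sets.Diff E1 E2 sets.top)
    also have "N.prob (space N - ?E2) = 1 - N.prob ?E2" using E2 by (rule N.prob_compl)
    finally show "N.prob {\<omega> \<in> space N. \<not> good_path u \<eta> m q p (H * q) (\<lambda>t. Z t \<omega>)} \<le> \<epsilon>"
      using D(2) u1 m \<epsilon> Z1 Z2 unfolding U_def by linarith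
    let ?F1 = "\<lambda>n. {x \<in> space M. \<forall>i<1. Y n (real (Suc i) / real q0) x \<le> u}"
    let ?F2 = "\<lambda>n. {x \<in> space M. \<forall>i<H. Y n (real (Suc i) / real 1) x \<le> U}"
    have l1: "(\<lambda>n. prob (?F1 n)) \<longlonglongrightarrow> G u powr (1 / real q0)"
      using grid_prob_tendsto[OF q0(1), of 1 "\<lambda>_. u"] unfolding Z1 by simp
    have l2: "(\<lambda>n. prob (?F2 n)) \<longlonglongrightarrow> G U ^ H"
      using grid_prob_tendsto[of 1 H "\<lambda>_. U"] unfolding Z2 by simp
    have e1: "\<forall>\<^sub>F n in sequentially. prob (?F1 n) < \<epsilon> / 3"
      by (rule order_tendstoD(2)[OF l1]) (use u1 \<epsilon> in linarith)
    have e2: "\<forall>\<^sub>F n in sequentially. 1 - \<epsilon> / 3 < prob (?F2 n)"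
      by (rule order_tendstoD(1)[OF l2]) (use m \<epsilon> in \<open>simp add: U_def\<close>)
    show "\<forall>\<^sub>F n in sequentially. \<exists>B\<in>events. prob B \<le> \<epsilon> \<and> (\<forall>x\<in>fin - B. good_path u \<eta> m q p (H * q) (\<lambda>t. Y n t x))"
      using e1 e2 Q[OF q(2)] eventually_ge_at_top[of q]
    proof eventually_elim
      case (elim n)
      let ?D' = "double_exceed n q (H * q) (lev (u + \<eta>) n)"
      have F1: "?F1 n \<in> events" and F2: "?F2 n \<in> events" by measurable
      show ?case
      proof (intro bexI[of _ "?F1 n \<union> (space M - ?F2 n) \<union> ?D'"] conjI ballI)
        show "?F1 n \<union> (space M - ?F2 n) \<union> ?D' \<in> events" by (intro sets.Un sets.Diff F1 F2 sets.top double_exceed_events)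
        have "prob (?F1 n \<union> (space M - ?F2 n) \<union> ?D') \<le> prob (?F1 n \<union> (space M - ?F2 n)) + prob ?D'"
          by (intro measure_Un_le sets.Un sets.Diff F1 F2 sets.top double_exceed_events)
        also have "\<dots> \<le> prob (?F1 n) + prob (space M - ?F2 n) + prob ?D'"
          by (intro add_right_mono measure_Un_le sets.Diff F1 F2 sets.top)
        also have "prob (space M - ?F2 n) = 1 - prob (?F2 n)" using F2 by (rule prob_compl)
        finally show "prob (?F1 n \<union> (space M - ?F2 n) \<union> ?D') \<le> \<epsilon>" using elim(1-3) by linarith
        fix x assume x: "x \<in> fin - (?F1 n \<union> (space M - ?F2 n) \<union> ?D')"
        then have xs: "x \<in> fin" "x \<in> space M" "x \<notin> ?F1 n" "x \<in> ?F2 n" "x \<notin> ?D'" by (auto simp: fin_def)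
        have "u < Y n (real p / real q) x" unfolding pq using xs(2,3) by simp
        moreover have "Y n (real (H * q) / real q) x \<le> U"
        proof -
          have "H - 1 < H" using H(1) by simp
          then show ?thesis unfolding Kq using xs(4) by blast
        qed
        moreover have "\<not> intermediate_level u \<eta> m q p (H * q) (\<lambda>t. Y n t x)"
        proof
          assume "intermediate_level u \<eta> m q p (H * q) (\<lambda>t. Y n t x)"
          then obtain i r where ir: "i \<in> {p..<H * q}" "real i / real q \<le> r" "r \<le> real (Suc i) / real q"
            "level u \<eta> m (Y n r x) \<notin> {level u \<eta> m (Y n (real i / real q) x), level u \<eta> m (Y n (real (Suc i) / real q) x)}"
            unfolding intermediate_level_def by blast
          have "1 \<le> i" "i < H * q" using ir(1) p(1) by auto
          from intermediate_level_double_exceed[OF xs(1) q(1) elim(4) this \<eta> ir(2-4)] xs(5) show False by blast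
        qed
        ultimately show "good_path u \<eta> m q p (H * q) (\<lambda>t. Y n t x)" by (simp add: good_path_def U_def w_def)
      qed
    qed
  qed
qed

text \<open>With fixed parameters both processes are close to their sampled paths, uniformly in
  large \<open>n\<close>, and the expectations of the sampled paths converge as they depend on
  finitely many levels. Only then is the tolerance refined.\<close>

lemma lipschitz_expectation_tendsto:
  assumes F: "J1_lipschitz F L" and Zm: "sample_path Z \<in> measurable N J1_borel"
  shows "(\<lambda>n. \<integral>x. F (sample_path (Y n) x) \<partial>M) \<longlonglongrightarrow> (\<integral>\<omega>. F (sample_path Z \<omega>) \<partial>N)"
proof (rule tendstoI)
  fix \<delta> :: real assume \<delta>: "\<delta> > 0"
  have L: "L > 0" using F by (simp add: J1_lipschitz_def)
  \<comment> \<open>The error \<open>3 * L * \<epsilon>\<close> of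
    \<open>lipschitz_integral_close\<close> becomes one third of \<open>\<delta>\<close>; it occurs
    once for each process.\<close>
  define \<epsilon> where "\<epsilon> = \<delta> / (9 * L)"
  have \<epsilon>: "\<epsilon> > 0" "3 * L * \<epsilon> = \<delta> / 3" using \<delta> L by (auto simp: \<epsilon>_def)
  obtain u \<eta> m q k K where p: "\<eta> > 0" "q > 0" "0 < k" "k \<le> K"
    and bd: "2 * \<eta> + (2 + real k + 4 * real m) / real q + exp (- (real K / real q)) \<le> \<epsilon>"
    and BZ: "{\<omega> \<in> space N. \<not> good_path u \<eta> m q k K (\<lambda>t. Z t \<omega>)} \<in> N.events"
      "N.prob {\<omega> \<in> space N. \<not> good_path u \<eta> m q k K (\<lambda>t. Z t \<omega>)} \<le> \<epsilon>"
    and BY: "\<forall>\<^sub>F n in sequentially. \<exists>B\<in>events. prob B \<le> \<epsilon> \<and> (\<forall>x\<in>fin - B. good_path u \<eta> m q k K (\<lambda>t. Y n t x))"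
    by (rule approximation_parameters[OF \<epsilon>(1)])
  define gY where "gY n x = levels_path u \<eta> q k K (\<lambda>j. level u \<eta> m (Y n (real (Suc j) / real q) x))" for n x
  define gZ where "gZ \<omega> = levels_path u \<eta> q k K (\<lambda>j. level u \<eta> m (Z (real (Suc j) / real q) \<omega>))" for \<omega>
  have meas: "(\<lambda>x. F (levels_path u \<eta> q k K (\<lambda>j. f j x))) \<in> borel_measurable P"
    if [measurable]: "\<And>j. f j \<in> measurable P (count_space UNIV)" for f :: "nat \<Rightarrow> 'c \<Rightarrow> nat" and P
  proof -
    have "levels_path u \<eta> q k K (\<lambda>j. f j x) = levels_path u \<eta> q k K (\<lambda>j. map (\<lambda>j. f j x) [0..<K] ! j)" for x
      by (rule levels_path_cong[OF p(3,4)]) simp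
    moreover have "(\<lambda>x. F (levels_path u \<eta> q k K (\<lambda>j. map (\<lambda>j. f j x) [0..<K] ! j))) \<in> borel_measurable P"
      by (rule measurable_compose[OF measurable_list_count_space[of f], of _ "\<lambda>zs. F (levels_path u \<eta> q k K (\<lambda>j. zs ! j))"]) auto
    ultimately show ?thesis by (simp only:)
  qed
  have FgY: "(\<lambda>x. F (gY n x)) \<in> borel_measurable M" for n unfolding gY_def by (rule meas) measurable
  have FgZ: "(\<lambda>\<omega>. F (gZ \<omega>)) \<in> borel_measurable N"
    unfolding gZ_def by (rule meas) (use p(2) in measurable)
  have cong: "levels_path u \<eta> q k K v = levels_path u \<eta> q k K (\<lambda>i. if i < K then v i else 0)" for v
    by (rule levels_path_cong[OF p(3,4)]) simp
  have mid: "(\<lambda>n. \<integral>x. F (gY n x) \<partial>M) \<longlonglongrightarrow> (\<integral>\<omega>. F (gZ \<omega>) \<partial>N)"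
    unfolding gY_def gZ_def cong[of "\<lambda>j. level u \<eta> m (_ j)"]
    by (rule level_expectation_tendsto[OF p(2,1), of "\<lambda>v. F (levels_path u \<eta> q k K v)" K u m])
  have Zclose: "\<bar>(\<integral>\<omega>. F (sample_path Z \<omega>) \<partial>N) - (\<integral>\<omega>. F (gZ \<omega>) \<partial>N)\<bar> \<le> \<delta> / 3"
    unfolding \<epsilon>(2)[symmetric]
  proof (rule lipschitz_integral_close[OF _ F Zm _ FgZ BZ])
    show "prob_space N" by unfold_locales
    show "gZ \<omega> \<in> skorokhod_space" for \<omega> unfolding gZ_def by (rule levels_path_in_skorokhod)
    show "AE \<omega> in N. \<omega> \<notin> {\<omega> \<in> space N. \<not> good_path u \<eta> m q k K (\<lambda>t. Z t \<omega>)} \<longrightarrow> J1_dist (sample_path Z \<omega>) (gZ \<omega>) \<le> \<epsilon>"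
    proof (intro AE_I2 impI)
      fix \<omega> assume \<omega>: "\<omega> \<in> space N" "\<omega> \<notin> {\<omega> \<in> space N. \<not> good_path u \<eta> m q k K (\<lambda>t. Z t \<omega>)}"
      have "sample_path Z \<omega> \<in> skorokhod_space" using ext \<omega>(1) by (simp add: extremal_process_def)
      from J1_dist_levels_path[OF p this Z_mono[OF \<omega>(1)]] \<omega> bd
      show "J1_dist (sample_path Z \<omega>) (gZ \<omega>) \<le> \<epsilon>" unfolding gZ_def by fastforce
    qed
  qed
  have "\<forall>\<^sub>F n in sequentially. dist (\<integral>x. F (gY n x) \<partial>M) (\<integral>\<omega>. F (gZ \<omega>) \<partial>N) < \<delta> / 3"
    by (rule tendstoD[OF mid]) (use \<delta> in simp)
  then show "\<forall>\<^sub>F n in sequentially. dist (\<integral>x. F (sample_path (Y n) x) \<partial>M) (\<integral>\<omega>. F (sample_path Z \<omega>) \<partial>N) < \<delta>"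
    using BY eventually_gt_at_top[of 0]
  proof eventually_elim
    case (elim n)
    then obtain B where B: "B \<in> events" "prob B \<le> \<epsilon>" "\<And>x. x \<in> fin - B \<Longrightarrow> good_path u \<eta> m q k K (\<lambda>t. Y n t x)" by blast
    have "\<bar>(\<integral>x. F (sample_path (Y n) x) \<partial>M) - (\<integral>x. F (gY n x) \<partial>M)\<bar> \<le> \<delta> / 3"
      unfolding \<epsilon>(2)[symmetric]
    proof (rule lipschitz_integral_close[OF _ F Y_measurable_J1 _ FgY B(1,2)])
      show "prob_space M" by unfold_locales
      show "gY n x \<in> skorokhod_space" for x unfolding gY_def by (rule levels_path_in_skorokhod)
      show "AE x in M. x \<notin> B \<longrightarrow> J1_dist (sample_path (Y n) x) (gY n x) \<le> \<epsilon>"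
        using AE_fin
      proof eventually_elim
        case (elim x)
        have "x \<notin> B \<Longrightarrow> J1_dist (sample_path (Y n) x) (gY n x) \<le> 2 * \<eta> + (2 + real k + 4 * real m) / real q + exp (- (real K / real q))"
          unfolding gY_def
          by (rule J1_dist_levels_path[OF p sample_path_Y_in_skorokhod Y_mono[OF elim \<open>0 < n\<close>] B(3)]) (use elim in auto)
        then show ?case using bd by fastforce
      qed
    qed
    then show ?case using elim(1) Zclose unfolding dist_real_def by linarith
  qed
qed

lemma converges_weakly:
  assumes "sample_path Z \<in> measurable N J1_borel"
  shows "converges_weakly_J1 M Y N Z"
  unfolding converges_weakly_J1_def
proof (intro conjI allI impI)
  fix H :: "(real \<Rightarrow> real) \<Rightarrow> real"
  assume H: "continuous_map J1_topology euclideanreal H \<and> bounded (H ` skorokhod_space)"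
  show "(\<lambda>n. \<integral>\<omega>. H (sample_path (Y n) \<omega>) \<partial>M) \<longlonglongrightarrow> (\<integral>\<omega>. H (sample_path Z \<omega>) \<partial>N)"
    by (rule J1_weak_convergence_lipschitz[OF _ _ Y_measurable_J1 assms lipschitz_expectation_tendsto[OF _ assms]])
       (use H prob_space_axioms N.prob_space_axioms in auto)
qed (rule Y_measurable_J1 assms)+

text \<open>Off a null set the paths are limits of grid paths; on the null set they are replaced by \<open>0\<close>.\<close>

lemma measurable_version:
  obtains Z' where "extremal_limit M T \<phi> X a b G N Z'" "sample_path Z' \<in> measurable N J1_borel"
proof -
  define R where "R j u \<eta> m q k K \<longleftrightarrow> 0 < \<eta> \<and> 0 < q \<and> 0 < k \<and> k \<le> K \<and>
     2 * \<eta> + (2 + real k + 4 * real m) / real q + exp (- (real K / real q)) \<le> (1 / 2) ^ j \<and>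
    {\<omega> \<in> space N. \<not> good_path u \<eta> m q k K (\<lambda>t. Z t \<omega>)} \<in> N.events \<and>
    N.prob {\<omega> \<in> space N. \<not> good_path u \<eta> m q k K (\<lambda>t. Z t \<omega>)} \<le> (1 / 2) ^ j"
    for j :: nat and u \<eta> :: real and m q k K :: nat
  have "\<exists>u \<eta> m q k K. R j u \<eta> m q k K" for j
  proof (rule approximation_parameters[of "(1/2)^j"])
    show "\<exists>u \<eta> m q k K. R j u \<eta> m q k K"
      if "0 < \<eta>" "0 < q" "0 < k" "k \<le> K"
        "2 * \<eta> + (2 + real k + 4 * real m) / real q + exp (- (real K / real q)) \<le> (1 / 2) ^ j"
        "{\<omega> \<in> space N. \<not> good_path u \<eta> m q k K (\<lambda>t. Z t \<omega>)} \<in> N.events"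
        "N.prob {\<omega> \<in> space N. \<not> good_path u \<eta> m q k K (\<lambda>t. Z t \<omega>)} \<le> (1 / 2) ^ j"
      for u \<eta> m q k K
      unfolding R_def using that by (intro exI conjI)
  qed simp
  then obtain u \<eta> m q k K where R: "\<And>j. R j (u j) (\<eta> j) (m j) (q j) (k j) (K j)" by metis
  have p: "0 < \<eta> j" "0 < q j" "0 < k j" "k j \<le> K j"
    and bd: "2 * \<eta> j + (2 + real (k j) + 4 * real (m j)) / real (q j) + exp (- (real (K j) / real (q j))) \<le> (1 / 2) ^ j"
    and B: "{\<omega> \<in> space N. \<not> good_path (u j) (\<eta> j) (m j) (q j) (k j) (K j) (\<lambda>t. Z t \<omega>)} \<in> N.events"
    and PB: "N.prob {\<omega> \<in> space N. \<not> good_path (u j) (\<eta> j) (m j) (q j) (k j) (K j) (\<lambda>t. Z t \<omega>)} \<le> (1 / 2) ^ j" for j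
    using R[of j] unfolding R_def by simp_all
  define Bj where "Bj j = {\<omega> \<in> space N. \<not> good_path (u j) (\<eta> j) (m j) (q j) (k j) (K j) (\<lambda>t. Z t \<omega>)}" for j
  have Bj [measurable]: "Bj j \<in> N.events" for j unfolding Bj_def by (rule B)
  define A where "A = {\<omega> \<in> space N. \<forall>\<^sub>F j in sequentially. \<omega> \<notin> Bj j}"
  have A [measurable]: "A \<in> N.events" unfolding A_def eventually_sequentially by measurable
  \<comment> \<open>The bad events have summable probabilities. By Borel-Cantelli almost every path
    is eventually good, and from then on it is within \<open>(1 / 2) ^ j\<close> of its grid
    path.\<close>
  have AE_A: "AE \<omega> in N. \<omega> \<in> A"
  proof -
    have "AE \<omega> in N. \<forall>\<^sub>F j in sequentially. \<omega> \<in> space N - Bj j"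
    proof (rule borel_cantelli_AE1)
      show "summable (\<lambda>j. N.prob (Bj j))"
        by (rule summable_comparison_test'[OF summable_geometric[of "1 / 2"], of 0]) (use PB in \<open>auto simp: Bj_def\<close>)
    qed (auto simp: N.emeasure_eq_measure)
    then show ?thesis using AE_space by eventually_elim (auto simp: A_def elim: eventually_mono)
  qed
  define Z' where "Z' t \<omega> = (if \<omega> \<in> A then Z t \<omega> else 0)" for t \<omega>
  have zero: "sample_path Z' \<omega> = step_path 0 (\<lambda>_. 0)" if "\<omega> \<notin> A" for \<omega>
    using that by (auto simp: sample_path_def step_path_def Z'_def fun_eq_iff restrict_def)
  have same: "sample_path Z' \<omega> = sample_path Z \<omega>" if "\<omega> \<in> A" for \<omega>
    using that by (simp add: sample_path_def Z'_def)
  have sk: "sample_path Z' \<omega> \<in> skorokhod_space" if "\<omega> \<in> space N" for \<omega>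
    using ext that zero[of \<omega>] same[of \<omega>] step_path_in_skorokhod[of 0] by (cases "\<omega> \<in> A") (auto simp: extremal_process_def)
  have ext': "extremal_process G N Z'"
    unfolding extremal_process_def
  proof (intro conjI allI impI ballI)
    show "prob_space N" by unfold_locales
    show Z'_meas: "Z' t \<in> borel_measurable N" if "t > 0" for t
      unfolding Z'_def[abs_def] by (rule measurable_If_set[OF Z_meas[OF that] measurable_const]) auto
    fix r :: nat and t v :: "nat \<Rightarrow> real"
    assume r: "1 \<le> r" and t: "0 < t 1 \<and> strict_mono_on {1..r} t"
    have tpos: "0 < t i" if "i \<in> {1..r}" for i
    proof -
      have "t 1 \<le> t i" using that r by (intro monotone_onD[OF strict_mono_on_imp_mono_on[OF conjunct2[OF t]]]) auto
      then show ?thesis using t by simp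
    qed
    have ms: "{\<omega> \<in> space N. \<forall>i\<in>{1..r}. W (t i) \<omega> \<le> v i} \<in> N.events" if "\<And>t. t > 0 \<Longrightarrow> W t \<in> borel_measurable N" for W
    proof (rule sets.sets_Collect_finite_All)
      fix i assume "i \<in> {1..r}"
      then have [measurable]: "W (t i) \<in> borel_measurable N" using that tpos by blast
      show "{\<omega> \<in> space N. W (t i) \<omega> \<le> v i} \<in> N.events" by measurable
    qed simp
    have "N.prob {\<omega> \<in> space N. \<forall>i\<in>{1..r}. Z' (t i) \<omega> \<le> v i} = N.prob {\<omega> \<in> space N. \<forall>i\<in>{1..r}. Z (t i) \<omega> \<le> v i}"
    proof (rule measure_eq_AE)
      show "AE \<omega> in N. (\<omega> \<in> {\<omega> \<in> space N. \<forall>i\<in>{1..r}. Z' (t i) \<omega> \<le> v i}) = (\<omega> \<in> {\<omega> \<in> space N. \<forall>i\<in>{1..r}. Z (t i) \<omega> \<le> v i})"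
        using AE_A by eventually_elim (simp add: Z'_def)
    qed (rule ms Z'_meas Z_meas | assumption)+
    also have "\<dots> = (\<Prod>i = 1..r. G (MIN j\<in>{i..r}. v j) powr (t i - (if i = 1 then 0 else t (i - 1))))"
      using ext r t unfolding extremal_process_def by blast
    finally show "N.prob {\<omega> \<in> space N. \<forall>i\<in>{1..r}. Z' (t i) \<omega> \<le> v i} =
      (\<Prod>i = 1..r. G (MIN j\<in>{i..r}. v j) powr (t i - (if i = 1 then 0 else t (i - 1))))" .
  qed (rule sk)
  have "extremal_limit M T \<phi> X a b G N Z'"
    by unfold_locales (use ext' Z_mono in \<open>auto simp: Z'_def\<close>)
  moreover have "sample_path Z' \<in> measurable N J1_borel"
  proof (rule measurable_J1_limit_countable)
    \<comment> \<open>The empty list codes the zero path on the null set; elsewhere the list has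
      positive length \<open>K j\<close>, so the two cases cannot be confused.\<close>
    define g where "g j \<omega> = (if \<omega> \<in> A then map (\<lambda>i. level (u j) (\<eta> j) (m j) (Z (real (Suc i) / real (q j)) \<omega>)) [0..<K j] else [])" for j \<omega>
    define F where "F j zs = (if zs = [] then step_path 0 (\<lambda>_. 0) else levels_path (u j) (\<eta> j) (q j) (k j) (K j) (\<lambda>i. zs ! i))" for j zs
    show "F j zs \<in> skorokhod_space" for j zs
      unfolding F_def using step_path_in_skorokhod[of 0] levels_path_in_skorokhod by simp
    show "sample_path Z' \<omega> \<in> skorokhod_space" if "\<omega> \<in> space N" for \<omega> by (rule sk[OF that])
    show "g j \<in> measurable N (count_space UNIV)" for j
      unfolding g_def[abs_def]
    proof (rule measurable_If_set)
      show "(\<lambda>\<omega>. map (\<lambda>i. level (u j) (\<eta> j) (m j) (Z (real (Suc i) / real (q j)) \<omega>)) [0..<K j]) \<in> measurable N (count_space UNIV)"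
        by (rule measurable_list_count_space) (use p(2)[of j] in measurable)
    qed auto
    fix \<omega> assume \<omega>: "\<omega> \<in> space N"
    show "(\<lambda>j. J1_dist (F j (g j \<omega>)) (sample_path Z' \<omega>)) \<longlonglongrightarrow> 0"
    proof (cases "\<omega> \<in> A")
      case False
      then show ?thesis by (simp add: F_def g_def zero J1_dist_refl)
    next
      case True
      have Zsk: "sample_path Z \<omega> \<in> skorokhod_space" using sk[OF \<omega>] same[OF True] by simp
      show ?thesis
      proof (rule real_tendsto_sandwich[where f = "\<lambda>_. 0" and h = "\<lambda>j. (1 / 2) ^ j"])
        have "\<forall>\<^sub>F j in sequentially. \<omega> \<notin> Bj j" using True by (simp add: A_def)
        then show "\<forall>\<^sub>F j in sequentially. J1_dist (F j (g j \<omega>)) (sample_path Z' \<omega>) \<le> (1 / 2) ^ j"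
        proof eventually_elim
          case (elim j)
          have "F j (g j \<omega>) = levels_path (u j) (\<eta> j) (q j) (k j) (K j) (\<lambda>i. map (\<lambda>i. level (u j) (\<eta> j) (m j) (Z (real (Suc i) / real (q j)) \<omega>)) [0..<K j] ! i)"
            using True p(3)[of j] p(4)[of j] by (simp add: F_def g_def)
          also have "\<dots> = levels_path (u j) (\<eta> j) (q j) (k j) (K j) (\<lambda>i. level (u j) (\<eta> j) (m j) (Z (real (Suc i) / real (q j)) \<omega>))"
            by (rule levels_path_cong[OF p(3,4)]) simp
          finally have F: "F j (g j \<omega>) = \<dots>" .
          have good: "good_path (u j) (\<eta> j) (m j) (q j) (k j) (K j) (\<lambda>t. Z t \<omega>)" using elim \<omega> by (simp add: Bj_def)
          have "J1_dist (sample_path Z \<omega>) (F j (g j \<omega>)) \<le> (1 / 2) ^ j"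
            unfolding F by (rule order.trans[OF J1_dist_levels_path[OF p Zsk Z_mono[OF \<omega>] good] bd])
          then show ?case by (simp add: same[OF True] J1.commute)
        qed
        show "(\<lambda>j. (1 / 2) ^ j :: real) \<longlonglongrightarrow> 0" by (rule LIMSEQ_realpow_zero) auto
      qed auto
    qed
  qed
  ultimately show thesis by (rule that)
qed

end

section \<open>Existence of extremal processes\<close>

text \<open>For \<open>c \<le> 0\<close> a point mass is the default, so that the family consists of
  probability measures for all indices, as infinite products demand.\<close>

definition power_dist :: "(real \<Rightarrow> real) \<Rightarrow> real \<Rightarrow> real measure" where
  "power_dist F c = (if c > 0 then interval_measure (\<lambda>x. F x powr c) else return borel 0)"

lemma power_dist:
  assumes F: "distribution_function F"
  shows "real_distribution (power_dist F c)" "c > 0 \<Longrightarrow> measure (power_dist F c) {..x} = F x powr c"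
proof -
  note D = distribution_functionD[OF F]
  have mono: "F x powr c \<le> F y powr c" if "c > 0" "x \<le> y" for x y
    using monoD[OF D(1) that(2)] D(2)[of x] that(1) by (intro powr_mono2) auto
  have rc: "continuous (at_right x) (\<lambda>x. F x powr c)" if "c > 0" for x
    unfolding continuous_within using D(4)[of x] that D(2)
    by (intro tendsto_powr') (auto intro: always_eventually)
  have bot: "((\<lambda>x. F x powr c) \<longlongrightarrow> 0) at_bot" if "c > 0"
  proof -
    have "((\<lambda>x. F x powr c) \<longlongrightarrow> 0 powr c) at_bot"
      using D(5) that D(2) by (intro tendsto_powr') (auto intro: always_eventually)
    then show ?thesis by simp
  qed
  have top: "((\<lambda>x. F x powr c) \<longlongrightarrow> 1) at_top"
  proof -
    have "((\<lambda>x. F x powr c) \<longlongrightarrow> 1 powr c) at_top"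
      using D(6) by (intro tendsto_powr) auto
    then show ?thesis by simp
  qed
  show "real_distribution (power_dist F c)"
  proof (cases "c > 0")
    case True
    then show ?thesis using real_distribution_interval_measure[OF mono rc bot top] by (simp add: power_dist_def)
  next
    case False
    then show ?thesis
      by (auto simp: power_dist_def real_distribution_def real_distribution_axioms_def prob_space_return)
  qed
  show "measure (power_dist F c) {..x} = F x powr c" if c: "c > 0"
    using fun_cong[OF cdf_interval_measure[OF mono rc bot], of x] c by (simp add: power_dist_def cdf_def)
qed

definition pred_time :: "real set \<Rightarrow> real \<Rightarrow> real" where
  "pred_time J t = Max (insert 0 {s \<in> J. s < t})"

lemma pred_time_less: "finite J \<Longrightarrow> t > 0 \<Longrightarrow> pred_time J t < t"
  by (simp add: pred_time_def)

text \<open>The law at the times \<open>J\<close>: running maxima of independent variables, the one at \<open>t\<close> with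
  distribution function \<open>F\<close> raised to the distance of \<open>t\<close> to the preceding time.\<close>

definition extremal_fdd :: "(real \<Rightarrow> real) \<Rightarrow> real set \<Rightarrow> (real \<Rightarrow> real) measure" where
  "extremal_fdd F J = distr (PiM J (\<lambda>t. power_dist F (t - pred_time J t))) (PiM J (\<lambda>_. borel))
     (\<lambda>w. \<lambda>t\<in>J. Max (w ` {s \<in> J. s \<le> t}))"

text \<open>The variable at \<open>s\<close> enters every running maximum from \<open>s\<close> on,
  hence the minimum of the later thresholds. Thresholds live on \<open>H\<close> and variables on
  \<open>J\<close>; keeping the two apart allows times to be added to \<open>J\<close> with the box
  fixed.\<close>

definition extremal_cdf :: "(real \<Rightarrow> real) \<Rightarrow> real set \<Rightarrow> real set \<Rightarrow> (real \<Rightarrow> real) \<Rightarrow> real" where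
  "extremal_cdf F J H u = (\<Prod>s\<in>J. if \<exists>t\<in>H. s \<le> t then F (Min (u ` {t \<in> H. s \<le> t})) powr (s - pred_time J s) else 1)"

text \<open>A new time splits the increment that ends at the next time of \<open>J\<close>. Both
  parts see the same thresholds, as \<open>H\<close> has no time in between, so their powers
  multiply to the old factor. A new last time sees no threshold at all.\<close>

lemma extremal_cdf_insert:
  assumes J: "finite J" "t0 \<notin> J" "H \<subseteq> J" and t0: "0 \<le> t0"
  shows "extremal_cdf F (insert t0 J) H u = extremal_cdf F J H u"
proof -
  let ?J = "insert t0 J"
  define f where "f J s = (if \<exists>t\<in>H. s \<le> t then F (Min (u ` {t \<in> H. s \<le> t})) powr (s - pred_time J s) else 1)" for J s
  have cdf: "extremal_cdf F J H u = (\<Prod>s\<in>J. f J s)" for J by (simp add: extremal_cdf_def f_def)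
  show ?thesis
  proof (cases "\<exists>s\<in>J. t0 < s")
    case False
    then have "pred_time ?J s = pred_time J s" if "s \<in> J" for s
      using that J(2) unfolding pred_time_def by (intro arg_cong[where f = "\<lambda>A. Max (insert 0 A)"]) auto
    then have "(\<Prod>s\<in>J. f ?J s) = (\<Prod>s\<in>J. f J s)" by (intro prod.cong) (auto simp: f_def)
    moreover have "f ?J t0 = 1"
    proof -
      have "\<not> t0 \<le> t" if "t \<in> H" for t
        using that False J(2,3) by (metis le_less subsetD)
      then show ?thesis by (auto simp: f_def)
    qed
    ultimately show ?thesis using J by (simp add: cdf)
  next
    case True
    define t1 where "t1 = Min {s \<in> J. t0 < s}"
    have fin: "finite {s \<in> J. t0 < s}" "{s \<in> J. t0 < s} \<noteq> {}" using True J by auto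
    have t1: "t1 \<in> J" "t0 < t1" using Min_in[OF fin] by (auto simp: t1_def)
    have t1_le: "t1 \<le> s" if "s \<in> J" "t0 < s" for s using that fin by (simp add: t1_def)
    have ps: "pred_time ?J s = pred_time J s" if s: "s \<in> J" "s \<noteq> t1" for s
    proof (cases "s < t0")
      case True
      then show ?thesis unfolding pred_time_def by (intro arg_cong[where f = "\<lambda>A. Max (insert 0 A)"]) auto
    next
      case False
      then have "t0 < s" using s J by (cases "s = t0") auto
      then have ts: "t1 < s" using t1_le s by force
      have "Max (insert 0 {r \<in> ?J. r < s}) = Max (insert t0 (insert 0 {r \<in> J. r < s}))"
        using \<open>t0 < s\<close> by (intro arg_cong[where f = Max]) auto
      also have "\<dots> = max t0 (Max (insert 0 {r \<in> J. r < s}))" using J by (intro Max_insert) auto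
      also have "\<dots> = Max (insert 0 {r \<in> J. r < s})"
      proof -
        have "t1 \<le> Max (insert 0 {r \<in> J. r < s})" using J t1 ts by (intro Max_ge) auto
        then show ?thesis using t1 by simp
      qed
      finally show ?thesis by (simp add: pred_time_def)
    qed
    have p0: "pred_time ?J t0 = pred_time J t1"
    proof -
      have "{s \<in> ?J. s < t0} = {s \<in> J. s < t1}"
        using J t1 t1_le by (auto dest: less_le_trans) (metis leI le_less_trans less_irrefl linorder_neqE_linordered_idom)
      then show ?thesis by (simp add: pred_time_def)
    qed
    have He: "{t \<in> H. t0 \<le> t} = {t \<in> H. t1 \<le> t}"
      using J t1 t1_le by (auto simp: le_less)
    have "f ?J t0 * f ?J t1 = f J t1"
    proof -
      have p1: "pred_time ?J t1 = t0"
        unfolding pred_time_def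
      proof (rule Max_eqI)
        fix r assume "r \<in> insert 0 {s \<in> ?J. s < t1}"
        then show "r \<le> t0" using t0 t1_le[of r] by force
      qed (use J t1 in auto)
      show ?thesis
      proof (cases "\<exists>t\<in>H. t1 \<le> t")
        case True
        then have "\<exists>t\<in>H. t0 \<le> t" using t1 by (meson less_imp_le order.trans)
        then show ?thesis using True by (simp add: f_def p0 p1 He powr_add[symmetric])
      next
        case False
        then have "\<not> (\<exists>t\<in>H. t0 \<le> t)" using He by blast
        then show ?thesis using False by (simp add: f_def)
      qed
    qed
    moreover have "(\<Prod>s\<in>J - {t1}. f ?J s) = (\<Prod>s\<in>J - {t1}. f J s)"
      using ps by (intro prod.cong) (auto simp: f_def)
    moreover have "(\<Prod>s\<in>J. g s) = g t1 * (\<Prod>s\<in>J - {t1}. g s)" for g :: "real \<Rightarrow> real"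
      using J t1 by (intro prod.remove) auto
    ultimately show ?thesis using J by (simp add: cdf)
  qed
qed

lemma extremal_cdf_superset:
  assumes "finite J" "H \<subseteq> J" "J \<subseteq> J'" "finite J'" "J' \<subseteq> {0<..}"
  shows "extremal_cdf F J' H u = extremal_cdf F J H u"
proof -
  have "extremal_cdf F (J \<union> D) H u = extremal_cdf F J H u" if "finite D" "D \<inter> J = {}" "D \<subseteq> {0<..}" for D
    using that
  proof (induction D rule: finite_induct)
    case (insert t D)
    have "extremal_cdf F (insert t (J \<union> D)) H u = extremal_cdf F (J \<union> D) H u"
      using insert assms by (intro extremal_cdf_insert) auto
    then show ?case using insert by simp
  qed simp
  from this[of "J' - J"] assms show ?thesis by (simp add: Un_absorb1 Int_commute Diff_disjoint subset_eq)
qed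

lemma sets_extremal_fdd [simp]: "sets (extremal_fdd F J) = sets (PiM J (\<lambda>_. borel))"
  by (simp add: extremal_fdd_def)

lemma space_extremal_fdd [simp]: "space (extremal_fdd F J) = space (PiM J (\<lambda>_. borel))"
  by (simp add: extremal_fdd_def)

lemma running_max_measurable:
  assumes "finite J"
  shows "(\<lambda>w. \<lambda>t\<in>J. Max (w ` {s \<in> J. s \<le> t})) \<in> measurable (PiM J (\<lambda>t. power_dist F (c t))) (PiM J (\<lambda>_. borel :: real measure))"
proof (rule measurable_restrict)
  fix t assume "t \<in> J"
  have s: "sets (power_dist F c) = sets borel" for c by (simp add: power_dist_def)
  have "(\<lambda>w. w i) \<in> borel_measurable (PiM J (\<lambda>t. power_dist F (c t)))" if "i \<in> J" for i
    using measurable_component_singleton[OF that, of "\<lambda>t. power_dist F (c t)"]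
    by (simp add: measurable_cong_sets[OF refl s])
  then show "(\<lambda>w. Max (w ` {s \<in> J. s \<le> t})) \<in> borel_measurable (PiM J (\<lambda>t. power_dist F (c t)))"
    using assms by (intro borel_measurable_Max) auto
qed

lemma prob_space_extremal_fdd:
  assumes F: "distribution_function F" and J: "finite J"
  shows "prob_space (extremal_fdd F J)"
  unfolding extremal_fdd_def
proof (rule prob_space.prob_space_distr[OF _ running_max_measurable[OF J]])
  show "prob_space (PiM J (\<lambda>t. power_dist F (t - pred_time J t)))"
    by (rule prob_space_PiM) (use power_dist(1)[OF F] in \<open>auto simp: real_distribution_def\<close>)
qed

text \<open>Exchanging the quantifiers over thresholds and variables turns a box for the running
  maxima into a box for the independent variables, whose probability is a product.\<close>

lemma extremal_fdd_box:
  assumes F: "distribution_function F" and J: "finite J" "J \<subseteq> {0<..}" "H \<subseteq> J"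
  shows "measure (extremal_fdd F J) {w \<in> space (PiM J (\<lambda>_. borel)). \<forall>t\<in>H. w t \<le> u t} = extremal_cdf F J H u"
proof -
  let ?\<nu> = "\<lambda>t. power_dist F (t - pred_time J t)"
  have s: "sets (power_dist F c) = sets borel" "space (power_dist F c) = UNIV" for c
    by (simp_all add: power_dist_def)
  have "product_prob_space ?\<nu>"
    by (rule product_prob_spaceI) (use power_dist(1)[OF F] in \<open>auto simp: real_distribution_def\<close>)
  then have fp: "finite_product_prob_space ?\<nu> J"
    using J(1) by (simp add: finite_product_prob_space_def finite_product_sigma_finite_def
      finite_product_sigma_finite_axioms_def product_prob_space_def)
  define A where "A s = (if \<exists>t\<in>H. s \<le> t then {..Min (u ` {t \<in> H. s \<le> t})} else UNIV)" for s
  have fH: "finite H" using J finite_subset by blast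
  have box: "{w \<in> space (PiM J (\<lambda>_. borel)). \<forall>t\<in>H. w t \<le> u t} \<in> sets (PiM J (\<lambda>_. borel :: real measure))"
  proof (rule sets.sets_Collect_finite_All[OF _ fH])
    fix t assume "t \<in> H"
    then have [measurable]: "(\<lambda>w. w t) \<in> borel_measurable (PiM J (\<lambda>_. borel :: real measure))"
      using J by (intro measurable_component_singleton) auto
    show "{w \<in> space (PiM J (\<lambda>_. borel)). w t \<le> u t} \<in> sets (PiM J (\<lambda>_. borel :: real measure))" by measurable
  qed
  have "measure (extremal_fdd F J) {w \<in> space (PiM J (\<lambda>_. borel)). \<forall>t\<in>H. w t \<le> u t} =
      measure (PiM J ?\<nu>) ((\<lambda>w. \<lambda>t\<in>J. Max (w ` {s \<in> J. s \<le> t})) -` {w \<in> space (PiM J (\<lambda>_. borel)). \<forall>t\<in>H. w t \<le> u t} \<inter> space (PiM J ?\<nu>))"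
    unfolding extremal_fdd_def by (rule measure_distr[OF running_max_measurable[OF J(1)] box])
  also have "(\<lambda>w. \<lambda>t\<in>J. Max (w ` {s \<in> J. s \<le> t})) -` {w \<in> space (PiM J (\<lambda>_. borel)). \<forall>t\<in>H. w t \<le> u t} \<inter> space (PiM J ?\<nu>) = PiE J A"
  proof -
    have "(\<forall>t\<in>H. (\<lambda>t\<in>J. Max (w ` {s \<in> J. s \<le> t})) t \<le> u t) \<longleftrightarrow> (\<forall>s\<in>J. w s \<in> A s)" for w
    proof -
      have "(\<forall>t\<in>H. (\<lambda>t\<in>J. Max (w ` {s \<in> J. s \<le> t})) t \<le> u t) \<longleftrightarrow> (\<forall>t\<in>H. Max (w ` {s \<in> J. s \<le> t}) \<le> u t)"
        using J by (intro ball_cong) auto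
      also have "\<dots> \<longleftrightarrow> (\<forall>t\<in>H. \<forall>s\<in>J. s \<le> t \<longrightarrow> w s \<le> u t)"
      proof (rule ball_cong[OF refl])
        fix t assume "t \<in> H"
        then have "w ` {s \<in> J. s \<le> t} \<noteq> {}" "finite (w ` {s \<in> J. s \<le> t})" using J by auto
        then show "Max (w ` {s \<in> J. s \<le> t}) \<le> u t \<longleftrightarrow> (\<forall>s\<in>J. s \<le> t \<longrightarrow> w s \<le> u t)" by (subst Max_le_iff) auto
      qed
      also have "\<dots> \<longleftrightarrow> (\<forall>s\<in>J. \<forall>t\<in>H. s \<le> t \<longrightarrow> w s \<le> u t)" by blast
      also have "\<dots> \<longleftrightarrow> (\<forall>s\<in>J. w s \<in> A s)"
      proof (rule ball_cong[OF refl])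
        fix s assume "s \<in> J"
        show "(\<forall>t\<in>H. s \<le> t \<longrightarrow> w s \<le> u t) \<longleftrightarrow> w s \<in> A s"
        proof (cases "\<exists>t\<in>H. s \<le> t")
          case True
          then have "u ` {t \<in> H. s \<le> t} \<noteq> {}" "finite (u ` {t \<in> H. s \<le> t})" using fH by auto
          then have "w s \<le> Min (u ` {t \<in> H. s \<le> t}) \<longleftrightarrow> (\<forall>t\<in>H. s \<le> t \<longrightarrow> w s \<le> u t)" by (subst Min_ge_iff) auto
          then show ?thesis using True by (simp add: A_def)
        qed (auto simp: A_def)
      qed
      finally show ?thesis .
    qed
    then show ?thesis by (auto simp: space_PiM s PiE_iff)
  qed
  also have "measure (PiM J ?\<nu>) (PiE J A) = (\<Prod>s\<in>J. measure (?\<nu> s) (A s))"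
    by (rule finite_product_prob_space.finite_measure_PiM_emb[OF fp]) (auto simp: s A_def)
  also have "\<dots> = extremal_cdf F J H u"
    unfolding extremal_cdf_def
  proof (rule prod.cong[OF refl])
    fix t assume t: "t \<in> J"
    have c: "t - pred_time J t > 0" using t J pred_time_less[of J t] by auto
    interpret real_distribution "?\<nu> t" by (rule power_dist(1)[OF F])
    have "prob UNIV = 1" using prob_space by (simp add: s)
    then show "measure (?\<nu> t) (A t) = (if \<exists>ta\<in>H. t \<le> ta then F (Min (u ` {ta \<in> H. t \<le> ta})) powr (t - pred_time J t) else 1)"
      using power_dist(2)[OF F c] by (simp add: A_def)
  qed
  finally show ?thesis .
qed

text \<open>Products of half-lines form an intersection-stable generator of the product
  sigma-algebra and contain an increasing sequence that exhausts the space.\<close>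

lemma measure_eqI_PiM_atMost:
  fixes M N :: "('i \<Rightarrow> real) measure"
  assumes I: "finite I" and M: "prob_space M" "sets M = sets (PiM I (\<lambda>_. borel))"
    and N: "prob_space N" "sets N = sets (PiM I (\<lambda>_. borel))"
    and eq: "\<And>u. measure M {w \<in> space (PiM I (\<lambda>_. borel)). \<forall>t\<in>I. w t \<le> u t} = measure N {w \<in> space (PiM I (\<lambda>_. borel)). \<forall>t\<in>I. w t \<le> u t}"
  shows "M = N"
proof -
  interpret M: prob_space M by fact
  interpret N: prob_space N by fact
  let ?P = "{PiE I A | A. \<forall>i\<in>I. A i \<in> range (\<lambda>a::real. {..a})}"
  have sig: "sets (PiM I (\<lambda>_. borel :: real measure)) = sigma_sets (space (PiM I (\<lambda>_. borel :: real measure))) ?P"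
  proof -
    have "sets (PiM I (\<lambda>_. sigma UNIV (range (\<lambda>a::real. {..a})))) =
      sets (sigma (PiE I (\<lambda>_. UNIV)) {{f \<in> PiE I (\<lambda>_. UNIV). \<forall>i\<in>j. f i \<in> A i} | A j. j \<in> {I} \<and> A \<in> Pi j (\<lambda>_. range (\<lambda>a::real. {..a}))})"
    proof (rule sets_PiM_sigma)
      show "\<exists>S\<subseteq>range (\<lambda>a::real. {..a}). countable S \<and> UNIV = \<Union>S"
        by (intro exI[of _ "range (\<lambda>n. {..real n})"]) (auto intro: real_arch_simple)
    qed (use I in auto)
    also have "{{f \<in> PiE I (\<lambda>_. UNIV). \<forall>i\<in>j. f i \<in> A i} | A j. j \<in> {I} \<and> A \<in> Pi j (\<lambda>_. range (\<lambda>a::real. {..a}))} = ?P"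
    proof -
      have "{f \<in> PiE I (\<lambda>_. UNIV). \<forall>i\<in>I. f i \<in> A i} = PiE I A" for A :: "'i \<Rightarrow> real set" by (auto simp: PiE_iff extensional_def)
      then show ?thesis by (simp add: Pi_iff)
    qed
    also have "sets (sigma (PiE I (\<lambda>_. UNIV)) ?P) = sigma_sets (PiE I (\<lambda>_. UNIV)) ?P"
      by (rule sets_measure_of) auto
    finally show ?thesis by (simp only: borel_eq_atMost[symmetric] space_PiM space_borel)
  qed
  have box: "PiE I A = {w \<in> space (PiM I (\<lambda>_. borel)). \<forall>t\<in>I. w t \<le> u t}" if "\<forall>i\<in>I. A i = {..u i}" for A and u :: "'i \<Rightarrow> real"
    using that by (auto simp: space_PiM PiE_iff extensional_def)
  show ?thesis
  proof (rule measure_eqI_generator_eq[where E = ?P and A = "\<lambda>n. PiE I (\<lambda>_. {..real n})" and \<Omega> = "space (PiM I (\<lambda>_. borel :: real measure))"])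
    show "Int_stable ?P"
    proof (rule Int_stableI)
      fix a b assume "a \<in> ?P" "b \<in> ?P"
      then obtain A B where A: "a = PiE I A" "\<forall>i\<in>I. A i \<in> range (\<lambda>a::real. {..a})"
        and B: "b = PiE I B" "\<forall>i\<in>I. B i \<in> range (\<lambda>a::real. {..a})" by blast
      have "a \<inter> b = PiE I (\<lambda>i. A i \<inter> B i)" unfolding A B by (rule PiE_Int)
      moreover have "A i \<inter> B i \<in> range (\<lambda>a::real. {..a})" if i: "i \<in> I" for i
      proof -
        obtain x where x: "A i = {..x}" using bspec[OF A(2) i] by (elim rangeE)
        obtain y where y: "B i = {..y}" using bspec[OF B(2) i] by (elim rangeE)
        have "A i \<inter> B i = {..min x y}" unfolding x y by auto
        then show ?thesis by (rule range_eqI)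
      qed
      ultimately show "a \<inter> b \<in> ?P" by (intro CollectI exI conjI ballI)
    qed
    show "?P \<subseteq> Pow (space (PiM I (\<lambda>_. borel :: real measure)))" by (auto simp: space_PiM)
    show "sets M = sigma_sets (space (PiM I (\<lambda>_. borel :: real measure))) ?P" "sets N = sigma_sets (space (PiM I (\<lambda>_. borel :: real measure))) ?P"
      using M(2) N(2) sig by simp_all
    fix X assume "X \<in> ?P"
    then obtain A where A: "X = PiE I A" "\<forall>i\<in>I. A i \<in> range (\<lambda>a::real. {..a})" by (elim CollectE exE conjE)
    then have "\<forall>i\<in>I. \<exists>a. A i = {..a}" by (simp add: image_iff)
    then obtain u where u: "\<forall>i\<in>I. A i = {..u i}" using bchoice by meson
    show "emeasure M X = emeasure N X"
      unfolding A(1) box[OF u] by (simp add: M.emeasure_eq_measure N.emeasure_eq_measure eq)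
  next
    show "range (\<lambda>n. PiE I (\<lambda>_. {..real n})) \<subseteq> ?P"
    proof (rule image_subsetI)
      fix n :: nat
      show "PiE I (\<lambda>_. {..real n}) \<in> ?P" by (rule CollectI, rule exI[of _ "\<lambda>_. {..real n}"]) simp
    qed
    show "(\<Union>n. PiE I (\<lambda>_. {..real n})) = space (PiM I (\<lambda>_. borel :: real measure))"
    proof
      show "space (PiM I (\<lambda>_. borel :: real measure)) \<subseteq> (\<Union>n. PiE I (\<lambda>_. {..real n}))"
      proof
        fix w assume w: "w \<in> space (PiM I (\<lambda>_. borel :: real measure))"
        obtain n :: nat where n: "Max (insert 0 (w ` I)) \<le> real n" using real_arch_simple by blast
        have "w i \<le> real n" if "i \<in> I" for i
          using order.trans[OF Max_ge n, of "w i"] I that by auto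
        then show "w \<in> (\<Union>n. PiE I (\<lambda>_. {..real n}))" using w by (auto simp: space_PiM PiE_iff)
      qed
    qed (auto simp: space_PiM)
  qed (auto simp: M.emeasure_eq_measure)
qed

text \<open>Both laws have the same joint distribution function, since by
  \<open>extremal_cdf_superset\<close> times of \<open>H\<close> outside \<open>J\<close> leave the
  formula unchanged.\<close>

lemma extremal_fdd_projective:
  assumes F: "distribution_function F" and J: "J \<subseteq> H" "finite H" "H \<subseteq> {0<..}"
  shows "extremal_fdd F J = distr (extremal_fdd F H) (PiM J (\<lambda>_. borel)) (\<lambda>f. restrict f J)"
proof -
  have fJ: "finite J" using J finite_subset by blast
  have m: "(\<lambda>f. restrict f J) \<in> measurable (extremal_fdd F H) (PiM J (\<lambda>_. borel))"
    using measurable_restrict_subset[OF J(1)] by (simp add: measurable_cong_sets[OF sets_extremal_fdd refl])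
  show ?thesis
  proof (rule measure_eqI_PiM_atMost[OF fJ])
    show "prob_space (extremal_fdd F J)" by (rule prob_space_extremal_fdd[OF F fJ])
    show "prob_space (distr (extremal_fdd F H) (PiM J (\<lambda>_. borel)) (\<lambda>f. restrict f J))"
      by (rule prob_space.prob_space_distr[OF prob_space_extremal_fdd[OF F J(2)] m])
    fix u :: "real \<Rightarrow> real"
    have box: "{w \<in> space (PiM J (\<lambda>_. borel)). \<forall>t\<in>J. w t \<le> u t} \<in> sets (PiM J (\<lambda>_. borel :: real measure))"
    proof (rule sets.sets_Collect_finite_All[OF _ fJ])
      fix t assume "t \<in> J"
      then have [measurable]: "(\<lambda>w. w t) \<in> borel_measurable (PiM J (\<lambda>_. borel :: real measure))"
        by (intro measurable_component_singleton)
      show "{w \<in> space (PiM J (\<lambda>_. borel)). w t \<le> u t} \<in> sets (PiM J (\<lambda>_. borel :: real measure))" by measurable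
    qed
    have "measure (distr (extremal_fdd F H) (PiM J (\<lambda>_. borel)) (\<lambda>f. restrict f J)) {w \<in> space (PiM J (\<lambda>_. borel)). \<forall>t\<in>J. w t \<le> u t} =
      measure (extremal_fdd F H) ((\<lambda>f. restrict f J) -` {w \<in> space (PiM J (\<lambda>_. borel)). \<forall>t\<in>J. w t \<le> u t} \<inter> space (extremal_fdd F H))"
      by (rule measure_distr[OF m box])
    also have "(\<lambda>f. restrict f J) -` {w \<in> space (PiM J (\<lambda>_. borel)). \<forall>t\<in>J. w t \<le> u t} \<inter> space (extremal_fdd F H) =
      {w \<in> space (PiM H (\<lambda>_. borel)). \<forall>t\<in>J. w t \<le> u t}"
      using J(1) by (auto simp: space_PiM)
    also have "measure (extremal_fdd F H) \<dots> = extremal_cdf F H J u" by (rule extremal_fdd_box[OF F J(2,3,1)])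
    also have "\<dots> = extremal_cdf F J J u" by (rule extremal_cdf_superset) (use J fJ in auto)
    also have "\<dots> = measure (extremal_fdd F J) {w \<in> space (PiM J (\<lambda>_. borel)). \<forall>t\<in>J. w t \<le> u t}"
      by (rule extremal_fdd_box[OF F, symmetric]) (use J fJ in auto)
    finally show "measure (extremal_fdd F J) {w \<in> space (PiM J (\<lambda>_. borel)). \<forall>t\<in>J. w t \<le> u t} =
      measure (distr (extremal_fdd F H) (PiM J (\<lambda>_. borel)) (\<lambda>f. restrict f J)) {w \<in> space (PiM J (\<lambda>_. borel)). \<forall>t\<in>J. w t \<le> u t}" by (rule sym)
  qed simp_all
qed

section \<open>Regularisation along the rationals and existence\<close>

lemma mono_on_left_limit:
  fixes f :: "real \<Rightarrow> real"
  assumes mono: "\<And>s t. 0 < s \<Longrightarrow> s \<le> t \<Longrightarrow> f s \<le> f t" and t: "t > 0"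
  shows "\<exists>l. (f \<longlongrightarrow> l) (at_left t)"
proof
  let ?S = "f ` {0<..<t}"
  have ne: "?S \<noteq> {}" using t by auto
  have bdd: "bdd_above ?S" by (rule bdd_aboveI[of _ "f t"]) (auto intro: mono)
  show "(f \<longlongrightarrow> Sup ?S) (at_left t)"
  proof (rule order_tendstoI)
    fix c assume "c < Sup ?S"
    then obtain s where s: "0 < s" "s < t" "c < f s" using less_cSupD[OF ne] by force
    have "c < f x" if "s < x" for x using mono[of s x] s that by simp
    then show "\<forall>\<^sub>F x in at_left t. c < f x"
      unfolding eventually_at_left_field using s(2) by (intro exI[of _ s]) auto
  next
    fix c assume c: "Sup ?S < c"
    have "f x < c" if "0 < x" "x < t" for x
      using cSup_upper[OF _ bdd, of "f x"] that c by force
    then show "\<forall>\<^sub>F x in at_left t. f x < c"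
      unfolding eventually_at_left_field using t by (intro exI[of _ 0]) auto
  qed
qed

text \<open>For a function monotone on the positive rationals this is its right limit at
  \<open>t\<close>.\<close>

definition rational_inf :: "(real \<Rightarrow> real) \<Rightarrow> real \<Rightarrow> real" where
  "rational_inf v t = (INF q\<in>{q \<in> \<rat>. t < q}. v q)"

lemma rational_inf:
  assumes v: "\<And>p q. p \<in> \<rat> \<Longrightarrow> q \<in> \<rat> \<Longrightarrow> 0 < p \<Longrightarrow> p \<le> q \<Longrightarrow> v p \<le> v q"
  shows "\<And>t q. 0 < t \<Longrightarrow> q \<in> \<rat> \<Longrightarrow> t < q \<Longrightarrow> rational_inf v t \<le> v q"
    and "\<And>t c. 0 < t \<Longrightarrow> (\<And>q. q \<in> \<rat> \<Longrightarrow> t < q \<Longrightarrow> c \<le> v q) \<Longrightarrow> c \<le> rational_inf v t"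
    and "\<And>s t. 0 < s \<Longrightarrow> s \<le> t \<Longrightarrow> rational_inf v s \<le> rational_inf v t"
    and "\<And>t. 0 < t \<Longrightarrow> (rational_inf v \<longlongrightarrow> rational_inf v t) (at_right t)"
proof -
  have ne: "{q \<in> \<rat>. t < q} \<noteq> {}" for t :: real
    using Rats_dense_in_real[of t "t + 1"] by auto
  have bdd: "bdd_below (v ` {q \<in> \<rat>. t < q})" if "0 < t" for t
  proof -
    from Rats_dense_in_real[OF that] obtain p where p: "p \<in> \<rat>" "0 < p" "p < t" by blast
    show ?thesis by (rule bdd_belowI2[of _ "v p"]) (use v p in auto)
  qed
  show 1: "rational_inf v t \<le> v q" if "0 < t" "q \<in> \<rat>" "t < q" for t q
    unfolding rational_inf_def by (rule cINF_lower[OF bdd]) (use that in auto)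
  show 2: "c \<le> rational_inf v t" if "0 < t" "\<And>q. q \<in> \<rat> \<Longrightarrow> t < q \<Longrightarrow> c \<le> v q" for t c
    unfolding rational_inf_def by (rule cINF_greatest[OF ne]) (use that in auto)
  show 3: "rational_inf v s \<le> rational_inf v t" if "0 < s" "s \<le> t" for s t
    by (rule 2) (use that 1[of s] in auto)
  show "(rational_inf v \<longlongrightarrow> rational_inf v t) (at_right t)" if t: "0 < t" for t
  proof (rule order_tendstoI)
    fix c assume "c < rational_inf v t"
    then show "\<forall>\<^sub>F x in at_right t. c < rational_inf v x"
      unfolding eventually_at_right_field using 3[OF t] by (intro exI[of _ "t + 1"]) (auto intro: less_le_trans)
  next
    fix c assume "rational_inf v t < c"
    then obtain q where q: "q \<in> \<rat>" "t < q" "v q < c"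
      unfolding rational_inf_def using cINF_less_iff[OF ne bdd[OF t]] by auto
    have "rational_inf v x < c" if "t < x" "x < q" for x
      using 1[of x q] q t that by auto
    then show "\<forall>\<^sub>F x in at_right t. rational_inf v x < c"
      unfolding eventually_at_right_field using q(2) by blast
  qed
qed

text \<open>Kolmogorov's theorem gives coordinates with the right laws but no regularity. They are
  almost surely monotone in pairs, hence simultaneously at all rationals, and right limits along the
  rationals yield paths that are monotone and cadlag. The point to prove is that this changes each
  coordinate only on a null set, which follows from continuity of \<open>F v powr t\<close> in
  \<open>t\<close>.\<close>

theorem extremal_process_exists:
  assumes F: "distribution_function F"
  obtains N :: "(real \<Rightarrow> real) measure" and Z where "extremal_process F N Z"
    "\<And>\<omega> s t. \<omega> \<in> space N \<Longrightarrow> 0 < s \<Longrightarrow> s \<le> t \<Longrightarrow> Z s \<omega> \<le> Z t \<omega>"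
proof -
  note FD = distribution_functionD[OF F]
  let ?I = "{0<..} :: real set"
  have "projective_family ?I (extremal_fdd F) (\<lambda>_. borel)"
    by (rule projective_family.intro) (auto intro: extremal_fdd_projective[OF F] prob_space_extremal_fdd[OF F])
  then interpret polish_projective ?I "extremal_fdd F" by (rule polish_projective.intro)
  define N where "N = lim"
  interpret N: prob_space N unfolding N_def by unfold_locales
  have N: "sets N = sets (PiM ?I (\<lambda>_. borel))" "space N = space (PiM ?I (\<lambda>_. borel))" by (simp_all add: N_def)
  have coord [measurable]: "(\<lambda>\<omega>. \<omega> t) \<in> borel_measurable N" if "t > 0" for t
    using measurable_component_singleton[of t ?I "\<lambda>_. borel"] that by (simp add: measurable_cong_sets[OF N(1) refl])
  have box: "{\<omega> \<in> space N. \<forall>t\<in>J. \<omega> t \<le> u t} \<in> N.events" if "finite J" "J \<subseteq> ?I" for J u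
  proof (rule sets.sets_Collect_finite_All[OF _ that(1)])
    fix t assume "t \<in> J"
    then have "t > 0" using that(2) by auto
    then show "{\<omega> \<in> space N. \<omega> t \<le> u t} \<in> N.events" by measurable
  qed
  have cdf: "N.prob {\<omega> \<in> space N. \<forall>t\<in>J. \<omega> t \<le> u t} = extremal_cdf F J J u" if J: "finite J" "J \<subseteq> ?I" for J u
  proof -
    let ?X = "{w \<in> space (PiM J (\<lambda>_. borel)). \<forall>t\<in>J. w t \<le> u t}"
    have "?X \<in> sets (PiM J (\<lambda>_. borel :: real measure))"
    proof (rule sets.sets_Collect_finite_All[OF _ J(1)])
      fix t assume "t \<in> J"
      then have [measurable]: "(\<lambda>w. w t) \<in> borel_measurable (PiM J (\<lambda>_. borel :: real measure))"
        by (intro measurable_component_singleton)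
      show "{w \<in> space (PiM J (\<lambda>_. borel)). w t \<le> u t} \<in> sets (PiM J (\<lambda>_. borel :: real measure))" by measurable
    qed
    then have "measure lim (emb ?I J ?X) = measure (extremal_fdd F J) ?X"
      using J by (intro measure_lim_emb)
    moreover have "emb ?I J ?X = {\<omega> \<in> space N. \<forall>t\<in>J. \<omega> t \<le> u t}"
      using J by (auto simp: prod_emb_def N space_PiM PiE_iff subset_eq extensional_def)
    ultimately show ?thesis using extremal_fdd_box[OF F J order_refl, of u] by (simp add: N_def)
  qed
  have cdf1: "N.prob {\<omega> \<in> space N. \<omega> t \<le> v} = F v powr t" if t: "t > 0" for t v
  proof -
    have e: "{s \<in> {t}. s < t} = {}" "{s \<in> {t}. t \<le> s} = {t}" by auto
    have "extremal_cdf F {t} {t} (\<lambda>_. v) = F v powr t"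
      unfolding extremal_cdf_def pred_time_def
      by (subst prod.insert) (simp_all only: finite.emptyI empty_iff not_False_eq_True prod.empty e, simp)
    then show ?thesis using cdf[of "{t}" "\<lambda>_. v"] t by simp
  qed
  \<comment> \<open>At a common level the condition at \<open>s\<close> removes no probability from
    the one at \<open>t\<close>; this is monotonicity expressed through the laws.\<close>
  have cdf2: "N.prob {\<omega> \<in> space N. \<omega> s \<le> v \<and> \<omega> t \<le> v} = F v powr t" if st: "0 < s" "s < t" for s t v
  proof -
    have "pred_time {s, t} s = 0" "pred_time {s, t} t = s"
    proof -
      have "{r \<in> {s, t}. r < s} = {}" "{r \<in> {s, t}. r < t} = {s}" using st by auto
      note e = this
      show "pred_time {s, t} s = 0" "pred_time {s, t} t = s" unfolding pred_time_def e using st by simp_all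
    qed
    moreover have "Min ((\<lambda>_. v) ` {r \<in> {s, t}. x \<le> r}) = v" if "x \<le> t" for x
    proof -
      have "(\<lambda>_. v) ` {r \<in> {s, t}. x \<le> r} = {v}" using that by auto
      then show ?thesis by simp
    qed
    ultimately have "extremal_cdf F {s, t} {s, t} (\<lambda>_. v) = F v powr s * F v powr (t - s)"
      using st by (simp add: extremal_cdf_def)
    also have "\<dots> = F v powr t" by (simp add: powr_add[symmetric])
    finally show ?thesis using cdf[of "{s, t}" "\<lambda>_. v"] st by simp
  qed
  have mono_pair: "AE \<omega> in N. \<omega> s \<le> \<omega> t" if st: "0 < s" "s < t" for s t
  proof -
    have t0: "0 < t" using st by simp
    have "AE \<omega> in N. \<forall>v\<in>\<rat>. \<omega> t \<le> v \<longrightarrow> \<omega> s \<le> v"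
    proof (subst AE_ball_countable[OF countable_rat], rule ballI)
      fix v :: real
      have [measurable]: "(\<lambda>\<omega>. \<omega> s) \<in> borel_measurable N" "(\<lambda>\<omega>. \<omega> t) \<in> borel_measurable N"
        using st(1) t0 by (auto intro: coord)
      have "N.prob ({\<omega> \<in> space N. \<omega> t \<le> v} - {\<omega> \<in> space N. \<omega> s \<le> v \<and> \<omega> t \<le> v}) =
        N.prob {\<omega> \<in> space N. \<omega> t \<le> v} - N.prob {\<omega> \<in> space N. \<omega> s \<le> v \<and> \<omega> t \<le> v}"
        by (rule N.finite_measure_Diff) (measurable, auto)
      then have "N.prob ({\<omega> \<in> space N. \<omega> t \<le> v} - {\<omega> \<in> space N. \<omega> s \<le> v \<and> \<omega> t \<le> v}) = 0"
        using cdf1[OF t0] cdf2[OF st] by simp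
      then show "AE \<omega> in N. \<omega> t \<le> v \<longrightarrow> \<omega> s \<le> v"
        by (intro AE_I[where N = "{\<omega> \<in> space N. \<omega> t \<le> v} - {\<omega> \<in> space N. \<omega> s \<le> v \<and> \<omega> t \<le> v}"])
           (auto simp: N.emeasure_eq_measure)
    qed
    then show ?thesis
    proof eventually_elim
      case (elim \<omega>)
      show ?case
      proof (rule ccontr)
        assume "\<not> \<omega> s \<le> \<omega> t"
        then obtain v where "v \<in> \<rat>" "\<omega> t < v" "v < \<omega> s" using Rats_dense_in_real[of "\<omega> t" "\<omega> s"] by auto
        then show False using elim by force
      qed
    qed
  qed
  define Q where "Q = {q \<in> \<rat>. (0::real) < q}"
  have cQ: "countable Q" unfolding Q_def by (rule countable_subset[OF _ countable_rat]) auto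
  define A where "A = {\<omega> \<in> space N. \<forall>p\<in>Q. \<forall>q\<in>Q. p < q \<longrightarrow> \<omega> p \<le> \<omega> q}"
  have A [measurable]: "A \<in> N.events"
    unfolding A_def
  proof (intro sets.sets_Collect_countable_All' cQ sets.sets_Collect_imp sets.sets_Collect_const)
    fix p q assume "p \<in> Q" "q \<in> Q"
    then have [measurable]: "(\<lambda>\<omega>. \<omega> p) \<in> borel_measurable N" "(\<lambda>\<omega>. \<omega> q) \<in> borel_measurable N"
      by (auto simp: Q_def intro: coord)
    show "{\<omega> \<in> space N. \<omega> p \<le> \<omega> q} \<in> N.events" by measurable
  qed
  have AE_A: "AE \<omega> in N. \<omega> \<in> A"
  proof -
    have "AE \<omega> in N. \<forall>p\<in>Q. \<forall>q\<in>Q. p < q \<longrightarrow> \<omega> p \<le> \<omega> q"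
    proof (subst AE_ball_countable[OF cQ], rule ballI, subst AE_ball_countable[OF cQ], rule ballI)
      fix p q assume "p \<in> Q" "q \<in> Q"
      then show "AE \<omega> in N. p < q \<longrightarrow> \<omega> p \<le> \<omega> q"
        using mono_pair[of p q] by (cases "p < q") (auto simp: Q_def)
    qed
    then show ?thesis using AE_space by eventually_elim (simp add: A_def)
  qed
  \<comment> \<open>The value 0 off \<open>A\<close> makes the path monotone along the rationals for
    every \<open>\<omega>\<close>, not just almost surely.\<close>
  define V where "V \<omega> q = (if \<omega> \<in> A then \<omega> q else 0)" for \<omega> and q :: real
  have V: "V \<omega> p \<le> V \<omega> q" if "p \<in> \<rat>" "q \<in> \<rat>" "0 < p" "p \<le> q" for \<omega> p q
    using that by (cases "p = q") (auto simp: V_def A_def Q_def)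
  define Z where "Z t \<omega> = rational_inf (V \<omega>) t" for t \<omega>
  note Z = rational_inf[of "V _", OF V, folded Z_def]
  have Z_meas: "Z t \<in> borel_measurable N" if t: "t > 0" for t
    unfolding Z_def[abs_def] rational_inf_def
  proof (rule borel_measurable_cINF_real)
    show "countable {q \<in> \<rat>. t < q}" by (rule countable_subset[OF _ countable_rat]) auto
    fix q assume "q \<in> {q \<in> \<rat>. t < q}"
    then have "(\<lambda>\<omega>. \<omega> q) \<in> borel_measurable N" using t by (intro coord) auto
    then show "(\<lambda>\<omega>. V \<omega> q) \<in> borel_measurable N"
      unfolding V_def by (rule measurable_If_set) auto
  qed
  have Z_eq: "AE \<omega> in N. Z t \<omega> = \<omega> t" if t: "t > 0" for t
  proof -
    have [measurable]: "(\<lambda>\<omega>. \<omega> t) \<in> borel_measurable N" "Z t \<in> borel_measurable N" using coord Z_meas t by auto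
    have "AE \<omega> in N. \<forall>q\<in>\<rat>. t < q \<longrightarrow> \<omega> t \<le> \<omega> q"
    proof (subst AE_ball_countable[OF countable_rat], rule ballI)
      fix q :: real
      show "AE \<omega> in N. t < q \<longrightarrow> \<omega> t \<le> \<omega> q" using mono_pair[OF t, of q] by (cases "t < q") auto
    qed
    then have le: "AE \<omega> in N. \<omega> t \<le> Z t \<omega>"
      using AE_A
    proof eventually_elim
      case (elim \<omega>)
      show ?case by (rule Z(2)[OF _ _ _ _ t]) (use elim in \<open>auto simp: V_def\<close>)
    qed
    \<comment> \<open>\<open>Z t\<close> is almost surely below each later rational coordinate, so
      its distribution function dominates \<open>F v powr q\<close>; now let \<open>q\<close>
      decrease to \<open>t\<close>. Together with \<open>\<omega> t \<le> Z t\<close> equal laws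
      force almost sure equality.\<close>
    have ge: "F v powr t \<le> N.prob {\<omega> \<in> space N. Z t \<omega> \<le> v}" for v
    proof -
      have "F v powr q \<le> N.prob {\<omega> \<in> space N. Z t \<omega> \<le> v}" if q: "q \<in> \<rat>" "t < q" for q
      proof -
        have q0: "q > 0" using q t by simp
        have [measurable]: "(\<lambda>\<omega>. \<omega> q) \<in> borel_measurable N" by (rule coord[OF q0])
        have "F v powr q = N.prob {\<omega> \<in> space N. \<omega> q \<le> v}" using cdf1[OF q0] by simp
        also have "\<dots> \<le> N.prob {\<omega> \<in> space N. Z t \<omega> \<le> v}"
        proof (rule N.finite_measure_mono_AE)
          show "AE \<omega> in N. \<omega> \<in> {\<omega> \<in> space N. \<omega> q \<le> v} \<longrightarrow> \<omega> \<in> {\<omega> \<in> space N. Z t \<omega> \<le> v}"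
            using AE_A
          proof eventually_elim
            case (elim \<omega>)
            have "Z t \<omega> \<le> V \<omega> q" by (rule Z(1)[OF _ _ _ _ t q]) auto
            then show ?case using elim by (auto simp: V_def)
          qed
        qed measurable
        finally show ?thesis .
      qed
      note * = this
      have "\<exists>q\<in>\<rat>. t < q \<and> q < t + 1 / real (Suc n)" for n
        using Rats_dense_in_real[of t "t + 1 / real (Suc n)"] by auto
      then obtain q where q: "\<And>n. q n \<in> \<rat>" "\<And>n. t < q n" "\<And>n. q n < t + 1 / real (Suc n)" by metis
      have "q \<longlonglongrightarrow> t"
      proof (rule real_tendsto_sandwich[where f = "\<lambda>_. t" and h = "\<lambda>n. t + 1 / real (Suc n)"])
        show "(\<lambda>n. t + 1 / real (Suc n)) \<longlonglongrightarrow> t"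
          using tendsto_add[OF tendsto_const LIMSEQ_Suc[OF lim_1_over_n], of t] by simp
      qed (intro always_eventually allI less_imp_le q tendsto_const)+
      then have "(\<lambda>n. F v powr q n) \<longlonglongrightarrow> F v powr t"
        by (cases "F v = 0") (auto intro!: tendsto_powr)
      then show ?thesis by (rule LIMSEQ_le_const2) (use * q in auto)
    qed
    have "AE \<omega> in N. \<forall>v\<in>\<rat>. \<omega> t \<le> v \<longrightarrow> Z t \<omega> \<le> v"
    proof (subst AE_ball_countable[OF countable_rat], rule ballI)
      fix v :: real
      let ?a = "{\<omega> \<in> space N. \<omega> t \<le> v}" and ?b = "{\<omega> \<in> space N. \<omega> t \<le> v \<and> Z t \<omega> \<le> v}"
      have "N.prob {\<omega> \<in> space N. Z t \<omega> \<le> v} = N.prob ?b"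
      proof (rule measure_eq_AE)
        show "AE \<omega> in N. (\<omega> \<in> {\<omega> \<in> space N. Z t \<omega> \<le> v}) = (\<omega> \<in> ?b)"
          using le by eventually_elim (auto intro: order.trans)
      qed measurable
      then have "N.prob ?a \<le> N.prob ?b" using ge[of v] cdf1[OF t, of v] by simp
      moreover have "N.prob (?a - ?b) = N.prob ?a - N.prob ?b"
        by (rule N.finite_measure_Diff) (measurable, auto)
      ultimately have "N.prob (?a - ?b) = 0" using measure_nonneg[of N "?a - ?b"] by linarith
      then show "AE \<omega> in N. \<omega> t \<le> v \<longrightarrow> Z t \<omega> \<le> v"
        by (intro AE_I[where N = "?a - ?b"]) (auto simp: N.emeasure_eq_measure)
    qed
    with le show ?thesis
    proof eventually_elim
      case (elim \<omega>)
      show ?case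
      proof (rule ccontr)
        assume "Z t \<omega> \<noteq> \<omega> t"
        then have "\<omega> t < Z t \<omega>" using elim by simp
        then obtain v where "v \<in> \<rat>" "\<omega> t < v" "v < Z t \<omega>" using Rats_dense_in_real by blast
        then show False using elim by force
      qed
    qed
  qed
  have "extremal_process F N Z"
    unfolding extremal_process_def
  proof (intro conjI allI impI ballI)
    show "prob_space N" by unfold_locales
    show "Z t \<in> borel_measurable N" if "t > 0" for t by (rule Z_meas[OF that])
    fix \<omega> assume "\<omega> \<in> space N"
    show "sample_path Z \<omega> \<in> skorokhod_space"
      unfolding skorokhod_space_def continuous_within
    proof (intro CollectI conjI allI impI)
      show "sample_path Z \<omega> \<in> extensional {0<..}" by (simp add: sample_path_def)
      fix t :: real assume t: "t > 0"
      have eq: "Z x \<omega> = sample_path Z \<omega> x" if "0 < x" for x using that by (simp add: sample_path_def)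
      have ev1: "\<forall>\<^sub>F x in at_right t. Z x \<omega> = sample_path Z \<omega> x"
        unfolding eventually_at_right_field by (rule exI[of _ "t + 1"]) (use t eq in auto)
      have ev2: "\<forall>\<^sub>F x in at_left t. Z x \<omega> = sample_path Z \<omega> x"
        unfolding eventually_at_left_field by (rule exI[of _ 0]) (use t eq in auto)
      have "((\<lambda>x. Z x \<omega>) \<longlongrightarrow> Z t \<omega>) (at_right t)"
        unfolding Z_def by (rule rational_inf(4)[OF V t])
      then show "(sample_path Z \<omega> \<longlongrightarrow> sample_path Z \<omega> t) (at_right t)"
        using Lim_transform_eventually[OF _ ev1] eq[OF t] by simp
      obtain l where "((\<lambda>x. Z x \<omega>) \<longlongrightarrow> l) (at_left t)"
        using mono_on_left_limit[of "\<lambda>x. Z x \<omega>", OF _ t] Z(3) by blast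
      then show "\<exists>l. (sample_path Z \<omega> \<longlongrightarrow> l) (at_left t)"
        using Lim_transform_eventually[OF _ ev2] by blast
    qed
  next
    fix k :: nat and t u :: "nat \<Rightarrow> real"
    assume k: "1 \<le> k" and t: "0 < t 1 \<and> strict_mono_on {1..k} t"
    have t_lt: "t i < t j \<longleftrightarrow> i < j" if "i \<in> {1..k}" "j \<in> {1..k}" for i j
    proof (cases i j rule: linorder_cases)
      case less
      then show ?thesis using strict_mono_onD[OF conjunct2[OF t] that] by simp
    next
      case greater
      then show ?thesis using strict_mono_onD[OF conjunct2[OF t] that(2,1)] by simp
    qed simp
    have t_le: "t i \<le> t j \<longleftrightarrow> i \<le> j" if "i \<in> {1..k}" "j \<in> {1..k}" for i j
      using t_lt[OF that(2,1)] by (simp add: not_less[symmetric])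
    have tpos: "0 < t i" if "i \<in> {1..k}" for i
      using t_le[of 1 i] that t by (auto intro: less_le_trans)
    have inj: "inj_on t {1..k}" using t by (auto intro: strict_mono_on_imp_inj_on)
    define J where "J = t ` {1..k}"
    have J: "finite J" "J \<subseteq> ?I" using tpos by (auto simp: J_def)
    define w where "w s = u (the_inv_into {1..k} t s)" for s
    have w: "w (t i) = u i" if "i \<in> {1..k}" for i using the_inv_into_f_f[OF inj that] by (simp add: w_def)
    have bx: "(\<forall>s\<in>J. \<omega> s \<le> w s) \<longleftrightarrow> (\<forall>i\<in>{1..k}. \<omega> (t i) \<le> u i)" for \<omega> :: "real \<Rightarrow> real"
      by (simp add: J_def w)
    have "N.prob {\<omega> \<in> space N. \<forall>i\<in>{1..k}. Z (t i) \<omega> \<le> u i} = N.prob {\<omega> \<in> space N. \<forall>s\<in>J. \<omega> s \<le> w s}"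
    proof (rule measure_eq_AE)
      have "AE \<omega> in N. \<forall>i\<in>{1..k}. Z (t i) \<omega> = \<omega> (t i)"
        by (rule AE_finite_allI) (use Z_eq tpos in auto)
      then show "AE \<omega> in N. (\<omega> \<in> {\<omega> \<in> space N. \<forall>i\<in>{1..k}. Z (t i) \<omega> \<le> u i}) = (\<omega> \<in> {\<omega> \<in> space N. \<forall>s\<in>J. \<omega> s \<le> w s})"
        unfolding bx by eventually_elim simp
      show "{\<omega> \<in> space N. \<forall>i\<in>{1..k}. Z (t i) \<omega> \<le> u i} \<in> N.events"
      proof (rule sets.sets_Collect_finite_All)
        fix i assume "i \<in> {1..k}"
        then have [measurable]: "Z (t i) \<in> borel_measurable N" using tpos Z_meas by blast
        show "{\<omega> \<in> space N. Z (t i) \<omega> \<le> u i} \<in> N.events" by measurable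
      qed simp
      show "{\<omega> \<in> space N. \<forall>s\<in>J. \<omega> s \<le> w s} \<in> N.events" by (rule box[OF J])
    qed
    also have "\<dots> = extremal_cdf F J J w" by (rule cdf[OF J])
    also have "\<dots> = (\<Prod>i = 1..k. F (MIN j\<in>{i..k}. u j) powr (t i - (if i = 1 then 0 else t (i - 1))))"
      unfolding extremal_cdf_def J_def prod.reindex[OF inj] comp_def
    proof (rule prod.cong[OF refl])
      fix i assume i: "i \<in> {1..k}"
      have "{s \<in> t ` {1..k}. t i \<le> s} = t ` {i..k}" using i t_le[OF i] by auto
      then have "w ` {s \<in> t ` {1..k}. t i \<le> s} = (w \<circ> t) ` {i..k}" by (simp add: image_comp)
      also have "\<dots> = u ` {i..k}" using i w by (intro image_cong) auto
      finally have 1: "w ` {s \<in> t ` {1..k}. t i \<le> s} = u ` {i..k}" .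
      have 2: "pred_time (t ` {1..k}) (t i) = (if i = 1 then 0 else t (i - 1))"
        unfolding pred_time_def
      proof (rule Max_eqI)
        show "r \<le> (if i = 1 then 0 else t (i - 1))" if "r \<in> insert 0 {s \<in> t ` {1..k}. s < t i}" for r
          using that i t_le t_lt tpos[of "i - 1"] by (auto simp: less_imp_le)
        show "(if i = 1 then 0 else t (i - 1)) \<in> insert 0 {s \<in> t ` {1..k}. s < t i}"
        proof (cases "i = 1")
          case False
          then have "i - 1 \<in> {1..k}" "i - 1 < i" using i by auto
          then have "t (i - 1) \<in> {s \<in> t ` {1..k}. s < t i}" using t_lt i by blast
          then show ?thesis using False by simp
        qed simp
      qed simp
      have "\<exists>s\<in>t ` {1..k}. t i \<le> s" using i by blast
      then show "(if \<exists>s\<in>t ` {1..k}. t i \<le> s then F (Min (w ` {s \<in> t ` {1..k}. t i \<le> s})) powr (t i - pred_time (t ` {1..k}) (t i)) else 1) =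
         F (MIN j\<in>{i..k}. u j) powr (t i - (if i = 1 then 0 else t (i - 1)))"
        by (simp only: 1 2 if_True)
    qed
    finally show "N.prob {\<omega> \<in> space N. \<forall>i\<in>{1..k}. Z (t i) \<omega> \<le> u i} =
      (\<Prod>i = 1..k. F (MIN j\<in>{i..k}. u j) powr (t i - (if i = 1 then 0 else t (i - 1))))" .
  qed
  moreover have "Z s \<omega> \<le> Z t \<omega>" if "0 < s" "s \<le> t" for \<omega> s t
    unfolding Z_def by (rule rational_inf(3)[OF V that])
  ultimately show thesis by (rule that)
qed

section \<open>The dynamical system\<close>

theorem theorem2p3:
  fixes \<X> :: "(real ^ 'd) set" and f :: "real ^ 'd \<Rightarrow> real ^ 'd"
    and \<mu> :: "(real ^ 'd) measure" and \<rho> :: "real ^ 'd \<Rightarrow> real"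
    and \<psi> :: "real \<Rightarrow> ereal" and p :: "real ^ 'd"
    and X :: "nat \<Rightarrow> real ^ 'd \<Rightarrow> ereal"
    and a b :: "nat \<Rightarrow> real" and G :: "real \<Rightarrow> real"
  assumes "\<X> \<in> sets lebesgue"
    and "prob_space \<mu>"
    and "sets \<mu> = sets (restrict_space borel \<X>)"
    and "f \<in> measurable \<mu> \<mu>"
    and "distr \<mu> \<mu> f = \<mu>"
    and "\<rho> \<in> borel_measurable (lebesgue_on \<X>)"
    and "\<And>x. x \<in> \<X> \<Longrightarrow> \<rho> x \<ge> 0"
    and "\<And>A. A \<in> sets \<mu> \<Longrightarrow> emeasure \<mu> A = (\<integral>\<^sup>+x\<in>A. ennreal (\<rho> x) \<partial>lebesgue_on \<X>)"
    and "p \<in> \<X>"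
    and "\<psi> \<in> borel_measurable (restrict_space borel {0..})"
    and "\<psi> 0 \<noteq> -\<infinity>"
    and "\<And>v. v > 0 \<Longrightarrow> \<bar>\<psi> v\<bar> \<noteq> \<infinity>"
    and "(SUP v\<in>{0..}. \<psi> v) = \<psi> 0"
    and X_eq: "X = time_series (observable \<psi> p) f"
    and "\<And>n. a n > 0"
    and "distribution_function G" and "nondegenerate G"
    and "\<And>u. (\<lambda>n. ereal (real n * measure \<mu> {x \<in> space \<mu>. X 1 x > ereal (u / a n + b n)}))
               \<longlonglongrightarrow> neg_log (G u)"
    and "\<And>(r::nat) (x :: nat \<Rightarrow> real) (u :: nat \<Rightarrow> nat \<Rightarrow> real).
           r \<ge> 1 \<Longrightarrow> 0 < x 1 \<Longrightarrow> mono_on {1..r} x \<Longrightarrow> (\<And>n. antimono_on {1..r} (\<lambda>k. u k n)) \<Longrightarrow>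
           (\<And>k. k \<in> {1..r} \<Longrightarrow>
              (\<lambda>n. real n * measure \<mu> {y \<in> space \<mu>. X 1 y > ereal (u k n)}) \<longlonglongrightarrow> x k) \<Longrightarrow>
           cond_D \<mu> X r u \<and> cond_D' \<mu> X r u"
  shows "\<exists>(N :: (real \<Rightarrow> real) measure) Y\<^sub>G.
           extremal_process G N Y\<^sub>G \<and> converges_weakly_J1 \<mu> (rescaled_max X a b) N Y\<^sub>G"
proof -
  let ?\<phi> = "observable \<psi> p :: real ^ 'd \<Rightarrow> ereal"
  have meas_id: "(\<lambda>x. x) \<in> measurable \<mu> borel"
    unfolding measurable_cong_sets[OF assms(3) refl] by (rule measurable_restrict_space1) simp
  have obs: "?\<phi> \<in> borel_measurable \<mu>"
  proof -
    have "(\<lambda>x. dist x p) \<in> borel_measurable \<mu>"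
      using meas_id by (intro borel_measurable_dist borel_measurable_const)
    then have "(\<lambda>x. dist x p) \<in> measurable \<mu> (restrict_space borel {0..})"
      by (intro measurable_restrict_space2) auto
    from measurable_compose[OF this assms(10)] show ?thesis by (simp only: observable_def[abs_def])
  qed
  interpret S: stationary_process \<mu> f ?\<phi> X
    by (intro stationary_process.intro stationary_process_axioms.intro) (rule assms obs)+
  \<comment> \<open>Points are Lebesgue null, so \<open>p\<close> has measure 0 by absolute
    continuity.\<close>
  have p_sets: "{p} \<in> sets \<mu>"
  proof -
    have "{p} = \<X> \<inter> {p}" using assms(9) by blast
    then show ?thesis unfolding assms(3) sets_restrict_space by (rule image_eqI) simp
  qed
  have "{p} \<in> null_sets (lebesgue_on \<X>)"
    using assms(1,9) by (simp add: null_sets_restrict_space null_sets_completionI finite_imp_null_set_lborel)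
  then have p_null: "emeasure \<mu> {p} = 0"
    unfolding assms(8)[OF p_sets] by (rule nn_integral_null_set)
  \<comment> \<open>Invariance makes the preimages of \<open>p\<close> null as well. An orbit that
    avoids \<open>p\<close> keeps positive distance from it at each time, where
    \<open>\<psi>\<close> is finite.\<close>
  have "AE x in \<mu>. \<forall>k. (f ^^ k) x \<noteq> p"
  proof (subst AE_all_countable, rule allI)
    fix k
    have "AE x in distr \<mu> \<mu> (f ^^ k). x \<noteq> p"
      unfolding S.T_pow_inv by (rule AE_I[of _ _ "{p}"]) (use p_null p_sets in auto)
    then show "AE x in \<mu>. (f ^^ k) x \<noteq> p"
      by (rule AE_distrD[OF S.T_pow])
  qed
  then have finite: "AE x in \<mu>. \<forall>i. \<bar>X i x\<bar> \<noteq> \<infinity>"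
    by eventually_elim (simp add: X_eq time_series_def observable_def assms(12))
  interpret E: extremal_domain \<mu> f ?\<phi> X a b G
    by (intro extremal_domain.intro extremal_domain_axioms.intro S.stationary_process_axioms)
       (use assms(15-19) finite in \<open>simp_all only: S.exc_def\<close>)
  obtain N :: "(real \<Rightarrow> real) measure" and Z where Z: "extremal_process G N Z"
    "\<And>\<omega> s t. \<omega> \<in> space N \<Longrightarrow> 0 < s \<Longrightarrow> s \<le> t \<Longrightarrow> Z s \<omega> \<le> Z t \<omega>"
    using extremal_process_exists[OF assms(16)] by blast
  interpret L: extremal_limit \<mu> f ?\<phi> X a b G N Z
    by (intro extremal_limit.intro extremal_limit_axioms.intro E.extremal_domain_axioms Z)
  \<comment> \<open>The constructed process has measurable coordinates; this version is also
    measurable for the Borel sets of the J1 topology.\<close>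
  obtain Z' where Z': "extremal_limit \<mu> f ?\<phi> X a b G N Z'" "sample_path Z' \<in> measurable N J1_borel"
    by (rule L.measurable_version)
  show ?thesis
    using extremal_limit.ext[OF Z'(1)] extremal_limit.converges_weakly[OF Z'] by blast
qed

end
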